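(* Let $(X_t)_{t\in\mathbf{Z}}$ be a strictly stationary process with mean zero and $X_t\in\mathcal{L}^8$, and let $\lambda\in\mathbf{R}$. Assume: (A1) $\lim_{x\to0}x^{-2}\{1-a(x)\}=c_2$, where $c_2$ is a nonzero constant; (A2) $\min_{\lambda\in[0,\pi]}f(\lambda)>0$; (A3) $\max_{\lambda\in[0,\pi]}|\tilde f(\lambda)-f(\lambda)|=o_{\mathbf{P}}(b_n)$; (A4) $\sum_{k\in\mathbf{Z}}|r(k)|k^2<\infty$; (A5$'$) $\sum_{t_1,\ldots,t_{k-1}\in\mathbf{Z}}|\mathrm{cum}(X_0,X_{t_1},\ldots,X_{t_{k-1}})|<\infty$ for $k=3,\ldots,8$; (A6) $\sqrt{nb_n}\{f_n(\lambda)-\mathbf{E}(f_n(\lambda))\}\Rightarrow N(0,\sigma^2(\lambda))$ and $nb_n\,\mathrm{var}(f_n(\lambda))\to\sigma^2(\lambda)$. Let $b_n\asymp n^{-1/5}$ and $b_n=o(\tilde b_n)$. Then, as $n\to\infty$, $$d_2[g_n(\lambda),g_n^*(\lambda)]=o_{\mathbf{P}}(1)\quad\text{and}\quad d_2\bigl[g_n(\lambda)/f(\lambda),\,g_n^*(\lambda)/\tilde f(\lambda)\bigr]=o_{\mathbf{P}}(1).$$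
   Context: $\xi\in\mathcal{L}^p$ means $\mathbf{E}|\xi|^p<\infty$; $\mathrm{cum}$ is the joint cumulant; $u_n\asymp v_n$ means $u_n/v_n$ is bounded away from $0$ and $\infty$ for large $n$. $r(k)=\mathbf{E}(X_0X_k)$; $f(\lambda)=\frac1{2\pi}\sum_kr(k)e^{ik\lambda}$. $a(\cdot)$ is an even Lipschitz continuous function with support $[-1,1]$ and $a(0)=1$. $\hat r(k)=n^{-1}\sum_{j=1}^{n-|k|}X_jX_{j+|k|}$. $B_n$, $\tilde B_n$ are sequences of positive integers tending to infinity and $o(n)$; $b_n=1/B_n$, $\tilde b_n=1/\tilde B_n$; $$f_n(\lambda)=\frac1{2\pi}\sum_{k=-B_n}^{B_n}\hat r(k)a(kb_n)e^{-ik\lambda},\qquad\tilde f(\lambda)=\frac1{2\pi}\sum_{k=-\tilde B_n}^{\tilde B_n}\hat r(k)a(k\tilde b_n)e^{-ik\lambda}.$$ $\sigma^2(\lambda)=\{1+\eta(2\lambda)\}f^2(\lambda)\int_{-1}^1a^2(t)dt$, where $\eta(\lambda)=1$ if $\lambda\in2\pi\mathbf{Z}$ and $0$ otherwise. Bootstrap: let $\omega_j=2\pi j/n$, $F_n=\{-\lfloor(n-1)/2\rfloor,\ldots,\lfloor n/2\rfloor\}$, $N=\lfloor n/2\rfloor$, $I_j=\frac1{2\pi n}|\sum_{k=1}^nX_ke^{ik\omega_j}|^2$, $\tilde f_j=\tilde f(\omega_j)$. Put $\tilde\varepsilon_j=I_j/\tilde f_j$ ($1\le j\le N$), $\bar\varepsilon=N^{-1}\sum_{j=1}^N\tilde\varepsilon_j$,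 $\bar\varepsilon_j=\tilde\varepsilon_j/\bar\varepsilon$. Conditionally on $X_1,\ldots,X_n$, draw $\varepsilon_1^*,\ldots,\varepsilon_N^*$ i.i.d. from the empirical distribution of $\bar\varepsilon_1,\ldots,\bar\varepsilon_N$; set $I_j^*=\tilde f_j\varepsilon_j^*$, $I_{-j}^*=I_j^*$, $I_0^*=0$, and $$f_n^*(\lambda)=\frac1n\sum_{j\in F_n}I_j^*\sum_{k=-B_n}^{B_n}a(kb_n)e^{-ik(\lambda-\omega_j)}.$$ (These are defined on the event that all $\tilde f_j\ne0$ and $\bar\varepsilon\neq0$, and arbitrarily off it.) Let $g_n(\lambda)=\sqrt{nb_n}\{f_n(\lambda)-f(\lambda)\}$ and $g_n^*(\lambda)=\sqrt{nb_n}\{f_n^*(\lambda)-\tilde f(\lambda)\}$. Mallows metric: for probability measures $P_1,P_2$ on $\mathbf{R}$ with finite second moments, $d_2(P_1,P_2)=\inf\|Y_1-Y_2\|$ with $\|\xi\|=(\mathbf{E}|\xi|^2)^{1/2}$, the infimum over all $(Y_1,Y_2)$ with marginals $P_1,P_2$. For a statistic $U_n$ and a bootstrap quantity $U_n^*$, $d_2[U_n,U_n^*]$ denotes the $d_2$ distance between the law of $U_n$ and the conditional law of $U_n^*$ given $X_1,\ldots,X_n$. *)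

theory Defs
  imports "HOL-Probability.Probability" "HOL-Library.Landau_Symbols" "HOL-Library.Disjoint_Sets"
begin

definition strictly_stationary :: "'a measure \<Rightarrow> (int \<Rightarrow> 'a \<Rightarrow> real) \<Rightarrow> bool" where
  "strictly_stationary M X \<longleftrightarrow>
     (\<forall>t. X t \<in> borel_measurable M) \<and>
     (\<forall>J h. finite J \<longrightarrow>
        distr M (PiM J (\<lambda>_. borel)) (\<lambda>\<omega>. \<lambda>t\<in>J. X (t + h) \<omega>) =
        distr M (PiM J (\<lambda>_. borel)) (\<lambda>\<omega>. \<lambda>t\<in>J. X t \<omega>))"

definition autocov :: "'a measure \<Rightarrow> (int \<Rightarrow> 'a \<Rightarrow> real) \<Rightarrow> int \<Rightarrow> real" where
  "autocov M X k = (\<integral>\<omega>. X 0 \<omega> * X k \<omega> \<partial>M)"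

text \<open>The moment-partition formula for the joint cumulant: the sum runs over all set
  partitions of the index set.\<close>

definition joint_cumulant :: "'a measure \<Rightarrow> ('a \<Rightarrow> real) list \<Rightarrow> real" where
  "joint_cumulant M Ys =
     (\<Sum>P | partition_on {..<length Ys} P.
        (-1) ^ (card P - 1) * fact (card P - 1) *
        (\<Prod>A\<in>P. \<integral>\<omega>. (\<Prod>i\<in>A. (Ys ! i) \<omega>) \<partial>M))"

text \<open>Several quantities below are complex exponential sums that are real by symmetry. They are
  declared real-valued by taking \<^const>\<open>Re\<close>; each is followed by a lemma stating that no
  imaginary part is lost.\<close>

lemma of_real_Re_scaled:
  assumes "Im S = 0"
  shows "complex_of_real (Re (of_real c * S)) = of_real c * S"
  using assms by (simp add: complex_eq_iff)

definition spectral_density :: "(int \<Rightarrow> real) \<Rightarrow> real \<Rightarrow> real" where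
  "spectral_density r l =
     Re (1 / (2 * of_real pi) * (\<Sum>\<^sub>\<infinity>k\<in>UNIV. of_real (r k) * cis (of_int k * l)))"

lemma of_real_spectral_density:
  assumes "\<And>k. r (- k) = r k"
  shows "complex_of_real (spectral_density r l) =
     1 / (2 * of_real pi) * (\<Sum>\<^sub>\<infinity>k\<in>UNIV. of_real (r k) * cis (of_int k * l))"
proof -
  define S where "S = (\<Sum>\<^sub>\<infinity>k\<in>UNIV. complex_of_real (r k) * cis (of_int k * l))"
  have "cnj S = (\<Sum>\<^sub>\<infinity>k\<in>UNIV. complex_of_real (r (- k)) * cis (of_int (- k) * l))"
    unfolding S_def infsum_cnj[symmetric] by (simp add: assms cis_cnj)
  also have "\<dots> = S"
    unfolding S_def by (rule infsum_reindex_bij_witness[of _ uminus uminus]) auto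
  finally have "Im S = 0"
    by (simp add: complex_eq_iff)
  then show ?thesis
    unfolding spectral_density_def S_def[symmetric]
    using of_real_Re_scaled[of S "1 / (2 * pi)"] by simp
qed

text \<open>Statistics are functions of the sample path \<open>x :: int \<Rightarrow> real\<close>; only \<open>x 1, \<dots>, x n\<close>
  are used.\<close>

definition sample_autocov :: "nat \<Rightarrow> (int \<Rightarrow> real) \<Rightarrow> int \<Rightarrow> real" where
  "sample_autocov n x k = (1 / real n) * (\<Sum>j = 1..int n - \<bar>k\<bar>. x j * x (j + \<bar>k\<bar>))"

abbreviation bandwidth :: "nat \<Rightarrow> real" where
  "bandwidth m \<equiv> 1 / real m"

definition lag_window_est ::
  "(real \<Rightarrow> real) \<Rightarrow> nat \<Rightarrow> nat \<Rightarrow> (int \<Rightarrow> real) \<Rightarrow> real \<Rightarrow> real" where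
  "lag_window_est a m n x l =
     Re (1 / (2 * of_real pi) *
         (\<Sum>k = - int m..int m.
            of_real (sample_autocov n x k * a (of_int k * bandwidth m)) * cis (- of_int k * l)))"

lemma Im_symmetric_sum_eq_0:
  assumes "\<And>k. c (- k) = (c k :: real)"
  shows "Im (\<Sum>k = - int m..int m. of_real (c k) * cis (- of_int k * l)) = 0"
proof -
  define S where "S = (\<Sum>k = - int m..int m. complex_of_real (c k) * cis (- of_int k * l))"
  have "cnj S = (\<Sum>k = - int m..int m. complex_of_real (c (- k)) * cis (- of_int (- k) * l))"
    unfolding S_def by (simp add: assms cis_cnj)
  also have "\<dots> = S"
    unfolding S_def by (rule sum.reindex_bij_witness[of _ uminus uminus]) auto
  finally have "Im S = 0"
    by (simp add: complex_eq_iff)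
  then show ?thesis
    unfolding S_def .
qed

lemma of_real_lag_window_est:
  assumes "\<And>t. a (- t) = a t"
  shows "complex_of_real (lag_window_est a m n x l) =
     1 / (2 * of_real pi) *
       (\<Sum>k = - int m..int m.
          of_real (sample_autocov n x k * a (of_int k * bandwidth m)) * cis (- of_int k * l))"
proof -
  define S where "S = (\<Sum>k = - int m..int m.
     complex_of_real (sample_autocov n x k * a (of_int k * bandwidth m)) * cis (- of_int k * l))"
  have "a (of_int (- k) * bandwidth m) = a (of_int k * bandwidth m)" for k
    using assms[of "of_int k * bandwidth m"] by simp
  then have "Im S = 0"
    unfolding S_def by (intro Im_symmetric_sum_eq_0) (simp add: sample_autocov_def)
  then show ?thesis
    unfolding lag_window_est_def S_def[symmetric]
    using of_real_Re_scaled[of S "1 / (2 * pi)"] by simp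
qed

definition eta :: "real \<Rightarrow> real" where
  "eta l = (if \<exists>k::int. l = 2 * pi * of_int k then 1 else 0)"

definition asymp_var :: "(real \<Rightarrow> real) \<Rightarrow> (real \<Rightarrow> real) \<Rightarrow> real \<Rightarrow> real" where
  "asymp_var a f l = (1 + eta (2 * l)) * (f l)\<^sup>2 * (LBINT t:{-1..1}. (a t)\<^sup>2)"

definition fourier_freq :: "nat \<Rightarrow> int \<Rightarrow> real" where
  "fourier_freq n j = 2 * pi * of_int j / real n"

definition periodogram :: "nat \<Rightarrow> (int \<Rightarrow> real) \<Rightarrow> int \<Rightarrow> real" where
  "periodogram n x j =
     1 / (2 * pi * real n) *
     (cmod (\<Sum>k = 1..int n. of_real (x k) * cis (of_int k * fourier_freq n j)))\<^sup>2"

text \<open>In what follows \<open>ft :: real \<Rightarrow> real\<close> is the pilot estimate of the spectral density computed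
  from the path \<open>x\<close>.\<close>

definition raw_resid :: "nat \<Rightarrow> (int \<Rightarrow> real) \<Rightarrow> (real \<Rightarrow> real) \<Rightarrow> nat \<Rightarrow> real" where
  "raw_resid n x ft j = periodogram n x (int j) / ft (fourier_freq n (int j))"

definition mean_resid :: "nat \<Rightarrow> (int \<Rightarrow> real) \<Rightarrow> (real \<Rightarrow> real) \<Rightarrow> real" where
  "mean_resid n x ft = 1 / real (n div 2) * (\<Sum>j = 1..n div 2. raw_resid n x ft j)"

definition scaled_resid :: "nat \<Rightarrow> (int \<Rightarrow> real) \<Rightarrow> (real \<Rightarrow> real) \<Rightarrow> nat \<Rightarrow> real" where
  "scaled_resid n x ft j = raw_resid n x ft j / mean_resid n x ft"

definition bootstrap_defined :: "nat \<Rightarrow> (int \<Rightarrow> real) \<Rightarrow> (real \<Rightarrow> real) \<Rightarrow> bool" where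
  "bootstrap_defined n x ft \<longleftrightarrow>
     1 \<le> n div 2 \<and>
     (\<forall>j\<in>{1..n div 2}. ft (fourier_freq n (int j)) \<noteq> 0) \<and> mean_resid n x ft \<noteq> 0"

text \<open>The joint conditional law, given the data, of the resampled residuals
  \<open>e 1, \<dots>, e (n div 2)\<close>: independent, each with the empirical distribution (with multiplicities)
  of the scaled residuals.\<close>

definition resampled_resid_pmf ::
  "nat \<Rightarrow> (int \<Rightarrow> real) \<Rightarrow> (real \<Rightarrow> real) \<Rightarrow> (nat \<Rightarrow> real) pmf" where
  "resampled_resid_pmf n x ft =
     Pi_pmf {1..n div 2} 0 (\<lambda>_. map_pmf (scaled_resid n x ft) (pmf_of_set {1..n div 2}))"

definition boot_periodogram :: "nat \<Rightarrow> (real \<Rightarrow> real) \<Rightarrow> (nat \<Rightarrow> real) \<Rightarrow> int \<Rightarrow> real" where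
  "boot_periodogram n ft e j =
     (if j = 0 then 0 else ft (fourier_freq n \<bar>j\<bar>) * e (nat \<bar>j\<bar>))"

definition boot_est ::
  "(real \<Rightarrow> real) \<Rightarrow> nat \<Rightarrow> nat \<Rightarrow> (real \<Rightarrow> real) \<Rightarrow> (nat \<Rightarrow> real) \<Rightarrow> real \<Rightarrow> real" where
  "boot_est a m n ft e l =
     Re (1 / of_nat n *
         (\<Sum>j = - ((int n - 1) div 2)..int n div 2.
            of_real (boot_periodogram n ft e j) *
            (\<Sum>k = - int m..int m.
               of_real (a (of_int k * bandwidth m)) * cis (- of_int k * (l - fourier_freq n j)))))"

lemma of_real_boot_est:
  assumes "\<And>t. a (- t) = a t"
  shows "complex_of_real (boot_est a m n ft e l) =
     1 / of_nat n *
       (\<Sum>j = - ((int n - 1) div 2)..int n div 2.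
          of_real (boot_periodogram n ft e j) *
          (\<Sum>k = - int m..int m.
             of_real (a (of_int k * bandwidth m)) * cis (- of_int k * (l - fourier_freq n j))))"
proof -
  define S where "S j = (\<Sum>k = - int m..int m.
     complex_of_real (a (of_int k * bandwidth m)) * cis (- of_int k * (l - fourier_freq n j)))" for j
  have "a (of_int (- k) * bandwidth m) = a (of_int k * bandwidth m)" for k
    using assms[of "of_int k * bandwidth m"] by simp
  then have "Im (S j) = 0" for j
    unfolding S_def by (intro Im_symmetric_sum_eq_0)
  then have "Im (\<Sum>j = - ((int n - 1) div 2)..int n div 2.
      of_real (boot_periodogram n ft e j) * S j) = 0"
    by simp
  from of_real_Re_scaled[OF this, of "1 / real n"] show ?thesis
    unfolding boot_est_def S_def[symmetric] by simp
qed

definition boot_est_law ::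
  "(real \<Rightarrow> real) \<Rightarrow> nat \<Rightarrow> nat \<Rightarrow> (int \<Rightarrow> real) \<Rightarrow> (real \<Rightarrow> real) \<Rightarrow> real \<Rightarrow> real measure" where
  "boot_est_law a m n x ft l =
     distr (measure_pmf (resampled_resid_pmf n x ft)) borel (\<lambda>e. boot_est a m n ft e l)"

text \<open>A random vector with marginals \<open>P\<close> and \<open>Q\<close> is represented by its joint law.\<close>

definition couplings :: "real measure \<Rightarrow> real measure \<Rightarrow> (real \<times> real) measure set" where
  "couplings P Q =
     {R. sets R = sets (borel \<Otimes>\<^sub>M borel) \<and> distr R borel fst = P \<and> distr R borel snd = Q}"

definition mallows_dist :: "real measure \<Rightarrow> real measure \<Rightarrow> real" where
  "mallows_dist P Q = (INF R\<in>couplings P Q. sqrt (\<integral>z. \<bar>fst z - snd z\<bar>\<^sup>2 \<partial>R))"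

text \<open>\<open>Z n = o\<^sub>P(c n)\<close>. The quantities \<open>Z n\<close> need not be measurable (for instance on a null set
  or where the bootstrap is undefined), so exceptional events are required to be covered by
  measurable sets of vanishing probability; the lemma below shows that this is the usual notion
  when \<open>Z n\<close> is measurable.\<close>

definition small_o_prob :: "'a measure \<Rightarrow> (nat \<Rightarrow> 'a \<Rightarrow> real) \<Rightarrow> (nat \<Rightarrow> real) \<Rightarrow> bool" where
  "small_o_prob M Z c \<longleftrightarrow>
     (\<forall>\<epsilon>>0. \<exists>A. (\<forall>n. A n \<in> sets M \<and> {\<omega> \<in> space M. \<bar>Z n \<omega> / c n\<bar> > \<epsilon>} \<subseteq> A n) \<and>
        (\<lambda>n. measure M (A n)) \<longlonglongrightarrow> 0)"

lemma small_o_prob_iff_measurable: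
  assumes "prob_space M" and [measurable]: "\<And>n. Z n \<in> borel_measurable M"
  shows "small_o_prob M Z c \<longleftrightarrow>
     (\<forall>\<epsilon>>0. (\<lambda>n. measure M {\<omega> \<in> space M. \<bar>Z n \<omega> / c n\<bar> > \<epsilon>}) \<longlonglongrightarrow> 0)"
proof -
  interpret prob_space M by fact
  let ?E = "\<lambda>\<epsilon> n. {\<omega> \<in> space M. \<bar>Z n \<omega> / c n\<bar> > \<epsilon>}"
  have meas: "?E \<epsilon> n \<in> sets M" for \<epsilon> n
    by measurable
  show ?thesis
  proof
    assume L: "small_o_prob M Z c"
    show "\<forall>\<epsilon>>0. (\<lambda>n. measure M (?E \<epsilon> n)) \<longlonglongrightarrow> 0"
    proof (intro allI impI)
      fix \<epsilon> :: real assume "\<epsilon> > 0"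
      then obtain A where A: "\<And>n. A n \<in> sets M" "\<And>n. ?E \<epsilon> n \<subseteq> A n"
        "(\<lambda>n. measure M (A n)) \<longlonglongrightarrow> 0"
        using L unfolding small_o_prob_def by meson
      show "(\<lambda>n. measure M (?E \<epsilon> n)) \<longlonglongrightarrow> 0"
      proof (rule tendsto_sandwich[OF _ _ tendsto_const A(3)])
        show "\<forall>\<^sub>F n in sequentially. measure M (?E \<epsilon> n) \<le> measure M (A n)"
          by (intro always_eventually allI finite_measure_mono A(1) A(2))
      qed simp
    qed
  next
    assume R: "\<forall>\<epsilon>>0. (\<lambda>n. measure M (?E \<epsilon> n)) \<longlonglongrightarrow> 0"
    show "small_o_prob M Z c"
      unfolding small_o_prob_def
    proof (intro allI impI)
      fix \<epsilon> :: real assume "\<epsilon> > 0"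
      then show "\<exists>A. (\<forall>n. A n \<in> sets M \<and> ?E \<epsilon> n \<subseteq> A n) \<and> (\<lambda>n. measure M (A n)) \<longlonglongrightarrow> 0"
        using R meas by (intro exI[of _ "?E \<epsilon>"]) auto
    qed
  qed
qed

end

theory Submission
  imports Defs
begin

text \<open>Both estimates split into a centred part and a bias. By (A6) the centred part of \<open>g\<^sub>n\<close> converges
  to a normal law together with its second moment, which is convergence in \<open>d\<^sub>2\<close>. Given the data,
  the centred part of \<open>g\<^sub>n\<^sup>*\<close> is a weighted sum of i.i.d. variables, so Lyapunov's theorem gives it the
  same limit as soon as the residuals \<open>I\<^sub>j / f(\<omega>\<^sub>j)\<close> have empirical first and second moments tending
  to 1 and 2 and empirical fourth moment \<open>o(n / B\<^sub>n)\<close>. In probability this holds because, for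
  summable cumulants, the moments of the discrete Fourier transforms obey Wick's formula up to an
  error of order \<open>n\<close> to the power \<open>- 1 / 2\<close>.

  The biases, of order \<open>b\<^sub>n\<^sup>2\<close>, agree to first order: the one of \<open>f\<^sub>n\<^sup>*\<close> is computed from the
  pilot covariances \<open>r(k) a(k b)\<close>, \<open>b\<close> being the pilot bandwidth, and the noise in it, multiplied by
  \<open>k\<^sup>2\<close>, has variance of order \<open>b\<close> to the power \<open>- 5\<close> over \<open>n\<close>, which tends to 0 since
  \<open>b\<^sub>n = o(b)\<close>.

  Convergence in probability reduces to convergence along arbitrary sequences \<open>(n\<^sub>k, \<omega>\<^sub>k)\<close> on which the
  finitely many controlling statistics converge, so all conditional laws are handled as
  deterministic ones.\<close>

section \<open>Cumulants of stationary processes\<close>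

text \<open>Order eight is forced by the empirical second moment of the residuals: its mean square
  contains E(I_i^2 I_j^2), a product of eight transforms. In such a moment a frequency can be paired
  only with its negative modulo \<open>n\<close>. At 2 j = n the transform is its own conjugate and
  extra pairings appear, so this single index is set aside, at a cost of O(1/n). The fourth
  empirical moment needs only a bounded mean, because the rescaled squared weights are O(B_n/n).

  The rate of b_n acts in both directions. Boundedness of n b_n^5 bounds sqrt(n b_n) b_n^2, so the
  two biases need agree only up to o(b_n^2); boundedness of B_n^5/n makes the noise of the pilot
  covariances vanish.

  The conditional mean of the bootstrap estimate is an exact finite sum: pilot and kernel are
  trigonometric polynomials, and orthogonality over the Fourier frequencies multiplies their
  coefficients. Only the suppressed frequency 0 leaves a remainder, of order B_n/n before scaling.

  Passing from f to the pilot changes residuals and weights by factors close to 1, uniformly, since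
  f is bounded below; all limits are therefore computed with f and then sandwiched.\<close>

text \<open>Moebius inversion on the lattice of set partitions, for an arbitrary set function
  \<open>m\<close>. Index sets in place of lists let a cumulant be restricted to a subset, as the
  recursion below requires.\<close>

definition moebius_cumulant :: "('i set \<Rightarrow> real) \<Rightarrow> 'i set \<Rightarrow> real" where
  "moebius_cumulant m S =
     (\<Sum>P | partition_on S P. (-1) ^ (card P - 1) * fact (card P - 1) * (\<Prod>A\<in>P. m A))"

lemma partition_on_remove_block:
  assumes "partition_on S P" "C \<in> P"
  shows "partition_on (S - C) (P - {C})"
proof (rule partition_onI)
  have *: "A \<inter> C = {}" if "A \<in> P - {C}" for A
    using assms that by (auto simp: partition_on_def disjoint_def)
  show "\<Union>(P - {C}) = S - C"
    using * assms by (auto simp: partition_on_def)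
  show "\<And>p q. p \<in> P - {C} \<Longrightarrow> q \<in> P - {C} \<Longrightarrow> p \<noteq> q \<Longrightarrow> disjnt p q"
    using assms by (auto simp: partition_on_def disjoint_def disjnt_def)
  show "{} \<notin> P - {C}"
    using assms by (auto simp: partition_on_def)
qed

lemma partition_on_add_block:
  assumes "partition_on A Q" "A \<subset> S"
  shows "partition_on S (insert (S - A) Q)" "S - A \<notin> Q"
proof -
  have sub: "B \<subseteq> A" if "B \<in> Q" for B
    using assms that by (auto simp: partition_on_def)
  show "partition_on S (insert (S - A) Q)"
  proof (rule partition_onI)
    show "\<Union>(insert (S - A) Q) = S"
      using assms by (auto simp: partition_on_def)
    fix p q assume pq: "p \<in> insert (S - A) Q" "q \<in> insert (S - A) Q" "p \<noteq> q"
    show "disjnt p q"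
    proof (cases "p = S - A \<or> q = S - A")
      case True
      then show ?thesis using pq sub by (auto simp: disjnt_def)
    next
      case False
      then show ?thesis using pq assms by (auto simp: disjnt_def partition_on_def disjoint_def)
    qed
  next
    show "{} \<notin> insert (S - A) Q"
      using assms by (auto simp: partition_on_def)
  qed
  show "S - A \<notin> Q"
    using sub[of "S - A"] assms by blast
qed

text \<open>Exactly one block contains \<open>i\<close>. This number is the multiplicity with which
  a partition returns in the recursion below.\<close>

lemma card_blocks_without:
  assumes "finite S" "partition_on S P" "i \<in> S"
  shows "card {C \<in> P. i \<notin> C} = card P - 1"
proof -
  have fin: "finite P" using assms finite_elements by blast
  obtain C0 where C0: "C0 \<in> P" "i \<in> C0"
    using assms by (auto simp: partition_on_def)
  have "{C \<in> P. i \<notin> C} = P - {C0}"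
    using assms C0 by (auto simp: partition_on_def disjoint_def)
  then show ?thesis using C0 fin by simp
qed

text \<open>In the expansion of the right-hand side a partition with at least two blocks arises once from
  \<^term>\<open>A = S\<close> and once for each of its blocks avoiding \<^term>\<open>i\<close>, and these contributions cancel.\<close>

lemma moment_moebius_cumulant_rec:
  fixes m :: "'i set \<Rightarrow> real"
  assumes fin: "finite S" and i: "i \<in> S" and m0: "m {} = 1"
  shows "m S = (\<Sum>A | A \<subseteq> S \<and> i \<in> A. moebius_cumulant m A * m (S - A))"
proof -
  define c :: "nat \<Rightarrow> real" where "c k = (-1) ^ (k - 1) * fact (k - 1)" for k
  define \<A> where "\<A> = {A. A \<subset> S \<and> i \<in> A}"
  define Q where "Q A = {P. partition_on A P}" for A :: "'i set"
  have finQ: "finite (Q A)" if "A \<subseteq> S" for A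
    unfolding Q_def using that fin finitely_many_partition_on finite_subset by blast
  have finA: "finite \<A>"
    by (rule finite_subset[of _ "Pow S"]) (use fin in \<open>auto simp: \<A>_def\<close>)
  have finP: "finite P" if "P \<in> Q A" "A \<subseteq> S" for P A
    using that fin finite_elements finite_subset unfolding Q_def by blast
  have split: "{A. A \<subseteq> S \<and> i \<in> A} = insert S \<A>" "S \<notin> \<A>"
    using i by (auto simp: \<A>_def)
  have "(\<Sum>A\<in>\<A>. moebius_cumulant m A * m (S - A)) =
        (\<Sum>A\<in>\<A>. \<Sum>P\<in>Q A. c (card P) * (\<Prod>B\<in>insert (S - A) P. m B))"
    unfolding moebius_cumulant_def sum_distrib_right Q_def[symmetric] c_def[symmetric]
  proof (intro sum.cong refl)
    fix A P assume "A \<in> \<A>" "P \<in> Q A"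
    then have "A \<subset> S" "partition_on A P" "P \<in> Q A" by (auto simp: \<A>_def Q_def)
    then have "S - A \<notin> P" "finite P"
      using partition_on_add_block(2)[of A P S] finP[of P A] by blast+
    then show "c (card P) * (\<Prod>A\<in>P. m A) * m (S - A) = c (card P) * (\<Prod>B\<in>insert (S - A) P. m B)"
      by simp
  qed
  also have "\<dots> = (\<Sum>(A, P)\<in>Sigma \<A> Q. c (card P) * (\<Prod>B\<in>insert (S - A) P. m B))"
    using finA finQ by (subst sum.Sigma) (auto simp: \<A>_def)
  \<comment> \<open>The complement \<open>S - A\<close> joins the partition of \<open>A\<close> as a
    marked block \<open>C\<close> avoiding \<open>i\<close>; deleting the marked block is the
    inverse map.\<close>
  also have "\<dots> = (\<Sum>(P, C)\<in>Sigma (Q S) (\<lambda>P. {C \<in> P. i \<notin> C}). c (card P - 1) * (\<Prod>B\<in>P. m B))"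
  proof (rule sum.reindex_bij_witness[where i="\<lambda>(P, C). (S - C, P - {C})"
        and j="\<lambda>(A, P). (insert (S - A) P, S - A)"], goal_cases)
    case (1 a)
    obtain A P where a: "a = (A, P)" by (cases a)
    have AP: "A \<subset> S" "partition_on A P" "i \<in> A" using 1 by (auto simp: \<A>_def Q_def a)
    then show ?case using partition_on_add_block[of A P S] by (auto simp: a)
  next
    case (2 a)
    obtain A P where a: "a = (A, P)" by (cases a)
    have AP: "A \<subset> S" "partition_on A P" "i \<in> A" using 2 by (auto simp: \<A>_def Q_def a)
    then show ?case using partition_on_add_block[of A P S] by (auto simp: Q_def a)
  next
    case (3 b)
    obtain P C where b: "b = (P, C)" by (cases b)
    have "C \<subseteq> S" "C \<noteq> {}" using 3 by (auto simp: b Q_def partition_on_def)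
    then show ?case using 3 double_diff[of C S S] by (auto simp: b insert_absorb)
  next
    case (4 b)
    obtain P C where b: "b = (P, C)" by (cases b)
    have "C \<subseteq> S" "C \<noteq> {}" using 4 by (auto simp: b Q_def partition_on_def)
    then show ?case using 4 i partition_on_remove_block[of S P C] by (auto simp: b Q_def \<A>_def)
  next
    case (5 a)
    obtain A P where a: "a = (A, P)" by (cases a)
    have AP: "A \<subset> S" "partition_on A P" "P \<in> Q A" using 5 by (auto simp: \<A>_def Q_def a)
    then have "S - A \<notin> P" "finite P"
      using partition_on_add_block(2)[of A P S] finP[of P A] by blast+
    then show ?case by (simp add: a)
  qed
  also have "\<dots> = (\<Sum>P\<in>Q S. real (card P - 1) * c (card P - 1) * (\<Prod>B\<in>P. m B))"
  proof (subst sum.Sigma[symmetric])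
    show "(\<Sum>P\<in>Q S. \<Sum>C\<in>{C \<in> P. i \<notin> C}. c (card P - 1) * (\<Prod>B\<in>P. m B)) =
      (\<Sum>P\<in>Q S. real (card P - 1) * c (card P - 1) * (\<Prod>B\<in>P. m B))"
      using card_blocks_without[OF fin _ i] by (intro sum.cong) (auto simp: Q_def)
  qed (use finQ finP in auto)
  finally have "(\<Sum>A | A \<subseteq> S \<and> i \<in> A. moebius_cumulant m A * m (S - A)) =
      (\<Sum>P\<in>Q S. c (card P) * (\<Prod>B\<in>P. m B)) +
      (\<Sum>P\<in>Q S. real (card P - 1) * c (card P - 1) * (\<Prod>B\<in>P. m B))"
    unfolding split(1) using split(2) finA m0
    by (simp add: moebius_cumulant_def Q_def c_def)
  \<comment> \<open>For k >= 2 the coefficients satisfy (k - 1) \<open>c\<close> (k - 1) = -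
    \<open>c\<close> k, so only the one-block partition survives.\<close>
  also have "\<dots> = (\<Sum>P\<in>Q S. if P = {S} then m S else 0)"
    unfolding sum.distrib[symmetric]
  proof (intro sum.cong refl)
    fix P assume P: "P \<in> Q S"
    have fP: "finite P" using P finP by blast
    have ne: "P \<noteq> {}" using P i by (auto simp: Q_def partition_on_def)
    show "c (card P) * (\<Prod>B\<in>P. m B) + real (card P - 1) * c (card P - 1) * (\<Prod>B\<in>P. m B) =
       (if P = {S} then m S else 0)"
    proof (cases "card P = 1")
      case True
      then obtain A where "P = {A}" by (auto simp: card_1_singleton_iff)
      then have "P = {S}" using P by (auto simp: Q_def partition_on_def)
      then show ?thesis by (simp add: c_def)
    next
      case False
      moreover have "card P \<noteq> 0" using fP ne by simp
      ultimately obtain k where k: "card P = Suc (Suc k)"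
        by (metis One_nat_def not0_implies_Suc)
      then have "P \<noteq> {S}" by auto
      then show ?thesis using k by (simp add: c_def algebra_simps)
    qed
  qed
  also have "\<dots> = m S"
  proof -
    have "{S} \<in> Q S" using i by (auto simp: Q_def intro: partition_on_space)
    then show ?thesis using finQ[of S] by simp
  qed
  finally show ?thesis by simp
qed

lemma partition_on_image_inj:
  assumes "partition_on S P" "inj_on h S"
  shows "partition_on (h ` S) ((`) h ` P)"
proof -
  have "{} \<notin> (`) h ` P" using assms(1) by (auto simp: partition_on_def)
  then show ?thesis using partition_on_inj_image[OF assms] by simp
qed

lemma moebius_cumulant_reindex:
  assumes "inj_on h S"
  shows "moebius_cumulant m (h ` S) = moebius_cumulant (\<lambda>A. m (h ` A)) S"
proof -
  have part: "bij_betw ((`) ((`) h)) {P. partition_on S P} {P. partition_on (h ` S) P}"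
  proof (rule bij_betwI[where g="(`) ((`) (inv_into S h))"])
    have inv: "inj_on (inv_into S h) (h ` S)" by (simp add: inj_on_inv_into)
    show "(`) ((`) h) \<in> {P. partition_on S P} \<rightarrow> {P. partition_on (h ` S) P}"
      using partition_on_image_inj[OF _ assms] by auto
    show "(`) ((`) (inv_into S h)) \<in> {P. partition_on (h ` S) P} \<rightarrow> {P. partition_on S P}"
      using partition_on_image_inj[OF _ inv] assms by auto
    fix P assume "P \<in> {P. partition_on S P}"
    then have "A \<subseteq> S" if "A \<in> P" for A using that by (auto simp: partition_on_def)
    then have "inv_into S h ` h ` A = A" if "A \<in> P" for A
      using that assms by (simp add: inv_into_image_cancel)
    then show "(`) (inv_into S h) ` (`) h ` P = P"
      by (auto simp: image_comp)
  next
    fix P assume "P \<in> {P. partition_on (h ` S) P}"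
    then have "A \<subseteq> h ` S" if "A \<in> P" for A using that by (auto simp: partition_on_def)
    then have "h ` inv_into S h ` A = A" if "A \<in> P" for A
      using that by (simp add: image_inv_into_cancel)
    then show "(`) h ` (`) (inv_into S h) ` P = P"
      by (auto simp: image_comp)
  qed
  have inj: "inj_on ((`) h) P" if "partition_on S P" for P
    using that assms by (auto simp: partition_on_def intro: inj_on_image)
  have "moebius_cumulant m (h ` S) = (\<Sum>P | partition_on S P. (-1) ^ (card ((`) h ` P) - 1) *
      fact (card ((`) h ` P) - 1) * (\<Prod>A\<in>(`) h ` P. m A))"
    unfolding moebius_cumulant_def by (subst sum.reindex_bij_betw[OF part, symmetric]) simp
  also have "\<dots> = moebius_cumulant (\<lambda>A. m (h ` A)) S"
    unfolding moebius_cumulant_def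
    by (intro sum.cong refl) (simp add: card_image[OF inj] prod.reindex[OF inj])
  finally show ?thesis .
qed

lemma moebius_cumulant_cong:
  assumes "\<And>A. A \<subseteq> S \<Longrightarrow> A \<noteq> {} \<Longrightarrow> m A = m' A"
  shows "moebius_cumulant m S = moebius_cumulant m' S"
  unfolding moebius_cumulant_def
proof (intro sum.cong refl arg_cong2[where f="(*)"] prod.cong)
  fix P A assume "P \<in> {P. partition_on S P}" "A \<in> P"
  then show "m A = m' A" using assms[of A] by (auto simp: partition_on_def)
qed

text \<open>Each factor is at most the \<open>p\<close>-th root of the right-hand side s, and s >= 1
  allows the exponent \<open>card A\<close> to be raised to \<open>p\<close>.\<close>

lemma abs_prod_le_sum_power:
  fixes x :: "'i \<Rightarrow> real"
  assumes "finite A" "card A \<le> p" "p > 0"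
  shows "\<bar>\<Prod>i\<in>A. x i\<bar> \<le> 1 + (\<Sum>i\<in>A. \<bar>x i\<bar> ^ p)"
proof -
  define s where "s = 1 + (\<Sum>i\<in>A. \<bar>x i\<bar> ^ p)"
  have s1: "s \<ge> 1" unfolding s_def by (simp add: sum_nonneg)
  have le: "\<bar>x i\<bar> \<le> root p s" if "i \<in> A" for i
  proof -
    have "\<bar>x i\<bar> ^ p \<le> (\<Sum>i\<in>A. \<bar>x i\<bar> ^ p)"
      using that assms by (intro member_le_sum) auto
    then have "\<bar>x i\<bar> ^ p \<le> s" unfolding s_def by simp
    then have "root p (\<bar>x i\<bar> ^ p) \<le> root p s" using assms by simp
    then show ?thesis using assms by (simp add: real_root_power_cancel)
  qed
  have "\<bar>\<Prod>i\<in>A. x i\<bar> = (\<Prod>i\<in>A. \<bar>x i\<bar>)" by (simp add: abs_prod)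
  also have "\<dots> \<le> (\<Prod>i\<in>A. root p s)" using le by (intro prod_mono) auto
  also have "\<dots> = root p s ^ card A" by simp
  also have "\<dots> \<le> root p s ^ p"
    using assms s1 by (intro power_increasing) auto
  also have "\<dots> = s" using assms s1 by (simp add: real_root_pow_pos2)
  finally show ?thesis unfolding s_def .
qed

locale stationary_cumulants = prob_space M for M :: "'a measure" +
  fixes X :: "int \<Rightarrow> 'a \<Rightarrow> real"
  assumes stationary: "strictly_stationary M X"
    and moment8: "\<And>t. integrable M (\<lambda>\<omega>. \<bar>X t \<omega>\<bar> ^ 8)"
    and centred: "\<And>t. expectation (X t) = 0"
    and cumulants_summable: "\<And>k. k \<in> {3..8} \<Longrightarrow>
      (\<lambda>ts. \<bar>joint_cumulant M (map X (0 # ts))\<bar>) summable_on {ts :: int list. length ts = k - 1}"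
    and autocov_summable: "(\<lambda>k. \<bar>autocov M X k\<bar> * (of_int k)\<^sup>2) summable_on UNIV"
begin

lemma measurable_X[measurable]: "X t \<in> borel_measurable M"
  using stationary unfolding strictly_stationary_def by blast

text \<open>Times are attached to abstract indices through \<open>t\<close>, so that coinciding
  times still count as separate factors.\<close>

definition joint_moment :: "('i \<Rightarrow> int) \<Rightarrow> 'i set \<Rightarrow> real" where
  "joint_moment t A = expectation (\<lambda>\<omega>. \<Prod>i\<in>A. X (t i) \<omega>)"

abbreviation cumul :: "('i \<Rightarrow> int) \<Rightarrow> 'i set \<Rightarrow> real" where
  "cumul t \<equiv> moebius_cumulant (joint_moment t)"

abbreviation r :: "int \<Rightarrow> real" where "r \<equiv> autocov M X"

lemma integrable_prod_X:
  assumes "finite A" "card A \<le> 8"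
  shows "integrable M (\<lambda>\<omega>. \<Prod>i\<in>A. X (t i) \<omega>)"
proof (rule Bochner_Integration.integrable_bound)
  show "integrable M (\<lambda>\<omega>. 1 + (\<Sum>i\<in>A. \<bar>X (t i) \<omega>\<bar> ^ 8))"
    using moment8 by auto
  show "AE \<omega> in M. norm (\<Prod>i\<in>A. X (t i) \<omega>) \<le> norm (1 + (\<Sum>i\<in>A. \<bar>X (t i) \<omega>\<bar> ^ 8))"
  proof (rule AE_I2)
    fix \<omega>
    have "0 \<le> (\<Sum>i\<in>A. \<bar>X (t i) \<omega>\<bar> ^ 8)" by (intro sum_nonneg) auto
    then show "norm (\<Prod>i\<in>A. X (t i) \<omega>) \<le> norm (1 + (\<Sum>i\<in>A. \<bar>X (t i) \<omega>\<bar> ^ 8))"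
      using abs_prod_le_sum_power[OF assms, of "\<lambda>i. X (t i) \<omega>"] by simp
  qed
qed measurable

text \<open>The product is a measurable function \<open>g\<close> of the path restricted to the
  finite set of times occurring in \<open>t\<close>, whose joint law is shift invariant by strict
  stationarity.\<close>

lemma joint_moment_shift:
  assumes fin: "finite A"
  shows "joint_moment (\<lambda>i. t i + h) A = joint_moment t A"
proof -
  define g where "g y = (\<Prod>i\<in>A. y (t i))" for y :: "int \<Rightarrow> real"
  have g: "g \<in> borel_measurable (PiM (t ` A) (\<lambda>_. borel))"
    unfolding g_def by (intro borel_measurable_prod measurable_component_singleton) auto
  have eq: "expectation (\<lambda>\<omega>. \<Prod>i\<in>A. X (t i + k) \<omega>) =
      (\<integral>y. g y \<partial>distr M (PiM (t ` A) (\<lambda>_. borel)) (\<lambda>\<omega>. \<lambda>s\<in>t ` A. X (s + k) \<omega>))" for k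
    by (subst integral_distr[OF _ g]) (auto simp: g_def intro!: Bochner_Integration.integral_cong prod.cong)
  have "distr M (PiM (t ` A) (\<lambda>_. borel)) (\<lambda>\<omega>. \<lambda>s\<in>t ` A. X (s + h) \<omega>) =
        distr M (PiM (t ` A) (\<lambda>_. borel)) (\<lambda>\<omega>. \<lambda>s\<in>t ` A. X (s + 0) \<omega>)"
    using stationary fin unfolding strictly_stationary_def by simp
  then show ?thesis using eq[of h] eq[of 0] by (simp add: joint_moment_def)
qed

lemma cumul_shift: "finite A \<Longrightarrow> cumul (\<lambda>i. t i + h) A = cumul t A"
  by (rule moebius_cumulant_cong, rule joint_moment_shift) (rule finite_subset)

lemma joint_moment_cong: "(\<And>i. i \<in> A \<Longrightarrow> t i = t' i) \<Longrightarrow> joint_moment t A = joint_moment t' A"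
  unfolding joint_moment_def by (auto intro!: Bochner_Integration.integral_cong prod.cong)

lemma cumul_cong: "(\<And>i. i \<in> A \<Longrightarrow> t i = t' i) \<Longrightarrow> cumul t A = cumul t' A"
  by (rule moebius_cumulant_cong) (rule joint_moment_cong, blast)

text \<open>Positions in the list parametrise the index set. This is the bridge from the hypothesis,
  stated for lists, to the set-indexed cumulants of the recursion.\<close>

lemma joint_cumulant_eq_cumul:
  assumes "distinct xs"
  shows "joint_cumulant M (map (\<lambda>i. X (t i)) xs) = cumul t (set xs)"
proof -
  have inj: "inj_on ((!) xs) {..<length xs}"
    using assms by (auto simp: inj_on_def nth_eq_iff_index_eq)
  have set: "set xs = (!) xs ` {..<length xs}" by (auto simp: set_conv_nth)
  have "joint_cumulant M (map (\<lambda>i. X (t i)) xs) =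
      moebius_cumulant (\<lambda>A. \<integral>\<omega>. (\<Prod>i\<in>A. (map (\<lambda>i. X (t i)) xs ! i) \<omega>) \<partial>M) {..<length xs}"
    by (simp add: joint_cumulant_def moebius_cumulant_def)
  also have "\<dots> = moebius_cumulant (\<lambda>A. joint_moment t ((!) xs ` A)) {..<length xs}"
  proof (rule moebius_cumulant_cong)
    fix A assume A: "A \<subseteq> {..<length xs}"
    then have "inj_on ((!) xs) A" using inj inj_on_subset by blast
    then show "(\<integral>\<omega>. (\<Prod>i\<in>A. (map (\<lambda>i. X (t i)) xs ! i) \<omega>) \<partial>M) = joint_moment t ((!) xs ` A)"
      unfolding joint_moment_def using A
      by (auto simp: prod.reindex intro!: Bochner_Integration.integral_cong prod.cong)
  qed
  also have "\<dots> = cumul t (set xs)"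
    unfolding set by (rule moebius_cumulant_reindex[OF inj, symmetric])
  finally show ?thesis .
qed

lemma joint_moment_empty[simp]: "joint_moment t {} = 1"
  by (simp add: joint_moment_def prob_space)

lemmas joint_moment_rec = moment_moebius_cumulant_rec[where m = "joint_moment t" for t, OF _ _ joint_moment_empty]

lemma joint_moment_singleton[simp]: "joint_moment t {i} = 0"
  by (simp add: joint_moment_def centred)

lemma cumul_singleton[simp]: "cumul t {i} = 0"
proof -
  have "{A. A \<subseteq> {i} \<and> i \<in> A} = {{i}}" by auto
  then show ?thesis using joint_moment_rec[of "{i}" i t] by simp
qed

lemma joint_moment_pair:
  assumes "i \<noteq> j"
  shows "joint_moment t {i, j} = r (t j - t i)"
proof -
  have "joint_moment t {i, j} = joint_moment (\<lambda>k. t k + (- t i)) {i, j}"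
    by (rule joint_moment_shift[symmetric]) simp
  also have "\<dots> = r (t j - t i)"
    using assms by (simp add: joint_moment_def autocov_def)
  finally show ?thesis .
qed

lemma cumul_pair:
  assumes "i \<noteq> j"
  shows "cumul t {i, j} = r (t j - t i)"
proof -
  have "{A. A \<subseteq> {i, j} \<and> i \<in> A} = {{i}, {i, j}}" by auto
  moreover have "{i} \<noteq> {i, j}" using assms by auto
  ultimately show ?thesis
    using joint_moment_rec[of "{i, j}" i t] joint_moment_pair[OF assms, of t] by simp
qed

lemma autocov_minus: "r (- k) = r k"
proof -
  have "r (- k) = joint_moment (\<lambda>i. if i then 0 else - k) {True, False}"
    by (subst joint_moment_pair) auto
  also have "{True, False} = {False, True}" by auto
  also have "joint_moment (\<lambda>i. if i then 0 else - k) {False, True} = r k"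
    by (subst joint_moment_pair) auto
  finally show ?thesis .
qed

text \<open>The weight k^2 dominates 1 except at lag 0, which is put back separately.\<close>

lemma summable_autocov: "(\<lambda>k. \<bar>r k\<bar>) summable_on UNIV"
proof -
  have "(\<lambda>k. \<bar>r k\<bar>) summable_on (UNIV - {0})"
  proof (rule summable_on_comparison_test)
    show "(\<lambda>k. \<bar>r k\<bar> * (of_int k)\<^sup>2) summable_on (UNIV - {0})"
      using autocov_summable by (rule summable_on_subset_banach) auto
    fix k :: int assume "k \<in> UNIV - {0}"
    then have "1 \<le> \<bar>k\<bar>" by auto
    then have "1 \<le> \<bar>k\<bar> * \<bar>k\<bar>" using mult_mono[of 1 "\<bar>k\<bar>" 1 "\<bar>k\<bar>"] by simp
    then have "(1::real) \<le> (of_int k)\<^sup>2"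
      by (metis abs_mult_self_eq of_int_1_le_iff of_int_mult power2_eq_square)
    then show "\<bar>r k\<bar> \<le> \<bar>r k\<bar> * (of_int k)\<^sup>2"
      using mult_left_mono[of 1 "(of_int k)\<^sup>2" "\<bar>r k\<bar>"] by simp
  qed auto
  then show ?thesis
    using summable_on_insert_iff[of "\<lambda>k. \<bar>r k\<bar>" 0 "UNIV - {0}"] by simp
qed

lemma summable_autocov_abs: "(\<lambda>k. \<bar>r k\<bar> * \<bar>of_int k\<bar>) summable_on UNIV"
proof (rule summable_on_comparison_test[OF autocov_summable])
  fix k :: int
  have "\<bar>k\<bar> * 1 \<le> \<bar>k\<bar> * \<bar>k\<bar>"
    by (cases "k = 0") (simp, intro mult_left_mono, auto)
  then have "\<bar>k\<bar> \<le> k\<^sup>2" by (simp add: power2_eq_square)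
  then have "\<bar>real_of_int k\<bar> \<le> (of_int k)\<^sup>2"
    by (metis of_int_abs of_int_le_iff of_int_power)
  then show "\<bar>r k\<bar> * \<bar>of_int k\<bar> \<le> \<bar>r k\<bar> * (of_int k)\<^sup>2"
    by (intro mult_left_mono) auto
qed auto

definition cumul_bound :: "nat \<Rightarrow> real" where
  "cumul_bound k = (\<Sum>\<^sub>\<infinity>ts\<in>{ts. length ts = k - 1}. \<bar>joint_cumulant M (map X (0 # ts))\<bar>)"

lemma cumul_bound_nonneg: "cumul_bound k \<ge> 0"
  unfolding cumul_bound_def by (rule infsum_nonneg) auto

lemma sum_joint_cumulant_le:
  assumes "k \<in> {3..8}" "finite L" "L \<subseteq> {ts. length ts = k - 1}"
  shows "(\<Sum>ts\<in>L. \<bar>joint_cumulant M (map X (0 # ts))\<bar>) \<le> cumul_bound k"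
  unfolding cumul_bound_def
  using assms cumulants_summable by (intro finite_sum_le_infsum) auto

lemma cumul_eq_joint_cumulant:
  assumes "distinct (a # ys)"
  shows "cumul t (set (a # ys)) = joint_cumulant M (map X (0 # map (\<lambda>i. t i - t a) ys))"
proof -
  have "cumul t (set (a # ys)) = cumul (\<lambda>i. t i + (- t a)) (set (a # ys))"
    by (rule cumul_shift[symmetric]) simp
  also have "\<dots> = joint_cumulant M (map (\<lambda>i. X (t i + (- t a))) (a # ys))"
    by (rule joint_cumulant_eq_cumul[OF assms, symmetric])
  also have "\<dots> = joint_cumulant M (map X (0 # map (\<lambda>i. t i - t a) ys))"
    by (simp add: comp_def)
  finally show ?thesis .
qed

text \<open>By stationarity a cumulant depends only on the differences to one distinguished time
  \<open>t a\<close>. The differences are absorbed by the absolutely convergent series, and the free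
  choice of \<open>t a\<close> contributes the factor \<open>n\<close>.\<close>

lemma sum_cumul_le:
  assumes A: "finite A" "card A \<in> {3..8}"
  shows "(\<Sum>t\<in>PiE A (\<lambda>_. {1..int n}). \<bar>cumul t A\<bar>) \<le> real n * cumul_bound (card A)"
proof -
  obtain xs where xs: "distinct xs" "set xs = A" using finite_distinct_list[OF A(1)] by blast
  have "xs \<noteq> []" using xs A by auto
  then obtain a ys where xs_eq: "xs = a # ys" by (cases xs) auto
  define \<Phi> where "\<Phi> t = (t a, map (\<lambda>i. t i - t a) ys)" for t :: "'b \<Rightarrow> int"
  define T where "T = PiE A (\<lambda>_. {1..int n})"
  define c where "c ts = \<bar>joint_cumulant M (map X (0 # ts))\<bar>" for ts
  have finT: "finite T" unfolding T_def using A by (intro finite_PiE) auto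
  have inj: "inj_on \<Phi> T"
  proof (rule inj_onI)
    fix t t' assume t: "t \<in> T" "t' \<in> T" "\<Phi> t = \<Phi> t'"
    then have "t i = t' i" if "i \<in> A" for i
      using that xs xs_eq by (auto simp: \<Phi>_def)
    then show "t = t'" using t unfolding T_def by (intro PiE_ext) auto
  qed
  define L where "L = snd ` \<Phi> ` T"
  have len: "length ys = card A - 1" using xs xs_eq distinct_card by fastforce
  have finL: "finite L" "L \<subseteq> {ts. length ts = card A - 1}"
    using finT len by (auto simp: L_def \<Phi>_def)
  have sub: "\<Phi> ` T \<subseteq> {1..int n} \<times> L"
  proof
    fix p assume p: "p \<in> \<Phi> ` T"
    then have "fst p \<in> {1..int n}" using xs xs_eq by (auto simp: T_def \<Phi>_def)
    moreover have "snd p \<in> L" using p by (auto simp: L_def)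
    ultimately show "p \<in> {1..int n} \<times> L" by (cases p) auto
  qed
  have "(\<Sum>t\<in>T. \<bar>cumul t A\<bar>) = (\<Sum>t\<in>T. c (snd (\<Phi> t)))"
    using cumul_eq_joint_cumulant[of a ys] xs xs_eq by (intro sum.cong) (auto simp: c_def \<Phi>_def)
  also have "\<dots> = (\<Sum>p\<in>\<Phi> ` T. c (snd p))" using inj by (simp add: sum.reindex)
  also have "\<dots> \<le> (\<Sum>p\<in>{1..int n} \<times> L. c (snd p))"
    using sub finL by (intro sum_mono2) (auto simp: c_def)
  also have "\<dots> = real n * (\<Sum>ts\<in>L. c ts)"
    using finL sum.cartesian_product[of "\<lambda>_ ts. c ts" L "{1..int n}"] by (simp add: case_prod_beta)
  also have "\<dots> \<le> real n * cumul_bound (card A)"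
    unfolding c_def using sum_joint_cumulant_le[OF A(2) finL] by (intro mult_left_mono) auto
  finally show ?thesis unfolding T_def .
qed

end

section \<open>Moments of the discrete Fourier transform\<close>

text \<open>A tuple of times on \<open>S\<close> is a pair of tuples on \<open>A\<close> and on
  \<open>S - A\<close>, and \<open>merge\<close> is the bijection. This carries products of
  cumulants and moments through the Fourier sums.\<close>

lemma sum_PiE_split:
  fixes g :: "('i \<Rightarrow> int) \<Rightarrow> 'c::comm_semiring_0"
  assumes "A \<subseteq> S" and T: "finite S"
    and f: "\<And>t t'. (\<And>i. i \<in> A \<Longrightarrow> t i = t' i) \<Longrightarrow> f t = f t'"
    and g: "\<And>t t'. (\<And>i. i \<in> S - A \<Longrightarrow> t i = t' i) \<Longrightarrow> g t = g t'"
  shows "(\<Sum>t\<in>PiE S B. f t * g t) = (\<Sum>t\<in>PiE A B. f t) * (\<Sum>t\<in>PiE (S - A) B. g t)"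
proof -
  have "(\<Sum>t\<in>PiE A B. f t) * (\<Sum>t\<in>PiE (S - A) B. g t) =
      (\<Sum>(t, u)\<in>PiE A B \<times> PiE (S - A) B. f t * g u)"
    by (simp add: sum_product sum.cartesian_product)
  also have "\<dots> = (\<Sum>t\<in>PiE S B. f t * g t)"
  proof (rule sum.reindex_bij_witness[where j="\<lambda>(t, u). merge A (S - A) (t, u)"
        and i="\<lambda>t. (restrict t A, restrict t (S - A))"], goal_cases)
    case (1 a)
    then show ?case
      by (cases a) (auto simp: merge_def restrict_def PiE_def extensional_def fun_eq_iff)
  next
    case (2 a)
    then show ?case using assms(1)
      by (cases a) (auto simp: merge_def PiE_def extensional_def Pi_def)
  next
    case (3 b)
    then show ?case using assms(1)
      by (auto simp: merge_def restrict_def PiE_def extensional_def fun_eq_iff)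
  next
    case (4 b)
    then show ?case using assms(1) by (auto simp: PiE_def Pi_def)
  next
    case (5 a)
    obtain t u where a: "a = (t, u)" by (cases a)
    have "f (merge A (S - A) (t, u)) = f t" by (rule f) (simp add: merge_def)
    moreover have "g (merge A (S - A) (t, u)) = g u" by (rule g) (auto simp: merge_def)
    ultimately show ?case by (simp add: a)
  qed
  finally show ?thesis by simp
qed

lemma infsum_finite_sum:
  fixes f :: "'i \<Rightarrow> 'b \<Rightarrow> 'c::{topological_comm_monoid_add, t2_space}"
  assumes "\<And>i. i \<in> I \<Longrightarrow> f i summable_on A"
  shows "(\<Sum>\<^sub>\<infinity>x\<in>A. \<Sum>i\<in>I. f i x) = (\<Sum>i\<in>I. \<Sum>\<^sub>\<infinity>x\<in>A. f i x)"
proof -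
  have "((\<lambda>x. \<Sum>i\<in>I. f i x) has_sum (\<Sum>i\<in>I. \<Sum>\<^sub>\<infinity>x\<in>A. f i x)) A"
    using assms by (induction I rule: infinite_finite_induct) (auto intro!: has_sum_add has_sum_infsum)
  then show ?thesis by (rule infsumI)
qed

lemma sum_cis_fourier:
  assumes "n > 0"
  shows "(\<Sum>t=1..int n. cis (of_int t * fourier_freq n v)) = (if int n dvd v then of_nat n else 0)"
proof -
  define z where "z = cis (fourier_freq n v)"
  have zk: "cis (of_int t * fourier_freq n v) = z ^ nat t" if "t \<ge> 0" for t
    unfolding z_def Complex.DeMoivre using that by simp
  have zn: "z ^ n = 1"
  proof -
    have "z ^ n = cis (2 * pi * of_int v)"
      using assms unfolding z_def Complex.DeMoivre by (simp add: fourier_freq_def)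
    also have "\<dots> = 1" by (rule cis_multiple_2pi) simp
    finally show ?thesis .
  qed
  have "(\<Sum>t=1..int n. cis (of_int t * fourier_freq n v)) = (\<Sum>t=1..int n. z ^ nat t)"
    by (intro sum.cong) (auto simp: zk)
  also have "\<dots> = (\<Sum>k<n. z ^ Suc k)"
    by (rule sum.reindex_bij_witness[where i="\<lambda>k. int (Suc k)" and j="\<lambda>t. nat t - 1"]) (auto simp: Suc_nat_eq_nat_zadd1 nat_diff_distrib)
  also have "\<dots> = z * (\<Sum>k<n. z ^ k)" by (simp add: sum_distrib_left)
  finally have eq: "(\<Sum>t=1..int n. cis (of_int t * fourier_freq n v)) = z * (\<Sum>k<n. z ^ k)" .
  show ?thesis
  proof (cases "int n dvd v")
    case True
    then obtain q where "v = int n * q" by (auto elim: dvdE)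
    then have "fourier_freq n v = 2 * pi * of_int q" using assms by (simp add: fourier_freq_def)
    then have "z = 1" unfolding z_def using cis_multiple_2pi[of "of_int q"] by simp
    then show ?thesis using eq True by simp
  next
    case False
    have "z \<noteq> 1"
    proof
      assume "z = 1"
      then have "cos (fourier_freq n v) = 1" by (simp add: z_def complex_eq_iff)
      then obtain q :: int where "fourier_freq n v = of_int q * 2 * pi"
        using iffD1[OF cos_one_2pi_int] by blast
      then have "of_int v = (of_int (int n * q) :: real)"
        using assms by (simp add: fourier_freq_def field_simps)
      then have "v = int n * q" by (simp only: of_int_eq_iff)
      then show False using False by simp
    qed
    then have "(\<Sum>k<n. z ^ k) = 0" using geometric_sum[of z n] zn by simp
    then show ?thesis using eq False by simp
  qed
qed

lemma fourier_freq_add: "fourier_freq n (u + v) = fourier_freq n u + fourier_freq n v"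
  by (simp add: fourier_freq_def distrib_left add_divide_distrib)

lemma fourier_freq_minus: "fourier_freq n (- u) = - fourier_freq n u"
  by (simp add: fourier_freq_def)

context stationary_cumulants
begin

definition dft_factor :: "nat \<Rightarrow> ('i \<Rightarrow> int) \<Rightarrow> 'i \<Rightarrow> int \<Rightarrow> complex" where
  "dft_factor n v i s = cis (of_int s * fourier_freq n (v i)) / of_real (sqrt (real n))"

definition dft :: "nat \<Rightarrow> int \<Rightarrow> 'a \<Rightarrow> complex" where
  "dft n j \<omega> = (\<Sum>s=1..int n. of_real (X s \<omega>) * (cis (of_int s * fourier_freq n j) / of_real (sqrt (real n))))"

definition dft_moment :: "nat \<Rightarrow> ('i \<Rightarrow> int) \<Rightarrow> 'i set \<Rightarrow> complex" where
  "dft_moment n v S =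
     (\<Sum>t\<in>PiE S (\<lambda>_. {1..int n}). (\<Prod>i\<in>S. dft_factor n v i (t i)) * of_real (joint_moment t S))"

definition dft_cumulant :: "nat \<Rightarrow> ('i \<Rightarrow> int) \<Rightarrow> 'i set \<Rightarrow> complex" where
  "dft_cumulant n v S =
     (\<Sum>t\<in>PiE S (\<lambda>_. {1..int n}). (\<Prod>i\<in>S. dft_factor n v i (t i)) * of_real (cumul t S))"

lemma expectation_prod_dft:
  assumes "finite S" "card S \<le> 8"
  shows "(\<integral>\<omega>. (\<Prod>i\<in>S. dft n (v i) \<omega>) \<partial>M) = dft_moment n v S"
    and "integrable M (\<lambda>\<omega>. \<Prod>i\<in>S. dft n (v i) \<omega>)"
proof -
  have eq: "(\<Prod>i\<in>S. dft n (v i) \<omega>) =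
      (\<Sum>t\<in>PiE S (\<lambda>_. {1..int n}). (\<Prod>i\<in>S. dft_factor n v i (t i)) * of_real (\<Prod>i\<in>S. X (t i) \<omega>))" for \<omega>
    unfolding dft_def using assms
    by (subst prod_sum_PiE) (auto simp only: prod.distrib of_real_prod mult.commute dft_factor_def finite_atLeastAtMost_int intro!: sum.cong)
  have int: "integrable M (\<lambda>\<omega>. complex_of_real (\<Prod>i\<in>S. X (t i) \<omega>))" for t
    using integrable_prod_X[OF assms, of t] by (rule integrable_of_real)
  show "integrable M (\<lambda>\<omega>. \<Prod>i\<in>S. dft n (v i) \<omega>)"
    unfolding eq by (intro Bochner_Integration.integrable_sum integrable_mult_right int)
  show "(\<integral>\<omega>. (\<Prod>i\<in>S. dft n (v i) \<omega>) \<partial>M) = dft_moment n v S"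
    unfolding eq dft_moment_def joint_moment_def
    by (simp add: int Bochner_Integration.integral_sum del: of_real_prod)
qed

text \<open>The recursion for joint moments survives Fourier summation because the cumulant sees
  only the times in \<open>A\<close> and the remaining moment only those outside.\<close>

lemma dft_moment_rec:
  assumes S: "finite S" and i: "i \<in> S"
  shows "dft_moment n v S = (\<Sum>A | A \<subseteq> S \<and> i \<in> A. dft_cumulant n v A * dft_moment n v (S - A))"
proof -
  have "dft_moment n v S = (\<Sum>t\<in>PiE S (\<lambda>_. {1..int n}). \<Sum>A | A \<subseteq> S \<and> i \<in> A.
      ((\<Prod>i\<in>A. dft_factor n v i (t i)) * of_real (cumul t A)) *
      ((\<Prod>i\<in>S - A. dft_factor n v i (t i)) * of_real (joint_moment t (S - A))))"
    unfolding dft_moment_def joint_moment_rec[OF S i] of_real_sum sum_distrib_left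
  proof (intro sum.cong refl)
    fix t A assume "A \<in> {A. A \<subseteq> S \<and> i \<in> A}"
    then have "(\<Prod>i\<in>S. dft_factor n v i (t i)) =
        (\<Prod>i\<in>S - A. dft_factor n v i (t i)) * (\<Prod>i\<in>A. dft_factor n v i (t i))"
      using S by (intro prod.subset_diff) auto
    then show "(\<Prod>i\<in>S. dft_factor n v i (t i)) * of_real (cumul t A * joint_moment t (S - A)) =
      ((\<Prod>i\<in>A. dft_factor n v i (t i)) * of_real (cumul t A)) *
      ((\<Prod>i\<in>S - A. dft_factor n v i (t i)) * of_real (joint_moment t (S - A)))" by simp
  qed
  also have "\<dots> = (\<Sum>A | A \<subseteq> S \<and> i \<in> A. \<Sum>t\<in>PiE S (\<lambda>_. {1..int n}).
      ((\<Prod>i\<in>A. dft_factor n v i (t i)) * of_real (cumul t A)) *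
      ((\<Prod>i\<in>S - A. dft_factor n v i (t i)) * of_real (joint_moment t (S - A))))"
    by (rule sum.swap)
  also have "\<dots> = (\<Sum>A | A \<subseteq> S \<and> i \<in> A. dft_cumulant n v A * dft_moment n v (S - A))"
    unfolding dft_cumulant_def dft_moment_def
  proof (intro sum.cong refl sum_PiE_split S)
    fix A and t t' :: "'b \<Rightarrow> int" assume *: "\<And>i. i \<in> A \<Longrightarrow> t i = t' i"
    show "(\<Prod>i\<in>A. dft_factor n v i (t i)) * complex_of_real (cumul t A) =
          (\<Prod>i\<in>A. dft_factor n v i (t' i)) * complex_of_real (cumul t' A)"
      using * cumul_cong[of A t t']
      by (intro arg_cong2[where f="(*)"] prod.cong) auto
  next
    fix A and t t' :: "'b \<Rightarrow> int" assume *: "\<And>i. i \<in> S - A \<Longrightarrow> t i = t' i"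
    show "(\<Prod>i\<in>S - A. dft_factor n v i (t i)) * complex_of_real (joint_moment t (S - A)) =
          (\<Prod>i\<in>S - A. dft_factor n v i (t' i)) * complex_of_real (joint_moment t' (S - A))"
      using * joint_moment_cong[of "S - A" t t']
      by (intro arg_cong2[where f="(*)"] prod.cong) auto
  qed auto
  finally show ?thesis .
qed

lemma norm_prod_dft_factor:
  "norm (\<Prod>i\<in>A. dft_factor n v i (t i)) = (1 / sqrt (real n)) ^ card A"
  by (simp add: prod_norm[symmetric] dft_factor_def norm_divide)

text \<open>The normalisation gives n^(-k/2) at order k and the sum over times gives
  \<open>n\<close>; for k >= 3 the product n^(1 - k/2) is at most n^(-1/2).\<close>

lemma norm_dft_cumulant_ge3:
  assumes "finite A" "card A \<in> {3..8}" "n \<ge> 1"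
  shows "norm (dft_cumulant n v A) \<le> cumul_bound (card A) / sqrt (real n)"
proof -
  have "norm (dft_cumulant n v A) \<le> (\<Sum>t\<in>PiE A (\<lambda>_. {1..int n}). (1 / sqrt (real n)) ^ card A * \<bar>cumul t A\<bar>)"
    unfolding dft_cumulant_def
    by (rule sum_norm_le) (simp add: norm_mult norm_prod_dft_factor)
  also have "\<dots> = (1 / sqrt (real n)) ^ card A * (\<Sum>t\<in>PiE A (\<lambda>_. {1..int n}). \<bar>cumul t A\<bar>)"
    by (simp add: sum_distrib_left)
  also have "\<dots> \<le> (1 / sqrt (real n)) ^ 3 * (real n * cumul_bound (card A))"
    using assms sum_cumul_le[OF assms(1,2)]
    by (intro mult_mono power_decreasing) (auto intro: sum_nonneg)
  also have "\<dots> = cumul_bound (card A) / sqrt (real n)"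
    using assms by (simp add: power3_eq_cube field_simps)
  finally show ?thesis .
qed

lemma dft_cumulant_singleton[simp]: "dft_cumulant n v {i} = 0"
  by (simp add: dft_cumulant_def)

definition R0 :: real where "R0 = (\<Sum>\<^sub>\<infinity>k. \<bar>r k\<bar>)"
definition R1 :: real where "R1 = (\<Sum>\<^sub>\<infinity>k. \<bar>r k\<bar> * \<bar>of_int k\<bar>)"

lemma R0_nonneg: "R0 \<ge> 0" and R1_nonneg: "R1 \<ge> 0"
  by (auto simp: R0_def R1_def intro!: infsum_nonneg)

abbreviation sd :: "real \<Rightarrow> real" where "sd \<equiv> spectral_density r"

lemma summable_autocov_cis: "(\<lambda>k. of_real (r k) * cis (of_int k * w)) summable_on UNIV"
  by (rule abs_summable_summable) (use summable_autocov in \<open>simp add: norm_mult\<close>)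

lemma infsum_autocov_cis: "(\<Sum>\<^sub>\<infinity>k. of_real (r k) * cis (of_int k * w)) = of_real (2 * pi * sd w)"
  using of_real_spectral_density[of r w] autocov_minus by (simp add: mult.commute)

lemma sd_has_sum: "((\<lambda>k. r k * cos (of_int k * w)) has_sum (2 * pi * sd w)) UNIV"
  using has_sum_Re[OF has_sum_infsum[OF summable_autocov_cis[of w]]]
  unfolding infsum_autocov_cis by simp

lemma sd_minus: "sd (- w) = sd w"
proof -
  have "(\<Sum>\<^sub>\<infinity>k. of_real (r k) * cis (of_int k * (- w))) = (\<Sum>\<^sub>\<infinity>k. of_real (r k) * cis (of_int k * w))"
    by (rule infsum_reindex_bij_witness[of _ uminus uminus]) (auto simp: autocov_minus)
  then have "complex_of_real (2 * pi * sd (- w)) = of_real (2 * pi * sd w)"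
    unfolding infsum_autocov_cis .
  then show ?thesis by (simp only: of_real_eq_iff) simp
qed

lemma abs_sd_le: "2 * pi * \<bar>sd w\<bar> \<le> R0"
proof -
  have "2 * pi * \<bar>sd w\<bar> = norm (complex_of_real (2 * pi * sd w))" unfolding norm_of_real by (simp add: abs_mult)
  also have "\<dots> = norm (\<Sum>\<^sub>\<infinity>k. of_real (r k) * cis (of_int k * w))" by (simp only: infsum_autocov_cis)
  also have "\<dots> \<le> (\<Sum>\<^sub>\<infinity>k. norm (complex_of_real (r k) * cis (of_int k * w)))"
    by (rule norm_infsum_bound) (use summable_autocov in \<open>simp add: norm_mult\<close>)
  also have "\<dots> = R0" by (simp add: R0_def norm_mult)
  finally show ?thesis .
qed

definition pair_limit :: "nat \<Rightarrow> ('i \<Rightarrow> int) \<Rightarrow> 'i \<Rightarrow> 'i \<Rightarrow> real" where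
  "pair_limit n v i j = (if int n dvd v i + v j then 2 * pi * sd (fourier_freq n (v i)) else 0)"

text \<open>Collected by the lag k, the double sum contains for each k a geometric sum from which at
  most |k| terms are missing. Completing all of them costs at most the sum of |r(k)| |k|, which is
  \<open>R1\<close>, before the division by \<open>n\<close>.\<close>

lemma dft_cumulant_pair:
  assumes ij: "i \<noteq> j" and n: "n \<ge> 1"
  shows "norm (dft_cumulant n v {i, j} - of_real (pair_limit n v i j)) \<le> R1 / real n"
proof -
  define u w where "u = fourier_freq n (v i)" and "w = fourier_freq n (v j)"
  have uw: "u + w = fourier_freq n (v i + v j)" by (simp add: u_def w_def fourier_freq_add)
  define T where "T = {1..int n}"
  \<comment> \<open>The truncated geometric sum belonging to lag \<open>k\<close>;
    \<open>\<delta>\<close> is the complete one and no longer depends on \<open>k\<close>.\<close>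
  define q where "q k = (\<Sum>t\<in>T. if t + k \<in> T then cis (of_int t * (u + w)) else 0)" for k
  define \<delta> :: complex where "\<delta> = (if int n dvd v i + v j then of_nat n else 0)"
  have \<delta>: "\<delta> = (\<Sum>t\<in>T. cis (of_int t * (u + w)))"
    unfolding \<delta>_def T_def uw using n by (subst sum_cis_fourier) auto
  have q: "norm (q k - \<delta>) \<le> \<bar>of_int k\<bar>" for k
  proof -
    have "q k - \<delta> = (\<Sum>t\<in>T. if t + k \<in> T then 0 else - cis (of_int t * (u + w)))"
      unfolding q_def \<delta> sum_subtractf[symmetric] by (intro sum.cong) auto
    also have "norm \<dots> \<le> (\<Sum>t\<in>T. if t + k \<in> T then 0 else 1)"
      by (rule sum_norm_le) auto
    also have "\<dots> = real (card {t \<in> T. t + k \<notin> T})"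
      by (simp add: sum.If_cases T_def Int_def Collect_conj_eq[symmetric])
    also have "\<dots> \<le> real (nat \<bar>k\<bar>)"
    proof -
      have "{t \<in> T. t + k \<notin> T} \<subseteq> {1..- k} \<union> {int n - k<..int n}" by (auto simp: T_def)
      then have "card {t \<in> T. t + k \<notin> T} \<le> card ({1..- k} \<union> {int n - k<..int n})"
        by (intro card_mono) auto
      also have "\<dots> \<le> card {1..- k} + card {int n - k<..int n}" by (rule card_Un_le)
      also have "\<dots> = nat \<bar>k\<bar>" by auto
      finally show ?thesis by simp
    qed
    finally show ?thesis by simp
  qed
  have fin: "(\<lambda>k. complex_of_real (r k) * cis (of_int k * u) * q k) summable_on UNIV"
    and sd': "(\<lambda>k. complex_of_real (r k) * cis (of_int k * u) * \<delta>) summable_on UNIV"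
  proof -
    show "(\<lambda>k. complex_of_real (r k) * cis (of_int k * u) * \<delta>) summable_on UNIV"
      by (intro summable_on_cmult_left summable_autocov_cis)
    have nq: "norm (q k) \<le> real n" for k
    proof -
      have "norm (q k) \<le> (\<Sum>t\<in>T. 1)" unfolding q_def by (rule sum_norm_le) auto
      then show ?thesis by (simp add: T_def)
    qed
    show "(\<lambda>k. complex_of_real (r k) * cis (of_int k * u) * q k) summable_on UNIV"
    proof (rule abs_summable_summable, rule summable_on_comparison_test)
      show "(\<lambda>k. \<bar>r k\<bar> * real n) summable_on UNIV" by (intro summable_on_cmult_left summable_autocov)
    qed (auto simp: norm_mult intro!: mult_left_mono nq)
  qed
  \<comment> \<open>Substitution s = t + k. Extending by zero, \<open>h\<close> lets the lag run
    through all integers, where the series of autocovariances is available.\<close>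
  have swap: "(\<Sum>s\<in>T. \<Sum>t\<in>T. cis (of_int s * u) * cis (of_int t * w) * of_real (r (s - t))) =
      (\<Sum>\<^sub>\<infinity>k. of_real (r k) * cis (of_int k * u) * q k)"
  proof -
    define h where "h t k = (if t + k \<in> T then of_real (r k) * cis (of_int k * u) * cis (of_int t * (u + w)) else 0)" for t k
    have hz: "h t k = 0" if "k \<notin> (\<lambda>s. s - t) ` T" for t k
    proof -
      have "t + k \<notin> T"
      proof
        assume "t + k \<in> T"
        then have "(t + k) - t \<in> (\<lambda>s. s - t) ` T" by (rule imageI)
        then show False using that by simp
      qed
      then show ?thesis by (simp add: h_def)
    qed
    have hs: "(\<lambda>k. h t k) summable_on UNIV" for t
    proof (rule finite_nonzero_values_imp_summable_on)
      have "{k \<in> UNIV. h t k \<noteq> 0} \<subseteq> (\<lambda>s. s - t) ` T" using hz by auto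
      then show "finite {k \<in> UNIV. h t k \<noteq> 0}" by (rule finite_subset) (simp add: T_def)
    qed
    have "(\<Sum>s\<in>T. cis (of_int s * u) * cis (of_int t * w) * of_real (r (s - t))) = (\<Sum>\<^sub>\<infinity>k. h t k)" for t
    proof -
      have "(\<Sum>\<^sub>\<infinity>k. h t k) = (\<Sum>\<^sub>\<infinity>k\<in>(\<lambda>s. s - t) ` T. h t k)"
        by (rule infsum_cong_neutral) (use hz in auto)
      also have "\<dots> = (\<Sum>k\<in>(\<lambda>s. s - t) ` T. h t k)" by (simp add: T_def)
      also have "\<dots> = (\<Sum>s\<in>T. h t (s - t))" by (subst sum.reindex) (auto simp: inj_on_def)
      also have "\<dots> = (\<Sum>s\<in>T. cis (of_int s * u) * cis (of_int t * w) * of_real (r (s - t)))"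
        by (intro sum.cong) (auto simp: h_def cis_mult algebra_simps)
      finally show ?thesis ..
    qed
    then have "(\<Sum>t\<in>T. \<Sum>s\<in>T. cis (of_int s * u) * cis (of_int t * w) * of_real (r (s - t))) = (\<Sum>t\<in>T. \<Sum>\<^sub>\<infinity>k. h t k)"
      by simp
    also have "\<dots> = (\<Sum>\<^sub>\<infinity>k. \<Sum>t\<in>T. h t k)" by (rule infsum_finite_sum[symmetric]) (rule hs)
    also have "\<dots> = (\<Sum>\<^sub>\<infinity>k. of_real (r k) * cis (of_int k * u) * q k)"
      unfolding q_def sum_distrib_left h_def by (intro infsum_cong sum.cong) auto
    finally show ?thesis by (subst sum.swap)
  qed
  have dc: "dft_cumulant n v {i, j} = (\<Sum>s\<in>T. \<Sum>t\<in>T. cis (of_int s * u) * cis (of_int t * w) * of_real (r (s - t))) / of_nat n"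
  proof -
    have "dft_cumulant n v {i, j} = (\<Sum>y\<in>PiE {i, j} (\<lambda>_. T). dft_factor n v i (y i) * dft_factor n v j (y j) * of_real (r (y i - y j)))"
      unfolding dft_cumulant_def T_def
    proof (intro sum.cong refl)
      fix y
      have "r (y j - y i) = r (y i - y j)" using autocov_minus[of "y i - y j"] by simp
      then show "(\<Prod>k\<in>{i, j}. dft_factor n v k (y k)) * of_real (cumul y {i, j}) =
          dft_factor n v i (y i) * dft_factor n v j (y j) * of_real (r (y i - y j))"
        using ij by (simp add: cumul_pair)
    qed
    also have "\<dots> = (\<Sum>(s, t)\<in>T \<times> T. dft_factor n v i s * dft_factor n v j t * of_real (r (s - t)))"
      by (rule sum.reindex_bij_witness[where i="\<lambda>(s, t). (\<lambda>k\<in>{i, j}. if k = i then s else t)" and j="\<lambda>y. (y i, y j)"])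
         (use ij in \<open>auto simp: PiE_def extensional_def fun_eq_iff restrict_def\<close>)
    also have "\<dots> = (\<Sum>s\<in>T. \<Sum>t\<in>T. cis (of_int s * u) * cis (of_int t * w) * of_real (r (s - t))) / of_nat n"
      unfolding sum.cartesian_product[symmetric] sum_divide_distrib
      by (intro sum.cong refl) (simp add: dft_factor_def u_def w_def of_real_mult[symmetric] del: of_real_mult)
    finally show ?thesis .
  qed
  have pl: "of_real (pair_limit n v i j) = (\<Sum>\<^sub>\<infinity>k. of_real (r k) * cis (of_int k * u) * \<delta>) / of_nat n"
    using n unfolding infsum_cmult_left' infsum_autocov_cis by (simp add: pair_limit_def \<delta>_def u_def)
  have diff: "((\<lambda>k. of_real (r k) * cis (of_int k * u) * (q k - \<delta>)) has_sum
      ((\<Sum>\<^sub>\<infinity>k. of_real (r k) * cis (of_int k * u) * q k) - (\<Sum>\<^sub>\<infinity>k. of_real (r k) * cis (of_int k * u) * \<delta>))) UNIV"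
    using has_sum_add[OF has_sum_infsum[OF fin] has_sum_uminusI[OF has_sum_infsum[OF sd']]]
    by (simp only: right_diff_distrib add_uminus_conv_diff)
  have "norm (dft_cumulant n v {i, j} - of_real (pair_limit n v i j)) =
      norm ((\<Sum>\<^sub>\<infinity>k. of_real (r k) * cis (of_int k * u) * q k) - (\<Sum>\<^sub>\<infinity>k. of_real (r k) * cis (of_int k * u) * \<delta>)) / real n"
    unfolding dc pl swap diff_divide_distrib[symmetric] norm_divide norm_of_nat ..
  also have "\<dots> \<le> (\<Sum>\<^sub>\<infinity>k. \<bar>r k\<bar> * \<bar>of_int k\<bar>) / real n"
  proof (rule divide_right_mono, rule norm_infsum_le)
    show "((\<lambda>k. of_real (r k) * cis (of_int k * u) * (q k - \<delta>)) has_sum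
      ((\<Sum>\<^sub>\<infinity>k. of_real (r k) * cis (of_int k * u) * q k) - (\<Sum>\<^sub>\<infinity>k. of_real (r k) * cis (of_int k * u) * \<delta>))) UNIV"
      by (rule diff)
    show "((\<lambda>k. \<bar>r k\<bar> * \<bar>of_int k\<bar>) has_sum (\<Sum>\<^sub>\<infinity>k. \<bar>r k\<bar> * \<bar>of_int k\<bar>)) UNIV"
      using summable_autocov_abs by (rule has_sum_infsum)
  qed (auto simp: norm_mult intro!: mult_left_mono q)
  finally show ?thesis unfolding R1_def .
qed

end

context stationary_cumulants
begin

definition cumul_total :: real where "cumul_total = (\<Sum>k\<in>{3..8}. cumul_bound k)"

lemma cumul_total_nonneg: "cumul_total \<ge> 0"
  unfolding cumul_total_def by (intro sum_nonneg cumul_bound_nonneg)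

lemma norm_dft_cumulant_le_total:
  assumes "finite A" "card A \<in> {3..8}" "n \<ge> 1"
  shows "norm (dft_cumulant n v A) \<le> cumul_total / sqrt (real n)"
proof -
  have "cumul_bound (card A) \<le> cumul_total"
    unfolding cumul_total_def using assms(2) by (intro member_le_sum cumul_bound_nonneg) auto
  then have "cumul_bound (card A) / sqrt (real n) \<le> cumul_total / sqrt (real n)"
    by (rule divide_right_mono) simp
  then show ?thesis using norm_dft_cumulant_ge3[OF assms, of v] by linarith
qed

lemma abs_pair_limit_le: "\<bar>pair_limit n v i j\<bar> \<le> R0"
  using abs_sd_le R0_nonneg by (simp add: pair_limit_def abs_mult)

text \<open>The summand 1 makes the bound at least 1, so that its powers grow with the
  exponent.\<close>

definition dft_cumulant_bound :: real where
  "dft_cumulant_bound = 1 + R0 + R1 + cumul_total"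

lemma norm_dft_cumulant_le:
  assumes A: "finite A" "A \<noteq> {}" "card A \<le> 8" and n: "n \<ge> 1"
  shows "norm (dft_cumulant n v A) \<le> dft_cumulant_bound"
proof -
  have pos: "0 \<le> R0" "0 \<le> R1" "0 \<le> cumul_total" using R0_nonneg R1_nonneg cumul_total_nonneg by auto
  have "card A \<noteq> 0" using A by simp
  then have "card A = 1 \<or> card A = 2 \<or> card A \<in> {3..8}" using A by (auto simp del: card_0_eq)
  then consider "card A = 1" | "card A = 2" | "card A \<in> {3..8}" by blast
  then show ?thesis
  proof cases
    case 1
    then obtain i where "A = {i}" by (auto simp: card_1_singleton_iff)
    then show ?thesis using pos by (simp add: dft_cumulant_bound_def)
  next
    case 2
    then obtain i j where ij: "A = {i, j}" "i \<noteq> j" by (auto simp: card_2_iff)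
    have "norm (dft_cumulant n v A) \<le> norm (dft_cumulant n v A - of_real (pair_limit n v i j)) + norm (complex_of_real (pair_limit n v i j))"
      by (metis diff_add_cancel norm_triangle_ineq)
    also have "\<dots> \<le> R1 / real n + R0"
      using dft_cumulant_pair[OF ij(2) n, of v] abs_pair_limit_le[of n v i j] ij by simp
    also have "R1 / real n + R0 \<le> R1 + R0" using n pos by (simp add: divide_le_eq mult_le_cancel_left1)
    finally show ?thesis using pos by (simp add: dft_cumulant_bound_def)
  next
    case 3
    have "cumul_total / sqrt (real n) \<le> cumul_total"
      using n pos by (simp add: divide_le_eq mult_le_cancel_left1)
    then show ?thesis using norm_dft_cumulant_le_total[OF A(1) 3 n, of v] pos
      by (simp add: dft_cumulant_bound_def)
  qed
qed

definition dft_moment_bound :: real where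
  "dft_moment_bound = (2 ^ 8 * dft_cumulant_bound) ^ 8"

lemma dft_cumulant_bound_ge1: "dft_cumulant_bound \<ge> 1"
  using R0_nonneg R1_nonneg cumul_total_nonneg by (simp add: dft_cumulant_bound_def)

lemma dft_moment_empty[simp]: "dft_moment n v {} = 1"
  by (simp add: dft_moment_def)

lemma card_subsets_le:
  assumes "finite S" "card S \<le> 8"
  shows "finite {A. A \<subseteq> S \<and> P A}" "real (card {A. A \<subseteq> S \<and> P A}) \<le> 2 ^ 8"
proof -
  show "finite {A. A \<subseteq> S \<and> P A}" by (rule finite_subset[of _ "Pow S"]) (use assms in auto)
  have "card {A. A \<subseteq> S \<and> P A} \<le> card (Pow S)" using assms by (intro card_mono) auto
  also have "\<dots> = 2 ^ card S" using assms by (simp add: card_Pow)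
  also have "\<dots> \<le> 2 ^ 8" using assms by (intro power_increasing) auto
  finally have "real (card {A. A \<subseteq> S \<and> P A}) \<le> real (2 ^ 8)" by (rule of_nat_mono)
  then show "real (card {A. A \<subseteq> S \<and> P A}) \<le> 2 ^ 8" by simp
qed

text \<open>One level of the recursion has at most 2^8 subsets and one cumulant factor, and it
  removes at least the index \<open>i\<close>; induction on the size of \<open>S\<close> collects
  one factor per index.\<close>

lemma norm_dft_moment_le_power:
  assumes "finite S" "card S \<le> 8" "n \<ge> 1"
  shows "norm (dft_moment n v S) \<le> (2 ^ 8 * dft_cumulant_bound) ^ card S"
  using assms
proof (induction "card S" arbitrary: S rule: less_induct)
  case less
  let ?K = "2 ^ 8 * dft_cumulant_bound"
  have K1: "?K \<ge> 1" using dft_cumulant_bound_ge1 by simp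
  show ?case
  proof (cases "S = {}")
    case True then show ?thesis by simp
  next
    case False
    then obtain i where i: "i \<in> S" by blast
    have cpos: "card S > 0" using i less.prems(1) by (auto simp: card_gt_0_iff)
    have "norm (dft_moment n v S) \<le> (\<Sum>A | A \<subseteq> S \<and> i \<in> A. dft_cumulant_bound * ?K ^ (card S - 1))"
      unfolding dft_moment_rec[OF less.prems(1) i]
    proof (rule sum_norm_le)
      fix A assume A: "A \<in> {A. A \<subseteq> S \<and> i \<in> A}"
      then have fA: "finite A" using less.prems finite_subset by blast
      have cA: "card A \<le> card S" using A less.prems by (auto intro: card_mono)
      have A': "A \<noteq> {}" "card A \<le> 8" "card A \<ge> 1"
        using A fA cA less.prems by (auto simp: Suc_le_eq card_gt_0_iff)
      have cS: "card (S - A) = card S - card A" using A fA by (simp add: card_Diff_subset)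
      have "norm (dft_moment n v (S - A)) \<le> ?K ^ card (S - A)"
        using A' cS cpos less.prems by (intro less.hyps) auto
      also have "\<dots> \<le> ?K ^ (card S - 1)"
        using K1 cS A' by (intro power_increasing) auto
      finally show "norm (dft_cumulant n v A * dft_moment n v (S - A)) \<le> dft_cumulant_bound * ?K ^ (card S - 1)"
        unfolding norm_mult using norm_dft_cumulant_le[OF fA A'(1,2) less.prems(3), of v] dft_cumulant_bound_ge1
        by (intro mult_mono) auto
    qed
    also have "\<dots> \<le> 2 ^ 8 * (dft_cumulant_bound * ?K ^ (card S - 1))"
      using card_subsets_le(2)[OF less.prems(1,2), of "\<lambda>A. i \<in> A"] dft_cumulant_bound_ge1
      unfolding sum_constant by (intro mult_right_mono) auto
    also have "\<dots> = ?K ^ Suc (card S - 1)" by simp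
    also have "Suc (card S - 1) = card S" using cpos by simp
    finally show ?thesis .
  qed
qed

lemma norm_dft_moment_le:
  assumes "finite S" "card S \<le> 8" "n \<ge> 1"
  shows "norm (dft_moment n v S) \<le> dft_moment_bound"
proof -
  have "(2 ^ 8 * dft_cumulant_bound) ^ card S \<le> dft_moment_bound"
    unfolding dft_moment_bound_def using assms dft_cumulant_bound_ge1 by (intro power_increasing) auto
  then show ?thesis using norm_dft_moment_le_power[OF assms, of v] by linarith
qed

lemma dft_moment_bound_ge1: "dft_moment_bound \<ge> 1"
  unfolding dft_moment_bound_def using dft_cumulant_bound_ge1 by (intro one_le_power) simp

definition wick_error :: real where
  "wick_error = 2 ^ 8 * dft_cumulant_bound * dft_moment_bound"

lemma wick_error_nonneg: "wick_error \<ge> 0"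
  unfolding wick_error_def using dft_cumulant_bound_ge1 dft_moment_bound_ge1 by simp

text \<open>Cumulants of order at least 3 of the discrete Fourier transforms are of order
  \<^term>\<open>1 / sqrt (real n)\<close>, so only the pairings survive, as in Wick's theorem.\<close>

lemma wick_step:
  assumes S: "finite S" "card S \<le> 8" and i: "i \<in> S" and n: "n \<ge> 1"
  shows "norm (dft_moment n v S - (\<Sum>j\<in>S - {i}. of_real (pair_limit n v i j) * dft_moment n v (S - {i, j})))
    \<le> wick_error / sqrt (real n)"
proof -
  define \<A> where "\<A> = {A. A \<subseteq> S \<and> i \<in> A}"
  define pr where "pr j = {i, j}" for j
  \<comment> \<open>The limit of the cumulant over \<open>A\<close>: the pairing value if
    \<open>A\<close> is \<open>i\<close> together with one partner, recovered by
    \<open>the_elem\<close>, and zero for every other size.\<close>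
  define q where "q A = (if card A = 2 then of_real (pair_limit n v i (the_elem (A - {i}))) else (0::complex))" for A
  have \<A>: "finite \<A>" "real (card \<A>) \<le> 2 ^ 8"
    unfolding \<A>_def using card_subsets_le[OF S, of "\<lambda>A. i \<in> A"] by auto
  have "(\<Sum>j\<in>S - {i}. of_real (pair_limit n v i j) * dft_moment n v (S - {i, j})) =
      (\<Sum>j\<in>S - {i}. q (pr j) * dft_moment n v (S - pr j))"
  proof (intro sum.cong refl)
    fix j assume "j \<in> S - {i}"
    then have "card (pr j) = 2" "pr j - {i} = {j}" by (auto simp: pr_def)
    then show "of_real (pair_limit n v i j) * dft_moment n v (S - {i, j}) = q (pr j) * dft_moment n v (S - pr j)"
      by (simp add: q_def) (simp add: pr_def)
  qed
  also have "\<dots> = (\<Sum>A\<in>pr ` (S - {i}). q A * dft_moment n v (S - A))"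
    by (subst sum.reindex) (auto simp: pr_def inj_on_def doubleton_eq_iff)
  also have "\<dots> = (\<Sum>A\<in>\<A>. q A * dft_moment n v (S - A))"
  proof (rule sum.mono_neutral_left[OF \<A>(1)])
    show "pr ` (S - {i}) \<subseteq> \<A>" using i by (auto simp: pr_def \<A>_def)
    show "\<forall>A\<in>\<A> - pr ` (S - {i}). q A * dft_moment n v (S - A) = 0"
    proof
      fix A assume A: "A \<in> \<A> - pr ` (S - {i})"
      have "card A \<noteq> 2"
      proof
        assume "card A = 2"
        then obtain j where "A = {i, j}" "i \<noteq> j" using A by (auto simp: card_2_iff \<A>_def)
        then show False using A by (auto simp: pr_def \<A>_def)
      qed
      then show "q A * dft_moment n v (S - A) = 0" by (simp add: q_def)
    qed
  qed
  finally have eq: "dft_moment n v S - (\<Sum>j\<in>S - {i}. of_real (pair_limit n v i j) * dft_moment n v (S - {i, j}))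
     = (\<Sum>A\<in>\<A>. (dft_cumulant n v A - q A) * dft_moment n v (S - A))"
    unfolding dft_moment_rec[OF S(1) i] \<A>_def by (simp add: sum_subtractf left_diff_distrib)
  have le: "norm (dft_cumulant n v A - q A) \<le> dft_cumulant_bound / sqrt (real n)" if A: "A \<in> \<A>" for A
  proof -
    have pos: "0 \<le> R0" "0 \<le> R1" "0 \<le> cumul_total" using R0_nonneg R1_nonneg cumul_total_nonneg by auto
    have AS: "A \<subseteq> S" "i \<in> A" using A by (auto simp: \<A>_def)
    then have fA: "finite A" using S finite_subset by blast
    have "card A \<le> 8" using AS S card_mono[of S A] by linarith
    moreover have "card A \<noteq> 0" using AS fA by auto
    ultimately have "card A = 1 \<or> card A = 2 \<or> card A \<in> {3..8}" by auto
    then consider "card A = 1" | "card A = 2" | "card A \<in> {3..8}" by blast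
    then show ?thesis
    proof cases
      case 1
      then have "A = {i}" using A by (auto simp: card_1_singleton_iff \<A>_def)
      then show ?thesis using dft_cumulant_bound_ge1 by (simp add: q_def)
    next
      case 2
      then obtain j where j: "A = {i, j}" "i \<noteq> j" using A by (auto simp: card_2_iff \<A>_def)
      then have "A - {i} = {j}" by auto
      then have "norm (dft_cumulant n v A - q A) \<le> R1 / real n"
        using dft_cumulant_pair[OF j(2) n, of v] 2 j(1) by (simp add: q_def)
      also have "\<dots> \<le> R1 / sqrt (real n)"
      proof (rule divide_left_mono)
        show "sqrt (real n) \<le> real n" using n by (intro real_le_lsqrt) (auto simp: self_le_power)
      qed (use n pos in auto)
      also have "\<dots> \<le> dft_cumulant_bound / sqrt (real n)"
        using pos by (intro divide_right_mono) (auto simp: dft_cumulant_bound_def)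
      finally show ?thesis .
    next
      case 3
      then have "norm (dft_cumulant n v A - q A) \<le> cumul_total / sqrt (real n)"
        using norm_dft_cumulant_le_total[OF fA(1) 3 n, of v] by (simp add: q_def)
      also have "\<dots> \<le> dft_cumulant_bound / sqrt (real n)"
        using pos by (intro divide_right_mono) (auto simp: dft_cumulant_bound_def)
      finally show ?thesis .
    qed
  qed
  have "norm (\<Sum>A\<in>\<A>. (dft_cumulant n v A - q A) * dft_moment n v (S - A)) \<le>
      (\<Sum>A\<in>\<A>. dft_cumulant_bound / sqrt (real n) * dft_moment_bound)"
  proof (rule sum_norm_le)
    fix A assume A: "A \<in> \<A>"
    have "card (S - A) \<le> 8" using S card_mono[of S "S - A"] by auto
    then have "norm (dft_moment n v (S - A)) \<le> dft_moment_bound"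
      using S n by (intro norm_dft_moment_le) auto
    then show "norm ((dft_cumulant n v A - q A) * dft_moment n v (S - A)) \<le> dft_cumulant_bound / sqrt (real n) * dft_moment_bound"
      unfolding norm_mult using le[OF A] dft_cumulant_bound_ge1 by (intro mult_mono) auto
  qed
  also have "\<dots> \<le> 2 ^ 8 * (dft_cumulant_bound / sqrt (real n) * dft_moment_bound)"
    unfolding sum_constant using \<A>(2) dft_cumulant_bound_ge1 dft_moment_bound_ge1 by (intro mult_right_mono) auto
  also have "\<dots> = wick_error / sqrt (real n)" by (simp add: wick_error_def)
  finally show ?thesis unfolding eq .
qed

end

section \<open>Mean square of an average of nearly uncorrelated variables\<close>

text \<open>After the square is expanded, at most 3 N of the N^2 pairs are exceptional: the
  diagonal, and the row and the column of the one index in \<open>G\<close>. They are charged the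
  crude bound \<open>K\<close>, all others the small error \<open>e\<close>; the mixed term has at
  most one exceptional index.\<close>

lemma (in prob_space) average_second_moment:
  fixes Z :: "nat \<Rightarrow> 'a \<Rightarrow> real"
  assumes N: "N \<ge> 1"
    and i1: "\<And>i. i \<in> {1..N} \<Longrightarrow> integrable M (Z i)"
    and i2: "\<And>i j. i \<in> {1..N} \<Longrightarrow> j \<in> {1..N} \<Longrightarrow> integrable M (\<lambda>x. Z i x * Z j x)"
    and bad: "finite G" "card G \<le> 1"
    and e1: "\<And>i. i \<in> {1..N} \<Longrightarrow> i \<notin> G \<Longrightarrow> \<bar>expectation (Z i) - m\<bar> \<le> e"
    and e2: "\<And>i j. i \<in> {1..N} \<Longrightarrow> j \<in> {1..N} \<Longrightarrow> i \<notin> G \<Longrightarrow> j \<notin> G \<Longrightarrow> i \<noteq> j \<Longrightarrow>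
      \<bar>expectation (\<lambda>x. Z i x * Z j x) - m\<^sup>2\<bar> \<le> e"
    and k1: "\<And>i. i \<in> {1..N} \<Longrightarrow> \<bar>expectation (Z i)\<bar> \<le> K"
    and k2: "\<And>i j. i \<in> {1..N} \<Longrightarrow> j \<in> {1..N} \<Longrightarrow> \<bar>expectation (\<lambda>x. Z i x * Z j x)\<bar> \<le> K"
    and nonneg: "e \<ge> 0" "K \<ge> 0" "m \<ge> 0"
  shows "integrable M (\<lambda>x. (1 / real N * (\<Sum>j=1..N. Z j x) - m)\<^sup>2)"
    and "expectation (\<lambda>x. (1 / real N * (\<Sum>j=1..N. Z j x) - m)\<^sup>2)
       \<le> (1 + 2 * m) * e + (3 * (K + m\<^sup>2) + 2 * m * (K + m)) / real N"
proof -
  have eq: "(1 / real N * (\<Sum>j=1..N. Z j x) - m)\<^sup>2 =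
      1 / (real N)\<^sup>2 * (\<Sum>i=1..N. \<Sum>j=1..N. Z i x * Z j x) - 2 * m / real N * (\<Sum>j=1..N. Z j x) + m\<^sup>2" for x
    unfolding sum_product[symmetric] power2_diff
    by (simp add: power2_eq_square)
  have int1: "integrable M (\<lambda>x. \<Sum>j=1..N. Z j x)" by (intro Bochner_Integration.integrable_sum i1)
  have int2: "integrable M (\<lambda>x. \<Sum>i=1..N. \<Sum>j=1..N. Z i x * Z j x)"
    by (intro Bochner_Integration.integrable_sum i2)
  show "integrable M (\<lambda>x. (1 / real N * (\<Sum>j=1..N. Z j x) - m)\<^sup>2)"
    unfolding eq using int1 int2 by auto
  have cG: "card {i \<in> {1..N}. i \<in> G} \<le> 1"
  proof -
    have "card {i \<in> {1..N}. i \<in> G} \<le> card G" by (intro card_mono bad(1)) auto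
    then show ?thesis using bad(2) by linarith
  qed
  have "(\<Sum>i=1..N. of_bool (i \<in> G)) = real (card {i \<in> {1..N}. i \<in> G})"
    by (simp add: of_bool_def sum.If_cases Int_def)
  with cG have sG: "(\<Sum>i=1..N. of_bool (i \<in> G)) \<le> (1::real)" by linarith
  define d2 where "d2 i j = expectation (\<lambda>x. Z i x * Z j x) - m\<^sup>2" for i j
  define d1 where "d1 i = expectation (Z i) - m" for i
  have "expectation (\<lambda>x. (1 / real N * (\<Sum>j=1..N. Z j x) - m)\<^sup>2) =
      1 / (real N)\<^sup>2 * (\<Sum>i=1..N. \<Sum>j=1..N. expectation (\<lambda>x. Z i x * Z j x)) - 2 * m / real N * (\<Sum>j=1..N. expectation (Z j)) + m\<^sup>2"
  proof -
    have "expectation (\<lambda>x. \<Sum>i=1..N. \<Sum>j=1..N. Z i x * Z j x) = (\<Sum>i=1..N. expectation (\<lambda>x. \<Sum>j=1..N. Z i x * Z j x))"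
      by (intro Bochner_Integration.integral_sum Bochner_Integration.integrable_sum i2)
    also have "\<dots> = (\<Sum>i=1..N. \<Sum>j=1..N. expectation (\<lambda>x. Z i x * Z j x))"
      by (intro sum.cong refl Bochner_Integration.integral_sum i2)
    finally have E2: "expectation (\<lambda>x. \<Sum>i=1..N. \<Sum>j=1..N. Z i x * Z j x) = \<dots>" .
    have E1: "expectation (\<lambda>x. \<Sum>j=1..N. Z j x) = (\<Sum>j=1..N. expectation (Z j))"
      by (intro Bochner_Integration.integral_sum i1)
    show ?thesis
      unfolding eq E2[symmetric] E1[symmetric] using int1 int2 by (simp add: prob_space)
  qed
  also have "\<dots> = 1 / (real N)\<^sup>2 * (\<Sum>i=1..N. \<Sum>j=1..N. d2 i j) - 2 * m / real N * (\<Sum>j=1..N. d1 j)"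
    using N by (simp add: d2_def d1_def sum_subtractf field_simps power2_eq_square)
  also have "\<dots> \<le> 1 / (real N)\<^sup>2 * ((real N)\<^sup>2 * e + 3 * (K + m\<^sup>2) * real N) + 2 * m / real N * (real N * e + (K + m))"
  proof -
    have "d2 i j \<le> e + (K + m\<^sup>2) * (of_bool (i = j) + of_bool (i \<in> G) + of_bool (j \<in> G))"
      if "i \<in> {1..N}" "j \<in> {1..N}" for i j
    proof (cases "i \<noteq> j \<and> i \<notin> G \<and> j \<notin> G")
      case True
      then show ?thesis using e2[OF that] unfolding d2_def by auto
    next
      case False
      then have "1 \<le> of_bool (i = j) + of_bool (i \<in> G) + (of_bool (j \<in> G) :: real)" by auto
      then have "K + m\<^sup>2 \<le> (K + m\<^sup>2) * (of_bool (i = j) + of_bool (i \<in> G) + of_bool (j \<in> G))"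
        using nonneg mult_left_mono[of 1 _ "K + m\<^sup>2"] by fastforce
      moreover have "d2 i j \<le> K + m\<^sup>2" using k2[OF that] unfolding d2_def by (smt (verit) zero_le_power2)
      ultimately show ?thesis using nonneg by linarith
    qed
    then have "(\<Sum>i=1..N. \<Sum>j=1..N. d2 i j) \<le>
       (\<Sum>i=1..N. \<Sum>j=1..N. e + (K + m\<^sup>2) * (of_bool (i = j) + of_bool (i \<in> G) + of_bool (j \<in> G)))"
      by (intro sum_mono) auto
    also have "\<dots> = (real N)\<^sup>2 * e + (K + m\<^sup>2) * (real N + 2 * real N * (\<Sum>i=1..N. of_bool (i \<in> G)))"
    proof -
      have "(\<Sum>j=1..N. of_bool (i = j)) = (1::real)" if "i \<in> {1..N}" for i
        using that by (simp add: of_bool_def)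
      then have "(\<Sum>i=1..N. \<Sum>j=1..N. of_bool (i = j)) = real N" by simp
      then show ?thesis
        by (simp add: sum.distrib sum_distrib_left[symmetric] algebra_simps power2_eq_square)
    qed
    also have "\<dots> \<le> (real N)\<^sup>2 * e + (K + m\<^sup>2) * (real N + 2 * real N * 1)"
      using sG nonneg by (intro add_left_mono mult_left_mono) auto
    finally have A: "(\<Sum>i=1..N. \<Sum>j=1..N. d2 i j) \<le> (real N)\<^sup>2 * e + 3 * (K + m\<^sup>2) * real N"
      by (simp add: algebra_simps)
    have "- d1 i \<le> e + (K + m) * of_bool (i \<in> G)" if "i \<in> {1..N}" for i
      using e1[OF that] k1[OF that] nonneg unfolding d1_def by (cases "i \<in> G") auto
    then have "(\<Sum>i=1..N. - d1 i) \<le> (\<Sum>i=1..N. e + (K + m) * of_bool (i \<in> G))"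
      by (intro sum_mono) auto
    also have "\<dots> = real N * e + (K + m) * (\<Sum>i=1..N. of_bool (i \<in> G))"
      by (simp add: sum.distrib sum_distrib_left)
    also have "\<dots> \<le> real N * e + (K + m) * 1"
      using sG nonneg by (intro add_left_mono mult_left_mono) auto
    finally have B: "- (\<Sum>i=1..N. d1 i) \<le> real N * e + (K + m)" by (simp add: sum_negf)
    have "1 / (real N)\<^sup>2 * (\<Sum>i=1..N. \<Sum>j=1..N. d2 i j) \<le> 1 / (real N)\<^sup>2 * ((real N)\<^sup>2 * e + 3 * (K + m\<^sup>2) * real N)"
      by (intro mult_left_mono A) simp
    moreover have "2 * m / real N * (- (\<Sum>i=1..N. d1 i)) \<le> 2 * m / real N * (real N * e + (K + m))"
      using nonneg by (intro mult_left_mono B) simp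
    ultimately show ?thesis by (simp only: mult_minus_right)
  qed
  also have "\<dots> = (1 + 2 * m) * e + (3 * (K + m\<^sup>2) + 2 * m * (K + m)) / real N"
    using N by (simp add: field_simps power2_eq_square)
  finally show "expectation (\<lambda>x. (1 / real N * (\<Sum>j=1..N. Z j x) - m)\<^sup>2)
       \<le> (1 + 2 * m) * e + (3 * (K + m\<^sup>2) + 2 * m * (K + m)) / real N" .
qed

section \<open>Joint moments of periodogram ordinates\<close>

context stationary_cumulants
begin

definition dft_power :: "nat \<Rightarrow> int \<Rightarrow> 'a \<Rightarrow> real" where
  "dft_power n j \<omega> = (cmod (dft n j \<omega>))\<^sup>2"

lemma measurable_dft[measurable]: "dft n j \<in> borel_measurable M"
  unfolding dft_def by measurable

lemma periodogram_eq_dft_power: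
  "periodogram n (\<lambda>t. X t \<omega>) j = dft_power n j \<omega> / (2 * pi)"
proof -
  have "dft n j \<omega> = (\<Sum>k=1..int n. of_real (X k \<omega>) * cis (of_int k * fourier_freq n j)) / of_real (sqrt (real n))"
    unfolding dft_def by (simp add: sum_divide_distrib)
  then show ?thesis
    unfolding periodogram_def dft_power_def by (simp add: norm_divide power_divide)
qed

lemma dft_uminus: "dft n (- j) \<omega> = cnj (dft n j \<omega>)"
  by (simp add: dft_def fourier_freq_minus cis_cnj)

lemma of_real_dft_power: "complex_of_real (dft_power n j \<omega>) = dft n j \<omega> * dft n (- j) \<omega>"
  unfolding dft_power_def dft_uminus by (rule complex_norm_square)

text \<open>Eight slots: 0 to 3 carry \<open>j\<close> and 4 to 7 carry \<open>l\<close>, with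
  alternating signs. Since the squared modulus of a transform is the product of the transforms at
  opposite frequencies, every power product needed below is a subset of the slots.\<close>

definition quad_freq :: "int \<Rightarrow> int \<Rightarrow> nat \<Rightarrow> int" where
  "quad_freq j l i = (if i < 4 then (if even i then j else - j) else (if even i then l else - l))"

lemma
  shows expectation_dft_power: "complex_of_real (expectation (dft_power n l)) = dft_moment n (quad_freq j l) {6, 7}"
    and expectation_dft_power2: "complex_of_real (expectation (\<lambda>\<omega>. (dft_power n l \<omega>)\<^sup>2)) = dft_moment n (quad_freq j l) {4, 5, 6, 7}"
    and expectation_dft_power11: "complex_of_real (expectation (\<lambda>\<omega>. dft_power n j \<omega> * dft_power n l \<omega>)) = dft_moment n (quad_freq j l) {0, 1, 4, 5}"
    and expectation_dft_power22: "complex_of_real (expectation (\<lambda>\<omega>. (dft_power n j \<omega>)\<^sup>2 * (dft_power n l \<omega>)\<^sup>2)) = dft_moment n (quad_freq j l) {0, 1, 2, 3, 4, 5, 6, 7}"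
    and integrable_dft_power: "integrable M (dft_power n l)"
    and integrable_dft_power2: "integrable M (\<lambda>\<omega>. (dft_power n l \<omega>)\<^sup>2)"
    and integrable_dft_power11: "integrable M (\<lambda>\<omega>. dft_power n j \<omega> * dft_power n l \<omega>)"
    and integrable_dft_power22: "integrable M (\<lambda>\<omega>. (dft_power n j \<omega>)\<^sup>2 * (dft_power n l \<omega>)\<^sup>2)"
proof -
  have *: "complex_of_real (expectation g) = dft_moment n (quad_freq j l) S \<and> integrable M g"
    if "finite S" "card S \<le> 8" "\<And>\<omega>. complex_of_real (g \<omega>) = (\<Prod>i\<in>S. dft n (quad_freq j l i) \<omega>)"
    for g :: "'a \<Rightarrow> real" and S
  proof
    show "complex_of_real (expectation g) = dft_moment n (quad_freq j l) S"
      using expectation_prod_dft(1)[OF that(1,2), of n "quad_freq j l"] unfolding that(3)[symmetric] by simp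
    have "integrable M (\<lambda>\<omega>. Re (complex_of_real (g \<omega>)))"
      using expectation_prod_dft(2)[OF that(1,2), of n "quad_freq j l"] unfolding that(3)[symmetric]
      by (rule integrable_Re)
    then show "integrable M g" by simp
  qed
  note simps = quad_freq_def of_real_dft_power power2_eq_square mult_ac
  show "complex_of_real (expectation (dft_power n l)) = dft_moment n (quad_freq j l) {6, 7}"
    "integrable M (dft_power n l)"
    using *[of "{6, 7}" "dft_power n l"] by (simp_all add: simps)
  show "complex_of_real (expectation (\<lambda>\<omega>. (dft_power n l \<omega>)\<^sup>2)) = dft_moment n (quad_freq j l) {4, 5, 6, 7}"
    "integrable M (\<lambda>\<omega>. (dft_power n l \<omega>)\<^sup>2)"
    using *[of "{4, 5, 6, 7}" "\<lambda>\<omega>. (dft_power n l \<omega>)\<^sup>2"] by (simp_all add: simps)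
  show "complex_of_real (expectation (\<lambda>\<omega>. dft_power n j \<omega> * dft_power n l \<omega>)) = dft_moment n (quad_freq j l) {0, 1, 4, 5}"
    "integrable M (\<lambda>\<omega>. dft_power n j \<omega> * dft_power n l \<omega>)"
    using *[of "{0, 1, 4, 5}" "\<lambda>\<omega>. dft_power n j \<omega> * dft_power n l \<omega>"] by (simp_all add: simps)
  show "complex_of_real (expectation (\<lambda>\<omega>. (dft_power n j \<omega>)\<^sup>2 * (dft_power n l \<omega>)\<^sup>2)) = dft_moment n (quad_freq j l) {0, 1, 2, 3, 4, 5, 6, 7}"
    "integrable M (\<lambda>\<omega>. (dft_power n j \<omega>)\<^sup>2 * (dft_power n l \<omega>)\<^sup>2)"
    using *[of "{0, 1, 2, 3, 4, 5, 6, 7}" "\<lambda>\<omega>. (dft_power n j \<omega>)\<^sup>2 * (dft_power n l \<omega>)\<^sup>2"] by (simp_all add: simps)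
qed

text \<open>The moment of eight transforms takes four nested Wick steps, and each multiplies the
  accumulated error by at most 1 + 2 \<open>R0\<close>.\<close>

definition moment_error :: real where
  "moment_error = (1 + 2 * R0) ^ 4 * wick_error"

context
  fixes n :: nat and j l :: int
  assumes n: "n \<ge> 1"
    and j: "1 \<le> j" "2 * j < int n" and l: "1 \<le> l" "2 * l < int n" and jl: "j \<noteq> l"
begin

private abbreviation v where "v \<equiv> quad_freq j l"
private abbreviation Fj where "Fj \<equiv> 2 * pi * sd (fourier_freq n j)"
private abbreviation Fl where "Fl \<equiv> 2 * pi * sd (fourier_freq n l)"
private abbreviation \<epsilon> where "\<epsilon> \<equiv> wick_error / sqrt (real n)"

private lemma not_dvd: "x \<noteq> 0 \<Longrightarrow> \<bar>x\<bar> < int n \<Longrightarrow> \<not> int n dvd x"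
  using zdvd_imp_le[of "int n" "\<bar>x\<bar>"] by auto

text \<open>With 0 < 2 j, 2 l < n and distinct frequencies, a sum of two signed frequencies vanishes
  modulo \<open>n\<close> only if they are opposite. The bound 2 j < n is what excludes
  \<open>j + j\<close>.\<close>

private lemma nd:
  "\<not> int n dvd j + j" "\<not> int n dvd l + l" "\<not> int n dvd j + l" "\<not> int n dvd j - l" "\<not> int n dvd - j + l"
  "\<not> int n dvd - j - l" "\<not> int n dvd l + j" "\<not> int n dvd l - j" "\<not> int n dvd - l + j" "\<not> int n dvd - l - j"
  "\<not> int n dvd - j - j" "\<not> int n dvd - l - l" "\<not> int n dvd 2 * j" "\<not> int n dvd 2 * l"
  by (rule not_dvd; use j l jl in linarith)+

private lemmas pl = pair_limit_def quad_freq_def nd fourier_freq_minus sd_minus insert_Diff_if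

private lemma F_le: "\<bar>Fj\<bar> \<le> R0" "\<bar>Fl\<bar> \<le> R0"
  using abs_sd_le by (auto simp: abs_mult)

private lemma eps: "\<epsilon> \<ge> 0" "R0 \<ge> 0"
  using wick_error_nonneg R0_nonneg by auto

text \<open>A Wick step with two surviving pairings of equal value: the new error is one
  \<open>\<epsilon>\<close> plus at most 2 \<open>R0\<close> times the old error, which gives the
  factor 1 + 2 \<open>R0\<close>.\<close>

private lemma step_bound:
  fixes D D1 D2 :: complex
  assumes "norm (D - of_real F * (D1 + D2)) \<le> \<epsilon>" "\<bar>F\<bar> \<le> R0"
    "norm (D1 - of_real w) \<le> (1 + 2 * R0) ^ k * \<epsilon>" "norm (D2 - of_real w) \<le> (1 + 2 * R0) ^ k * \<epsilon>"
  shows "norm (D - of_real (2 * F * w)) \<le> (1 + 2 * R0) ^ Suc k * \<epsilon>"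
proof -
  have "norm (D1 + D2 - of_real (2 * w)) \<le> 2 * (1 + 2 * R0) ^ k * \<epsilon>"
    using norm_triangle_mono[OF assms(3,4)] by (simp add: algebra_simps)
  then have "norm (of_real F * (D1 + D2 - of_real (2 * w))) \<le> R0 * (2 * (1 + 2 * R0) ^ k * \<epsilon>)"
    unfolding norm_mult using assms(2) eps by (intro mult_mono) auto
  from norm_triangle_mono[OF assms(1) this]
  have "norm (D - of_real (2 * F * w)) \<le> \<epsilon> + R0 * (2 * (1 + 2 * R0) ^ k * \<epsilon>)"
    by (simp add: algebra_simps)
  also have "\<dots> \<le> (1 + 2 * R0) ^ k * \<epsilon> + R0 * (2 * (1 + 2 * R0) ^ k * \<epsilon>)"
    using mult_right_mono[OF one_le_power[of "1 + 2 * R0" k], of \<epsilon>] eps by simp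
  also have "\<dots> = (1 + 2 * R0) ^ Suc k * \<epsilon>" by (simp add: algebra_simps)
  finally show ?thesis .
qed

text \<open>A single surviving pairing is treated as two pairings with half of \<open>D1\<close>
  each.\<close>

private lemma step_bound1:
  fixes D D1 :: complex
  assumes "norm (D - of_real F * D1) \<le> \<epsilon>" "\<bar>F\<bar> \<le> R0"
    "norm (D1 - of_real w) \<le> (1 + 2 * R0) ^ k * \<epsilon>"
  shows "norm (D - of_real (F * w)) \<le> (1 + 2 * R0) ^ Suc k * \<epsilon>"
  using step_bound[of D F "D1 / 2" "D1 / 2" "w / 2" k] assms
proof -
  have "norm (D1 / 2 - of_real (w / 2)) = norm (D1 - of_real w) / 2"
  proof -
    have "D1 / 2 - of_real (w / 2) = (D1 - of_real w) / 2" by (simp add: diff_divide_distrib)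
    then show ?thesis by (simp only: norm_divide norm_numeral)
  qed
  also have "\<dots> \<le> (1 + 2 * R0) ^ k * \<epsilon>" using assms(3) norm_ge_zero[of "D1 - of_real w"] by linarith
  finally show ?thesis using step_bound[of D F "D1 / 2" "D1 / 2" "w / 2" k] assms by simp
qed

private lemma w2: "norm (dft_moment n v {6, 7} - of_real Fl) \<le> (1 + 2 * R0) ^ 1 * \<epsilon>"
  "norm (dft_moment n v {5, 6} - of_real Fl) \<le> (1 + 2 * R0) ^ 1 * \<epsilon>"
  "norm (dft_moment n v {4, 5} - of_real Fl) \<le> (1 + 2 * R0) ^ 1 * \<epsilon>"
  using wick_step[of "{6, 7}" 6 n v] wick_step[of "{5, 6}" 5 n v] wick_step[of "{4, 5}" 4 n v] n
    step_bound1[of _ Fl 1 1 0] F_le eps by (auto simp: pl)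

text \<open>Slot 4 can be paired with slot 5 or slot 7. This is the 2 in E|Z|^4 = 2 (E|Z|^2)^2 for a
  circular complex Gaussian variable Z.\<close>

private lemma w4: "norm (dft_moment n v {4, 5, 6, 7} - of_real (2 * Fl * Fl)) \<le> (1 + 2 * R0) ^ 2 * \<epsilon>"
proof -
  have "norm (dft_moment n v {4, 5, 6, 7} - of_real Fl * (dft_moment n v {6, 7} + dft_moment n v {5, 6})) \<le> \<epsilon>"
    using wick_step[of "{4, 5, 6, 7}" 4 n v] n by (simp add: pl distrib_left)
  from step_bound[OF this F_le(2) w2(1,2)] show ?thesis by (simp add: numeral_2_eq_2)
qed

private lemma w11: "norm (dft_moment n v {0, 1, 4, 5} - of_real (Fj * Fl)) \<le> (1 + 2 * R0) ^ 2 * \<epsilon>"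
proof -
  have "norm (dft_moment n v {0, 1, 4, 5} - of_real Fj * dft_moment n v {4, 5}) \<le> \<epsilon>"
    using wick_step[of "{0, 1, 4, 5}" 0 n v] n by (simp add: pl)
  from step_bound1[OF this F_le(1) w2(3)] show ?thesis by (simp add: numeral_2_eq_2)
qed

text \<open>Slot 0 has the two partners 1 and 3; each remaining six-slot moment has one pair of
  \<open>j\<close>-slots left and reduces to the four slots of \<open>l\<close>. Thus 4 = 2 * 2, as
  for independent ordinates.\<close>

private lemma w22: "norm (dft_moment n v {0, 1, 2, 3, 4, 5, 6, 7} - of_real (4 * (Fj * Fj) * (Fl * Fl))) \<le> (1 + 2 * R0) ^ 4 * \<epsilon>"
proof -
  have a: "norm (dft_moment n v {2, 3, 4, 5, 6, 7} - of_real Fj * dft_moment n v {4, 5, 6, 7}) \<le> \<epsilon>"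
    using wick_step[of "{2, 3, 4, 5, 6, 7}" 2 n v] n by (simp add: pl)
  have b: "norm (dft_moment n v {1, 2, 4, 5, 6, 7} - of_real Fj * dft_moment n v {4, 5, 6, 7}) \<le> \<epsilon>"
    using wick_step[of "{1, 2, 4, 5, 6, 7}" 1 n v] n by (simp add: pl)
  have c: "norm (dft_moment n v {0, 1, 2, 3, 4, 5, 6, 7} -
      of_real Fj * (dft_moment n v {2, 3, 4, 5, 6, 7} + dft_moment n v {1, 2, 4, 5, 6, 7})) \<le> \<epsilon>"
    using wick_step[of "{0, 1, 2, 3, 4, 5, 6, 7}" 0 n v] n by (simp add: pl distrib_left)
  show ?thesis
    using step_bound[OF c F_le(1) step_bound1[OF a F_le(1) w4] step_bound1[OF b F_le(1) w4]]
    by (simp add: eval_nat_numeral mult_ac)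
qed

private lemma to_real:
  assumes "complex_of_real x = D" "norm (D - of_real w) \<le> (1 + 2 * R0) ^ k * \<epsilon>" "k \<le> 4"
  shows "\<bar>x - w\<bar> \<le> moment_error / sqrt (real n)"
proof -
  have "\<bar>x - w\<bar> = norm (complex_of_real x - of_real w)" by (simp flip: of_real_diff)
  also have "\<dots> \<le> (1 + 2 * R0) ^ k * \<epsilon>" using assms by simp
  also have "\<dots> \<le> (1 + 2 * R0) ^ 4 * \<epsilon>" using assms(3) eps by (intro mult_right_mono power_increasing) auto
  finally show ?thesis by (simp add: moment_error_def)
qed

lemma dft_power_moments_approx:
  "\<bar>expectation (dft_power n l) - Fl\<bar> \<le> moment_error / sqrt (real n)"
  "\<bar>expectation (\<lambda>\<omega>. (dft_power n l \<omega>)\<^sup>2) - 2 * Fl * Fl\<bar> \<le> moment_error / sqrt (real n)"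
  "\<bar>expectation (\<lambda>\<omega>. dft_power n j \<omega> * dft_power n l \<omega>) - Fj * Fl\<bar> \<le> moment_error / sqrt (real n)"
  "\<bar>expectation (\<lambda>\<omega>. (dft_power n j \<omega>)\<^sup>2 * (dft_power n l \<omega>)\<^sup>2) - 4 * (Fj * Fj) * (Fl * Fl)\<bar> \<le> moment_error / sqrt (real n)"
  using to_real[OF expectation_dft_power w2(1)] to_real[OF expectation_dft_power2 w4]
    to_real[OF expectation_dft_power11 w11] to_real[OF expectation_dft_power22 w22] by simp_all

end

lemma dft_power_moments_bounded:
  assumes n: "n \<ge> 1"
  shows "\<bar>expectation (dft_power n l)\<bar> \<le> dft_moment_bound"
    and "\<bar>expectation (\<lambda>\<omega>. (dft_power n l \<omega>)\<^sup>2)\<bar> \<le> dft_moment_bound"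
    and "\<bar>expectation (\<lambda>\<omega>. dft_power n j \<omega> * dft_power n l \<omega>)\<bar> \<le> dft_moment_bound"
    and "\<bar>expectation (\<lambda>\<omega>. (dft_power n j \<omega>)\<^sup>2 * (dft_power n l \<omega>)\<^sup>2)\<bar> \<le> dft_moment_bound"
proof -
  have *: "\<bar>x\<bar> \<le> dft_moment_bound" if "complex_of_real x = dft_moment n (quad_freq j l) S" "finite S" "card S \<le> 8" for x S
    using norm_dft_moment_le[OF that(2,3) n, of "quad_freq j l"] unfolding that(1)[symmetric] by simp
  show "\<bar>expectation (dft_power n l)\<bar> \<le> dft_moment_bound"
    by (rule *[OF expectation_dft_power]) auto
  show "\<bar>expectation (\<lambda>\<omega>. (dft_power n l \<omega>)\<^sup>2)\<bar> \<le> dft_moment_bound"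
    by (rule *[OF expectation_dft_power2]) auto
  show "\<bar>expectation (\<lambda>\<omega>. dft_power n j \<omega> * dft_power n l \<omega>)\<bar> \<le> dft_moment_bound"
    by (rule *[OF expectation_dft_power11]) auto
  show "\<bar>expectation (\<lambda>\<omega>. (dft_power n j \<omega>)\<^sup>2 * (dft_power n l \<omega>)\<^sup>2)\<bar> \<le> dft_moment_bound"
    by (rule *[OF expectation_dft_power22]) auto
qed

end

section \<open>Empirical moments of the residuals\<close>

lemma div_real_half_le:
  assumes "n \<ge> 2" "c \<ge> 0"
  shows "c / real (n div 2) \<le> 3 * c / real n"
proof -
  have "n \<le> 3 * (n div 2)" using assms(1) by presburger
  then have "real n \<le> 3 * real (n div 2)" by linarith
  then show ?thesis using assms by (simp add: field_simps mult_left_mono)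
qed

lemma fourier_freq_half:
  assumes "j \<in> {1..n div 2}"
  shows "fourier_freq n (int j) \<in> {0..pi}"
proof -
  have "2 * j \<le> n" using assms by auto
  then have "2 * real j \<le> real n" by linarith
  then have "2 * pi * real j \<le> pi * real n" by (simp add: mult_ac)
  moreover have "real n > 0" using assms by auto
  ultimately show ?thesis by (simp add: fourier_freq_def field_simps)
qed

context stationary_cumulants
begin

context
  fixes f0 :: real
  assumes f0: "f0 > 0" "\<And>w. w \<in> {0..pi} \<Longrightarrow> f0 \<le> sd w"
begin

private definition F where "F n j = 2 * pi * sd (fourier_freq n (int j))"

private lemma F_ge: "j \<in> {1..n div 2} \<Longrightarrow> F n j \<ge> 2 * pi * f0"
  unfolding F_def using f0(2)[OF fourier_freq_half] by auto

private lemma F_pos: "j \<in> {1..n div 2} \<Longrightarrow> F n j > 0"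
  using F_ge[of j n] f0(1) by (smt (verit) mult_pos_pos pi_gt_zero)

private lemma raw_resid_eq: "raw_resid n (\<lambda>t. X t \<omega>) sd j = dft_power n (int j) \<omega> / F n j"
  by (simp add: raw_resid_def periodogram_eq_dft_power F_def)

text \<open>One constant for all denominators that occur: one density value, a product of two, and a
  product of two squares.\<close>

private definition cF where "cF = 1 / (2 * pi * f0) + 1 / (2 * pi * f0) ^ 2 + 1 / (2 * pi * f0) ^ 4"

private lemma inverse_F_le:
  assumes "i \<in> {1..n div 2}" "j \<in> {1..n div 2}"
  shows "1 / F n i \<le> cF" "1 / (F n i * F n j) \<le> cF" "1 / (F n i)\<^sup>2 \<le> cF" "1 / ((F n i)\<^sup>2 * (F n j)\<^sup>2) \<le> cF"
    and "cF \<ge> 0"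
proof -
  define d where "d = 2 * pi * f0"
  have d: "d > 0" "d \<le> F n i" "d \<le> F n j" using f0(1) F_ge assms by (auto simp: d_def)
  then have pos: "F n i > 0" "F n j > 0" by linarith+
  have c: "1 / d \<le> cF" "1 / d ^ 2 \<le> cF" "1 / d ^ 4 \<le> cF" "cF \<ge> 0"
    using d(1) by (auto simp: cF_def d_def[symmetric])
  have "d * d \<le> F n i * F n j" "d * d \<le> F n i * F n i" using d pos by (auto intro!: mult_mono)
  moreover have "(d * d) * (d * d) \<le> (F n i * F n i) * (F n j * F n j)" using d pos by (intro mult_mono) auto
  ultimately have "1 / F n i \<le> 1 / d" "1 / (F n i * F n j) \<le> 1 / (d * d)" "1 / (F n i * F n i) \<le> 1 / (d * d)"
    "1 / ((F n i * F n i) * (F n j * F n j)) \<le> 1 / ((d * d) * (d * d))"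
    using d pos by (auto intro!: divide_left_mono mult_pos_pos)
  then show "1 / F n i \<le> cF" "1 / (F n i * F n j) \<le> cF" "1 / (F n i)\<^sup>2 \<le> cF" "1 / ((F n i)\<^sup>2 * (F n j)\<^sup>2) \<le> cF"
    "cF \<ge> 0"
    using c by (auto simp: power2_eq_square power4_eq_xxxx mult.assoc)
qed

private lemma scaled_approx:
  assumes "\<bar>x - m * y\<bar> \<le> e" "y > 0" "1 / y \<le> cF"
  shows "\<bar>x / y - m\<bar> \<le> e * cF"
proof -
  have "x / y - m = (x - m * y) / y" using assms by (simp add: field_simps)
  then have "\<bar>x / y - m\<bar> = \<bar>x - m * y\<bar> * (1 / y)" using assms by (simp add: abs_divide)
  also have "\<dots> \<le> e * cF" using assms by (intro mult_mono) auto
  finally show ?thesis .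
qed

private lemma scaled_bound:
  assumes "\<bar>x\<bar> \<le> e" "y > 0" "1 / y \<le> cF"
  shows "\<bar>x / y\<bar> \<le> e * cF"
  using scaled_approx[of x 0 y e] assms by simp

text \<open>The moment approximations are stated for a pair of distinct frequencies; those that
  concern only \<open>l\<close> still need a companion, which exists once
  \<open>n >= 5\<close>.\<close>

private lemma other_freq:
  assumes "n \<ge> 5" "l \<ge> 1"
  obtains j :: int where "1 \<le> j" "2 * j < int n" "j \<noteq> l"
proof (cases "l = 1")
  case True then show ?thesis using assms that[of 2] by auto
next
  case False then show ?thesis using assms that[of 1] by auto
qed

private lemma generic_freq:
  assumes "i \<in> {1..n div 2}" "i \<notin> {i. 2 * i = n}"
  shows "1 \<le> int i" "2 * int i < int n"
  using assms by auto

private lemma bad_freq: "finite {i. 2 * i = n}" "card {i::nat. 2 * i = n} \<le> 1"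
proof -
  have sub: "{i. 2 * i = n} \<subseteq> {n div 2}" by auto
  then show "finite {i. 2 * i = n}" by (rule finite_subset) simp
  show "card {i::nat. 2 * i = n} \<le> 1" using card_mono[OF _ sub] by simp
qed

private lemma tendsto_bound: "(\<lambda>n. c * (moment_error / sqrt (real n) * cF) + 3 * d / real n) \<longlonglongrightarrow> 0"
proof -
  have "(\<lambda>n. c * (moment_error / sqrt (real n) * cF) + 3 * d / real n) \<longlonglongrightarrow> c * (0 * cF) + 0"
  proof (intro tendsto_add tendsto_mult tendsto_const)
    show "(\<lambda>n. moment_error / sqrt (real n)) \<longlonglongrightarrow> 0"
      by (rule tendsto_divide_0[OF tendsto_const])
         (intro filterlim_at_top_imp_at_infinity filterlim_compose[OF sqrt_at_top filterlim_real_sequentially])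
    show "(\<lambda>n. 3 * d / real n) \<longlonglongrightarrow> 0" by (rule lim_const_over_n)
  qed
  then show ?thesis by simp
qed

private lemma moment_error_nonneg: "moment_error \<ge> 0"
  unfolding moment_error_def using wick_error_nonneg R0_nonneg by simp

text \<open>Residuals formed with the true density have moments close to those of uncorrelated
  standard exponential variables, and the exponential mean is 1; only the frequency pi escapes the
  approximation.\<close>

lemma mean_resid_L2:
  shows "integrable M (\<lambda>\<omega>. (mean_resid n (\<lambda>t. X t \<omega>) sd - 1)\<^sup>2)"
    and "(\<lambda>n. expectation (\<lambda>\<omega>. (mean_resid n (\<lambda>t. X t \<omega>) sd - 1)\<^sup>2)) \<longlonglongrightarrow> 0"
proof -
  have eq: "mean_resid n (\<lambda>t. X t \<omega>) sd = 1 / real (n div 2) * (\<Sum>j=1..n div 2. dft_power n (int j) \<omega> / F n j)" for n \<omega>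
    by (simp add: mean_resid_def raw_resid_eq)
  define e where "e n = moment_error / sqrt (real n) * cF" for n
  define K where "K = dft_moment_bound * cF"
  have prod: "dft_power n (int i) \<omega> / F n i * (dft_power n (int j) \<omega> / F n j) =
      dft_power n (int i) \<omega> * dft_power n (int j) \<omega> / (F n i * F n j)" for n i j \<omega> by simp
  have cF0: "cF \<ge> 0" using inverse_F_le(5)[of 1 2 1] by simp
  have main: "integrable M (\<lambda>\<omega>. (mean_resid n (\<lambda>t. X t \<omega>) sd - 1)\<^sup>2) \<and>
      expectation (\<lambda>\<omega>. (mean_resid n (\<lambda>t. X t \<omega>) sd - 1)\<^sup>2) \<le> 3 * e n + (3 * (K + 1) + 2 * (K + 1)) / real (n div 2)"
    if n: "n \<ge> 5" for n
  proof -
    have n1: "n \<ge> 1" using n by simp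
    note A = average_second_moment[where N="n div 2" and Z="\<lambda>j \<omega>. dft_power n (int j) \<omega> / F n j" and G="{i. 2 * i = n}"
       and m=1 and e="e n" and K=K, folded eq]
    have "1 \<le> n div 2" using n by simp
    moreover have "integrable M (\<lambda>\<omega>. dft_power n (int i) \<omega> / F n i)" for i
      by (intro integrable_divide integrable_dft_power)
    moreover have "integrable M (\<lambda>\<omega>. dft_power n (int i) \<omega> / F n i * (dft_power n (int j) \<omega> / F n j))" for i j
      unfolding prod by (intro integrable_divide integrable_dft_power11)
    moreover have "\<bar>expectation (\<lambda>\<omega>. dft_power n (int i) \<omega> / F n i) - 1\<bar> \<le> e n"
      if i: "i \<in> {1..n div 2}" "i \<notin> {i. 2 * i = n}" for i
    proof -
      obtain j where j: "1 \<le> j" "2 * j < int n" "j \<noteq> int i" using other_freq[of n "int i"] i n by auto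
      have "\<bar>expectation (dft_power n (int i)) - 1 * F n i\<bar> \<le> moment_error / sqrt (real n)"
        using dft_power_moments_approx(1)[OF n1 j(1,2) generic_freq[OF i] j(3)] by (simp add: F_def)
      from scaled_approx[OF this F_pos[OF i(1)] inverse_F_le(1)[OF i(1) i(1)]]
      show ?thesis by (simp add: e_def)
    qed
    moreover have "\<bar>expectation (\<lambda>\<omega>. dft_power n (int i) \<omega> / F n i * (dft_power n (int j) \<omega> / F n j)) - 1\<^sup>2\<bar> \<le> e n"
      if i: "i \<in> {1..n div 2}" "j \<in> {1..n div 2}" "i \<notin> {i. 2 * i = n}" "j \<notin> {i. 2 * i = n}" "i \<noteq> j" for i j
    proof -
      have "\<bar>expectation (\<lambda>\<omega>. dft_power n (int i) \<omega> * dft_power n (int j) \<omega>) - 1 * (F n i * F n j)\<bar>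
          \<le> moment_error / sqrt (real n)"
        using dft_power_moments_approx(3)[OF n1 generic_freq[OF i(1,3)] generic_freq[OF i(2,4)]] i(5) by (simp add: F_def)
      from scaled_approx[OF this mult_pos_pos[OF F_pos[OF i(1)] F_pos[OF i(2)]] inverse_F_le(2)[OF i(1) i(2)]]
      show ?thesis unfolding prod by (simp add: e_def)
    qed
    moreover have "\<bar>expectation (\<lambda>\<omega>. dft_power n (int i) \<omega> / F n i)\<bar> \<le> K" if i: "i \<in> {1..n div 2}" for i
      unfolding K_def
      using scaled_bound[OF dft_power_moments_bounded(1)[OF n1] F_pos[OF i] inverse_F_le(1)[OF i i]] by simp
    moreover have "\<bar>expectation (\<lambda>\<omega>. dft_power n (int i) \<omega> / F n i * (dft_power n (int j) \<omega> / F n j))\<bar> \<le> K"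
      if i: "i \<in> {1..n div 2}" "j \<in> {1..n div 2}" for i j
      unfolding K_def prod
      using scaled_bound[OF dft_power_moments_bounded(3)[OF n1] mult_pos_pos[OF F_pos[OF i(1)] F_pos[OF i(2)]] inverse_F_le(2)[OF i]] by simp
    moreover have "e n \<ge> 0" "K \<ge> 0"
      using moment_error_nonneg cF0 dft_moment_bound_ge1 by (auto simp: e_def K_def)
    ultimately show ?thesis using A bad_freq by simp
  qed
  show "(\<lambda>n. expectation (\<lambda>\<omega>. (mean_resid n (\<lambda>t. X t \<omega>) sd - 1)\<^sup>2)) \<longlonglongrightarrow> 0"
  proof (rule tendsto_sandwich[OF _ _ tendsto_const tendsto_bound[of 3 "3 * (K + 1) + 2 * (K + 1)"]])
    show "\<forall>\<^sub>F n in sequentially. expectation (\<lambda>\<omega>. (mean_resid n (\<lambda>t. X t \<omega>) sd - 1)\<^sup>2)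
       \<le> 3 * (moment_error / sqrt (real n) * cF) + 3 * (3 * (K + 1) + 2 * (K + 1)) / real n"
      using eventually_ge_at_top[of 5]
    proof eventually_elim
      case (elim n)
      have "0 \<le> K" using cF0 dft_moment_bound_ge1 by (simp add: K_def)
      then have "(3 * (K + 1) + 2 * (K + 1)) / real (n div 2) \<le> 3 * (3 * (K + 1) + 2 * (K + 1)) / real n"
        using elim by (intro div_real_half_le) auto
      then show ?case using main[OF elim] unfolding e_def by linarith
    qed
  qed auto
  \<comment> \<open>Integrability is claimed for every \<open>n\<close>, including the small ones
    that \<open>main\<close> leaves out.\<close>
  have sq: "mean_resid n (\<lambda>t. X t \<omega>) sd * mean_resid n (\<lambda>t. X t \<omega>) sd = 1 / real (n div 2) * (1 / real (n div 2)) *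
     (\<Sum>i=1..n div 2. \<Sum>j=1..n div 2. dft_power n (int i) \<omega> / F n i * (dft_power n (int j) \<omega> / F n j))" for \<omega>
    unfolding eq sum_product[symmetric] by (simp only: mult_ac)
  have "integrable M (\<lambda>\<omega>. mean_resid n (\<lambda>t. X t \<omega>) sd * mean_resid n (\<lambda>t. X t \<omega>) sd - 2 * mean_resid n (\<lambda>t. X t \<omega>) sd + 1)"
    unfolding sq unfolding eq prod
    by (intro Bochner_Integration.integrable_add Bochner_Integration.integrable_diff integrable_mult_right
         Bochner_Integration.integrable_sum integrable_const integrable_divide integrable_dft_power integrable_dft_power11)
  then show "integrable M (\<lambda>\<omega>. (mean_resid n (\<lambda>t. X t \<omega>) sd - 1)\<^sup>2)"
    by (simp add: power2_eq_square algebra_simps)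
qed

text \<open>The second moment of a standard exponential variable is 2. Products of two squared
  ordinates are eighth-order moments of the process, the highest order that is available.\<close>

lemma mean_square_resid_L2:
  shows "integrable M (\<lambda>\<omega>. (1 / real (n div 2) * (\<Sum>j=1..n div 2. (raw_resid n (\<lambda>t. X t \<omega>) sd j)\<^sup>2) - 2)\<^sup>2)"
    and "(\<lambda>n. expectation (\<lambda>\<omega>. (1 / real (n div 2) * (\<Sum>j=1..n div 2. (raw_resid n (\<lambda>t. X t \<omega>) sd j)\<^sup>2) - 2)\<^sup>2)) \<longlonglongrightarrow> 0"
proof -
  define S where "S n \<omega> = 1 / real (n div 2) * (\<Sum>j=1..n div 2. (raw_resid n (\<lambda>t. X t \<omega>) sd j)\<^sup>2)" for n \<omega>
  have eq: "S n \<omega> = 1 / real (n div 2) * (\<Sum>j=1..n div 2. (dft_power n (int j) \<omega>)\<^sup>2 / (F n j)\<^sup>2)" for n \<omega>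
    by (simp add: S_def raw_resid_eq power_divide)
  define e where "e n = moment_error / sqrt (real n) * cF" for n
  define K where "K = dft_moment_bound * cF"
  have prod: "(dft_power n (int i) \<omega>)\<^sup>2 / (F n i)\<^sup>2 * ((dft_power n (int j) \<omega>)\<^sup>2 / (F n j)\<^sup>2) =
      (dft_power n (int i) \<omega>)\<^sup>2 * (dft_power n (int j) \<omega>)\<^sup>2 / ((F n i)\<^sup>2 * (F n j)\<^sup>2)" for n i j \<omega> by simp
  have cF0: "cF \<ge> 0" using inverse_F_le(5)[of 1 2 1] by simp
  have main: "expectation (\<lambda>\<omega>. (S n \<omega> - 2)\<^sup>2) \<le> 5 * e n + (3 * (K + 4) + 4 * (K + 2)) / real (n div 2)"
    if n: "n \<ge> 5" for n
  proof -
    have n1: "n \<ge> 1" using n by simp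
    note A = average_second_moment[where N="n div 2" and Z="\<lambda>j \<omega>. (dft_power n (int j) \<omega>)\<^sup>2 / (F n j)\<^sup>2" and G="{i. 2 * i = n}"
       and m=2 and e="e n" and K=K, folded eq]
    have sqpos: "i \<in> {1..n div 2} \<Longrightarrow> (F n i)\<^sup>2 > 0" for i using F_pos[of i n] by simp
    have "1 \<le> n div 2" using n by simp
    moreover have "integrable M (\<lambda>\<omega>. (dft_power n (int i) \<omega>)\<^sup>2 / (F n i)\<^sup>2)" for i
      by (intro integrable_divide integrable_dft_power2)
    moreover have "integrable M (\<lambda>\<omega>. (dft_power n (int i) \<omega>)\<^sup>2 / (F n i)\<^sup>2 * ((dft_power n (int j) \<omega>)\<^sup>2 / (F n j)\<^sup>2))" for i j
      unfolding prod by (intro integrable_divide integrable_dft_power22)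
    moreover have "\<bar>expectation (\<lambda>\<omega>. (dft_power n (int i) \<omega>)\<^sup>2 / (F n i)\<^sup>2) - 2\<bar> \<le> e n"
      if i: "i \<in> {1..n div 2}" "i \<notin> {i. 2 * i = n}" for i
    proof -
      obtain j where j: "1 \<le> j" "2 * j < int n" "j \<noteq> int i" using other_freq[of n "int i"] i n by auto
      have "\<bar>expectation (\<lambda>\<omega>. (dft_power n (int i) \<omega>)\<^sup>2) - 2 * (F n i)\<^sup>2\<bar> \<le> moment_error / sqrt (real n)"
        using dft_power_moments_approx(2)[OF n1 j(1,2) generic_freq[OF i] j(3)] by (simp add: F_def power2_eq_square mult_ac)
      from scaled_approx[OF this sqpos[OF i(1)] inverse_F_le(3)[OF i(1) i(1)]]
      show ?thesis by (simp add: e_def)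
    qed
    moreover have "\<bar>expectation (\<lambda>\<omega>. (dft_power n (int i) \<omega>)\<^sup>2 / (F n i)\<^sup>2 * ((dft_power n (int j) \<omega>)\<^sup>2 / (F n j)\<^sup>2)) - 2\<^sup>2\<bar> \<le> e n"
      if i: "i \<in> {1..n div 2}" "j \<in> {1..n div 2}" "i \<notin> {i. 2 * i = n}" "j \<notin> {i. 2 * i = n}" "i \<noteq> j" for i j
    proof -
      have "\<bar>expectation (\<lambda>\<omega>. (dft_power n (int i) \<omega>)\<^sup>2 * (dft_power n (int j) \<omega>)\<^sup>2) - 4 * ((F n i)\<^sup>2 * (F n j)\<^sup>2)\<bar>
          \<le> moment_error / sqrt (real n)"
        using dft_power_moments_approx(4)[OF n1 generic_freq[OF i(1,3)] generic_freq[OF i(2,4)]] i(5)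
        by (simp add: F_def power2_eq_square mult_ac)
      from scaled_approx[OF this mult_pos_pos[OF sqpos[OF i(1)] sqpos[OF i(2)]] inverse_F_le(4)[OF i(1) i(2)]]
      show ?thesis unfolding prod by (simp add: e_def)
    qed
    moreover have "\<bar>expectation (\<lambda>\<omega>. (dft_power n (int i) \<omega>)\<^sup>2 / (F n i)\<^sup>2)\<bar> \<le> K" if i: "i \<in> {1..n div 2}" for i
      unfolding K_def
      using scaled_bound[OF dft_power_moments_bounded(2)[OF n1] sqpos[OF i] inverse_F_le(3)[OF i i]] by simp
    moreover have "\<bar>expectation (\<lambda>\<omega>. (dft_power n (int i) \<omega>)\<^sup>2 / (F n i)\<^sup>2 * ((dft_power n (int j) \<omega>)\<^sup>2 / (F n j)\<^sup>2))\<bar> \<le> K"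
      if i: "i \<in> {1..n div 2}" "j \<in> {1..n div 2}" for i j
      unfolding K_def prod
      using scaled_bound[OF dft_power_moments_bounded(4)[OF n1] mult_pos_pos[OF sqpos[OF i(1)] sqpos[OF i(2)]] inverse_F_le(4)[OF i]] by simp
    moreover have "e n \<ge> 0" "K \<ge> 0"
      using moment_error_nonneg cF0 dft_moment_bound_ge1 by (auto simp: e_def K_def)
    ultimately show ?thesis using A(2) bad_freq by simp
  qed
  show "(\<lambda>n. expectation (\<lambda>\<omega>. (1 / real (n div 2) * (\<Sum>j=1..n div 2. (raw_resid n (\<lambda>t. X t \<omega>) sd j)\<^sup>2) - 2)\<^sup>2)) \<longlonglongrightarrow> 0"
    unfolding S_def[symmetric]
  proof (rule tendsto_sandwich[OF _ _ tendsto_const tendsto_bound[of 5 "3 * (K + 4) + 4 * (K + 2)"]])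
    show "\<forall>\<^sub>F n in sequentially. expectation (\<lambda>\<omega>. (S n \<omega> - 2)\<^sup>2)
       \<le> 5 * (moment_error / sqrt (real n) * cF) + 3 * (3 * (K + 4) + 4 * (K + 2)) / real n"
      using eventually_ge_at_top[of 5]
    proof eventually_elim
      case (elim n)
      have "0 \<le> K" using cF0 dft_moment_bound_ge1 by (simp add: K_def)
      then have "(3 * (K + 4) + 4 * (K + 2)) / real (n div 2) \<le> 3 * (3 * (K + 4) + 4 * (K + 2)) / real n"
        using elim by (intro div_real_half_le) auto
      then show ?case using main[OF elim] unfolding e_def by linarith
    qed
  qed auto
  have sq: "S n \<omega> * S n \<omega> = 1 / real (n div 2) * (1 / real (n div 2)) *
     (\<Sum>i=1..n div 2. \<Sum>j=1..n div 2. (dft_power n (int i) \<omega>)\<^sup>2 / (F n i)\<^sup>2 * ((dft_power n (int j) \<omega>)\<^sup>2 / (F n j)\<^sup>2))" for \<omega>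
    unfolding eq sum_product[symmetric] by (simp only: mult_ac)
  have "integrable M (\<lambda>\<omega>. S n \<omega> * S n \<omega> - 4 * S n \<omega> + 4)"
    unfolding sq unfolding eq prod
    by (intro Bochner_Integration.integrable_add Bochner_Integration.integrable_diff integrable_mult_right
         Bochner_Integration.integrable_sum integrable_const integrable_divide integrable_dft_power2 integrable_dft_power22)
  then show "integrable M (\<lambda>\<omega>. (1 / real (n div 2) * (\<Sum>j=1..n div 2. (raw_resid n (\<lambda>t. X t \<omega>) sd j)\<^sup>2) - 2)\<^sup>2)"
    unfolding S_def[symmetric] by (simp add: power2_eq_square algebra_simps)
qed

text \<open>A bound is enough here, and the crude bound on moments of eight transforms allows the
  two frequencies to coincide, so all ordinates are covered, the one at pi included.\<close>

lemma mean_fourth_resid_bounded: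
  shows "integrable M (\<lambda>\<omega>. 1 / real (n div 2) * (\<Sum>j=1..n div 2. (raw_resid n (\<lambda>t. X t \<omega>) sd j) ^ 4))"
    and "\<exists>K. \<forall>n\<ge>2. expectation (\<lambda>\<omega>. 1 / real (n div 2) * (\<Sum>j=1..n div 2. (raw_resid n (\<lambda>t. X t \<omega>) sd j) ^ 4)) \<le> K"
proof -
  have eq: "(raw_resid n (\<lambda>t. X t \<omega>) sd j) ^ 4 =
      (dft_power n (int j) \<omega>)\<^sup>2 * (dft_power n (int j) \<omega>)\<^sup>2 / ((F n j)\<^sup>2 * (F n j)\<^sup>2)" for n j \<omega>
    by (simp add: raw_resid_eq power_divide power4_eq_xxxx power2_eq_square)
  have int: "integrable M (\<lambda>\<omega>. (raw_resid n (\<lambda>t. X t \<omega>) sd j) ^ 4)" for n j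
    unfolding eq by (intro integrable_divide integrable_dft_power22)
  show "integrable M (\<lambda>\<omega>. 1 / real (n div 2) * (\<Sum>j=1..n div 2. (raw_resid n (\<lambda>t. X t \<omega>) sd j) ^ 4))" for n
    by (intro integrable_mult_right Bochner_Integration.integrable_sum int)
  have "expectation (\<lambda>\<omega>. 1 / real (n div 2) * (\<Sum>j=1..n div 2. (raw_resid n (\<lambda>t. X t \<omega>) sd j) ^ 4)) \<le> dft_moment_bound * cF"
    if n: "n \<ge> 2" for n
  proof -
    have n1: "n \<ge> 1" using n by simp
    have le: "expectation (\<lambda>\<omega>. (raw_resid n (\<lambda>t. X t \<omega>) sd j) ^ 4) \<le> dft_moment_bound * cF" if j: "j \<in> {1..n div 2}" for j
    proof -
      have sqpos: "(F n j)\<^sup>2 > 0" using F_pos[OF j] by simp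
      show ?thesis unfolding eq
        using scaled_bound[OF dft_power_moments_bounded(4)[OF n1] mult_pos_pos[OF sqpos sqpos] inverse_F_le(4)[OF j j], of "int j" "int j"]
        by simp
    qed
    have "expectation (\<lambda>\<omega>. 1 / real (n div 2) * (\<Sum>j=1..n div 2. (raw_resid n (\<lambda>t. X t \<omega>) sd j) ^ 4)) =
        1 / real (n div 2) * (\<Sum>j=1..n div 2. expectation (\<lambda>\<omega>. (raw_resid n (\<lambda>t. X t \<omega>) sd j) ^ 4))"
      using int by (simp add: Bochner_Integration.integral_sum)
    also have "\<dots> \<le> 1 / real (n div 2) * (\<Sum>j=1..n div 2. dft_moment_bound * cF)"
      using le by (intro mult_left_mono sum_mono) auto
    also have "\<dots> = dft_moment_bound * cF" using n by simp
    finally show ?thesis .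
  qed
  then show "\<exists>K. \<forall>n\<ge>2. expectation (\<lambda>\<omega>. 1 / real (n div 2) * (\<Sum>j=1..n div 2. (raw_resid n (\<lambda>t. X t \<omega>) sd j) ^ 4)) \<le> K"
    by blast
qed

end

end

section \<open>Kernel sums over the Fourier frequencies\<close>

abbreviation fourier_idx :: "nat \<Rightarrow> int set" where
  "fourier_idx n \<equiv> {- ((int n - 1) div 2)..int n div 2}"

lemma sum_cis_fourier_idx:
  assumes "n > 0"
  shows "(\<Sum>j\<in>fourier_idx n. cis (of_int v * fourier_freq n j)) = (if int n dvd v then of_nat n else 0)"
proof -
  \<comment> \<open>The indices are the \<open>n\<close> consecutive integers s + 1, ..., s +
    n.\<close>
  define s where "s = - ((int n - 1) div 2) - 1"
  have top: "int n div 2 = s + int n" unfolding s_def by presburger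
  have "(\<Sum>j\<in>fourier_idx n. cis (of_int v * fourier_freq n j)) = (\<Sum>j\<in>fourier_idx n. cis (of_int j * fourier_freq n v))"
    by (intro sum.cong refl arg_cong[where f=cis]) (simp add: fourier_freq_def)
  also have "\<dots> = (\<Sum>t=1..int n. cis (of_int (t + s) * fourier_freq n v))"
    by (rule sum.reindex_bij_witness[where i="\<lambda>t. t + s" and j="\<lambda>j. j - s"]) (auto simp: top, auto simp: s_def)
  also have "\<dots> = cis (of_int s * fourier_freq n v) * (\<Sum>t=1..int n. cis (of_int t * fourier_freq n v))"
    unfolding sum_distrib_left by (intro sum.cong) (auto simp: cis_mult algebra_simps)
  also have "\<dots> = (if int n dvd v then of_nat n else 0)"
  proof (cases "int n dvd v")
    case True
    then obtain q where q: "v = int n * q" by (auto elim: dvdE)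
    then have "of_int s * fourier_freq n v = 2 * pi * of_int (s * q)"
      using assms by (simp add: fourier_freq_def)
    then have "cis (of_int s * fourier_freq n v) = 1" by (simp only: cis_multiple_2pi Ints_of_int)
    then show ?thesis using True assms by (simp add: sum_cis_fourier)
  next
    case False
    then show ?thesis using assms by (simp add: sum_cis_fourier)
  qed
  finally show ?thesis .
qed

text \<open>By \<open>close\<close> no two different frequencies are congruent modulo
  \<open>n\<close>, so there is no aliasing and only the diagonal survives the sum over the
  grid.\<close>

lemma fourier_orthogonality:
  fixes \<alpha> \<beta> :: "int \<Rightarrow> complex"
  assumes "finite P" "finite Q" and n: "n > 0"
    and close: "\<And>k l. k \<in> P \<Longrightarrow> l \<in> Q \<Longrightarrow> \<bar>k - l\<bar> < int n"
  shows "(\<Sum>j\<in>fourier_idx n. (\<Sum>k\<in>P. \<alpha> k * cis (of_int k * fourier_freq n j)) *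
            (\<Sum>l\<in>Q. \<beta> l * cis (- of_int l * fourier_freq n j)))
     = of_nat n * (\<Sum>k\<in>P \<inter> Q. \<alpha> k * \<beta> k)"
proof -
  have "(\<Sum>j\<in>fourier_idx n. (\<Sum>k\<in>P. \<alpha> k * cis (of_int k * fourier_freq n j)) *
            (\<Sum>l\<in>Q. \<beta> l * cis (- of_int l * fourier_freq n j))) =
     (\<Sum>j\<in>fourier_idx n. \<Sum>k\<in>P. \<Sum>l\<in>Q. \<alpha> k * \<beta> l * cis (of_int (k - l) * fourier_freq n j))"
    unfolding sum_product
    by (intro sum.cong refl) (simp add: cis_mult algebra_simps)
  also have "\<dots> = (\<Sum>k\<in>P. \<Sum>l\<in>Q. \<Sum>j\<in>fourier_idx n. \<alpha> k * \<beta> l * cis (of_int (k - l) * fourier_freq n j))"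
    unfolding sum.swap[of _ _ "fourier_idx n"] ..
  also have "\<dots> = (\<Sum>k\<in>P. \<Sum>l\<in>Q. if k = l then of_nat n * (\<alpha> k * \<beta> k) else 0)"
  proof (intro sum.cong refl)
    fix k l assume kl: "k \<in> P" "l \<in> Q"
    have "int n dvd k - l \<longleftrightarrow> k = l"
      using close[OF kl] n zdvd_imp_le[of "int n" "\<bar>k - l\<bar>"] by auto
    then show "(\<Sum>j\<in>fourier_idx n. \<alpha> k * \<beta> l * cis (of_int (k - l) * fourier_freq n j)) =
        (if k = l then of_nat n * (\<alpha> k * \<beta> k) else 0)"
      unfolding sum_distrib_left[symmetric] sum_cis_fourier_idx[OF n] by simp
  qed
  also have "\<dots> = (\<Sum>k\<in>P. if k \<in> Q then of_nat n * (\<alpha> k * \<beta> k) else 0)"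
    using assms by (intro sum.cong refl) (simp add: sum.delta)
  also have "\<dots> = of_nat n * (\<Sum>k\<in>P \<inter> Q. \<alpha> k * \<beta> k)"
    using assms by (simp add: sum.inter_restrict sum_distrib_left if_distrib cong: if_cong)
  finally show ?thesis .
qed

definition lag_kernel :: "(real \<Rightarrow> real) \<Rightarrow> nat \<Rightarrow> real \<Rightarrow> real" where
  "lag_kernel a m u = (\<Sum>k=- int m..int m. a (of_int k * bandwidth m) * cos (of_int k * u))"

lemma lag_kernel_minus: "lag_kernel a m (- u) = lag_kernel a m u"
  by (simp add: lag_kernel_def)

text \<open>The mean value theorem for an antiderivative gives an error of at most L / m^2 on each
  of the \<open>2 * m\<close> cells. Left endpoints are used, and the extra term k = m is zero
  because \<open>h 1 = 0\<close>.\<close>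

lemma riemann_sum_lipschitz:
  fixes h :: "real \<Rightarrow> real"
  assumes lip: "\<And>s t. \<bar>h s - h t\<bar> \<le> L * \<bar>s - t\<bar>" and m: "m > 0" and zero: "h 1 = 0"
  shows "\<bar>bandwidth m * (\<Sum>k=- int m..int m. h (of_int k * bandwidth m)) - (LBINT t:{-1..1}. h t)\<bar>
     \<le> 2 * L * bandwidth m"
proof -
  have L: "L \<ge> 0" using lip[of 0 1] by simp
  have cont: "continuous_on UNIV h"
  proof (rule lipschitz_on_continuous_on)
    show "L-lipschitz_on UNIV h" by (rule lipschitz_onI) (auto simp: dist_real_def lip L)
  qed
  then have cont': "continuous_on S h" for S by (rule continuous_on_subset) auto
  \<comment> \<open>Starting at -2 makes both -1 and 1 interior points, where \<open>H\<close> is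
    differentiable in the ordinary sense.\<close>
  define H where "H x = integral {-2..x} h" for x
  have deriv: "DERIV H x :> h x" if "x \<in> {-1..1}" for x
  proof -
    have "(H has_real_derivative h x) (at x within {-2..2})"
      unfolding H_def using that by (intro integral_has_real_derivative cont') auto
    then show ?thesis using that by (subst (asm) at_within_interior) auto
  qed
  have H: "(LBINT t:{-1..1}. h t) = H 1 - H (-1)"
  proof -
    have "(LBINT t:{-1..1}. h t) = integral {-1..1} h"
      by (intro set_borel_integral_eq_integral borel_integrable_atLeastAtMost') (rule cont')
    also have "\<dots> = H 1 - H (-1)"
      by (intro integral_unique fundamental_theorem_of_calculus)
         (use deriv in \<open>auto simp: has_real_derivative_iff_has_vector_derivative[symmetric] intro: has_field_derivative_at_within\<close>)
    finally show ?thesis .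
  qed
  define b where "b = bandwidth m"
  have b: "b > 0" "real m * b = 1" using m by (auto simp: b_def)
  have step: "\<bar>b * h (of_int k * b) - (H (of_int (k + 1) * b) - H (of_int k * b))\<bar> \<le> L * b\<^sup>2"
    if k: "k \<in> {- int m..<int m}" for k
  proof -
    have lo: "-1 \<le> of_int k * b"
    proof -
      have "- real m \<le> of_int k" using k by (metis atLeastLessThan_iff of_int_le_iff of_int_minus of_int_of_nat_eq)
      then have "- real m * b \<le> of_int k * b" using b by (intro mult_right_mono) auto
      then show ?thesis using b by simp
    qed
    have hi: "of_int (k + 1) * b \<le> 1"
    proof -
      have "k + 1 \<le> int m" using k by auto
      then have "of_int (k + 1) \<le> real m" by linarith
      then have "of_int (k + 1) * b \<le> real m * b" using b by (intro mult_right_mono) auto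
      then show ?thesis using b by simp
    qed
    have lt: "of_int k * b < of_int (k + 1) * b" using b by simp
    obtain z where z: "of_int k * b < z" "z < of_int (k + 1) * b"
      "H (of_int (k + 1) * b) - H (of_int k * b) = (of_int (k + 1) * b - of_int k * b) * h z"
      using MVT2[OF lt, of H h] deriv lo hi by force
    have "b * h (of_int k * b) - (H (of_int (k + 1) * b) - H (of_int k * b)) = b * (h (of_int k * b) - h z)"
      unfolding z(3) by (simp add: algebra_simps)
    also have "\<bar>\<dots>\<bar> \<le> b * (L * \<bar>of_int k * b - z\<bar>)"
      using lip b by (simp add: abs_mult)
    also have "\<dots> \<le> b * (L * b)"
      using z(1,2) b L by (intro mult_left_mono) (auto simp: algebra_simps)
    finally show ?thesis by (simp add: power2_eq_square mult_ac)
  qed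
  have tele: "(\<Sum>k\<in>{- int m..<int m}. H (of_int (k + 1) * b) - H (of_int k * b)) = H 1 - H (-1)"
  proof -
    have "(\<Sum>k\<in>{- int m..<int m}. H (of_int (k + 1) * b) - H (of_int k * b)) =
       (\<Sum>i<2 * m. H (of_int (int (Suc i) - int m) * b) - H (of_int (int i - int m) * b))"
      by (rule sum.reindex_bij_witness[where i="\<lambda>i. int i - int m" and j="\<lambda>k. nat (k + int m)"]) (auto simp: algebra_simps)
    also have "\<dots> = H (of_int (int (2 * m) - int m) * b) - H (of_int (int 0 - int m) * b)"
      by (rule sum_lessThan_telescope)
    also have "\<dots> = H 1 - H (-1)" using b by simp
    finally show ?thesis .
  qed
  have split: "{- int m..int m} = insert (int m) {- int m..<int m}" by auto
  have "b * (\<Sum>k=- int m..int m. h (of_int k * b)) = (\<Sum>k\<in>{- int m..<int m}. b * h (of_int k * b))"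
    unfolding split using b zero by (simp add: sum_distrib_left)
  then have "b * (\<Sum>k=- int m..int m. h (of_int k * b)) - (LBINT t:{-1..1}. h t) =
      (\<Sum>k\<in>{- int m..<int m}. b * h (of_int k * b) - (H (of_int (k + 1) * b) - H (of_int k * b)))"
    unfolding H tele[symmetric] by (simp add: sum_subtractf)
  also have "\<bar>\<dots>\<bar> \<le> (\<Sum>k\<in>{- int m..<int m}. L * b\<^sup>2)"
    by (rule order_trans[OF sum_abs sum_mono]) (rule step)
  also have "\<dots> = 2 * L * b * (real m * b)" by (simp add: power2_eq_square)
  finally show ?thesis using b by (simp add: b_def)
qed

text \<open>Multiplying by 1 - cis w replaces coefficients by their differences. The range grows by
  one, and no boundary term remains because \<open>h\<close> vanishes outside the open
  interval.\<close>

lemma abel_summation: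
  fixes h :: "real \<Rightarrow> real"
  assumes m: "m > 0" and zero: "\<And>t. \<bar>t\<bar> \<ge> 1 \<Longrightarrow> h t = 0"
  shows "(1 - cis w) * (\<Sum>k=- int m..int m. of_real (h (of_int k * bandwidth m)) * cis (of_int k * w)) =
    (\<Sum>k=- int m..int m + 1. of_real (h (of_int k * bandwidth m) - h (of_int (k - 1) * bandwidth m)) * cis (of_int k * w))"
proof -
  define b where "b = bandwidth m"
  have b: "b > 0" "real m * b = 1" using m by (auto simp: b_def)
  define S where "S = (\<Sum>k=- int m..int m. of_real (h (of_int k * b)) * cis (of_int k * w))"
  have out: "h (of_int k * b) = 0" if "\<bar>k\<bar> \<ge> int m" for k
  proof (rule zero)
    have "real m \<le> \<bar>of_int k\<bar>" using that by (metis of_int_abs of_int_le_iff of_int_of_nat_eq)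
    then have "real m * b \<le> \<bar>of_int k\<bar> * b" using b by (intro mult_right_mono) auto
    then show "1 \<le> \<bar>of_int k * b\<bar>" using b by (simp add: abs_mult)
  qed
  have S: "S = (\<Sum>k=- int m..int m + 1. of_real (h (of_int k * b)) * cis (of_int k * w))"
    unfolding S_def by (rule sum.mono_neutral_left) (auto simp: out)
  have "cis w * S = (\<Sum>k=- int m..int m. of_real (h (of_int k * b)) * cis (of_int (k + 1) * w))"
    unfolding S_def sum_distrib_left by (intro sum.cong) (auto simp: cis_mult algebra_simps)
  also have "\<dots> = (\<Sum>k=- int m + 1..int m + 1. of_real (h (of_int (k - 1) * b)) * cis (of_int k * w))"
    by (rule sum.reindex_bij_witness[where i="\<lambda>k. k - 1" and j="\<lambda>k. k + 1"]) auto
  also have "\<dots> = (\<Sum>k=- int m..int m + 1. of_real (h (of_int (k - 1) * b)) * cis (of_int k * w))"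
    by (rule sum.mono_neutral_left) (auto simp del: of_int_diff intro!: out)
  finally show ?thesis
    using S by (simp add: left_diff_distrib sum_subtractf S_def b_def)
qed

text \<open>After summation by parts there are \<open>2 * m + 2\<close> differences of size at most
  L / m, so the bound does not grow with \<open>m\<close>.\<close>

lemma oscillating_sum_bound:
  fixes h :: "real \<Rightarrow> real"
  assumes lip: "\<And>s t. \<bar>h s - h t\<bar> \<le> L * \<bar>s - t\<bar>" and m: "m > 0" and zero: "\<And>t. \<bar>t\<bar> \<ge> 1 \<Longrightarrow> h t = 0"
  shows "cmod (1 - cis w) * \<bar>\<Sum>k=- int m..int m. h (of_int k * bandwidth m) * cos (of_int k * w)\<bar> \<le> 4 * L"
proof -
  have L: "L \<ge> 0" using lip[of 0 1] by simp
  define b where "b = bandwidth m"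
  have b: "b > 0" "real m * b = 1" using m by (auto simp: b_def)
  define S where "S = (\<Sum>k=- int m..int m. of_real (h (of_int k * b)) * cis (of_int k * w))"
  have "(1 - cis w) * S = (\<Sum>k=- int m..int m + 1. of_real (h (of_int k * b) - h (of_int (k - 1) * b)) * cis (of_int k * w))"
    unfolding S_def b_def by (rule abel_summation[OF m zero])
  also have "norm \<dots> \<le> (\<Sum>k=- int m..int m + 1. L * b)"
  proof (rule sum_norm_le)
    fix k
    have "\<bar>h (of_int k * b) - h (of_int (k - 1) * b)\<bar> \<le> L * \<bar>of_int k * b - of_int (k - 1) * b\<bar>" by (rule lip)
    also have "of_int k * b - of_int (k - 1) * b = b" by (simp add: algebra_simps)
    finally show "norm (of_real (h (of_int k * b) - h (of_int (k - 1) * b)) * cis (of_int k * w)) \<le> L * b"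
      using b by (simp add: norm_mult del: of_real_diff)
  qed
  also have "\<dots> = L * (2 * (real m * b) + 2 * b)" by (simp add: algebra_simps)
  also have "\<dots> \<le> L * 4" using b L m by (intro mult_left_mono) (auto simp: b_def divide_le_eq)
  finally have 1: "cmod (1 - cis w) * cmod S \<le> 4 * L" by (simp add: norm_mult)
  have 2: "(\<Sum>k=- int m..int m. h (of_int k * bandwidth m) * cos (of_int k * w)) = Re S"
    by (simp add: S_def b_def)
  have "cmod (1 - cis w) * \<bar>Re S\<bar> \<le> cmod (1 - cis w) * cmod S"
    by (intro mult_left_mono abs_Re_le_cmod) auto
  then show ?thesis unfolding 2 using 1 by linarith
qed

section \<open>Parseval identities for the kernel of the lag window\<close>

locale lag_window =
  fixes a :: "real \<Rightarrow> real" and L :: real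
  assumes even: "\<And>t. a (- t) = a t" and lipschitz: "L-lipschitz_on UNIV a"
    and support: "closure {t. a t \<noteq> 0} = {-1..1}" and at_0: "a 0 = 1"
begin

lemma lip: "\<bar>a s - a t\<bar> \<le> L * \<bar>s - t\<bar>"
  using lipschitz_onD[OF lipschitz, of s t] by (simp add: dist_real_def)

lemma L_nonneg: "L \<ge> 0"
  using lipschitz by (rule lipschitz_on_nonneg)

text \<open>The set of non-zeros is open and contained in the closed interval, hence in its
  interior; so \<open>a\<close> vanishes at the endpoints as well.\<close>

lemma zero: assumes "\<bar>t\<bar> \<ge> 1" shows "a t = 0"
proof -
  have "open {t. a t \<noteq> 0}"
    using lipschitz_on_continuous_on[OF lipschitz] by (intro open_Collect_neq) auto
  moreover have "{t. a t \<noteq> 0} \<subseteq> {-1..1}"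
    using closure_subset[of "{t. a t \<noteq> 0}"] unfolding support .
  ultimately have "{t. a t \<noteq> 0} \<subseteq> interior {-1..1}" by (intro interior_maximal)
  then show ?thesis using assms by fastforce
qed

lemma bound: "\<bar>a t\<bar> \<le> 1 + L"
proof (cases "\<bar>t\<bar> \<ge> 1")
  case True
  then show ?thesis using zero[of t] L_nonneg by simp
next
  case False
  then have "L * \<bar>t\<bar> \<le> L * 1" using L_nonneg by (intro mult_left_mono) auto
  then show ?thesis using lip[of t 0] at_0 by auto
qed

lemma square_lip: "\<bar>(a s)\<^sup>2 - (a t)\<^sup>2\<bar> \<le> (2 * (1 + L) * L) * \<bar>s - t\<bar>"
proof -
  have "(a s)\<^sup>2 - (a t)\<^sup>2 = (a s + a t) * (a s - a t)" by (simp add: power2_eq_square algebra_simps)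
  then have "\<bar>(a s)\<^sup>2 - (a t)\<^sup>2\<bar> = \<bar>a s + a t\<bar> * \<bar>a s - a t\<bar>" by (simp add: abs_mult)
  also have "\<dots> \<le> (2 * (1 + L)) * (L * \<bar>s - t\<bar>)"
    using bound[of s] bound[of t] lip[of s t] L_nonneg by (intro mult_mono) auto
  finally show ?thesis by (simp add: mult_ac)
qed

lemma square_bound: "(a t)\<^sup>2 \<le> (1 + L)\<^sup>2"
  using power_mono[OF bound[of t], of 2] by simp

abbreviation K :: "nat \<Rightarrow> real \<Rightarrow> real" where "K \<equiv> lag_kernel a"

lemma of_real_kernel:
  "complex_of_real (K m u) = (\<Sum>k=- int m..int m. of_real (a (of_int k * bandwidth m)) * cis (of_int k * u))"
proof -
  have "Im (\<Sum>k=- int m..int m. of_real (a (of_int k * bandwidth m)) * cis (- of_int k * (- u))) = 0"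
    by (rule Im_symmetric_sum_eq_0[where c="\<lambda>k. a (of_int k * bandwidth m)"])
       (use even[of "of_int k * bandwidth m" for k] in simp)
  then show ?thesis by (simp add: complex_eq_iff lag_kernel_def)
qed

lemma abs_kernel_le: "m > 0 \<Longrightarrow> \<bar>K m u\<bar> \<le> 3 * (1 + L) * real m"
proof -
  assume m: "m > 0"
  have "\<bar>K m u\<bar> \<le> (\<Sum>k=- int m..int m. (1 + L) * 1)"
    unfolding lag_kernel_def
    by (rule order_trans[OF sum_abs sum_mono], unfold abs_mult) (intro mult_mono bound, use L_nonneg in auto)
  also have "\<dots> = (1 + L) * (2 * real m + 1)" by simp
  also have "\<dots> \<le> (1 + L) * (3 * real m)" using m L_nonneg by (intro mult_left_mono) auto
  finally show ?thesis by (simp add: mult_ac)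
qed

text \<open>Parseval on the Fourier grid. Since the kernel is even, each factor can be expanded with
  either sign of the grid frequency, as orthogonality demands. In the square the phases of
  \<open>l\<close> cancel; in the cross term they add up to 2 l.\<close>

lemma
  fixes l :: real
  assumes mn: "2 * m < n"
  shows sum_kernel_square: "(\<Sum>j\<in>fourier_idx n. (K m (l - fourier_freq n j))\<^sup>2) =
      real n * (\<Sum>k=- int m..int m. (a (of_int k * bandwidth m))\<^sup>2)"
    and sum_kernel_cross: "(\<Sum>j\<in>fourier_idx n. K m (l - fourier_freq n j) * K m (l + fourier_freq n j)) =
      real n * (\<Sum>k=- int m..int m. (a (of_int k * bandwidth m))\<^sup>2 * cos (of_int k * (2 * l)))"
proof -
  define c where "c k = complex_of_real (a (of_int k * bandwidth m))" for k :: int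
  have cc: "cis (of_int k * u) * cis (of_int k * w) = cis (of_int k * (u + w))"
    "cis (- of_int k * u) * cis (of_int k * w) = cis (of_int k * (w - u))"
    "cis (of_int k * u) * cis (- of_int k * w) = cis (of_int k * (u - w))"
    for k :: int and u w
    unfolding cis_mult by (intro arg_cong[where f=cis], simp add: algebra_simps)+
  have 1: "complex_of_real (K m (l - w)) = (\<Sum>k=- int m..int m. (c k * cis (- of_int k * l)) * cis (of_int k * w))" for l w
  proof -
    have "K m (l - w) = K m (w - l)" using lag_kernel_minus[of a m "w - l"] by simp
    then show ?thesis unfolding c_def mult.assoc cc by (simp only: of_real_kernel)
  qed
  have 2: "complex_of_real (K m (l - w)) = (\<Sum>k=- int m..int m. (c k * cis (of_int k * l)) * cis (- of_int k * w))" for l w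
    unfolding c_def mult.assoc cc by (simp only: of_real_kernel)
  have 3: "complex_of_real (K m (l + w)) = (\<Sum>k=- int m..int m. (c k * cis (- of_int k * l)) * cis (- of_int k * w))" for l w
  proof -
    have "K m (l + w) = K m (- l - w)" using lag_kernel_minus[of a m "l + w"] by simp
    then show ?thesis using 2[of "- l" w] by simp
  qed
  note 12 = arg_cong2[where f="(*)", OF 1 2, of l _ l]
  note 13 = arg_cong2[where f="(*)", OF 1 3, of l _ l]
  have close: "\<bar>k - k'\<bar> < int n" if "k \<in> {- int m..int m}" "k' \<in> {- int m..int m}" for k k'
    using that mn by auto
  have n: "n > 0" using mn by simp
  have "complex_of_real (\<Sum>j\<in>fourier_idx n. (K m (l - fourier_freq n j))\<^sup>2) =
      of_nat n * (\<Sum>k\<in>{- int m..int m} \<inter> {- int m..int m}. (c k * cis (- of_int k * l)) * (c k * cis (of_int k * l)))"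
    unfolding of_real_sum power2_eq_square of_real_mult
    unfolding 12 by (rule fourier_orthogonality[OF _ _ n close]) auto
  also have "\<dots> = complex_of_real (real n * (\<Sum>k=- int m..int m. (a (of_int k * bandwidth m))\<^sup>2))"
  proof -
    have "(c k * cis (- of_int k * l)) * (c k * cis (of_int k * l)) = of_real ((a (of_int k * bandwidth m))\<^sup>2)" for k
    proof -
      have "(c k * cis (- of_int k * l)) * (c k * cis (of_int k * l)) = c k * c k * (cis (- of_int k * l) * cis (of_int k * l))"
        by (simp only: mult_ac)
      then show ?thesis by (simp add: cis_mult c_def power2_eq_square)
    qed
    then show ?thesis by simp
  qed
  finally show "(\<Sum>j\<in>fourier_idx n. (K m (l - fourier_freq n j))\<^sup>2) =
      real n * (\<Sum>k=- int m..int m. (a (of_int k * bandwidth m))\<^sup>2)"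
    by (simp only: of_real_eq_iff)
  have "complex_of_real (\<Sum>j\<in>fourier_idx n. K m (l - fourier_freq n j) * K m (l + fourier_freq n j)) =
      of_nat n * (\<Sum>k\<in>{- int m..int m} \<inter> {- int m..int m}. (c k * cis (- of_int k * l)) * (c k * cis (- of_int k * l)))"
    unfolding of_real_sum power2_eq_square of_real_mult
    unfolding 13 by (rule fourier_orthogonality[OF _ _ n close]) auto
  also have "\<dots> = of_nat n * (\<Sum>k=- int m..int m. of_real ((a (of_int k * bandwidth m))\<^sup>2) * cis (- of_int k * (2 * l)))"
  proof -
    have "(c k * cis (- of_int k * l)) * (c k * cis (- of_int k * l)) = of_real ((a (of_int k * bandwidth m))\<^sup>2) * cis (- of_int k * (2 * l))" for k
    proof -
      have "(c k * cis (- of_int k * l)) * (c k * cis (- of_int k * l)) = c k * c k * (cis (- of_int k * l) * cis (- of_int k * l))"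
        by (simp only: mult_ac)
      also have "cis (- of_int k * l) * cis (- of_int k * l) = cis (- of_int k * (2 * l))"
        unfolding cis_mult by (rule arg_cong[where f=cis]) simp
      finally show ?thesis by (simp add: c_def power2_eq_square)
    qed
    then show ?thesis by simp
  qed
  finally have "Re (complex_of_real (\<Sum>j\<in>fourier_idx n. K m (l - fourier_freq n j) * K m (l + fourier_freq n j))) =
      Re (of_nat n * (\<Sum>k=- int m..int m. of_real ((a (of_int k * bandwidth m))\<^sup>2) * cis (- of_int k * (2 * l))))" by simp
  also have "\<dots> = real n * (\<Sum>k=- int m..int m. (a (of_int k * bandwidth m))\<^sup>2 * cos (of_int k * (2 * l)))"
    by (simp flip: of_real_power)
  finally show "(\<Sum>j\<in>fourier_idx n. K m (l - fourier_freq n j) * K m (l + fourier_freq n j)) =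
      real n * (\<Sum>k=- int m..int m. (a (of_int k * bandwidth m))\<^sup>2 * cos (of_int k * (2 * l)))" by simp
qed

text \<open>The distance between \<open>cis l\<close> and \<open>cis w\<close> is the modulus of the
  multiplier in summation by parts. Parseval then applies to differences of the window, each at most
  L / m; their range is longer by one, hence \<open>2 * m + 1 < n\<close>.\<close>

lemma sum_kernel_localised:
  assumes m: "m > 0" and mn: "2 * m + 1 < n"
  shows "(\<Sum>j\<in>fourier_idx n. (cmod (cis l - cis (fourier_freq n j)) * K m (l - fourier_freq n j))\<^sup>2) \<le> real n * (4 * L\<^sup>2 * bandwidth m)"
proof -
  define b where "b = bandwidth m"
  have b: "b > 0" "real m * b = 1" "b \<le> 1" using m by (auto simp: b_def)
  define \<delta> where "\<delta> k = complex_of_real (a (of_int k * b) - a (of_int (k - 1) * b))" for k :: int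
  define T where "T w = (\<Sum>k=- int m..int m + 1. (\<delta> k * cis (- of_int k * l)) * cis (of_int k * w))" for w
  have T: "T w = (1 - cis (w - l)) * of_real (K m (l - w))" for w
  proof -
    have "K m (l - w) = K m (w - l)" using lag_kernel_minus[of a m "w - l"] by simp
    then have "(1 - cis (w - l)) * of_real (K m (l - w)) =
      (\<Sum>k=- int m..int m + 1. \<delta> k * cis (of_int k * (w - l)))"
      using abel_summation[OF m zero, where w="w - l"] by (simp add: of_real_kernel \<delta>_def b_def)
    also have "\<dots> = T w" unfolding T_def
      by (intro sum.cong refl) (simp add: cis_mult algebra_simps)
    finally show ?thesis by simp
  qed
  have cnjT: "cnj (T w) = (\<Sum>k=- int m..int m + 1. (\<delta> k * cis (of_int k * l)) * cis (- of_int k * w))" for w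
    unfolding T_def by (simp add: cis_cnj \<delta>_def)
  have cm: "cmod (cis l - cis w) = cmod (1 - cis (w - l))" for w
  proof -
    have "cis l - cis w = cis l * (1 - cis (w - l))" by (simp add: right_diff_distrib cis_mult)
    then show ?thesis by (simp add: norm_mult)
  qed
  have sq: "complex_of_real ((cmod (cis l - cis w) * K m (l - w))\<^sup>2) = T w * cnj (T w)" for w
  proof -
    have "(cmod (cis l - cis w) * K m (l - w))\<^sup>2 = (cmod (T w))\<^sup>2"
      unfolding T cm norm_mult norm_of_real by (simp add: power_mult_distrib)
    then show ?thesis by (simp only: complex_norm_square)
  qed
  have close: "\<bar>k - k'\<bar> < int n" if "k \<in> {- int m..int m + 1}" "k' \<in> {- int m..int m + 1}" for k k'
    using that mn by auto
  have n: "n > 0" using mn by simp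
  have "complex_of_real (\<Sum>j\<in>fourier_idx n. (cmod (cis l - cis (fourier_freq n j)) * K m (l - fourier_freq n j))\<^sup>2) =
     of_nat n * (\<Sum>k\<in>{- int m..int m + 1} \<inter> {- int m..int m + 1}. (\<delta> k * cis (- of_int k * l)) * (\<delta> k * cis (of_int k * l)))"
    unfolding of_real_sum sq cnjT
    unfolding T_def by (rule fourier_orthogonality[OF _ _ n close]) auto
  also have "\<dots> = complex_of_real (real n * (\<Sum>k=- int m..int m + 1. (a (of_int k * b) - a (of_int (k - 1) * b))\<^sup>2))"
  proof -
    have "(\<delta> k * cis (- of_int k * l)) * (\<delta> k * cis (of_int k * l)) = of_real ((a (of_int k * b) - a (of_int (k - 1) * b))\<^sup>2)" for k
    proof -
      have "(\<delta> k * cis (- of_int k * l)) * (\<delta> k * cis (of_int k * l)) = \<delta> k * \<delta> k * (cis (- of_int k * l) * cis (of_int k * l))"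
        by (simp only: mult_ac)
      then show ?thesis by (simp add: cis_mult \<delta>_def power2_eq_square)
    qed
    then show ?thesis by simp
  qed
  finally have "(\<Sum>j\<in>fourier_idx n. (cmod (cis l - cis (fourier_freq n j)) * K m (l - fourier_freq n j))\<^sup>2) =
      real n * (\<Sum>k=- int m..int m + 1. (a (of_int k * b) - a (of_int (k - 1) * b))\<^sup>2)"
    by (simp only: of_real_eq_iff)
  also have "\<dots> \<le> real n * (\<Sum>k=- int m..int m + 1. (L * b)\<^sup>2)"
  proof (intro mult_left_mono sum_mono)
    fix k
    have "\<bar>a (of_int k * b) - a (of_int (k - 1) * b)\<bar> \<le> L * \<bar>of_int k * b - of_int (k - 1) * b\<bar>" by (rule lip)
    also have "of_int k * b - of_int (k - 1) * b = b" by (simp add: algebra_simps)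
    finally show "(a (of_int k * b) - a (of_int (k - 1) * b))\<^sup>2 \<le> (L * b)\<^sup>2"
      using b power_mono[of "\<bar>a (of_int k * b) - a (of_int (k - 1) * b)\<bar>" "L * b" 2] by simp
  qed auto
  also have "\<dots> = real n * (L\<^sup>2 * b * (2 * (real m * b) + 2 * b))"
    by (simp add: power2_eq_square algebra_simps)
  also have "\<dots> \<le> real n * (L\<^sup>2 * b * 4)" using b by (intro mult_left_mono) auto
  finally show ?thesis by (simp add: b_def mult_ac)
qed

end

context lag_window
begin

text \<open>Opposite frequencies carry the same bootstrap ordinate, so their kernels must be added
  before squaring. The resulting cross term is the source of \<open>eta\<close>.\<close>

definition kernel_sym :: "nat \<Rightarrow> real \<Rightarrow> real \<Rightarrow> real" where
  "kernel_sym m l w = K m (l - w) + K m (l + w)"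

lemma sum_kernel_sym_square:
  assumes mn: "2 * m < n"
  shows "(\<Sum>j\<in>fourier_idx n. (kernel_sym m l (fourier_freq n j))\<^sup>2) =
    2 * real n * (\<Sum>k=- int m..int m. (a (of_int k * bandwidth m))\<^sup>2) +
    2 * real n * (\<Sum>k=- int m..int m. (a (of_int k * bandwidth m))\<^sup>2 * cos (of_int k * (2 * l)))"
proof -
  have "K m (l + w) = K m (- l - w)" for w using lag_kernel_minus[of a m "l + w"] by simp
  then have "(kernel_sym m l w)\<^sup>2 = (K m (l - w))\<^sup>2 + (K m (- l - w))\<^sup>2 + 2 * (K m (l - w) * K m (l + w))" for w
    unfolding kernel_sym_def power2_sum by simp
  then show ?thesis
    using sum_kernel_square[OF mn, of l] sum_kernel_square[OF mn, of "- l"] sum_kernel_cross[OF mn, of l]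
    by (simp add: sum.distrib sum_distrib_left[symmetric] algebra_simps)
qed

text \<open>Replacing the values of \<^term>\<open>g\<close> by the value at \<^term>\<open>l\<close> costs a Lipschitz factor, which
  cancels the singularity of the kernel.\<close>

lemma sum_kernel_sym_freeze:
  assumes m: "m > 0" and mn: "2 * m + 1 < n"
    and g: "\<And>w w'. \<bar>g w - g w'\<bar> \<le> G * cmod (cis w - cis w')" and ev: "\<And>w. g (- w) = g w"
  shows "\<bar>(\<Sum>j\<in>fourier_idx n. g (fourier_freq n j) * (kernel_sym m l (fourier_freq n j))\<^sup>2) -
     g l * (\<Sum>j\<in>fourier_idx n. (kernel_sym m l (fourier_freq n j))\<^sup>2)\<bar> \<le> 2 * real n * G * (4 * L\<^sup>2 + 3 * (1 + L)\<^sup>2)"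
proof -
  define b where "b = bandwidth m"
  have b: "b > 0" "real m * b = 1" using m by (auto simp: b_def)
  have n: "n > 0" using mn by simp
  have G: "G \<ge> 0"
  proof -
    have "cmod (cis 0 - cis pi) = 2" by (simp add: complex_eq_iff cmod_def)
    then show ?thesis using g[of 0 pi] by simp
  qed
  define q where "q l w = cmod (cis l - cis w) * (K m (l - w))\<^sup>2" for l w
  have q: "(\<Sum>j\<in>fourier_idx n. q l (fourier_freq n j)) \<le> real n * (4 * L\<^sup>2 + 3 * (1 + L)\<^sup>2) / 2" for l
  proof -
    have "q l w \<le> (real m * (cmod (cis l - cis w) * K m (l - w))\<^sup>2 + b * (K m (l - w))\<^sup>2) / 2" for w
    proof -
      define c where "c = cmod (cis l - cis w)"
      \<comment> \<open>The first power of the distance has no Parseval identity. This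
        arithmetic-geometric inequality, with equality at c = 1 / m, exchanges it for the square and
        a constant, both of which have one.\<close>
      have "2 * c \<le> real m * c\<^sup>2 + b"
      proof -
        have "0 \<le> b * (real m * c - 1)\<^sup>2" using b by simp
        also have "\<dots> = (real m * b) * (real m * c\<^sup>2) - 2 * (real m * b) * c + b" by (simp add: power2_eq_square algebra_simps)
        finally show ?thesis using b by simp
      qed
      then have "2 * c * (K m (l - w))\<^sup>2 \<le> (real m * c\<^sup>2 + b) * (K m (l - w))\<^sup>2" by (intro mult_right_mono) auto
      then show ?thesis by (simp add: q_def c_def[symmetric] power_mult_distrib algebra_simps)
    qed
    then have "(\<Sum>j\<in>fourier_idx n. q l (fourier_freq n j)) \<le>
      (\<Sum>j\<in>fourier_idx n. (real m * (cmod (cis l - cis (fourier_freq n j)) * K m (l - fourier_freq n j))\<^sup>2 + b * (K m (l - fourier_freq n j))\<^sup>2) / 2)"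
      by (intro sum_mono)
    also have "\<dots> = (real m * (\<Sum>j\<in>fourier_idx n. (cmod (cis l - cis (fourier_freq n j)) * K m (l - fourier_freq n j))\<^sup>2)
        + b * (\<Sum>j\<in>fourier_idx n. (K m (l - fourier_freq n j))\<^sup>2)) / 2"
      by (simp add: sum_divide_distrib[symmetric] sum.distrib sum_distrib_left)
    also have "\<dots> \<le> (real m * (real n * (4 * L\<^sup>2 * b)) + b * (real n * (3 * real m * (1 + L)\<^sup>2))) / 2"
    proof (intro divide_right_mono add_mono mult_left_mono)
      show "(\<Sum>j\<in>fourier_idx n. (cmod (cis l - cis (fourier_freq n j)) * K m (l - fourier_freq n j))\<^sup>2) \<le> real n * (4 * L\<^sup>2 * b)"
        unfolding b_def by (rule sum_kernel_localised[OF m mn])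
      have "(\<Sum>k=- int m..int m. (a (of_int k * bandwidth m))\<^sup>2) \<le> (\<Sum>k=- int m..int m. (1 + L)\<^sup>2)"
        by (intro sum_mono square_bound)
      also have "\<dots> = (2 * real m + 1) * (1 + L)\<^sup>2" by simp
      also have "\<dots> \<le> 3 * real m * (1 + L)\<^sup>2" using m by (intro mult_right_mono) auto
      finally show "(\<Sum>j\<in>fourier_idx n. (K m (l - fourier_freq n j))\<^sup>2) \<le> real n * (3 * real m * (1 + L)\<^sup>2)"
        using mn by (subst sum_kernel_square) (auto intro: mult_left_mono)
    qed (use b in auto)
    also have "\<dots> = (real m * b) * (real n * (4 * L\<^sup>2 + 3 * (1 + L)\<^sup>2)) / 2" by (simp add: algebra_simps)
    finally show ?thesis using b by simp
  qed
  have pt: "\<bar>g w - g l\<bar> * (kernel_sym m l w)\<^sup>2 \<le> 2 * G * (q l w + q (- l) w)" for w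
  proof -
    have K2: "K m (l + w) = K m (- l - w)" using lag_kernel_minus[of a m "l + w"] by simp
    have "(kernel_sym m l w)\<^sup>2 \<le> 2 * (K m (l - w))\<^sup>2 + 2 * (K m (- l - w))\<^sup>2"
      unfolding kernel_sym_def K2[symmetric]
      using sum_squares_bound[of "K m (l - w)" "K m (l + w)"] by (simp add: power2_sum)
    then have "\<bar>g w - g l\<bar> * (kernel_sym m l w)\<^sup>2 \<le> \<bar>g w - g l\<bar> * (2 * (K m (l - w))\<^sup>2 + 2 * (K m (- l - w))\<^sup>2)"
      by (intro mult_left_mono) auto
    also have "\<dots> = 2 * (\<bar>g l - g w\<bar> * (K m (l - w))\<^sup>2) + 2 * (\<bar>g (- l) - g w\<bar> * (K m (- l - w))\<^sup>2)"
      by (simp add: ev abs_minus_commute algebra_simps)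
    also have "\<dots> \<le> 2 * (G * cmod (cis l - cis w) * (K m (l - w))\<^sup>2) + 2 * (G * cmod (cis (- l) - cis w) * (K m (- l - w))\<^sup>2)"
      by (intro add_mono mult_left_mono mult_right_mono g) auto
    finally show ?thesis by (simp add: q_def algebra_simps)
  qed
  have "\<bar>(\<Sum>j\<in>fourier_idx n. g (fourier_freq n j) * (kernel_sym m l (fourier_freq n j))\<^sup>2) -
     g l * (\<Sum>j\<in>fourier_idx n. (kernel_sym m l (fourier_freq n j))\<^sup>2)\<bar> =
     \<bar>\<Sum>j\<in>fourier_idx n. (g (fourier_freq n j) - g l) * (kernel_sym m l (fourier_freq n j))\<^sup>2\<bar>"
    by (simp add: sum_distrib_left sum_subtractf left_diff_distrib)
  also have "\<dots> \<le> (\<Sum>j\<in>fourier_idx n. 2 * G * (q l (fourier_freq n j) + q (- l) (fourier_freq n j)))"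
    by (rule order_trans[OF sum_abs sum_mono]) (simp add: abs_mult pt)
  also have "\<dots> = 2 * G * ((\<Sum>j\<in>fourier_idx n. q l (fourier_freq n j)) + (\<Sum>j\<in>fourier_idx n. q (- l) (fourier_freq n j)))"
    unfolding sum.distrib[symmetric] sum_distrib_left ..
  also have "\<dots> \<le> 2 * G * (real n * (4 * L\<^sup>2 + 3 * (1 + L)\<^sup>2) / 2 + real n * (4 * L\<^sup>2 + 3 * (1 + L)\<^sup>2) / 2)"
    using G by (intro mult_left_mono add_mono q) auto
  finally show ?thesis by (simp add: mult_ac)
qed

lemma bandwidth_tendsto_0:
  assumes "filterlim B at_top sequentially"
  shows "(\<lambda>n. bandwidth (B n)) \<longlonglongrightarrow> 0"
proof -
  have "filterlim (\<lambda>n. real (B n)) at_top sequentially"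
    by (rule filterlim_compose[OF filterlim_real_sequentially assms])
  then show ?thesis
    by (intro tendsto_divide_0[OF tendsto_const] filterlim_at_top_imp_at_infinity)
qed

lemma window_riemann_limit:
  assumes "filterlim B at_top sequentially" "\<And>n. B n > 0"
  shows "(\<lambda>n. bandwidth (B n) * (\<Sum>k=- int (B n)..int (B n). (a (of_int k * bandwidth (B n)))\<^sup>2)) \<longlonglongrightarrow> (LBINT t:{-1..1}. (a t)\<^sup>2)"
proof -
  have "(\<lambda>n. bandwidth (B n) * (\<Sum>k=- int (B n)..int (B n). (a (of_int k * bandwidth (B n)))\<^sup>2) - (LBINT t:{-1..1}. (a t)\<^sup>2)) \<longlonglongrightarrow> 0"
  proof (rule Lim_null_comparison)
    show "\<forall>\<^sub>F n in sequentially. norm (bandwidth (B n) * (\<Sum>k=- int (B n)..int (B n). (a (of_int k * bandwidth (B n)))\<^sup>2) - (LBINT t:{-1..1}. (a t)\<^sup>2))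
        \<le> 2 * (2 * (1 + L) * L) * bandwidth (B n)"
      unfolding real_norm_def using assms(2) zero[of 1]
      by (intro always_eventually allI riemann_sum_lipschitz[where h="\<lambda>t. (a t)\<^sup>2"] square_lip) auto
    show "(\<lambda>n. 2 * (2 * (1 + L) * L) * bandwidth (B n)) \<longlonglongrightarrow> 0"
      using tendsto_mult_left[OF bandwidth_tendsto_0[OF assms(1)], of "2 * (2 * (1 + L) * L)"] by simp
  qed
  then show ?thesis by (simp add: LIM_zero_iff)
qed

text \<open>If 2 l is a multiple of 2 pi, all cosines equal 1 and the sum is a Riemann sum.
  Otherwise the oscillating sum stays bounded, and the bandwidth in front sends it to 0.\<close>

lemma window_cos_limit:
  assumes B: "filterlim B at_top sequentially" "\<And>n. B n > 0"
  shows "(\<lambda>n. bandwidth (B n) * (\<Sum>k=- int (B n)..int (B n). (a (of_int k * bandwidth (B n)))\<^sup>2 * cos (of_int k * (2 * l))))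
    \<longlonglongrightarrow> eta (2 * l) * (LBINT t:{-1..1}. (a t)\<^sup>2)"
proof (cases "\<exists>k::int. 2 * l = 2 * pi * of_int k")
  case True
  then obtain q :: int where q: "2 * l = 2 * pi * of_int q" by blast
  have "cos (of_int k * (2 * l)) = 1" for k :: int
  proof -
    have "cos (of_int k * (2 * l)) = Re (cis (2 * pi * of_int (k * q)))" using q by (simp add: mult_ac)
    also have "\<dots> = 1" by (subst cis_multiple_2pi) auto
    finally show ?thesis .
  qed
  then show ?thesis using window_riemann_limit[OF B] True by (simp add: eta_def)
next
  case False
  define \<theta> where "\<theta> = cmod (1 - cis (2 * l))"
  have "cis (2 * l) \<noteq> 1"
  proof
    assume "cis (2 * l) = 1"
    then have "cos (2 * l) = 1" by (simp add: complex_eq_iff)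
    then obtain q :: int where "2 * l = of_int q * 2 * pi" using iffD1[OF cos_one_2pi_int] by blast
    then show False using False by (auto simp: mult_ac)
  qed
  then have \<theta>: "\<theta> > 0" unfolding \<theta>_def by simp
  have "(\<lambda>n. bandwidth (B n) * (\<Sum>k=- int (B n)..int (B n). (a (of_int k * bandwidth (B n)))\<^sup>2 * cos (of_int k * (2 * l)))) \<longlonglongrightarrow> 0"
  proof (rule Lim_null_comparison)
    show "\<forall>\<^sub>F n in sequentially. norm (bandwidth (B n) * (\<Sum>k=- int (B n)..int (B n). (a (of_int k * bandwidth (B n)))\<^sup>2 * cos (of_int k * (2 * l))))
        \<le> bandwidth (B n) * (4 * (2 * (1 + L) * L) / \<theta>)"
    proof (intro always_eventually allI)
      fix n
      have "\<theta> * \<bar>\<Sum>k=- int (B n)..int (B n). (a (of_int k * bandwidth (B n)))\<^sup>2 * cos (of_int k * (2 * l))\<bar> \<le> 4 * (2 * (1 + L) * L)"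
        unfolding \<theta>_def by (rule oscillating_sum_bound[where h="\<lambda>t. (a t)\<^sup>2"]) (use square_lip B zero in auto)
      then have "\<bar>\<Sum>k=- int (B n)..int (B n). (a (of_int k * bandwidth (B n)))\<^sup>2 * cos (of_int k * (2 * l))\<bar> \<le> 4 * (2 * (1 + L) * L) / \<theta>"
        using \<theta> by (simp add: field_simps)
      then show "norm (bandwidth (B n) * (\<Sum>k=- int (B n)..int (B n). (a (of_int k * bandwidth (B n)))\<^sup>2 * cos (of_int k * (2 * l))))
        \<le> bandwidth (B n) * (4 * (2 * (1 + L) * L) / \<theta>)"
        unfolding real_norm_def abs_mult by (intro mult_mono) auto
    qed
    show "(\<lambda>n. bandwidth (B n) * (4 * (2 * (1 + L) * L) / \<theta>)) \<longlonglongrightarrow> 0"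
      using tendsto_mult_right[OF bandwidth_tendsto_0[OF B(1)], of "4 * (2 * (1 + L) * L) / \<theta>"] by simp
  qed
  then show ?thesis using False by (simp add: eta_def)
qed

lemma eventually_window_small:
  assumes "(\<lambda>n. real (B n)) \<in> o(\<lambda>n. real n)"
  shows "eventually (\<lambda>n. 2 * B n + 1 < n) sequentially"
proof -
  have "eventually (\<lambda>n. norm (real (B n)) \<le> (1/4) * norm (real n)) sequentially"
    using landau_o.smallD[OF assms, of "1/4"] by simp
  then show ?thesis using eventually_gt_at_top[of 2]
  proof eventually_elim
    case (elim n)
    then have "4 * real (B n) \<le> real n" by simp
    then have "4 * B n \<le> n" by linarith
    then show ?case using elim(2) by linarith
  qed
qed

text \<open>Freezing \<open>g\<close> at \<open>l\<close> costs O(1 / B n), which reduces the claim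
  to the plain and the cross Parseval sums. The factor 1/2 accounts for the fact that the grid
  contains both signs of almost every frequency.\<close>

theorem kernel_variance_limit:
  assumes B: "filterlim B at_top sequentially" "\<And>n. B n > 0" "(\<lambda>n. real (B n)) \<in> o(\<lambda>n. real n)"
    and g: "\<And>w w'. \<bar>g w - g w'\<bar> \<le> G * cmod (cis w - cis w')" and ev: "\<And>w. g (- w) = g w"
  shows "(\<lambda>n. bandwidth (B n) / (2 * real n) * (\<Sum>j\<in>fourier_idx n. g (fourier_freq n j) * (kernel_sym (B n) l (fourier_freq n j))\<^sup>2))
     \<longlonglongrightarrow> (1 + eta (2 * l)) * g l * (LBINT t:{-1..1}. (a t)\<^sup>2)"
proof -
  define b where "b n = bandwidth (B n)" for n
  define S where "S n = (\<Sum>j\<in>fourier_idx n. (kernel_sym (B n) l (fourier_freq n j))\<^sup>2)" for n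
  define T where "T n = (\<Sum>j\<in>fourier_idx n. g (fourier_freq n j) * (kernel_sym (B n) l (fourier_freq n j))\<^sup>2)" for n
  define I where "I = (LBINT t:{-1..1}. (a t)\<^sup>2)"
  have b0: "b \<longlonglongrightarrow> 0" unfolding b_def by (rule bandwidth_tendsto_0[OF B(1)])
  have bpos: "b n > 0" for n unfolding b_def using B(2) by simp
  note small = eventually_window_small[OF B(3)]
  have "(\<lambda>n. b n / (2 * real n) * S n) \<longlonglongrightarrow> I + eta (2 * l) * I"
  proof (rule Lim_transform_eventually[OF tendsto_add[OF window_riemann_limit[OF B(1,2)] window_cos_limit[OF B(1,2), of l]], folded I_def])
    show "\<forall>\<^sub>F n in sequentially. bandwidth (B n) * (\<Sum>k=- int (B n)..int (B n). (a (of_int k * bandwidth (B n)))\<^sup>2) +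
        bandwidth (B n) * (\<Sum>k=- int (B n)..int (B n). (a (of_int k * bandwidth (B n)))\<^sup>2 * cos (of_int k * (2 * l))) =
        b n / (2 * real n) * S n"
      using small
    proof eventually_elim
      case (elim n)
      then have mn: "2 * B n < n" and n: "real n > 0" by auto
      show ?case unfolding S_def sum_kernel_sym_square[OF mn] b_def[symmetric] using n
        by (simp add: distrib_left)
    qed
  qed
  from tendsto_mult_left[OF this, of "g l"]
  have A: "(\<lambda>n. g l * (b n / (2 * real n) * S n)) \<longlonglongrightarrow> (1 + eta (2 * l)) * g l * I" by (simp add: algebra_simps)
  have Bz: "(\<lambda>n. b n / (2 * real n) * T n - g l * (b n / (2 * real n) * S n)) \<longlonglongrightarrow> 0"
  proof (rule Lim_null_comparison)
    show "\<forall>\<^sub>F n in sequentially. norm (b n / (2 * real n) * T n - g l * (b n / (2 * real n) * S n)) \<le> b n * (G * (4 * L\<^sup>2 + 3 * (1 + L)\<^sup>2))"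
      using small
    proof eventually_elim
      case (elim n)
      then have n: "real n > 0" by auto
      have "b n / (2 * real n) * T n - g l * (b n / (2 * real n) * S n) = b n / (2 * real n) * (T n - g l * S n)"
        by (simp add: right_diff_distrib)
      also have "norm \<dots> = b n / (2 * real n) * \<bar>T n - g l * S n\<bar>" using bpos[of n] by (simp add: abs_mult)
      also have "\<dots> \<le> b n / (2 * real n) * (2 * real n * G * (4 * L\<^sup>2 + 3 * (1 + L)\<^sup>2))"
        unfolding T_def S_def using bpos[of n] by (intro mult_left_mono sum_kernel_sym_freeze[OF B(2) elim g ev]) auto
      also have "\<dots> = b n * (G * (4 * L\<^sup>2 + 3 * (1 + L)\<^sup>2))" using n by simp
      finally show ?case .
    qed
    show "(\<lambda>n. b n * (G * (4 * L\<^sup>2 + 3 * (1 + L)\<^sup>2))) \<longlonglongrightarrow> 0"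
      using tendsto_mult_right[OF b0, of "G * (4 * L\<^sup>2 + 3 * (1 + L)\<^sup>2)"] by simp
  qed
  show ?thesis using tendsto_add[OF Bz A] by (simp add: b_def T_def I_def)
qed

end

section \<open>Variance of linear forms in the sample autocovariances\<close>

lemma sum_Pow_insert:
  assumes "finite S" "x \<notin> S"
  shows "(\<Sum>A\<in>Pow (insert x S). f A) = (\<Sum>A\<in>Pow S. f A) + (\<Sum>A\<in>Pow S. f (insert x A))"
proof -
  have "inj_on (insert x) (Pow S)" using assms(2) by (auto simp: inj_on_def)
  moreover have "Pow S \<inter> insert x ` Pow S = {}" using assms(2) by auto
  ultimately show ?thesis
    using assms by (simp add: Pow_insert sum.union_disjoint sum.reindex)
qed

context stationary_cumulants
begin

text \<open>In the recursion through index 0, subsets of size 1 or 3 leave a factor with a single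
  index, which vanishes by centring; the three pairs and the full cumulant remain.\<close>

lemma joint_moment_four:
  fixes t :: "nat \<Rightarrow> int"
  shows "joint_moment t {0, 1, 2, 3} = cumul t {0, 1, 2, 3} + r (t 1 - t 0) * r (t 3 - t 2)
     + r (t 2 - t 0) * r (t 3 - t 1) + r (t 3 - t 0) * r (t 2 - t 1)"
proof -
  have sets: "{A. A \<subseteq> {0, 1, 2, 3} \<and> 0 \<in> A} = insert 0 ` Pow {1, 2, 3::nat}"
  proof (intro equalityI subsetI)
    fix A :: "nat set" assume A: "A \<in> {A. A \<subseteq> {0, 1, 2, 3} \<and> 0 \<in> A}"
    then have "A = insert 0 (A - {0})" by blast
    moreover have "A - {0} \<in> Pow {1, 2, 3}" using A by blast
    ultimately show "A \<in> insert 0 ` Pow {1, 2, 3::nat}" by (rule image_eqI)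
  qed blast
  define f where "f A = cumul t (insert 0 A) * joint_moment t ({0, 1, 2, 3} - insert 0 A)" for A
  have inj: "inj_on (insert 0) (Pow {1, 2, 3::nat})"
  proof (rule inj_onI)
    fix A B :: "nat set" assume AB: "A \<in> Pow {1, 2, 3}" "B \<in> Pow {1, 2, 3}" "insert 0 A = insert 0 B"
    then have 0: "0 \<notin> A" "0 \<notin> B" by auto
    show "A = B" by (rule iffD1[OF insert_ident[OF 0] AB(3)])
  qed
  have "joint_moment t {0, 1, 2, 3} = (\<Sum>A\<in>insert 0 ` Pow {1, 2, 3::nat}. cumul t A * joint_moment t ({0, 1, 2, 3} - A))"
    by (rule joint_moment_rec[of "{0, 1, 2, 3}" 0 t, unfolded sets]) auto
  also have "\<dots> = (\<Sum>A\<in>Pow {1, 2, 3::nat}. cumul t (insert 0 A) * joint_moment t ({0, 1, 2, 3} - insert 0 A))"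
    by (simp only: sum.reindex[OF inj] o_def)
  also have "\<dots> = (\<Sum>A\<in>Pow {1, 2, 3::nat}. f A)" by (simp only: f_def)
  also have "\<dots> = f {} + f {3} + (f {2} + f {2, 3}) + (f {1} + f {1, 3} + (f {1, 2} + f {1, 2, 3}))"
    by (simp add: sum_Pow_insert)
  also have "f {} = 0" by (simp add: f_def)
  also have "f {3} = r (t 3 - t 0) * r (t 2 - t 1)"
  proof -
    have "{0, 1, 2, 3} - insert 0 {3} = {1, 2::nat}" by auto
    then show ?thesis unfolding f_def by (simp only: cumul_pair[of 0 3] joint_moment_pair[of 1 2])
  qed
  also have "f {2} = r (t 2 - t 0) * r (t 3 - t 1)"
  proof -
    have "{0, 1, 2, 3} - insert 0 {2} = {1, 3::nat}" by auto
    then show ?thesis unfolding f_def by (simp add: cumul_pair[of 0 2] joint_moment_pair[of 1 3] del: One_nat_def)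
  qed
  also have "f {1} = r (t 1 - t 0) * r (t 3 - t 2)"
  proof -
    have "{0, 1, 2, 3} - insert 0 {1} = {2, 3::nat}" by auto
    then show ?thesis unfolding f_def by (simp add: cumul_pair[of 0 1] joint_moment_pair[of 2 3] del: One_nat_def)
  qed
  also have "f {2, 3} = 0"
  proof -
    have "{0, 1, 2, 3} - insert 0 {2, 3} = {1::nat}" by auto
    then show ?thesis unfolding f_def by simp
  qed
  also have "f {1, 3} = 0"
  proof -
    have "{0, 1, 2, 3} - insert 0 {1, 3} = {2::nat}" by auto
    then show ?thesis unfolding f_def by simp
  qed
  also have "f {1, 2} = 0"
  proof -
    have "{0, 1, 2, 3} - insert 0 {1, 2} = {3::nat}" by auto
    then show ?thesis unfolding f_def by simp
  qed
  also have "f {1, 2, 3} = cumul t {0, 1, 2, 3}"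
    unfolding f_def by simp
  finally show ?thesis by simp
qed

text \<open>The covariance of X_0 X_k and X_m X_(m+l).\<close>

definition prod_cov :: "int \<Rightarrow> int \<Rightarrow> int \<Rightarrow> real" where
  "prod_cov k m l = joint_cumulant M (map X [0, k, m, m + l]) + r m * r (m + l - k) + r (m + l) * r (m - k)"

lemma
  shows expectation_four: "expectation (\<lambda>\<omega>. X i \<omega> * X (i + k) \<omega> * (X j \<omega> * X (j + l) \<omega>)) = prod_cov k (j - i) l + r k * r l"
    and integrable_four: "integrable M (\<lambda>\<omega>. X i \<omega> * X (i + k) \<omega> * (X j \<omega> * X (j + l) \<omega>))"
proof -
  define t where "t = (\<lambda>x::nat. if x = 0 then i else if x = 1 then i + k else if x = 2 then j else j + l)"
  have eq: "(\<Prod>x\<in>{0, 1, 2, 3}. X (t x) \<omega>) = X i \<omega> * X (i + k) \<omega> * (X j \<omega> * X (j + l) \<omega>)" for \<omega>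
    by (simp add: t_def)
  have "cumul t {0, 1, 2, 3} = joint_cumulant M (map X (0 # map (\<lambda>x. t x - t 0) [1, 2, 3]))"
    using cumul_eq_joint_cumulant[of 0 "[1, 2, 3]" t] by simp
  also have "0 # map (\<lambda>x. t x - t 0) [1, 2, 3] = [0, k, j - i, (j - i) + l]" by (simp add: t_def)
  finally have c: "cumul t {0, 1, 2, 3} = joint_cumulant M (map X [0, k, j - i, (j - i) + l])" .
  have s: "r (t 3 - t 1) = r (j - i + l - k)" "r (t 3 - t 0) = r (j - i + l)" "r (t 2 - t 1) = r (j - i - k)"
    by (rule arg_cong[where f=r], simp add: t_def)+
  show "expectation (\<lambda>\<omega>. X i \<omega> * X (i + k) \<omega> * (X j \<omega> * X (j + l) \<omega>)) = prod_cov k (j - i) l + r k * r l"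
    using joint_moment_four[of t] unfolding c s prod_cov_def
    unfolding joint_moment_def eq by (simp add: t_def)
  show "integrable M (\<lambda>\<omega>. X i \<omega> * X (i + k) \<omega> * (X j \<omega> * X (j + l) \<omega>))"
    using integrable_prod_X[of "{0, 1, 2, 3}" t] unfolding eq by simp
qed

lemma
  shows expectation_two: "expectation (\<lambda>\<omega>. X i \<omega> * X (i + k) \<omega>) = r k"
    and integrable_two: "integrable M (\<lambda>\<omega>. X i \<omega> * X (i + k) \<omega>)"
proof -
  define t where "t = (\<lambda>x. if x then i + k else i)"
  have eq: "(\<Prod>x\<in>{False, True}. X (t x) \<omega>) = X i \<omega> * X (i + k) \<omega>" for \<omega> by (simp add: t_def)
  show "expectation (\<lambda>\<omega>. X i \<omega> * X (i + k) \<omega>) = r k"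
    using joint_moment_pair[of False True t] unfolding joint_moment_def eq by (simp add: t_def)
  show "integrable M (\<lambda>\<omega>. X i \<omega> * X (i + k) \<omega>)"
    using integrable_prod_X[of "{False, True}" t] unfolding eq by simp
qed

lemma sum_autocov_le: "finite F \<Longrightarrow> (\<Sum>k\<in>F. \<bar>r k\<bar>) \<le> R0"
  unfolding R0_def by (intro finite_sum_le_infsum summable_autocov) auto

text \<open>The injective image of \<open>F\<close> lies in a finite rectangle, over which the
  double sum factors.\<close>

lemma sum_autocov_prod_le:
  assumes "finite F" "inj_on h F"
  shows "(\<Sum>x\<in>F. \<bar>r (fst (h x))\<bar> * \<bar>r (snd (h x))\<bar>) \<le> R0\<^sup>2"
proof -
  have "(\<Sum>x\<in>F. \<bar>r (fst (h x))\<bar> * \<bar>r (snd (h x))\<bar>) = (\<Sum>p\<in>h ` F. \<bar>r (fst p)\<bar> * \<bar>r (snd p)\<bar>)"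
    using assms by (simp add: sum.reindex)
  also have "\<dots> \<le> (\<Sum>p\<in>(fst ` h ` F) \<times> (snd ` h ` F). \<bar>r (fst p)\<bar> * \<bar>r (snd p)\<bar>)"
  proof (rule sum_mono2)
    show "h ` F \<subseteq> (fst ` h ` F) \<times> (snd ` h ` F)"
      unfolding mem_Times_iff subset_iff by (intro allI impI conjI imageI)
  qed (use assms in auto)
  also have "\<dots> = (\<Sum>k\<in>fst ` h ` F. \<bar>r k\<bar>) * (\<Sum>k\<in>snd ` h ` F. \<bar>r k\<bar>)"
    by (simp add: sum_product sum.cartesian_product case_prod_beta)
  also have "\<dots> \<le> R0 * R0"
    using assms R0_nonneg by (intro mult_mono sum_autocov_le sum_nonneg) auto
  finally show ?thesis by (simp add: power2_eq_square)
qed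

definition prod_cov_bound :: real where
  "prod_cov_bound = cumul_bound 4 + 2 * R0\<^sup>2"

text \<open>For fixed \<open>k\<close> the arguments of each of the three terms determine the pair
  (m, l), so absolute summability bounds the sum uniformly in \<open>k\<close>.\<close>

lemma sum_prod_cov_le:
  assumes F: "finite F"
  shows "(\<Sum>(m, l)\<in>F. \<bar>prod_cov k m l\<bar>) \<le> prod_cov_bound"
proof -
  have "(\<Sum>(m, l)\<in>F. \<bar>prod_cov k m l\<bar>) \<le>
     (\<Sum>x\<in>F. \<bar>joint_cumulant M (map X (0 # [k, fst x, fst x + snd x]))\<bar>
        + \<bar>r (fst (fst x, fst x + snd x - k))\<bar> * \<bar>r (snd (fst x, fst x + snd x - k))\<bar>
        + \<bar>r (fst (fst x + snd x, fst x - k))\<bar> * \<bar>r (snd (fst x + snd x, fst x - k))\<bar>)"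
    unfolding case_prod_beta prod_cov_def
    by (intro sum_mono order_trans[OF abs_triangle_ineq] add_mono) (auto simp: abs_mult intro: order_trans[OF abs_triangle_ineq])
  also have "\<dots> = (\<Sum>x\<in>F. \<bar>joint_cumulant M (map X (0 # [k, fst x, fst x + snd x]))\<bar>)
     + (\<Sum>x\<in>F. \<bar>r (fst (fst x, fst x + snd x - k))\<bar> * \<bar>r (snd (fst x, fst x + snd x - k))\<bar>)
     + (\<Sum>x\<in>F. \<bar>r (fst (fst x + snd x, fst x - k))\<bar> * \<bar>r (snd (fst x + snd x, fst x - k))\<bar>)"
    by (simp only: sum.distrib)
  also have "\<dots> \<le> cumul_bound 4 + R0\<^sup>2 + R0\<^sup>2"
  proof (intro add_mono)
    have "(\<Sum>x\<in>F. \<bar>joint_cumulant M (map X (0 # [k, fst x, fst x + snd x]))\<bar>) =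
      (\<Sum>ts\<in>(\<lambda>x. [k, fst x, fst x + snd x]) ` F. \<bar>joint_cumulant M (map X (0 # ts))\<bar>)"
      by (subst sum.reindex) (auto simp: inj_on_def prod_eq_iff)
    also have "\<dots> \<le> cumul_bound 4" by (rule sum_joint_cumulant_le) (use F in auto)
    finally show "(\<Sum>x\<in>F. \<bar>joint_cumulant M (map X (0 # [k, fst x, fst x + snd x]))\<bar>) \<le> cumul_bound 4" .
    show "(\<Sum>x\<in>F. \<bar>r (fst (fst x, fst x + snd x - k))\<bar> * \<bar>r (snd (fst x, fst x + snd x - k))\<bar>) \<le> R0\<^sup>2"
      by (rule sum_autocov_prod_le[OF F, where h="\<lambda>x. (fst x, fst x + snd x - k)"]) (auto simp: inj_on_def prod_eq_iff)
    show "(\<Sum>x\<in>F. \<bar>r (fst (fst x + snd x, fst x - k))\<bar> * \<bar>r (snd (fst x + snd x, fst x - k))\<bar>) \<le> R0\<^sup>2"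
      by (rule sum_autocov_prod_le[OF F, where h="\<lambda>x. (fst x + snd x, fst x - k)"]) (auto simp: inj_on_def prod_eq_iff)
  qed
  finally show ?thesis by (simp add: prod_cov_bound_def)
qed

lemma prod_cov_bound_nonneg: "prod_cov_bound \<ge> 0"
  unfolding prod_cov_bound_def using cumul_bound_nonneg by simp

abbreviation racov :: "nat \<Rightarrow> 'a \<Rightarrow> int \<Rightarrow> real" where
  "racov n \<omega> \<equiv> sample_autocov n (\<lambda>t. X t \<omega>)"

lemma
  shows integrable_racov: "integrable M (\<lambda>\<omega>. racov n \<omega> k)"
    and expectation_racov: "n > 0 \<Longrightarrow> \<bar>k\<bar> \<le> int n \<Longrightarrow> expectation (\<lambda>\<omega>. racov n \<omega> k) = (1 - \<bar>of_int k\<bar> / real n) * r k"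
proof -
  show "integrable M (\<lambda>\<omega>. racov n \<omega> k)"
    unfolding sample_autocov_def by (intro integrable_mult_right Bochner_Integration.integrable_sum integrable_two)
  assume n: "n > 0" and k: "\<bar>k\<bar> \<le> int n"
  have rk: "r \<bar>k\<bar> = r k" using autocov_minus[of k] by (cases "k \<ge> 0") auto
  have "expectation (\<lambda>\<omega>. racov n \<omega> k) = 1 / real n * (\<Sum>j=1..int n - \<bar>k\<bar>. r \<bar>k\<bar>)"
    unfolding sample_autocov_def by (simp add: integrable_two Bochner_Integration.integral_sum expectation_two)
  also have "\<dots> = 1 / real n * (real n - \<bar>of_int k\<bar>) * r k"
    using k rk by simp
  also have "\<dots> = (1 - \<bar>of_int k\<bar> / real n) * r k"
    using n by (simp add: field_simps)
  finally show "expectation (\<lambda>\<omega>. racov n \<omega> k) = (1 - \<bar>of_int k\<bar> / real n) * r k" .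
qed

text \<open>A Schur test: |u v| <= (u^2 + v^2)/2 reduces the quadratic form in products X_i
  X_(i+|k|) to its row sums, which are bounded uniformly by the summable covariances.\<close>

theorem autocov_form_variance:
  fixes u :: "int \<Rightarrow> real"
  assumes p: "p < n"
  defines "Q \<equiv> \<lambda>\<omega>. \<Sum>k=- int p..int p. u k * (racov n \<omega> k - (1 - \<bar>of_int k\<bar> / real n) * r k)"
  shows "integrable M (\<lambda>\<omega>. (Q \<omega>)\<^sup>2)"
    and "expectation (\<lambda>\<omega>. (Q \<omega>)\<^sup>2) \<le> 2 * prod_cov_bound / real n * (\<Sum>k=- int p..int p. (u k)\<^sup>2)"
proof -
  have n: "real n > 0" using p by simp
  define P where "P = Sigma {- int p..int p} (\<lambda>k. {1..int n - \<bar>k\<bar>})"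
  have finP: "finite P" unfolding P_def by auto
  define Y where "Y x \<omega> = X (snd x) \<omega> * X (snd x + \<bar>fst x\<bar>) \<omega> - r \<bar>fst x\<bar>" for x :: "int \<times> int" and \<omega>
  have rabs: "r \<bar>k\<bar> = r k" for k using autocov_minus[of k] by (cases "k \<ge> 0") auto
  have Q: "Q \<omega> = 1 / real n * (\<Sum>x\<in>P. u (fst x) * Y x \<omega>)" for \<omega>
  proof -
    have "racov n \<omega> k - (1 - \<bar>of_int k\<bar> / real n) * r k = 1 / real n * (\<Sum>i=1..int n - \<bar>k\<bar>. Y (k, i) \<omega>)"
      if "k \<in> {- int p..int p}" for k
    proof -
      have "\<bar>k\<bar> \<le> int n" using that p by auto
      then have "real (nat (int n - \<bar>k\<bar>)) = real n - \<bar>of_int k\<bar>" by simp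
      then have "(\<Sum>i=1..int n - \<bar>k\<bar>. Y (k, i) \<omega>) = (\<Sum>i=1..int n - \<bar>k\<bar>. X i \<omega> * X (i + \<bar>k\<bar>) \<omega>) - (real n - \<bar>of_int k\<bar>) * r k"
        by (simp add: Y_def sum_subtractf rabs)
      then show ?thesis unfolding sample_autocov_def using n by (simp add: field_simps)
    qed
    then have "Q \<omega> = (\<Sum>k=- int p..int p. u k * (1 / real n * (\<Sum>i=1..int n - \<bar>k\<bar>. Y (k, i) \<omega>)))"
      unfolding Q_def by simp
    also have "\<dots> = 1 / real n * (\<Sum>k=- int p..int p. \<Sum>i=1..int n - \<bar>k\<bar>. u k * Y (k, i) \<omega>)"
      unfolding sum_distrib_left by (intro sum.cong refl) simp
    also have "(\<Sum>k=- int p..int p. \<Sum>i=1..int n - \<bar>k\<bar>. u k * Y (k, i) \<omega>) = (\<Sum>x\<in>P. u (fst x) * Y x \<omega>)"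
      unfolding P_def by (subst sum.Sigma) (auto simp: case_prod_beta)
    finally show ?thesis .
  qed
  have YY: "integrable M (\<lambda>\<omega>. Y x \<omega> * Y y \<omega>)" "expectation (\<lambda>\<omega>. Y x \<omega> * Y y \<omega>) = prod_cov \<bar>fst x\<bar> (snd y - snd x) \<bar>fst y\<bar>" for x y
  proof -
    have eq: "Y x \<omega> * Y y \<omega> = X (snd x) \<omega> * X (snd x + \<bar>fst x\<bar>) \<omega> * (X (snd y) \<omega> * X (snd y + \<bar>fst y\<bar>) \<omega>)
      - r \<bar>fst y\<bar> * (X (snd x) \<omega> * X (snd x + \<bar>fst x\<bar>) \<omega>) - r \<bar>fst x\<bar> * (X (snd y) \<omega> * X (snd y + \<bar>fst y\<bar>) \<omega>) + r \<bar>fst x\<bar> * r \<bar>fst y\<bar>" for \<omega>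
      by (simp add: Y_def algebra_simps)
    note ints = integrable_four[of "snd x" "\<bar>fst x\<bar>" "snd y" "\<bar>fst y\<bar>"] integrable_two[of "snd x" "\<bar>fst x\<bar>"] integrable_two[of "snd y" "\<bar>fst y\<bar>"]
    show "integrable M (\<lambda>\<omega>. Y x \<omega> * Y y \<omega>)"
      unfolding eq using ints by auto
    show "expectation (\<lambda>\<omega>. Y x \<omega> * Y y \<omega>) = prod_cov \<bar>fst x\<bar> (snd y - snd x) \<bar>fst y\<bar>"
      unfolding eq using ints by (simp add: expectation_four expectation_two prob_space)
  qed
  have Q2: "(Q \<omega>)\<^sup>2 = 1 / (real n)\<^sup>2 * (\<Sum>x\<in>P. \<Sum>y\<in>P. u (fst x) * u (fst y) * (Y x \<omega> * Y y \<omega>))" for \<omega>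
    unfolding Q power_mult_distrib power2_eq_square[of "sum _ _"] sum_product
    by (simp add: power_one_over mult_ac)
  show "integrable M (\<lambda>\<omega>. (Q \<omega>)\<^sup>2)"
    unfolding Q2 by (intro integrable_mult_right Bochner_Integration.integrable_sum YY)
  define e where "e x y = \<bar>expectation (\<lambda>\<omega>. Y x \<omega> * Y y \<omega>)\<bar>" for x y
  have esym: "e x y = e y x" for x y by (simp add: e_def mult.commute)
  have esum: "(\<Sum>y\<in>P. e x y) \<le> 2 * prod_cov_bound" for x
  proof -
    \<comment> \<open>The pair of time difference and |k| is injective only on lags of one sign;
      splitting \<open>P\<close> accordingly produces the factor 2.\<close>
    have part: "(\<Sum>y\<in>P'. e x y) \<le> prod_cov_bound"
      if "P' \<subseteq> P" "inj_on (\<lambda>y. (snd y - snd x, \<bar>fst y\<bar>)) P'" for P'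
    proof -
      have "(\<Sum>y\<in>P'. e x y) = (\<Sum>(m, l)\<in>(\<lambda>y. (snd y - snd x, \<bar>fst y\<bar>)) ` P'. \<bar>prod_cov \<bar>fst x\<bar> m l\<bar>)"
        using that by (simp add: sum.reindex e_def YY)
      also have "\<dots> \<le> prod_cov_bound"
        using that finP finite_subset by (intro sum_prod_cov_le) blast
      finally show ?thesis .
    qed
    have "P = {y\<in>P. fst y \<ge> 0} \<union> {y\<in>P. fst y < 0}" by auto
    then have "(\<Sum>y\<in>P. e x y) = (\<Sum>y\<in>{y\<in>P. fst y \<ge> 0} \<union> {y\<in>P. fst y < 0}. e x y)" by simp
    also have "\<dots> = (\<Sum>y\<in>{y\<in>P. fst y \<ge> 0}. e x y) + (\<Sum>y\<in>{y\<in>P. fst y < 0}. e x y)"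
      using finP by (intro sum.union_disjoint) auto
    also have "\<dots> \<le> prod_cov_bound + prod_cov_bound"
      by (intro add_mono part) (auto simp: inj_on_def prod_eq_iff)
    finally show ?thesis by simp
  qed
  have "expectation (\<lambda>\<omega>. (Q \<omega>)\<^sup>2) = 1 / (real n)\<^sup>2 * (\<Sum>x\<in>P. \<Sum>y\<in>P. u (fst x) * u (fst y) * expectation (\<lambda>\<omega>. Y x \<omega> * Y y \<omega>))"
    unfolding Q2 using YY(1) by (simp add: Bochner_Integration.integral_sum)
  also have "\<dots> \<le> 1 / (real n)\<^sup>2 * (\<Sum>x\<in>P. \<Sum>y\<in>P. ((u (fst x))\<^sup>2 / 2) * e x y + ((u (fst y))\<^sup>2 / 2) * e y x)"
  proof (intro mult_left_mono sum_mono)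
    fix x y
    have "u (fst x) * u (fst y) * expectation (\<lambda>\<omega>. Y x \<omega> * Y y \<omega>) \<le> \<bar>u (fst x) * u (fst y)\<bar> * e x y"
      unfolding e_def abs_mult[symmetric] by simp
    also have "\<dots> \<le> (((u (fst x))\<^sup>2 + (u (fst y))\<^sup>2) / 2) * e x y"
      using sum_squares_bound[of "\<bar>u (fst x)\<bar>" "\<bar>u (fst y)\<bar>"]
      by (intro mult_right_mono) (auto simp: abs_mult e_def)
    finally show "u (fst x) * u (fst y) * expectation (\<lambda>\<omega>. Y x \<omega> * Y y \<omega>) \<le> ((u (fst x))\<^sup>2 / 2) * e x y + ((u (fst y))\<^sup>2 / 2) * e y x"
      by (simp add: esym[of y x] distrib_right add_divide_distrib)
  qed auto
  also have "(\<Sum>x\<in>P. \<Sum>y\<in>P. ((u (fst x))\<^sup>2 / 2) * e x y + ((u (fst y))\<^sup>2 / 2) * e y x) = (\<Sum>x\<in>P. (u (fst x))\<^sup>2 * (\<Sum>y\<in>P. e x y))"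
  proof -
    have "(\<Sum>x\<in>P. \<Sum>y\<in>P. ((u (fst y))\<^sup>2 / 2) * e y x) = (\<Sum>x\<in>P. \<Sum>y\<in>P. ((u (fst x))\<^sup>2 / 2) * e x y)"
      by (rule sum.swap)
    then have "(\<Sum>x\<in>P. \<Sum>y\<in>P. ((u (fst x))\<^sup>2 / 2) * e x y + ((u (fst y))\<^sup>2 / 2) * e y x) = 2 * (\<Sum>x\<in>P. \<Sum>y\<in>P. ((u (fst x))\<^sup>2 / 2) * e x y)"
      by (simp add: sum.distrib)
    also have "\<dots> = (\<Sum>x\<in>P. (u (fst x))\<^sup>2 * (\<Sum>y\<in>P. e x y))"
      unfolding sum_distrib_left by (intro sum.cong refl) simp
    finally show ?thesis .
  qed
  also have "1 / (real n)\<^sup>2 * (\<Sum>x\<in>P. (u (fst x))\<^sup>2 * (\<Sum>y\<in>P. e x y)) \<le> 1 / (real n)\<^sup>2 * (\<Sum>x\<in>P. (u (fst x))\<^sup>2 * (2 * prod_cov_bound))"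
    by (intro mult_left_mono sum_mono esum) auto
  also have "\<dots> = 2 * prod_cov_bound / (real n)\<^sup>2 * (\<Sum>x\<in>P. (u (fst x))\<^sup>2)"
    unfolding sum_distrib_left by (intro sum.cong refl) simp
  also have "\<dots> \<le> 2 * prod_cov_bound / (real n)\<^sup>2 * (real n * (\<Sum>k=- int p..int p. (u k)\<^sup>2))"
  proof (intro mult_left_mono)
    have "(\<Sum>x\<in>P. (u (fst x))\<^sup>2) = (\<Sum>k=- int p..int p. \<Sum>i=1..int n - \<bar>k\<bar>. (u k)\<^sup>2)"
      unfolding P_def by (subst sum.Sigma) (auto simp: case_prod_beta)
    also have "\<dots> \<le> (\<Sum>k=- int p..int p. real n * (u k)\<^sup>2)"
      by (intro sum_mono) (auto intro!: mult_right_mono)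
    finally show "(\<Sum>x\<in>P. (u (fst x))\<^sup>2) \<le> real n * (\<Sum>k=- int p..int p. (u k)\<^sup>2)" by (simp add: sum_distrib_left)
  qed (use prod_cov_bound_nonneg in auto)
  also have "\<dots> = 2 * prod_cov_bound / real n * (\<Sum>k=- int p..int p. (u k)\<^sup>2)"
    using n by (simp add: power2_eq_square)
  finally show "expectation (\<lambda>\<omega>. (Q \<omega>)\<^sup>2) \<le> 2 * prod_cov_bound / real n * (\<Sum>k=- int p..int p. (u k)\<^sup>2)" .
qed

end

section \<open>The Mallows metric and a central limit theorem\<close>

text \<open>The joint law of \<open>U\<close> and \<open>V\<close> also shows that the set of
  couplings is non-empty. An infimum of reals is informative only then, so nonnegativity is recorded
  here too.\<close>

lemma mallows_dist_le_coupling: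
  assumes "prob_space \<Omega>" and [measurable]: "U \<in> borel_measurable \<Omega>" "V \<in> borel_measurable \<Omega>"
  shows "0 \<le> mallows_dist (distr \<Omega> borel U) (distr \<Omega> borel V)"
    and "mallows_dist (distr \<Omega> borel U) (distr \<Omega> borel V) \<le> sqrt (\<integral>\<omega>. (U \<omega> - V \<omega>)\<^sup>2 \<partial>\<Omega>)"
proof -
  define R where "R = distr \<Omega> (borel \<Otimes>\<^sub>M borel) (\<lambda>\<omega>. (U \<omega>, V \<omega>))"
  have R: "R \<in> couplings (distr \<Omega> borel U) (distr \<Omega> borel V)"
    unfolding couplings_def R_def by (auto simp: distr_distr comp_def)
  have int: "(\<integral>z. \<bar>fst z - snd z\<bar>\<^sup>2 \<partial>R) = (\<integral>\<omega>. (U \<omega> - V \<omega>)\<^sup>2 \<partial>\<Omega>)"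
    unfolding R_def by (subst integral_distr) auto
  show "0 \<le> mallows_dist (distr \<Omega> borel U) (distr \<Omega> borel V)"
    unfolding mallows_dist_def using R by (intro cINF_greatest) auto
  show "mallows_dist (distr \<Omega> borel U) (distr \<Omega> borel V) \<le> sqrt (\<integral>\<omega>. (U \<omega> - V \<omega>)\<^sup>2 \<partial>\<Omega>)"
    unfolding mallows_dist_def int[symmetric]
    using R by (intro cINF_lower bdd_belowI2[where m=0]) auto
qed

text \<open>A quadratic form of Scheffe's lemma. The squared distance is at most
  \<open>2 * (Y n x)\<^sup>2 - 2 * (Z x)\<^sup>2\<close> plus corrections \<open>p\<close> and
  \<open>q\<close>, which are dominated by multiples of the squared limit and tend to 0
  pointwise.\<close>

lemma L2_convergence_of_norms:
  fixes Y :: "nat \<Rightarrow> 'b \<Rightarrow> real"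
  assumes [measurable]: "\<And>n. Y n \<in> borel_measurable \<Omega>" "Z \<in> borel_measurable \<Omega>"
    and lim: "\<And>x. x \<in> space \<Omega> \<Longrightarrow> (\<lambda>n. Y n x) \<longlonglongrightarrow> Z x"
    and int[simp]: "\<And>n. integrable \<Omega> (\<lambda>x. (Y n x)\<^sup>2)" "integrable \<Omega> (\<lambda>x. (Z x)\<^sup>2)"
    and conv: "(\<lambda>n. \<integral>x. (Y n x)\<^sup>2 \<partial>\<Omega>) \<longlonglongrightarrow> (\<integral>x. (Z x)\<^sup>2 \<partial>\<Omega>)"
  shows "(\<lambda>n. \<integral>x. (Y n x - Z x)\<^sup>2 \<partial>\<Omega>) \<longlonglongrightarrow> 0"
proof -
  define p where "p n x = max ((Z x)\<^sup>2 - (Y n x)\<^sup>2) 0" for n x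
  define q where "q n x = min ((Y n x - Z x)\<^sup>2) (4 * (Z x)\<^sup>2)" for n x
  have [measurable]: "p n \<in> borel_measurable \<Omega>" "q n \<in> borel_measurable \<Omega>" for n
    by (auto simp: p_def[abs_def] q_def[abs_def])
  have p_le: "norm (p n x) \<le> (Z x)\<^sup>2" and q_le: "norm (q n x) \<le> 4 * (Z x)\<^sup>2" for n x
    by (auto simp: p_def q_def)
  have p_lim: "(\<lambda>n. p n x) \<longlonglongrightarrow> 0" if "x \<in> space \<Omega>" for x
    unfolding p_def using lim[OF that] by (auto intro!: tendsto_eq_intros)
  have q_lim: "(\<lambda>n. q n x) \<longlonglongrightarrow> 0" if "x \<in> space \<Omega>" for x
    unfolding q_def using lim[OF that] by (auto intro!: tendsto_eq_intros)
  have ip: "(\<lambda>n. integral\<^sup>L \<Omega> (p n)) \<longlonglongrightarrow> integral\<^sup>L \<Omega> (\<lambda>_. 0)" and ip': "integrable \<Omega> (p n)" for n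
  proof -
    show "(\<lambda>n. integral\<^sup>L \<Omega> (p n)) \<longlonglongrightarrow> integral\<^sup>L \<Omega> (\<lambda>_. 0)"
      by (rule integral_dominated_convergence[where w="\<lambda>x. (Z x)\<^sup>2"]) (use p_le p_lim in auto)
    show "integrable \<Omega> (p n)"
      by (rule Bochner_Integration.integrable_bound[OF int(2)]) (use p_le in auto)
  qed
  have iq: "(\<lambda>n. integral\<^sup>L \<Omega> (q n)) \<longlonglongrightarrow> integral\<^sup>L \<Omega> (\<lambda>_. 0)" and iq': "integrable \<Omega> (q n)" for n
  proof -
    show "(\<lambda>n. integral\<^sup>L \<Omega> (q n)) \<longlonglongrightarrow> integral\<^sup>L \<Omega> (\<lambda>_. 0)"
      by (rule integral_dominated_convergence[where w="\<lambda>x. 4 * (Z x)\<^sup>2"]) (use q_le q_lim in auto)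
    show "integrable \<Omega> (q n)"
      by (rule Bochner_Integration.integrable_bound[where f="\<lambda>x. 4 * (Z x)\<^sup>2"]) (use q_le in auto)
  qed
  have le: "(Y n x - Z x)\<^sup>2 \<le> 2 * (Y n x)\<^sup>2 - 2 * (Z x)\<^sup>2 + 4 * p n x + q n x" for n x
  proof -
    have "(Y n x - Z x)\<^sup>2 \<le> 2 * (Y n x)\<^sup>2 + 2 * (Z x)\<^sup>2"
      using sum_squares_bound[of "Y n x" "- Z x"] by (simp add: power2_diff)
    moreover have "(Y n x)\<^sup>2 - (Z x)\<^sup>2 + 2 * p n x \<ge> 0" by (simp add: p_def max_def)
    moreover have "p n x \<ge> 0" by (simp add: p_def)
    moreover have "4 * p n x \<ge> 4 * ((Z x)\<^sup>2 - (Y n x)\<^sup>2)" by (simp add: p_def max_def)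
    ultimately show ?thesis by (auto simp: q_def min_def)
  qed
  show ?thesis
  proof (rule tendsto_sandwich[of "\<lambda>_. 0"])
    show "\<forall>\<^sub>F n in sequentially. (\<integral>x. (Y n x - Z x)\<^sup>2 \<partial>\<Omega>) \<le>
        2 * (\<integral>x. (Y n x)\<^sup>2 \<partial>\<Omega>) - 2 * (\<integral>x. (Z x)\<^sup>2 \<partial>\<Omega>) + 4 * integral\<^sup>L \<Omega> (p n) + integral\<^sup>L \<Omega> (q n)"
    proof (rule always_eventually, rule allI)
      fix n
      have "(\<integral>x. (Y n x - Z x)\<^sup>2 \<partial>\<Omega>) \<le> (\<integral>x. 2 * (Y n x)\<^sup>2 - 2 * (Z x)\<^sup>2 + 4 * p n x + q n x \<partial>\<Omega>)"
      proof (rule integral_mono_AE')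
        show "AE x in \<Omega>. 0 \<le> 2 * (Y n x)\<^sup>2 - 2 * (Z x)\<^sup>2 + 4 * p n x + q n x"
          using order_trans[OF zero_le_power2 le] by auto
      qed (use le ip' iq' in auto)
      also have "\<dots> = 2 * (\<integral>x. (Y n x)\<^sup>2 \<partial>\<Omega>) - 2 * (\<integral>x. (Z x)\<^sup>2 \<partial>\<Omega>) + 4 * integral\<^sup>L \<Omega> (p n) + integral\<^sup>L \<Omega> (q n)"
        using ip' iq' by simp
      finally show "(\<integral>x. (Y n x - Z x)\<^sup>2 \<partial>\<Omega>) \<le> \<dots>" .
    qed
    show "(\<lambda>n. 2 * (\<integral>x. (Y n x)\<^sup>2 \<partial>\<Omega>) - 2 * (\<integral>x. (Z x)\<^sup>2 \<partial>\<Omega>) + 4 * integral\<^sup>L \<Omega> (p n) + integral\<^sup>L \<Omega> (q n)) \<longlonglongrightarrow> 0"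
      using tendsto_add[OF tendsto_add[OF tendsto_diff[OF tendsto_mult_left[OF conv, of 2]
        tendsto_const[of "2 * (\<integral>x. (Z x)\<^sup>2 \<partial>\<Omega>)"]] tendsto_mult_left[OF ip, of 4]] iq] by simp
  qed auto
qed

section \<open>Characteristic functions and the central limit theorem\<close>

lemma normal_distribution_scaled:
  assumes "\<tau> > 0"
  shows "density lborel (normal_density 0 \<tau>) = distr std_normal_distribution borel (\<lambda>x. \<tau> * x)"
proof -
  interpret S: prob_space std_normal_distribution by (rule prob_space_normal_density) simp
  have "distributed std_normal_distribution lborel (\<lambda>x. x) std_normal_density"
    by (auto simp: distributed_def intro!: distr_id2)
  then have "distributed std_normal_distribution lborel (\<lambda>x. \<tau> * x) (normal_density 0 \<tau>)"
    using assms by (subst S.normal_standard_normal_convert) auto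
  then have "distr std_normal_distribution lborel (\<lambda>x. \<tau> * x) = density lborel (normal_density 0 \<tau>)"
    by (simp add: distributed_def)
  moreover have "distr std_normal_distribution lborel (\<lambda>x. \<tau> * x) = distr std_normal_distribution borel (\<lambda>x. \<tau> * x)"
    by (rule distr_cong) auto
  ultimately show ?thesis by simp
qed

lemma normal_distribution_facts:
  assumes "\<tau> > 0"
  defines "N \<equiv> density lborel (\<lambda>x. ennreal (normal_density 0 \<tau> x))"
  shows "real_distribution N"
    and "char N t = of_real (exp (- (\<tau>\<^sup>2 * t\<^sup>2) / 2))"
    and "integrable N (\<lambda>x. x\<^sup>2)" and "(\<integral>x. x\<^sup>2 \<partial>N) = \<tau>\<^sup>2"
proof -
  have N: "N = distr std_normal_distribution borel (\<lambda>x. \<tau> * x)"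
    unfolding N_def by (rule normal_distribution_scaled[OF assms(1)])
  interpret S: real_distribution std_normal_distribution by (rule real_dist_normal_dist)
  show "real_distribution N"
    unfolding N by (rule S.real_distribution_distr) simp
  have "char N t = char std_normal_distribution (\<tau> * t)"
    unfolding N char_def by (subst integral_distr) (auto simp: mult_ac)
  then show "char N t = of_real (exp (- (\<tau>\<^sup>2 * t\<^sup>2) / 2))"
    by (simp add: char_std_normal_distribution power_mult_distrib)
  have "integrable std_normal_distribution (\<lambda>x. x ^ 2)" "(\<integral>x. x ^ 2 \<partial>std_normal_distribution) = 1"
    using integrable_std_normal_distribution_moment[of 2] std_normal_distribution_even_moments[of 1] by auto
  then show "integrable N (\<lambda>x. x\<^sup>2)" "(\<integral>x. x\<^sup>2 \<partial>N) = \<tau>\<^sup>2"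
    unfolding N by (auto simp: integrable_distr_eq integral_distr power_mult_distrib)
qed

text \<open>One side is the tangent line at 0. The other follows from (1 - x + x^2/2)(1 + x + x^2/2)
  = 1 + x^4/4 >= 1 and the quadratic lower bound for the exponential function.\<close>

lemma exp_minus_approx:
  fixes x :: real assumes "x \<ge> 0"
  shows "\<bar>(1 - x) - exp (- x)\<bar> \<le> x\<^sup>2 / 2"
proof -
  have 1: "1 - x \<le> exp (- x)" using exp_ge_add_one_self[of "- x"] by simp
  have 2: "1 + x + x\<^sup>2 / 2 \<le> exp x" by (rule exp_lower_Taylor_quadratic[OF assms])
  have pos: "1 + x + x\<^sup>2 / 2 > 0" using assms by (simp add: add_pos_nonneg)
  have pos': "1 - x + x\<^sup>2 / 2 > 0"
  proof -
    have "1 - x + x\<^sup>2 / 2 = ((1 - x)\<^sup>2 + 1) / 2" by (simp add: power2_diff field_simps)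
    also have "\<dots> > 0" by (intro divide_pos_pos add_nonneg_pos) auto
    finally show ?thesis .
  qed
  have "1 \<le> (1 - x + x\<^sup>2 / 2) * (1 + x + x\<^sup>2 / 2)"
  proof -
    have "(1 - x + x\<^sup>2 / 2) * (1 + x + x\<^sup>2 / 2) = 1 + x ^ 4 / 4"
      by (simp add: algebra_simps power2_eq_square power4_eq_xxxx)
    then show ?thesis by simp
  qed
  also have "\<dots> \<le> (1 - x + x\<^sup>2 / 2) * exp x"
    using 2 pos' by (intro mult_left_mono) auto
  finally have "exp (- x) \<le> 1 - x + x\<^sup>2 / 2"
    by (simp add: exp_minus field_simps)
  then show ?thesis using 1 by auto
qed

text \<open>The third absolute moment is split by |y|^3 <= d y^2 + y^4/d with \<open>d\<close> left
  free, so that only variance and fourth moment enter. The inequality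
  \<open>v\<^sup>2 \<le> l\<close> is nonnegativity of the variance of the squared variable.\<close>

lemma (in prob_space) char_quadratic_approx:
  assumes [measurable]: "random_variable borel Y" and [simp]: "expectation Y = 0"
    and i4: "integrable M (\<lambda>x. (Y x) ^ 4)" and d: "d > 0"
  defines "v \<equiv> expectation (\<lambda>x. (Y x)\<^sup>2)" and "l \<equiv> expectation (\<lambda>x. (Y x) ^ 4)"
  shows "cmod (char (distr M borel Y) t - of_real (exp (- (t\<^sup>2 * v / 2))))
      \<le> \<bar>t\<bar> ^ 3 * (d * v + l / d) + t ^ 4 * l"
    and "v\<^sup>2 \<le> l" and "v \<ge> 0"
proof -
  have i2[simp]: "integrable M (\<lambda>x. (Y x)\<^sup>2)"
  proof (rule Bochner_Integration.integrable_bound[where f="\<lambda>x. 1 + (Y x) ^ 4"])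
    have "y\<^sup>2 \<le> 1 + y ^ 4" for y :: real
    proof -
      have "2 * y\<^sup>2 \<le> (y\<^sup>2)\<^sup>2 + 1" using sum_squares_bound[of "y\<^sup>2" 1] by simp
      moreover have "(y\<^sup>2)\<^sup>2 = y ^ 4" by simp
      moreover have "0 \<le> y\<^sup>2" by simp
      ultimately show ?thesis by linarith
    qed
    then show "AE x in M. norm ((Y x)\<^sup>2) \<le> norm (1 + Y x ^ 4)" by simp
  qed (use i4 in auto)
  have i1[simp]: "integrable M Y"
    by (rule square_integrable_imp_integrable) auto
  show v0: "v \<ge> 0" unfolding v_def by simp
  have "variance (\<lambda>x. (Y x)\<^sup>2) \<ge> 0" by (rule variance_positive)
  moreover have "variance (\<lambda>x. (Y x)\<^sup>2) = l - v\<^sup>2"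
    unfolding l_def v_def using i4 by (subst variance_eq) auto
  ultimately show vl: "v\<^sup>2 \<le> l" by simp
  have min_le: "min (6 * y\<^sup>2) (\<bar>t\<bar> * \<bar>y\<bar> ^ 3) \<le> \<bar>t\<bar> * (d * y\<^sup>2 + y ^ 4 / d)" for y :: real
  proof -
    have "2 * (d * \<bar>y\<bar>) * y\<^sup>2 \<le> (d * \<bar>y\<bar>)\<^sup>2 + (y\<^sup>2)\<^sup>2" by (rule sum_squares_bound)
    then have "2 * (d * \<bar>y\<bar> ^ 3) \<le> d * (d * y\<^sup>2 + y ^ 4 / d)"
      using d by (simp add: power_mult_distrib power2_eq_square power3_eq_cube power4_eq_xxxx algebra_simps)
    then have "2 * \<bar>y\<bar> ^ 3 \<le> d * y\<^sup>2 + y ^ 4 / d"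
      using d by (simp add: mult.left_commute[of 2 d])
    moreover have "0 \<le> \<bar>y\<bar> ^ 3" by simp
    ultimately have "\<bar>y\<bar> ^ 3 \<le> d * y\<^sup>2 + y ^ 4 / d" by linarith
    then have "\<bar>t\<bar> * \<bar>y\<bar> ^ 3 \<le> \<bar>t\<bar> * (d * y\<^sup>2 + y ^ 4 / d)" by (intro mult_left_mono) auto
    then show ?thesis by (simp add: min.coboundedI2)
  qed
  have "cmod (char (distr M borel Y) t - (1 - t\<^sup>2 * v / 2)) \<le>
      (t\<^sup>2 / 6) * expectation (\<lambda>x. min (6 * (Y x)\<^sup>2) (\<bar>t\<bar> * \<bar>Y x\<bar> ^ 3))"
    by (rule char_approx3') (auto simp: v_def)
  also have "\<dots> \<le> (t\<^sup>2 / 6) * expectation (\<lambda>x. \<bar>t\<bar> * (d * (Y x)\<^sup>2 + (Y x) ^ 4 / d))"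
    using min_le i4 d by (intro mult_left_mono integral_mono_AE') (auto intro!: add_nonneg_nonneg)
  also have "expectation (\<lambda>x. \<bar>t\<bar> * (d * (Y x)\<^sup>2 + (Y x) ^ 4 / d)) = \<bar>t\<bar> * (d * v + l / d)"
    unfolding v_def l_def using i4 by simp
  also have "(t\<^sup>2 / 6) * (\<bar>t\<bar> * (d * v + l / d)) = \<bar>t\<bar> ^ 3 * (d * v + l / d) / 6"
    by (simp add: power3_eq_cube power2_eq_square)
  also have "\<dots> \<le> \<bar>t\<bar> ^ 3 * (d * v + l / d)"
    using v0 d vl order_trans[OF zero_le_power2 vl] by (simp add: mult_nonneg_nonneg)
  finally have a: "cmod (char (distr M borel Y) t - (1 - t\<^sup>2 * v / 2)) \<le> \<bar>t\<bar> ^ 3 * (d * v + l / d)" .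
  have "\<bar>(1 - t\<^sup>2 * v / 2) - exp (- (t\<^sup>2 * v / 2))\<bar> \<le> (t\<^sup>2 * v / 2)\<^sup>2 / 2"
    by (rule exp_minus_approx) (use v0 in simp)
  also have "\<dots> = t ^ 4 * v\<^sup>2 / 8" by (simp add: power_mult_distrib power_divide)
  also have "\<dots> \<le> t ^ 4 * l"
  proof -
    have "t ^ 4 * v\<^sup>2 \<le> t ^ 4 * l" by (intro mult_left_mono vl) simp
    moreover have "0 \<le> t ^ 4 * v\<^sup>2" by simp
    ultimately show ?thesis by linarith
  qed
  finally have b: "cmod (of_real (1 - t\<^sup>2 * v / 2) - of_real (exp (- (t\<^sup>2 * v / 2)))) \<le> t ^ 4 * l"
    unfolding of_real_diff[symmetric] norm_of_real .
  show "cmod (char (distr M borel Y) t - of_real (exp (- (t\<^sup>2 * v / 2))))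
      \<le> \<bar>t\<bar> ^ 3 * (d * v + l / d) + t ^ 4 * l"
    using norm_triangle_mono[OF a b] by simp
qed

text \<open>Factor by factor, characteristic functions are compared with Gaussian ones of the same
  variance. The product of the latter involves the actual row variance, so row variances need only
  converge.\<close>

theorem lyapunov_central_limit:
  fixes P :: "nat \<Rightarrow> 'b measure" and Y :: "nat \<Rightarrow> 'i \<Rightarrow> 'b \<Rightarrow> real"
  assumes P: "\<And>k. prob_space (P k)" and J: "\<And>k. finite (J k)"
    and ind: "\<And>k. prob_space.indep_vars (P k) (\<lambda>_. borel) (Y k) (J k)"
    and i4: "\<And>k j. j \<in> J k \<Longrightarrow> integrable (P k) (\<lambda>x. (Y k j x) ^ 4)"
    and mean: "\<And>k j. j \<in> J k \<Longrightarrow> (\<integral>x. Y k j x \<partial>P k) = 0"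
    and var: "(\<lambda>k. \<Sum>j\<in>J k. \<integral>x. (Y k j x)\<^sup>2 \<partial>P k) \<longlonglongrightarrow> \<tau>\<^sup>2" and \<tau>: "\<tau> > 0"
    and lyap: "(\<lambda>k. \<Sum>j\<in>J k. \<integral>x. (Y k j x) ^ 4 \<partial>P k) \<longlonglongrightarrow> 0"
  shows "weak_conv_m (\<lambda>k. distr (P k) borel (\<lambda>x. \<Sum>j\<in>J k. Y k j x)) (density lborel (normal_density 0 \<tau>))"
proof (rule levy_continuity)
  have [measurable]: "Y k j \<in> borel_measurable (P k)" if "j \<in> J k" for k j
    using ind[of k] that unfolding prob_space.indep_vars_def[OF P] by auto
  show "real_distribution (distr (P k) borel (\<lambda>x. \<Sum>j\<in>J k. Y k j x))" for k
    by (intro prob_space.real_distribution_distr P) measurable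
  show "real_distribution (density lborel (normal_density 0 \<tau>))"
    by (rule normal_distribution_facts[OF \<tau>])
  fix t
  define v where "v k j = (\<integral>x. (Y k j x)\<^sup>2 \<partial>P k)" for k j
  define l where "l k j = (\<integral>x. (Y k j x) ^ 4 \<partial>P k)" for k j
  define V where "V k = (\<Sum>j\<in>J k. v k j)" for k
  define L where "L k = (\<Sum>j\<in>J k. l k j)" for k
  \<comment> \<open>Balances the two error terms: \<open>L k / d k\<close> is at most
    \<open>d k\<close>, which tends to 0. The term 1/(k+1) keeps \<open>d k\<close>
    positive.\<close>
  define d where "d k = sqrt (L k + 1 / real (Suc k))" for k
  have V: "V \<longlonglongrightarrow> \<tau>\<^sup>2" and L: "L \<longlonglongrightarrow> 0"
    using var lyap unfolding V_def[abs_def] v_def L_def[abs_def] l_def by auto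
  have L0: "L k \<ge> 0" for k unfolding L_def l_def by (intro sum_nonneg) auto
  have d0: "d k > 0" for k unfolding d_def using L0[of k] by (simp add: add_nonneg_pos)
  have "(\<lambda>k. sqrt (L k + 1 / real (Suc k))) \<longlonglongrightarrow> sqrt (0 + 0)"
    by (intro tendsto_intros L LIMSEQ_Suc[OF lim_1_over_n])
  then have d: "d \<longlonglongrightarrow> 0" unfolding d_def by simp
  have Ld: "L k / d k \<le> d k" for k
  proof -
    have "d k * d k = L k + 1 / real (Suc k)" unfolding d_def using L0[of k] by simp
    then have "L k \<le> d k * d k" by simp
    then show ?thesis using d0[of k] by (simp add: field_simps)
  qed
  define \<phi> where "\<phi> k j = char (distr (P k) borel (Y k j)) t" for k j
  have bound: "cmod (char (distr (P k) borel (\<lambda>x. \<Sum>j\<in>J k. Y k j x)) t - of_real (exp (- (t\<^sup>2 * V k / 2))))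
      \<le> \<bar>t\<bar> ^ 3 * (d k * V k + d k) + t ^ 4 * L k" for k
  proof -
    interpret Pk: prob_space "P k" by (rule P)
    note ap = Pk.char_quadratic_approx[of "Y k j" for j, OF _ mean i4 d0[of k], folded v_def l_def]
    have "char (distr (P k) borel (\<lambda>x. \<Sum>j\<in>J k. Y k j x)) t = (\<Prod>j\<in>J k. \<phi> k j)"
      unfolding \<phi>_def by (rule Pk.char_distr_sum[OF ind])
    moreover have "complex_of_real (exp (- (t\<^sup>2 * V k / 2))) = (\<Prod>j\<in>J k. of_real (exp (- (t\<^sup>2 * v k j / 2))))"
      unfolding of_real_prod[symmetric] exp_sum[OF J, symmetric] V_def
      by (simp add: sum_negf sum_distrib_left sum_divide_distrib)
    ultimately have "cmod (char (distr (P k) borel (\<lambda>x. \<Sum>j\<in>J k. Y k j x)) t - of_real (exp (- (t\<^sup>2 * V k / 2))))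
       = cmod ((\<Prod>j\<in>J k. \<phi> k j) - (\<Prod>j\<in>J k. of_real (exp (- (t\<^sup>2 * v k j / 2)))))" by simp
    also have "\<dots> \<le> (\<Sum>j\<in>J k. cmod (\<phi> k j - of_real (exp (- (t\<^sup>2 * v k j / 2)))))"
    proof (rule norm_prod_diff)
      fix j assume j: "j \<in> J k"
      have "real_distribution (distr (P k) borel (Y k j))"
        using j by (intro Pk.real_distribution_distr) auto
      then show "cmod (\<phi> k j) \<le> 1" unfolding \<phi>_def by (rule real_distribution.cmod_char_le_1)
      show "cmod (of_real (exp (- (t\<^sup>2 * v k j / 2)))) \<le> 1" using ap(3)[OF _ j j] j by simp
    qed
    also have "\<dots> \<le> (\<Sum>j\<in>J k. \<bar>t\<bar> ^ 3 * (d k * v k j + l k j / d k) + t ^ 4 * l k j)"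
      unfolding \<phi>_def by (intro sum_mono ap(1)) auto
    also have "\<dots> = \<bar>t\<bar> ^ 3 * (d k * V k + L k / d k) + t ^ 4 * L k"
      unfolding V_def L_def by (simp add: sum.distrib sum_distrib_left sum_divide_distrib distrib_left)
    also have "\<dots> \<le> \<bar>t\<bar> ^ 3 * (d k * V k + d k) + t ^ 4 * L k"
      using Ld[of k] by (intro add_mono mult_left_mono) (auto simp: d0 less_imp_le)
    finally show ?thesis .
  qed
  have "(\<lambda>k. \<bar>t\<bar> ^ 3 * (d k * V k + d k) + t ^ 4 * L k) \<longlonglongrightarrow> \<bar>t\<bar> ^ 3 * (0 * \<tau>\<^sup>2 + 0) + t ^ 4 * 0"
    by (intro tendsto_intros d V L)
  then have z: "(\<lambda>k. \<bar>t\<bar> ^ 3 * (d k * V k + d k) + t ^ 4 * L k) \<longlonglongrightarrow> 0" by simp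
  have e: "(\<lambda>k. complex_of_real (exp (- (t\<^sup>2 * V k / 2)))) \<longlonglongrightarrow> of_real (exp (- (t\<^sup>2 * \<tau>\<^sup>2 / 2)))"
    by (intro tendsto_intros V) auto
  have "(\<lambda>k. char (distr (P k) borel (\<lambda>x. \<Sum>j\<in>J k. Y k j x)) t - of_real (exp (- (t\<^sup>2 * V k / 2)))) \<longlonglongrightarrow> 0"
    by (rule Lim_null_comparison[OF always_eventually z]) (use bound in auto)
  from tendsto_add[OF this e]
  show "(\<lambda>k. char (distr (P k) borel (\<lambda>x. \<Sum>j\<in>J k. Y k j x)) t) \<longlonglongrightarrow>
      char (density lborel (normal_density 0 \<tau>)) t"
    by (simp add: normal_distribution_facts(2)[OF \<tau>] mult.commute)
qed

section \<open>Convergence in the Mallows metric\<close>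

lemma weak_conv_m_interleave:
  assumes "weak_conv_m \<mu> N" "weak_conv_m \<nu> N"
  shows "weak_conv_m (\<lambda>n. if even n then \<mu> (n div 2) else \<nu> (n div 2)) N"
  unfolding weak_conv_m_def weak_conv_def
proof (intro allI impI)
  fix x assume "isCont (cdf N) x"
  then have "(\<lambda>n. cdf (\<mu> n) x) \<longlonglongrightarrow> cdf N x" "(\<lambda>n. cdf (\<nu> n) x) \<longlonglongrightarrow> cdf N x"
    using assms unfolding weak_conv_m_def weak_conv_def by auto
  then show "(\<lambda>n. cdf (if even n then \<mu> (n div 2) else \<nu> (n div 2)) x) \<longlonglongrightarrow> cdf N x"
    by (intro limseq_even_odd[where f="\<lambda>n. cdf (if even n then \<mu> (n div 2) else \<nu> (n div 2)) x"]) simp_all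
qed

text \<open>Skorohod's theorem for the two sequences interleaved puts both of them and their limit on one
  probability space, which yields couplings without any gluing.\<close>

theorem mallows_dist_tendsto_0:
  assumes \<mu>: "\<And>k. real_distribution (\<mu> k)" and \<nu>: "\<And>k. real_distribution (\<nu> k)"
    and w: "weak_conv_m \<mu> N" "weak_conv_m \<nu> N" and N: "real_distribution N" "integrable N (\<lambda>z. z\<^sup>2)"
    and i\<mu>: "\<And>k. integrable (\<mu> k) (\<lambda>z. z\<^sup>2)" and i\<nu>: "\<And>k. integrable (\<nu> k) (\<lambda>z. z\<^sup>2)"
    and m\<mu>: "(\<lambda>k. \<integral>z. z\<^sup>2 \<partial>\<mu> k) \<longlonglongrightarrow> (\<integral>z. z\<^sup>2 \<partial>N)" and m\<nu>: "(\<lambda>k. \<integral>z. z\<^sup>2 \<partial>\<nu> k) \<longlonglongrightarrow> (\<integral>z. z\<^sup>2 \<partial>N)"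
    and c: "c' \<longlonglongrightarrow> c" and x: "Bseq x" and xy: "(\<lambda>k. x k - y k) \<longlonglongrightarrow> 0"
  shows "(\<lambda>k. mallows_dist (distr (\<mu> k) borel (\<lambda>z. c * (z + x k)))
                           (distr (\<nu> k) borel (\<lambda>z. c' k * (z + y k)))) \<longlonglongrightarrow> 0"
proof -
  define \<rho> where "\<rho> n = (if even n then \<mu> (n div 2) else \<nu> (n div 2))" for n :: nat
  have \<rho>: "real_distribution (\<rho> n)" for n unfolding \<rho>_def using \<mu> \<nu> by simp
  have "weak_conv_m \<rho> N" unfolding \<rho>_def using w by (rule weak_conv_m_interleave)
  from Skorohod[OF \<rho> N(1) this] obtain \<Omega> :: "real measure" and Ys Z where
    \<Omega>: "prob_space \<Omega>" and Ys[measurable]: "\<And>n. Ys n \<in> borel_measurable \<Omega>"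
    and Ysd: "\<And>n. distr \<Omega> borel (Ys n) = \<rho> n" and Z: "Z \<in> measurable \<Omega> lborel"
    and Zd: "distr \<Omega> borel Z = N" and lim: "\<And>u. u \<in> space \<Omega> \<Longrightarrow> (\<lambda>n. Ys n u) \<longlonglongrightarrow> Z u" by blast
  interpret \<Omega>: prob_space \<Omega> by (rule \<Omega>)
  have [measurable]: "Z \<in> borel_measurable \<Omega>" using Z by simp
  have i\<rho>: "integrable (\<rho> n) (\<lambda>z. z\<^sup>2)" for n unfolding \<rho>_def using i\<mu> i\<nu> by simp
  have iY: "integrable \<Omega> (\<lambda>u. (Ys n u)\<^sup>2)" for n
    using i\<rho>[of n] unfolding Ysd[symmetric] by (subst (asm) integrable_distr_eq) auto
  have iZ: "integrable \<Omega> (\<lambda>u. (Z u)\<^sup>2)"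
    using N(2) unfolding Zd[symmetric] by (subst (asm) integrable_distr_eq) auto
  have eY: "(\<integral>u. (Ys n u)\<^sup>2 \<partial>\<Omega>) = (\<integral>z. z\<^sup>2 \<partial>\<rho> n)" for n
    unfolding Ysd[symmetric] by (subst integral_distr) auto
  have eZ: "(\<integral>u. (Z u)\<^sup>2 \<partial>\<Omega>) = (\<integral>z. z\<^sup>2 \<partial>N)"
    unfolding Zd[symmetric] by (subst integral_distr) auto
  have m: "(\<lambda>n. \<integral>u. (Ys n u)\<^sup>2 \<partial>\<Omega>) \<longlonglongrightarrow> (\<integral>u. (Z u)\<^sup>2 \<partial>\<Omega>)"
    unfolding eY eZ by (rule limseq_even_odd) (use m\<mu> m\<nu> in \<open>simp_all add: \<rho>_def\<close>)
  define D where "D n = (\<integral>u. (Ys n u - Z u)\<^sup>2 \<partial>\<Omega>)" for n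
  have D: "D \<longlonglongrightarrow> 0"
    unfolding D_def by (rule L2_convergence_of_norms) (use lim iY iZ m in auto)
  have iD: "integrable \<Omega> (\<lambda>u. (Ys n u - Z u)\<^sup>2)" for n
  proof (rule Bochner_Integration.integrable_bound[where f="\<lambda>u. 2 * (Ys n u)\<^sup>2 + 2 * (Z u)\<^sup>2"])
    show "AE u in \<Omega>. norm ((Ys n u - Z u)\<^sup>2) \<le> norm (2 * (Ys n u)\<^sup>2 + 2 * (Z u)\<^sup>2)"
    proof (rule AE_I2)
      fix u
      have "(Ys n u - Z u)\<^sup>2 \<le> 2 * (Ys n u)\<^sup>2 + 2 * (Z u)\<^sup>2"
        using sum_squares_bound[of "Ys n u" "- Z u"] by (simp add: power2_diff)
      also have "\<dots> \<le> norm (2 * (Ys n u)\<^sup>2 + 2 * (Z u)\<^sup>2)" by simp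
      finally show "norm ((Ys n u - Z u)\<^sup>2) \<le> norm (2 * (Ys n u)\<^sup>2 + 2 * (Z u)\<^sup>2)"
        using zero_le_power2[of "Ys n u - Z u"] by (simp only: real_norm_def abs_of_nonneg)
    qed
  qed (use iY iZ in auto)
  \<comment> \<open>\<open>U - V\<close> is split into the distances of both variables to the common
    limit \<open>Z\<close>, the difference of the shifts and the difference of the scale factors;
    squaring a sum of four terms gives the 4.\<close>
  define E where "E k = 4 * (c\<^sup>2 * D (2 * k) + c\<^sup>2 * D (2 * k + 1) + c\<^sup>2 * (x k - y k)\<^sup>2 +
      (c - c' k)\<^sup>2 * (2 * (\<integral>z. z\<^sup>2 \<partial>\<nu> k) + 2 * (y k)\<^sup>2))" for k
  have bound: "0 \<le> mallows_dist (distr (\<mu> k) borel (\<lambda>z. c * (z + x k))) (distr (\<nu> k) borel (\<lambda>z. c' k * (z + y k)))"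
      (is "0 \<le> ?m")
    "mallows_dist (distr (\<mu> k) borel (\<lambda>z. c * (z + x k))) (distr (\<nu> k) borel (\<lambda>z. c' k * (z + y k))) \<le> sqrt (E k)"
    for k
  proof -
    define U where "U u = c * (Ys (2 * k) u + x k)" for u
    define V where "V u = c' k * (Ys (2 * k + 1) u + y k)" for u
    have [measurable]: "U \<in> borel_measurable \<Omega>" "V \<in> borel_measurable \<Omega>"
      by (auto simp: U_def[abs_def] V_def[abs_def])
    have \<mu>': "\<mu> k = distr \<Omega> borel (Ys (2 * k))" and \<nu>': "\<nu> k = distr \<Omega> borel (Ys (2 * k + 1))"
      by (simp_all add: Ysd \<rho>_def)
    have UV: "distr (\<mu> k) borel (\<lambda>z. c * (z + x k)) = distr \<Omega> borel U"
      "distr (\<nu> k) borel (\<lambda>z. c' k * (z + y k)) = distr \<Omega> borel V"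
      unfolding \<mu>' \<nu>' by (subst distr_distr; auto simp: comp_def U_def[abs_def] V_def[abs_def])+
    have sq: "(p + q + s + w)\<^sup>2 \<le> 4 * (p\<^sup>2 + q\<^sup>2 + s\<^sup>2 + w\<^sup>2)" for p q s w :: real
      using sum_squares_bound[of p q] sum_squares_bound[of p s] sum_squares_bound[of p w]
        sum_squares_bound[of q s] sum_squares_bound[of q w] sum_squares_bound[of s w]
      by (simp add: power2_eq_square algebra_simps)
    have pt: "(U u - V u)\<^sup>2 \<le> 4 * (c\<^sup>2 * (Ys (2 * k) u - Z u)\<^sup>2 + c\<^sup>2 * (Ys (2 * k + 1) u - Z u)\<^sup>2 + c\<^sup>2 * (x k - y k)\<^sup>2 +
      (c - c' k)\<^sup>2 * (2 * (Ys (2 * k + 1) u)\<^sup>2 + 2 * (y k)\<^sup>2))" for u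
    proof -
      have "U u - V u = c * (Ys (2 * k) u - Z u) + (- c) * (Ys (2 * k + 1) u - Z u) + c * (x k - y k) +
          (c - c' k) * (Ys (2 * k + 1) u + y k)" by (simp add: U_def V_def algebra_simps)
      moreover have "(Ys (2 * k + 1) u + y k)\<^sup>2 \<le> 2 * (Ys (2 * k + 1) u)\<^sup>2 + 2 * (y k)\<^sup>2"
        using sum_squares_bound[of "Ys (2 * k + 1) u" "y k"] by (simp add: power2_sum)
      then have "(c - c' k)\<^sup>2 * (Ys (2 * k + 1) u + y k)\<^sup>2 \<le> (c - c' k)\<^sup>2 * (2 * (Ys (2 * k + 1) u)\<^sup>2 + 2 * (y k)\<^sup>2)"
        by (intro mult_left_mono) auto
      ultimately show ?thesis
        using sq[of "c * (Ys (2 * k) u - Z u)" "(- c) * (Ys (2 * k + 1) u - Z u)" "c * (x k - y k)" "(c - c' k) * (Ys (2 * k + 1) u + y k)"]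
        by (simp add: power_mult_distrib)
    qed
    have "(\<integral>u. (U u - V u)\<^sup>2 \<partial>\<Omega>) \<le> (\<integral>u. 4 * (c\<^sup>2 * (Ys (2 * k) u - Z u)\<^sup>2 + c\<^sup>2 * (Ys (2 * k + 1) u - Z u)\<^sup>2 + c\<^sup>2 * (x k - y k)\<^sup>2 +
      (c - c' k)\<^sup>2 * (2 * (Ys (2 * k + 1) u)\<^sup>2 + 2 * (y k)\<^sup>2)) \<partial>\<Omega>)"
    proof (rule integral_mono_AE')
      show "integrable \<Omega> (\<lambda>u. 4 * (c\<^sup>2 * (Ys (2 * k) u - Z u)\<^sup>2 + c\<^sup>2 * (Ys (2 * k + 1) u - Z u)\<^sup>2 + c\<^sup>2 * (x k - y k)\<^sup>2 +
        (c - c' k)\<^sup>2 * (2 * (Ys (2 * k + 1) u)\<^sup>2 + 2 * (y k)\<^sup>2)))"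
        by (intro integrable_mult_right Bochner_Integration.integrable_add iD iY) auto
    qed (use pt in auto)
    also have "\<dots> = E k"
      unfolding E_def D_def using iD[of "2 * k"] iD[of "2 * k + 1"] iY[of "2 * k + 1"] eY[of "2 * k + 1"]
      by (simp add: \<Omega>.prob_space \<rho>_def)
    finally have le: "(\<integral>u. (U u - V u)\<^sup>2 \<partial>\<Omega>) \<le> E k" .
    show "0 \<le> mallows_dist (distr (\<mu> k) borel (\<lambda>z. c * (z + x k))) (distr (\<nu> k) borel (\<lambda>z. c' k * (z + y k)))"
      unfolding UV by (rule mallows_dist_le_coupling) (auto intro: \<Omega>)
    have "mallows_dist (distr \<Omega> borel U) (distr \<Omega> borel V) \<le> sqrt (\<integral>u. (U u - V u)\<^sup>2 \<partial>\<Omega>)"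
      by (rule mallows_dist_le_coupling) (auto intro: \<Omega>)
    also have "\<dots> \<le> sqrt (E k)" using le by simp
    finally show "mallows_dist (distr (\<mu> k) borel (\<lambda>z. c * (z + x k))) (distr (\<nu> k) borel (\<lambda>z. c' k * (z + y k))) \<le> sqrt (E k)"
      unfolding UV .
  qed
  obtain K where K: "\<And>k. \<bar>y k\<bar> \<le> K"
  proof -
    have "Bseq (\<lambda>k. x k - y k)" using xy by (intro convergent_imp_Bseq convergentI)
    then obtain K1 where K1: "\<And>k. \<bar>x k - y k\<bar> \<le> K1" unfolding Bseq_def by auto
    obtain K2 where K2: "\<And>k. \<bar>x k\<bar> \<le> K2" using x unfolding Bseq_def by auto
    have "\<bar>y k\<bar> \<le> K1 + K2" for k using K1[of k] K2[of k] by linarith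
    then show ?thesis by (rule that)
  qed
  have E0: "E \<longlonglongrightarrow> 0"
  proof -
    have cc: "(\<lambda>k. (c - c' k)\<^sup>2) \<longlonglongrightarrow> (c - c)\<^sup>2" by (intro tendsto_intros c)
    have "(\<lambda>k. (c - c' k)\<^sup>2 * K\<^sup>2) \<longlonglongrightarrow> (c - c)\<^sup>2 * K\<^sup>2" by (intro tendsto_intros c)
    then have K0: "(\<lambda>k. (c - c' k)\<^sup>2 * K\<^sup>2) \<longlonglongrightarrow> 0" by simp
    have b: "(\<lambda>k. (c - c' k)\<^sup>2 * (y k)\<^sup>2) \<longlonglongrightarrow> 0"
    proof (rule tendsto_sandwich[OF _ _ tendsto_const K0])
      have "(y k)\<^sup>2 \<le> K\<^sup>2" for k using K[of k] power_mono[of "\<bar>y k\<bar>" K 2] by simp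
      then show "\<forall>\<^sub>F k in sequentially. (c - c' k)\<^sup>2 * (y k)\<^sup>2 \<le> (c - c' k)\<^sup>2 * K\<^sup>2"
        by (intro always_eventually allI mult_left_mono) auto
    qed auto
    have D2: "(\<lambda>k. D (2 * k)) \<longlonglongrightarrow> 0" "(\<lambda>k. D (2 * k + 1)) \<longlonglongrightarrow> 0"
      by (rule filterlim_compose[OF D], rule filterlim_subseq, simp add: strict_mono_def)+
    have "(\<lambda>k. 4 * (c\<^sup>2 * D (2 * k) + c\<^sup>2 * D (2 * k + 1) + c\<^sup>2 * (x k - y k)\<^sup>2 +
      (2 * ((c - c' k)\<^sup>2 * (\<integral>z. z\<^sup>2 \<partial>\<nu> k)) + 2 * ((c - c' k)\<^sup>2 * (y k)\<^sup>2))))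
      \<longlonglongrightarrow> 4 * (c\<^sup>2 * 0 + c\<^sup>2 * 0 + c\<^sup>2 * 0\<^sup>2 + (2 * ((c - c)\<^sup>2 * (\<integral>z. z\<^sup>2 \<partial>N)) + 2 * 0))"
      by (intro tendsto_add tendsto_mult tendsto_const tendsto_power D2 xy m\<nu> b cc)
    then show ?thesis unfolding E_def by (simp add: algebra_simps)
  qed
  show ?thesis
  proof (rule tendsto_sandwich[of "\<lambda>_. 0"])
    show "(\<lambda>k. sqrt (E k)) \<longlonglongrightarrow> 0" using tendsto_real_sqrt[OF E0] by simp
  qed (use bound in auto)
qed

section \<open>Bias of the spectral estimates\<close>

text \<open>Under the bound \<open>w\<close> the infinite sums are integrals for counting measure.
  Domination is only eventual, so \<open>f'\<close> replaces the finitely many offending functions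
  by 0.\<close>

lemma infsum_dominated_convergence:
  fixes f :: "nat \<Rightarrow> 'i \<Rightarrow> real"
  assumes lim: "\<And>k. (\<lambda>n. f n k) \<longlonglongrightarrow> g k"
    and dom: "eventually (\<lambda>n. \<forall>k. \<bar>f n k\<bar> \<le> w k) sequentially"
    and w: "w summable_on UNIV"
  shows "(\<lambda>n. infsum (f n) UNIV) \<longlonglongrightarrow> infsum g UNIV"
proof -
  define f' where "f' n k = (if \<forall>k. \<bar>f n k\<bar> \<le> w k then f n k else 0)" for n k
  have ev: "eventually (\<lambda>n. f' n = f n) sequentially"
    using dom by eventually_elim (auto simp: f'_def)
  have w0: "w k \<ge> 0" for k
  proof -
    obtain n where "\<forall>k. \<bar>f n k\<bar> \<le> w k" using eventually_happens[OF dom] by auto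
    then show ?thesis by (meson abs_ge_zero order_trans)
  qed
  have f'_le: "\<bar>f' n k\<bar> \<le> w k" for n k using w0 by (auto simp: f'_def)
  have f'_lim: "(\<lambda>n. f' n k) \<longlonglongrightarrow> g k" for k
    by (rule Lim_transform_eventually[OF lim]) (use ev in eventually_elim, simp)
  have g_le: "\<bar>g k\<bar> \<le> w k" for k
    by (rule LIMSEQ_le_const2[OF tendsto_rabs[OF f'_lim]]) (use f'_le in auto)
  have as: "Infinite_Set_Sum.abs_summable_on h UNIV" if "\<And>k. \<bar>h k\<bar> \<le> w k" for h
  proof -
    have "(\<lambda>k. norm (h k)) summable_on UNIV"
      by (rule summable_on_comparison_test[OF w]) (use that in auto)
    then show ?thesis using abs_summable_equivalent by blast
  qed
  have eq: "infsum h UNIV = integral\<^sup>L (count_space UNIV) h" if "\<And>k. \<bar>h k\<bar> \<le> w k" for h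
    using infsetsum_infsum[OF as[OF that]] by (simp add: infsetsum_def)
  have wi: "integrable (count_space UNIV) w"
    using as[of w] w0 by (simp add: abs_summable_on_def)
  have "(\<lambda>n. integral\<^sup>L (count_space UNIV) (f' n)) \<longlonglongrightarrow> integral\<^sup>L (count_space UNIV) g"
    by (rule integral_dominated_convergence[OF _ _ wi]) (use f'_lim f'_le in \<open>auto simp: AE_count_space\<close>)
  then have "(\<lambda>n. infsum (f' n) UNIV) \<longlonglongrightarrow> infsum g UNIV"
    by (simp add: eq[OF f'_le] eq[OF g_le])
  then show ?thesis by (rule Lim_transform_eventually) (use ev in eventually_elim, simp)
qed

lemma lag_window_est_cos:
  "lag_window_est a m n x l =
     1 / (2 * pi) * (\<Sum>k=- int m..int m. sample_autocov n x k * a (of_int k * bandwidth m) * cos (of_int k * l))"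
  by (simp add: lag_window_est_def Re_divide_of_real[symmetric] flip: of_real_mult)

section \<open>Rates of the two bandwidths\<close>

locale bootstrap_setting = stationary_cumulants M X + lag_window a L
  for M :: "'a measure" and X :: "int \<Rightarrow> 'a \<Rightarrow> real" and a :: "real \<Rightarrow> real" and L :: real +
  fixes B Bt :: "nat \<Rightarrow> nat" and c2 lam :: real
  assumes B_pos: "\<And>n. B n > 0" and Bt_pos: "\<And>n. Bt n > 0"
    and B_top: "filterlim B at_top sequentially" and Bt_top: "filterlim Bt at_top sequentially"
    and B_small: "(\<lambda>n. real (B n)) \<in> o(\<lambda>n. real n)"
    and B_rate: "(\<lambda>n. bandwidth (B n)) \<in> \<Theta>(\<lambda>n. real n powr (- 1 / 5))"
    and B_Bt: "(\<lambda>n. bandwidth (B n)) \<in> o(\<lambda>n. bandwidth (Bt n))"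
    and A1: "((\<lambda>x. (1 - a x) / x\<^sup>2) \<longlongrightarrow> c2) (at 0)"
begin

abbreviation bw :: "nat \<Rightarrow> real" where "bw n \<equiv> bandwidth (B n)"
abbreviation bwt :: "nat \<Rightarrow> real" where "bwt n \<equiv> bandwidth (Bt n)"
abbreviation scale :: "nat \<Rightarrow> real" where "scale n \<equiv> sqrt (real n * bw n)"

lemma bw_pos: "bw n > 0" and bwt_pos: "bwt n > 0"
  using B_pos Bt_pos by auto

lemma bw_0: "bw \<longlonglongrightarrow> 0" and bwt_0: "bwt \<longlonglongrightarrow> 0"
  using bandwidth_tendsto_0 B_top Bt_top by auto

lemma powr_fifth: "n > 0 \<Longrightarrow> (real n powr (- 1 / 5)) ^ 5 = 1 / real n"
proof -
  assume n: "n > 0"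
  have "(real n powr (- 1 / 5)) ^ 5 = real n powr (of_nat 5 * (- 1 / 5))"
    by (rule powr_power) (use n in simp)
  also have "of_nat 5 * (- 1 / 5) = (- 1 :: real)" by simp
  finally show ?thesis using n by (simp add: powr_minus_divide)
qed

lemma n_bw5_bounded: "\<exists>C>0. eventually (\<lambda>n. real n * bw n ^ 5 \<le> C) sequentially"
proof -
  obtain c where c: "c > 0" "eventually (\<lambda>n. norm (bw n) \<le> c * norm (real n powr (- 1 / 5))) sequentially"
    using bigthetaD1[OF B_rate] by (elim landau_o.bigE)
  have "eventually (\<lambda>n. real n * bw n ^ 5 \<le> c ^ 5) sequentially"
    using c(2) eventually_gt_at_top[of 0]
  proof eventually_elim
    case (elim n)
    have "bw n \<le> c * real n powr (- 1 / 5)" using elim(1) by simp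
    then have "bw n ^ 5 \<le> (c * real n powr (- 1 / 5)) ^ 5" using bw_pos[of n] by (intro power_mono) auto
    also have "\<dots> = c ^ 5 / real n" unfolding power_mult_distrib powr_fifth[OF elim(2)] by simp
    finally show ?case using elim by (simp add: field_simps)
  qed
  then show ?thesis using c(1) by (intro exI[of _ "c ^ 5"]) auto
qed

lemma B5_bounded: "\<exists>C>0. eventually (\<lambda>n. real (B n) ^ 5 / real n \<le> C) sequentially"
proof -
  obtain c where c: "c > 0" "eventually (\<lambda>n. norm (bw n) \<ge> c * norm (real n powr (- 1 / 5))) sequentially"
    using bigthetaD2[OF B_rate] by (elim landau_omega.bigE)
  have "eventually (\<lambda>n. real (B n) ^ 5 / real n \<le> 1 / c ^ 5) sequentially"
    using c(2) eventually_gt_at_top[of 0]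
  proof eventually_elim
    case (elim n)
    have "c * real n powr (- 1 / 5) \<le> bw n" using elim(1) by simp
    then have "(c * real n powr (- 1 / 5)) ^ 5 \<le> bw n ^ 5" using c by (intro power_mono) auto
    then have "c ^ 5 / real n \<le> 1 / real (B n) ^ 5"
      unfolding power_mult_distrib powr_fifth[OF elim(2)] power_one_over by simp
    then show ?case using elim B_pos[of n] c(1) by (simp add: field_simps)
  qed
  then show ?thesis using c(1) by (intro exI[of _ "1 / c ^ 5"]) auto
qed

lemma Bt_bw_0: "(\<lambda>n. real (Bt n) * bw n) \<longlonglongrightarrow> 0"
  using smalloD_tendsto[OF B_Bt] by (simp add: mult.commute)

lemma B_over_n_0: "(\<lambda>n. real (B n) / real n) \<longlonglongrightarrow> 0"
  by (rule smalloD_tendsto[OF B_small])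

text \<open>The factor 1 - |k|/n in the mean of the sample autocovariances becomes |k| B_n^2/n after
  division by b_n^2; this limit makes it negligible.\<close>

lemma B2_over_n_0: "(\<lambda>n. real (B n) ^ 2 / real n) \<longlonglongrightarrow> 0"
proof -
  obtain C where C: "eventually (\<lambda>n. real (B n) ^ 5 / real n \<le> C) sequentially" using B5_bounded by blast
  show ?thesis
  proof (rule tendsto_sandwich[OF _ _ tendsto_const])
    show "\<forall>\<^sub>F n in sequentially. real (B n) ^ 2 / real n \<le> C * bw n ^ 3"
      using C
    proof eventually_elim
      case (elim n)
      have "real (B n) ^ 2 / real n = (real (B n) ^ 5 / real n) * bw n ^ 3"
        using B_pos[of n] by (simp add: power_one_over eval_nat_numeral)
      also have "\<dots> \<le> C * bw n ^ 3" using elim bw_pos[of n] by (intro mult_right_mono) auto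
      finally show ?case .
    qed
    show "(\<lambda>n. C * bw n ^ 3) \<longlonglongrightarrow> 0"
      using tendsto_mult_left[OF tendsto_power[OF bw_0, of 3], of C] by simp
  qed auto
qed

text \<open>The order of the variance of \<open>pilot_noise\<close>. Here the faster decay of the
  bandwidth b_n relative to the pilot bandwidth is used.\<close>

lemma Bt5_over_n_0: "(\<lambda>n. real (Bt n) ^ 5 / real n) \<longlonglongrightarrow> 0"
proof -
  obtain C where C: "eventually (\<lambda>n. real (B n) ^ 5 / real n \<le> C) sequentially" using B5_bounded by blast
  show ?thesis
  proof (rule tendsto_sandwich[OF _ _ tendsto_const])
    show "\<forall>\<^sub>F n in sequentially. real (Bt n) ^ 5 / real n \<le> C * (real (Bt n) * bw n) ^ 5"
      using C
    proof eventually_elim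
      case (elim n)
      have "real (Bt n) ^ 5 / real n = (real (B n) ^ 5 / real n) * (real (Bt n) * bw n) ^ 5"
        using B_pos[of n] by (simp add: power_divide)
      also have "\<dots> \<le> C * (real (Bt n) * bw n) ^ 5" using elim bw_pos[of n] by (intro mult_right_mono) auto
      finally show ?case .
    qed
    show "(\<lambda>n. C * (real (Bt n) * bw n) ^ 5) \<longlonglongrightarrow> 0"
      using tendsto_mult_left[OF tendsto_power[OF Bt_bw_0, of 5], of C] by simp
  qed auto
qed

lemma scale_bw2_bounded: "\<exists>C>0. eventually (\<lambda>n. scale n * (bw n)\<^sup>2 \<le> C) sequentially"
proof -
  obtain C where C: "C > 0" "eventually (\<lambda>n. real n * bw n ^ 5 \<le> C) sequentially" using n_bw5_bounded by blast
  have "eventually (\<lambda>n. scale n * (bw n)\<^sup>2 \<le> sqrt C) sequentially"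
    using C(2)
  proof eventually_elim
    case (elim n)
    have "sqrt ((bw n ^ 2)\<^sup>2) = bw n ^ 2" by (rule real_sqrt_unique) auto
    then have "scale n * (bw n)\<^sup>2 = sqrt (real n * bw n) * sqrt ((bw n ^ 2)\<^sup>2)" by (simp only:)
    also have "\<dots> = sqrt (real n * bw n ^ 5)"
    proof -
      have "q * x * (x\<^sup>2)\<^sup>2 = q * x ^ 5" for q x :: real by algebra
      then show ?thesis unfolding real_sqrt_mult[symmetric] by (simp only:)
    qed
    also have "\<dots> \<le> sqrt C" using elim by simp
    finally show ?case .
  qed
  then show ?thesis using C(1) by (intro exI[of _ "sqrt C"]) auto
qed

text \<open>The order, after scaling, of the contribution of frequency 0, which the bootstrap sets
  to zero.\<close>

lemma scale_B_over_n_0: "(\<lambda>n. scale n * (real (B n) / real n)) \<longlonglongrightarrow> 0"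
proof (rule Lim_transform_eventually)
  show "(\<lambda>n. sqrt (real (B n) / real n)) \<longlonglongrightarrow> 0"
    using tendsto_real_sqrt[OF B_over_n_0] by simp
  show "\<forall>\<^sub>F n in sequentially. sqrt (real (B n) / real n) = scale n * (real (B n) / real n)"
    using eventually_gt_at_top[of 0]
  proof eventually_elim
    case (elim n)
    have "scale n * (real (B n) / real n) = sqrt (real n * bw n) * sqrt ((real (B n) / real n)\<^sup>2)" by simp
    also have "\<dots> = sqrt (real (B n) / real n)"
      unfolding real_sqrt_mult[symmetric] using elim B_pos[of n]
      by (intro arg_cong[where f=sqrt]) (simp add: power2_eq_square field_simps)
    finally show ?case ..
  qed
qed

text \<open>Near 0 this is the limit \<open>A1\<close>; away from 0 the numerator is bounded and x^2
  is not small. The global form supplies the dominating series for all lags at once.\<close>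

lemma one_minus_window_le: "\<exists>C>0. \<forall>x. \<bar>1 - a x\<bar> \<le> C * x\<^sup>2"
proof -
  have "eventually (\<lambda>x. dist ((1 - a x) / x\<^sup>2) c2 < 1) (at 0)" by (rule tendstoD[OF A1]) simp
  then obtain d where d: "d > 0" "\<And>x. x \<noteq> 0 \<Longrightarrow> \<bar>x\<bar> < d \<Longrightarrow> \<bar>(1 - a x) / x\<^sup>2 - c2\<bar> < 1"
    unfolding eventually_at by (auto simp: dist_real_def)
  define C where "C = \<bar>c2\<bar> + 1 + (2 + L) / d\<^sup>2"
  have "0 \<le> (2 + L) / d\<^sup>2" using L_nonneg by simp
  then have C: "C > 0" "\<bar>c2\<bar> + 1 \<le> C" "(2 + L) / d\<^sup>2 \<le> C" unfolding C_def by linarith+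
  have "\<bar>1 - a x\<bar> \<le> C * x\<^sup>2" for x
  proof -
    consider "x = 0" | "x \<noteq> 0" "\<bar>x\<bar> < d" | "\<bar>x\<bar> \<ge> d" by linarith
    then show ?thesis
    proof cases
      case 1 then show ?thesis using at_0 by simp
    next
      case 2
      then have "\<bar>(1 - a x) / x\<^sup>2\<bar> \<le> C" using d(2)[OF 2] C by linarith
      then show ?thesis using 2 by (simp add: abs_divide field_simps)
    next
      case 3
      have "\<bar>1 - a x\<bar> \<le> 2 + L" using bound[of x] by linarith
      also have "\<dots> = (2 + L) / d\<^sup>2 * d\<^sup>2" using d by simp
      also have "\<dots> \<le> C * x\<^sup>2"
        using C L_nonneg d(1) 3 power_mono[of d "\<bar>x\<bar>" 2] by (intro mult_mono) auto
      finally show ?thesis .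
    qed
  qed
  then show ?thesis using C by blast
qed

definition window_C :: real where
  "window_C = (SOME C. C > 0 \<and> (\<forall>x. \<bar>1 - a x\<bar> \<le> C * x\<^sup>2))"

lemma window_C: "window_C > 0" "\<bar>1 - a x\<bar> \<le> window_C * x\<^sup>2"
  using someI_ex[OF one_minus_window_le] unfolding window_C_def by auto

lemma window_C_scaled: "b > 0 \<Longrightarrow> \<bar>(a (of_int k * b) - 1) / b\<^sup>2\<bar> \<le> window_C * (of_int k)\<^sup>2"
  using window_C(2)[of "of_int k * b"]
  by (simp add: abs_divide power_mult_distrib field_simps abs_minus_commute)

lemma window_second_order:
  "(\<lambda>n. (a (of_int k * bw n) - 1) / (bw n)\<^sup>2) \<longlonglongrightarrow> - c2 * (of_int k)\<^sup>2"
proof (cases "k = 0")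
  case True then show ?thesis using at_0 by simp
next
  case False
  have "filterlim (\<lambda>n. of_int k * bw n) (at 0) sequentially"
    unfolding filterlim_at using tendsto_mult_left[OF bw_0, of "of_int k"] False bw_pos
    by (auto intro!: always_eventually simp: less_imp_neq[symmetric])
  from filterlim_compose[OF A1 this]
  have "(\<lambda>n. - ((1 - a (of_int k * bw n)) / (of_int k * bw n)\<^sup>2) * (of_int k)\<^sup>2) \<longlonglongrightarrow> - c2 * (of_int k)\<^sup>2"
    by (intro tendsto_intros)
  moreover have "- ((1 - a (of_int k * bw n)) / (of_int k * bw n)\<^sup>2) * (of_int k)\<^sup>2 = (a (of_int k * bw n) - 1) / (bw n)\<^sup>2" for n
    using False bw_pos[of n] by (simp add: power_mult_distrib field_simps)
  ultimately show ?thesis by simp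
qed

lemma window_at_0: "b \<longlonglongrightarrow> 0 \<Longrightarrow> (\<lambda>n. a (of_int k * b n)) \<longlonglongrightarrow> 1"
proof -
  assume b: "b \<longlonglongrightarrow> 0"
  have "isCont a 0" using lipschitz_on_continuous_on[OF lipschitz] by (simp add: continuous_on_eq_continuous_at)
  moreover have "(\<lambda>n. of_int k * b n) \<longlonglongrightarrow> 0" using tendsto_mult_left[OF b, of "of_int k"] by simp
  ultimately show ?thesis using isCont_tendsto_compose[of 0 a] at_0 by metis
qed

lemma window_out: "m > 0 \<Longrightarrow> \<bar>k\<bar> \<ge> int m \<Longrightarrow> a (of_int k * bandwidth m) = 0"
proof (rule zero)
  assume m: "m > 0" and k: "\<bar>k\<bar> \<ge> int m"
  then have "real m \<le> \<bar>of_int k\<bar>" by (metis of_int_abs of_int_le_iff of_int_of_nat_eq)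
  then show "1 \<le> \<bar>of_int k * bandwidth m\<bar>" using m by (simp add: abs_mult field_simps)
qed

lemma abs_le_square_int: "\<bar>real_of_int k\<bar> \<le> (of_int k)\<^sup>2"
proof -
  have "\<bar>k\<bar> * 1 \<le> \<bar>k\<bar> * \<bar>k\<bar>" by (cases "k = 0") (simp, intro mult_left_mono, auto)
  then have "\<bar>k\<bar> \<le> k\<^sup>2" by (simp add: power2_eq_square)
  then show ?thesis by (metis of_int_abs of_int_le_iff of_int_power)
qed

text \<open>This is 2 pi \<open>c2\<close> times the second derivative of the spectral density at
  \<open>lam\<close>.\<close>

definition curvature :: real where
  "curvature = (\<Sum>\<^sub>\<infinity>k. - c2 * (of_int k)\<^sup>2 * (r k * cos (of_int k * lam)))"

lemma infsum_sum_window: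
  assumes "m > 0"
  shows "(\<Sum>\<^sub>\<infinity>k. a (of_int k * bandwidth m) * g k) = (\<Sum>k=- int m..int m. a (of_int k * bandwidth m) * g k)"
proof -
  have "(\<Sum>\<^sub>\<infinity>k. a (of_int k * bandwidth m) * g k) = (\<Sum>\<^sub>\<infinity>k\<in>{- int m..int m}. a (of_int k * bandwidth m) * g k)"
    by (rule infsum_cong_neutral) (use window_out[OF assms] in auto)
  then show ?thesis by simp
qed

abbreviation fhat :: "nat \<Rightarrow> 'a \<Rightarrow> real \<Rightarrow> real" where
  "fhat n \<omega> \<equiv> lag_window_est a (B n) n (\<lambda>t. X t \<omega>)"

abbreviation pilot :: "nat \<Rightarrow> 'a \<Rightarrow> real \<Rightarrow> real" where
  "pilot n \<omega> \<equiv> lag_window_est a (Bt n) n (\<lambda>t. X t \<omega>)"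

lemma integrable_fhat: "integrable M (\<lambda>\<omega>. fhat n \<omega> w)"
  unfolding lag_window_est_cos
  by (intro integrable_mult_right integrable_mult_left Bochner_Integration.integrable_sum integrable_racov)

lemma expectation_fhat:
  assumes "B n < n"
  shows "2 * pi * expectation (\<lambda>\<omega>. fhat n \<omega> lam) =
    (\<Sum>\<^sub>\<infinity>k. a (of_int k * bw n) * ((1 - \<bar>of_int k\<bar> / real n) * (r k * cos (of_int k * lam))))"
proof -
  have "2 * pi * expectation (\<lambda>\<omega>. fhat n \<omega> lam) =
    (\<Sum>k=- int (B n)..int (B n). expectation (\<lambda>\<omega>. racov n \<omega> k) * a (of_int k * bw n) * cos (of_int k * lam))"
    unfolding lag_window_est_cos by (simp add: integrable_racov Bochner_Integration.integral_sum)
  also have "\<dots> = (\<Sum>k=- int (B n)..int (B n). a (of_int k * bw n) * ((1 - \<bar>of_int k\<bar> / real n) * (r k * cos (of_int k * lam))))"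
  proof (intro sum.cong refl)
    fix k assume "k \<in> {- int (B n)..int (B n)}"
    then have "\<bar>k\<bar> \<le> int n" "n > 0" using assms by auto
    then show "expectation (\<lambda>\<omega>. racov n \<omega> k) * a (of_int k * bw n) * cos (of_int k * lam) =
        a (of_int k * bw n) * ((1 - \<bar>of_int k\<bar> / real n) * (r k * cos (of_int k * lam)))"
      by (simp add: expectation_racov)
  qed
  finally show ?thesis unfolding infsum_sum_window[OF B_pos] .
qed

lemma autocov_dominated:
  assumes "\<bar>c\<bar> \<le> C * (of_int k)\<^sup>2"
  shows "\<bar>c * (r k * cos (of_int k * w))\<bar> \<le> C * (\<bar>r k\<bar> * (of_int k)\<^sup>2)"
proof -
  have "\<bar>c * (r k * cos (of_int k * w))\<bar> \<le> \<bar>c\<bar> * (\<bar>r k\<bar> * 1)"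
    unfolding abs_mult by (intro mult_left_mono) auto
  also have "\<dots> \<le> (C * (of_int k)\<^sup>2) * (\<bar>r k\<bar> * 1)" using assms by (intro mult_right_mono) auto
  finally show ?thesis by (simp add: mult_ac)
qed

lemma dominating_summable: "(\<lambda>k. C * (\<bar>r k\<bar> * (of_int k)\<^sup>2)) summable_on UNIV"
  by (intro summable_on_cmult_right autocov_summable)

text \<open>After division by b_n^2 the coefficients of the autocovariances converge lag by lag, and
  the series of |r(k)| k^2 dominates them.\<close>

theorem fhat_bias: "(\<lambda>n. 2 * pi * (expectation (\<lambda>\<omega>. fhat n \<omega> lam) - sd lam) / (bw n)\<^sup>2) \<longlonglongrightarrow> curvature"
proof -
  \<comment> \<open>The first term is the smoothing bias. The second comes from the factor 1 -
    |k|/n, with 1 / b_n^2 written as B_n^2.\<close>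
  define g where "g n k = (a (of_int k * bw n) - 1) / (bw n)\<^sup>2 - \<bar>of_int k\<bar> * a (of_int k * bw n) * (real (B n) ^ 2 / real n)" for n and k :: int
  have "(\<lambda>n. \<Sum>\<^sub>\<infinity>k. g n k * (r k * cos (of_int k * lam))) \<longlonglongrightarrow> curvature"
    unfolding curvature_def
  proof (rule infsum_dominated_convergence[OF _ _ dominating_summable[of "window_C + (1 + L)"]])
    fix k :: int
    have "(\<lambda>n. g n k) \<longlonglongrightarrow> - c2 * (of_int k)\<^sup>2 - \<bar>of_int k\<bar> * 1 * 0"
      unfolding g_def by (intro tendsto_intros window_second_order window_at_0 bw_0 B2_over_n_0)
    then show "(\<lambda>n. g n k * (r k * cos (of_int k * lam))) \<longlonglongrightarrow> - c2 * (of_int k)\<^sup>2 * (r k * cos (of_int k * lam))"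
      by (intro tendsto_mult_right) simp
  next
    have "eventually (\<lambda>n. real (B n) ^ 2 / real n < 1) sequentially"
      by (rule order_tendstoD(2)[OF B2_over_n_0]) simp
    then show "eventually (\<lambda>n. \<forall>k. \<bar>g n k * (r k * cos (of_int k * lam))\<bar> \<le> (window_C + (1 + L)) * (\<bar>r k\<bar> * (of_int k)\<^sup>2)) sequentially"
    proof eventually_elim
      case (elim n)
      have "\<bar>g n k\<bar> \<le> (window_C + (1 + L)) * (of_int k)\<^sup>2" for k
      proof -
        have "\<bar>\<bar>of_int k\<bar> * a (of_int k * bw n) * (real (B n) ^ 2 / real n)\<bar> \<le> (of_int k)\<^sup>2 * (1 + L) * 1"
          unfolding abs_mult using elim abs_le_square_int[of k] bound L_nonneg by (intro mult_mono) auto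
        then have "\<bar>\<bar>of_int k\<bar> * a (of_int k * bw n) * (real (B n) ^ 2 / real n)\<bar> \<le> (1 + L) * (of_int k)\<^sup>2"
          by (simp only: mult.commute mult_1_right)
        then show ?thesis using window_C_scaled[OF bw_pos[of n], of k]
          unfolding g_def distrib_right[of window_C] by linarith
      qed
      then show ?case by (intro allI autocov_dominated)
    qed
  qed
  then show ?thesis
  proof (rule Lim_transform_eventually)
    show "\<forall>\<^sub>F n in sequentially. (\<Sum>\<^sub>\<infinity>k. g n k * (r k * cos (of_int k * lam))) = 2 * pi * (expectation (\<lambda>\<omega>. fhat n \<omega> lam) - sd lam) / (bw n)\<^sup>2"
      using eventually_window_small[OF B_small]
    proof eventually_elim
      case (elim n)
      then have n: "B n < n" "real n > 0" by auto
      have fin: "(\<lambda>k. a (of_int k * bw n) * ((1 - \<bar>of_int k\<bar> / real n) * (r k * cos (of_int k * lam)))) summable_on UNIV"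
      proof -
        have "(\<lambda>k. a (of_int k * bw n) * ((1 - \<bar>of_int k\<bar> / real n) * (r k * cos (of_int k * lam)))) summable_on {- int (B n)..int (B n)}" by simp
        then show ?thesis
          by (rule iffD1[OF summable_on_cong_neutral, rotated -1]) (use window_out[OF B_pos[of n]] in auto)
      qed
      have "((\<lambda>k. (a (of_int k * bw n) * ((1 - \<bar>of_int k\<bar> / real n) * (r k * cos (of_int k * lam))) + - (r k * cos (of_int k * lam))) * (1 / (bw n)\<^sup>2)) has_sum
          (2 * pi * expectation (\<lambda>\<omega>. fhat n \<omega> lam) + - (2 * pi * sd lam)) * (1 / (bw n)\<^sup>2)) UNIV"
        unfolding expectation_fhat[OF n(1)]
        by (intro has_sum_cmult_left has_sum_add has_sum_infsum[OF fin] has_sum_uminusI[OF sd_has_sum])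
      moreover have "(a (of_int k * bw n) * ((1 - \<bar>of_int k\<bar> / real n) * (r k * cos (of_int k * lam))) + - (r k * cos (of_int k * lam))) * (1 / (bw n)\<^sup>2)
          = g n k * (r k * cos (of_int k * lam))" for k
      proof -
        have bsq: "1 / (bw n)\<^sup>2 = real (B n) ^ 2" by (simp add: power_one_over)
        have e: "(a (of_int k * bw n) - 1) / (bw n)\<^sup>2 = (a (of_int k * bw n) - 1) * (1 / (bw n)\<^sup>2)" by simp
        have g: "g n k = (a (of_int k * bw n) - 1) * (1 / (bw n)\<^sup>2) - \<bar>of_int k\<bar> * a (of_int k * bw n) * (1 / (bw n)\<^sup>2 / real n)"
          unfolding g_def e unfolding bsq ..
        have "(\<alpha> * ((1 - \<kappa> / \<nu>) * \<rho>) + - \<rho>) * \<beta> = ((\<alpha> - 1) * \<beta> - \<kappa> * \<alpha> * (\<beta> / \<nu>)) * \<rho>" for \<alpha> \<kappa> \<nu> \<rho> \<beta> :: real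
          by (simp add: algebra_simps)
        then show ?thesis unfolding g .
      qed
      ultimately have "((\<lambda>k. g n k * (r k * cos (of_int k * lam))) has_sum
          (2 * pi * expectation (\<lambda>\<omega>. fhat n \<omega> lam) + - (2 * pi * sd lam)) * (1 / (bw n)\<^sup>2)) UNIV" by simp
      then show ?case by (auto dest!: infsumI simp: right_diff_distrib)
    qed
  qed
qed

text \<open>The coefficient of the k-th sample autocovariance in 2 pi times the bootstrap bias,
  divided by b_n^2: one window comes from the pilot estimate, the difference of windows from
  smoothing it again.\<close>

definition pilot_coeff :: "nat \<Rightarrow> int \<Rightarrow> real" where
  "pilot_coeff n k = a (of_int k * bwt n) * ((a (of_int k * bw n) - 1) / (bw n)\<^sup>2) * cos (of_int k * lam)"

definition pilot_noise :: "nat \<Rightarrow> 'a \<Rightarrow> real" where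
  "pilot_noise n \<omega> = (\<Sum>k=- int (Bt n)..int (Bt n). pilot_coeff n k * (racov n \<omega> k - (1 - \<bar>of_int k\<bar> / real n) * r k))"

lemma eventually_Bt_le_B: "eventually (\<lambda>n. Bt n \<le> B n) sequentially"
proof -
  have "eventually (\<lambda>n. real (Bt n) * bw n < 1) sequentially"
    by (rule order_tendstoD(2)[OF Bt_bw_0]) simp
  then show ?thesis
  proof eventually_elim
    case (elim n)
    then have "real (Bt n) < real (B n)" using B_pos[of n] by (simp add: field_simps)
    then show ?case by simp
  qed
qed

text \<open>The extra factors, the pilot window and 1 - |k|/n, tend to 1 at every lag, so the limit
  is that of \<open>fhat_bias\<close>. Large lags, where 1 - |k|/n is not bounded by 1, are cut off
  by the pilot window.\<close>

theorem pilot_bias: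
  "(\<lambda>n. \<Sum>k=- int (Bt n)..int (Bt n). pilot_coeff n k * ((1 - \<bar>of_int k\<bar> / real n) * r k)) \<longlonglongrightarrow> curvature"
proof -
  define g where "g n k = (1 - \<bar>of_int k\<bar> / real n) * a (of_int k * bwt n) * ((a (of_int k * bw n) - 1) / (bw n)\<^sup>2)" for n and k :: int
  have "(\<lambda>n. \<Sum>\<^sub>\<infinity>k. g n k * (r k * cos (of_int k * lam))) \<longlonglongrightarrow> curvature"
    unfolding curvature_def
  proof (rule infsum_dominated_convergence[OF _ _ dominating_summable[of "(1 + L) * window_C"]])
    fix k :: int
    have "(\<lambda>n. g n k) \<longlonglongrightarrow> (1 - 0) * 1 * (- c2 * (of_int k)\<^sup>2)"
      unfolding g_def by (intro tendsto_intros window_second_order window_at_0 bwt_0 lim_const_over_n)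
    then show "(\<lambda>n. g n k * (r k * cos (of_int k * lam))) \<longlonglongrightarrow> - c2 * (of_int k)\<^sup>2 * (r k * cos (of_int k * lam))"
      by (intro tendsto_mult_right) simp
  next
    show "eventually (\<lambda>n. \<forall>k. \<bar>g n k * (r k * cos (of_int k * lam))\<bar> \<le> ((1 + L) * window_C) * (\<bar>r k\<bar> * (of_int k)\<^sup>2)) sequentially"
      using eventually_window_small[OF B_small] eventually_Bt_le_B
    proof eventually_elim
      case (elim n)
      have "\<bar>g n k\<bar> \<le> ((1 + L) * window_C) * (of_int k)\<^sup>2" for k
      proof (cases "\<bar>k\<bar> \<ge> int (Bt n)")
        case True
        then show ?thesis using window_out[OF Bt_pos True] window_C(1) L_nonneg by (simp add: g_def)
      next
        case False
        then have "\<bar>k\<bar> \<le> int n" using elim by linarith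
        then have "\<bar>real_of_int k\<bar> \<le> real n" by linarith
        then have "\<bar>1 - \<bar>of_int k\<bar> / real n\<bar> \<le> 1" using elim(1) by (simp add: abs_le_iff field_simps)
        then have "\<bar>g n k\<bar> \<le> 1 * (1 + L) * (window_C * (of_int k)\<^sup>2)"
          unfolding g_def abs_mult using bound window_C_scaled[OF bw_pos[of n], of k] L_nonneg window_C(1)
          by (intro mult_mono) (auto simp: abs_mult)
        then show ?thesis by (simp add: mult_ac)
      qed
      then show ?case by (intro allI autocov_dominated)
    qed
  qed
  moreover have "(\<Sum>\<^sub>\<infinity>k. g n k * (r k * cos (of_int k * lam))) =
      (\<Sum>k=- int (Bt n)..int (Bt n). pilot_coeff n k * ((1 - \<bar>of_int k\<bar> / real n) * r k))" for n
  proof -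
    have "g n k * (r k * cos (of_int k * lam)) = a (of_int k * bwt n) *
       ((1 - \<bar>of_int k\<bar> / real n) * ((a (of_int k * bw n) - 1) / (bw n)\<^sup>2) * (r k * cos (of_int k * lam)))" for k
      by (simp only: g_def mult_ac)
    then have "(\<Sum>\<^sub>\<infinity>k. g n k * (r k * cos (of_int k * lam))) = (\<Sum>k=- int (Bt n)..int (Bt n). a (of_int k * bwt n) *
       ((1 - \<bar>of_int k\<bar> / real n) * ((a (of_int k * bw n) - 1) / (bw n)\<^sup>2) * (r k * cos (of_int k * lam))))"
      by (simp only: infsum_sum_window[OF Bt_pos])
    then show ?thesis by (simp only: pilot_coeff_def mult_ac)
  qed
  ultimately show ?thesis by simp
qed

text \<open>At most \<open>2 * Bt n + 1\<close> coefficients, each of order \<open>Bt n\<close>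
  squared, give a sum of squares of order \<open>Bt n\<close> to the fifth power; the variance bound
  for linear forms divides this by \<open>n\<close>.\<close>

theorem pilot_noise_L2:
  "\<exists>h. h \<longlonglongrightarrow> 0 \<and> eventually (\<lambda>n. integrable M (\<lambda>\<omega>. (pilot_noise n \<omega>)\<^sup>2) \<and> expectation (\<lambda>\<omega>. (pilot_noise n \<omega>)\<^sup>2) \<le> h n) sequentially"
proof -
  define C where "C = (1 + L) * window_C"
  have C: "C \<ge> 0" unfolding C_def using L_nonneg window_C(1) by simp
  define h where "h n = 2 * prod_cov_bound * (3 * C\<^sup>2) * (real (Bt n) ^ 5 / real n)" for n
  have "h \<longlonglongrightarrow> 0"
    unfolding h_def using tendsto_mult_left[OF Bt5_over_n_0, of "2 * prod_cov_bound * (3 * C\<^sup>2)"] by simp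
  moreover have "eventually (\<lambda>n. integrable M (\<lambda>\<omega>. (pilot_noise n \<omega>)\<^sup>2) \<and> expectation (\<lambda>\<omega>. (pilot_noise n \<omega>)\<^sup>2) \<le> h n) sequentially"
    using eventually_window_small[OF B_small] eventually_Bt_le_B
  proof eventually_elim
    case (elim n)
    then have p: "Bt n < n" by linarith
    have u: "\<bar>pilot_coeff n k\<bar> \<le> C * real (Bt n) ^ 2" if "k \<in> {- int (Bt n)..int (Bt n)}" for k
    proof -
      have "\<bar>real_of_int k\<bar> \<le> real (Bt n)" using that by (simp add: abs_le_iff)
      then have k2: "(of_int k)\<^sup>2 \<le> real (Bt n) ^ 2" using power_mono[of "\<bar>real_of_int k\<bar>" "real (Bt n)" 2] by simp
      have "\<bar>pilot_coeff n k\<bar> \<le> (1 + L) * (window_C * (of_int k)\<^sup>2) * 1"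
        unfolding pilot_coeff_def abs_mult[of _ "cos _"] abs_mult[of "a _"] using bound window_C_scaled[OF bw_pos[of n], of k] L_nonneg window_C(1)
        by (intro mult_mono) auto
      also have "\<dots> \<le> (1 + L) * (window_C * real (Bt n) ^ 2) * 1"
        using k2 L_nonneg window_C(1) by (intro mult_right_mono mult_left_mono) auto
      finally show ?thesis by (simp add: C_def)
    qed
    have "(\<Sum>k=- int (Bt n)..int (Bt n). (pilot_coeff n k)\<^sup>2) \<le> (\<Sum>k=- int (Bt n)..int (Bt n). (C * real (Bt n) ^ 2)\<^sup>2)"
    proof (rule sum_mono)
      fix k assume "k \<in> {- int (Bt n)..int (Bt n)}"
      from power_mono[OF u[OF this], of 2] show "(pilot_coeff n k)\<^sup>2 \<le> (C * real (Bt n) ^ 2)\<^sup>2" by simp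
    qed
    also have "\<dots> = (2 * real (Bt n) + 1) * (C\<^sup>2 * real (Bt n) ^ 4)" by (simp add: power_mult_distrib)
    also have "\<dots> \<le> (3 * real (Bt n)) * (C\<^sup>2 * real (Bt n) ^ 4)"
      using Bt_pos[of n] by (intro mult_right_mono) auto
    also have "\<dots> = 3 * C\<^sup>2 * real (Bt n) ^ 5" by (simp add: eval_nat_numeral)
    finally have s: "(\<Sum>k=- int (Bt n)..int (Bt n). (pilot_coeff n k)\<^sup>2) \<le> 3 * C\<^sup>2 * real (Bt n) ^ 5" .
    have "2 * prod_cov_bound / real n * (\<Sum>k=- int (Bt n)..int (Bt n). (pilot_coeff n k)\<^sup>2) \<le> 2 * prod_cov_bound / real n * (3 * C\<^sup>2 * real (Bt n) ^ 5)"
      using prod_cov_bound_nonneg by (intro mult_left_mono s) auto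
    also have "\<dots> = h n" by (simp add: h_def)
    finally have "2 * prod_cov_bound / real n * (\<Sum>k=- int (Bt n)..int (Bt n). (pilot_coeff n k)\<^sup>2) \<le> h n" .
    then show ?case
      using autocov_form_variance[OF p, of "pilot_coeff n"] unfolding pilot_noise_def by linarith
  qed
  ultimately show ?thesis by blast
qed

end

section \<open>The conditional law of the bootstrap estimate\<close>

text \<open>For even \<open>n\<close> the index n/2 has no mirror image in the set, because pi and
  -pi are the same frequency; the \<open>if\<close> removes it.\<close>

lemma sum_fourier_idx:
  fixes h :: "int \<Rightarrow> 'c::comm_monoid_add"
  assumes n: "n \<ge> 1"
  shows "(\<Sum>j\<in>fourier_idx n. h j) = h 0 + (\<Sum>j=1..n div 2. h (int j) + (if 2 * j = n then 0 else h (- int j)))"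
proof -
  have idx: "fourier_idx n = insert 0 ({1..int n div 2} \<union> {- ((int n - 1) div 2)..-1})"
    using n by auto
  have pos: "(\<Sum>j\<in>{1..int n div 2}. h j) = (\<Sum>j=1..n div 2. h (int j))"
    by (rule sum.reindex_bij_witness[where i=int and j=nat]) (auto simp: zdiv_int)
  have "(\<Sum>j\<in>{- ((int n - 1) div 2)..-1}. h j) = (\<Sum>j\<in>{j \<in> {1..n div 2}. 2 * j \<noteq> n}. h (- int j))"
  proof (rule sum.reindex_bij_witness[where i="\<lambda>j. - int j" and j="\<lambda>j. nat (- j)"])
    fix j assume "j \<in> {- ((int n - 1) div 2)..-1}"
    then have "1 \<le> nat (- j)" "2 * nat (- j) < n" by auto
    then show "nat (- j) \<in> {j \<in> {1..n div 2}. 2 * j \<noteq> n}" by auto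
  next
    fix j assume j: "j \<in> {j \<in> {1..n div 2}. 2 * j \<noteq> n}"
    then have "2 * j < n" by auto
    then have "int j \<le> (int n - 1) div 2" by linarith
    then show "- int j \<in> {- ((int n - 1) div 2)..-1}" using j by auto
  qed auto
  also have "\<dots> = (\<Sum>j=1..n div 2. if 2 * j = n then 0 else h (- int j))"
    by (rule sum.mono_neutral_cong_left) auto
  finally have neg: "(\<Sum>j\<in>{- ((int n - 1) div 2)..-1}. h j) = (\<Sum>j=1..n div 2. if 2 * j = n then 0 else h (- int j))" .
  have "(\<Sum>j\<in>fourier_idx n. h j) = h 0 + ((\<Sum>j\<in>{1..int n div 2}. h j) + (\<Sum>j\<in>{- ((int n - 1) div 2)..-1}. h j))"
    unfolding idx by (subst sum.insert, simp, force, subst sum.union_disjoint) auto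
  then show ?thesis unfolding pos neg by (simp add: sum.distrib)
qed

context lag_window
begin

definition boot_weight :: "nat \<Rightarrow> nat \<Rightarrow> (real \<Rightarrow> real) \<Rightarrow> real \<Rightarrow> nat \<Rightarrow> real" where
  "boot_weight m n ft l j = ft (fourier_freq n (int j)) / real n *
     (K m (l - fourier_freq n (int j)) + (if 2 * j = n then 0 else K m (l + fourier_freq n (int j))))"

lemma boot_est_eq_weights:
  assumes n: "n \<ge> 1"
  shows "boot_est a m n ft e l = (\<Sum>j=1..n div 2. e j * boot_weight m n ft l j)"
proof -
  have inner: "(\<Sum>k=- int m..int m. of_real (a (of_int k * bandwidth m)) * cis (- of_int k * u)) = complex_of_real (K m u)" for u
    using of_real_kernel[of m "- u"] lag_kernel_minus[of a m u] by simp
  define h where "h j = boot_periodogram n ft e j * K m (l - fourier_freq n j)" for j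
  have "boot_est a m n ft e l = Re (1 / of_nat n * complex_of_real (\<Sum>j\<in>fourier_idx n. h j))"
    unfolding boot_est_def inner h_def by simp
  also have "\<dots> = 1 / real n * (\<Sum>j\<in>fourier_idx n. h j)"
    by (metis Re_complex_of_real of_real_1 of_real_divide of_real_mult of_real_of_nat_eq)
  also have "\<dots> = (\<Sum>j=1..n div 2. 1 / real n * (h (int j) + (if 2 * j = n then 0 else h (- int j))))"
    unfolding sum_fourier_idx[OF n] by (simp add: h_def boot_periodogram_def sum_distrib_left)
  also have "\<dots> = (\<Sum>j=1..n div 2. e j * boot_weight m n ft l j)"
    by (intro sum.cong refl) (auto simp: h_def boot_periodogram_def boot_weight_def fourier_freq_minus field_simps)
  finally show ?thesis .
qed

lemma lag_window_est_minus: "lag_window_est a m n x (- w) = lag_window_est a m n x w"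
  by (simp add: lag_window_est_cos)

theorem sum_boot_weight:
  fixes x :: "int \<Rightarrow> real"
  assumes m: "m > 0" "mt > 0" and mn: "2 * m + 1 < n" "mt \<le> m"
  defines "ft \<equiv> lag_window_est a mt n x"
  shows "(\<Sum>j=1..n div 2. boot_weight m n ft l j) =
    1 / (2 * pi) * (\<Sum>k=- int mt..int mt. sample_autocov n x k * a (of_int k * bandwidth mt) * a (of_int k * bandwidth m) * cos (of_int k * l))
    - ft 0 * K m l / real n"
proof -
  have n: "n > 0" "n \<ge> 1" using mn by auto
  define \<alpha> where "\<alpha> k = complex_of_real (a (of_int k * bandwidth m)) * cis (- of_int k * l)" for k :: int
  define \<beta> where "\<beta> k = complex_of_real (1 / (2 * pi) * (sample_autocov n x k * a (of_int k * bandwidth mt)))" for k :: int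
  have A: "complex_of_real (K m (l - w)) = (\<Sum>k=- int m..int m. \<alpha> k * cis (of_int k * w))" for w
  proof -
    have "K m (l - w) = K m (w - l)" using lag_kernel_minus[of a m "w - l"] by simp
    moreover have "cis (- of_int k * l) * cis (of_int k * w) = cis (of_int k * (w - l))" for k :: int
      unfolding cis_mult by (rule arg_cong[where f=cis]) (simp add: algebra_simps)
    ultimately show ?thesis unfolding \<alpha>_def mult.assoc by (simp only: of_real_kernel)
  qed
  have Bq: "complex_of_real (ft w) = (\<Sum>k=- int mt..int mt. \<beta> k * cis (- of_int k * w))" for w
    unfolding ft_def of_real_lag_window_est[where a=a, OF even] \<beta>_def sum_distrib_left
    by (intro sum.cong refl) simp
  have "complex_of_real (\<Sum>j\<in>fourier_idx n. K m (l - fourier_freq n j) * ft (fourier_freq n j)) =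
     of_nat n * (\<Sum>k\<in>{- int m..int m} \<inter> {- int mt..int mt}. \<alpha> k * \<beta> k)"
    unfolding of_real_sum of_real_mult A Bq
    by (rule fourier_orthogonality[OF _ _ n(1)]) (use mn in auto)
  also have "{- int m..int m} \<inter> {- int mt..int mt} = {- int mt..int mt}" using mn by auto
  finally have "Re (complex_of_real (\<Sum>j\<in>fourier_idx n. K m (l - fourier_freq n j) * ft (fourier_freq n j))) =
     Re (of_nat n * (\<Sum>k=- int mt..int mt. \<alpha> k * \<beta> k))" by simp
  then have F: "(\<Sum>j\<in>fourier_idx n. K m (l - fourier_freq n j) * ft (fourier_freq n j)) =
     real n * (\<Sum>k=- int mt..int mt. 1 / (2 * pi) * (sample_autocov n x k * a (of_int k * bandwidth mt) * a (of_int k * bandwidth m) * cos (of_int k * l)))"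
    by (simp add: \<alpha>_def \<beta>_def mult_ac)
  define h where "h j = K m (l - fourier_freq n j) * ft (fourier_freq n j)" for j
  have W: "boot_weight m n ft l j = 1 / real n * (h (int j) + (if 2 * j = n then 0 else h (- int j)))" for j
    by (simp add: boot_weight_def h_def fourier_freq_minus ft_def lag_window_est_minus field_simps)
  have "(\<Sum>j=1..n div 2. boot_weight m n ft l j) = 1 / real n * ((\<Sum>j\<in>fourier_idx n. h j) - h 0)"
    unfolding W sum_distrib_left[symmetric] sum_fourier_idx[OF n(2)] by simp
  also have "\<dots> = 1 / (2 * pi) * (\<Sum>k=- int mt..int mt. sample_autocov n x k * a (of_int k * bandwidth mt) * a (of_int k * bandwidth m) * cos (of_int k * l))
    - h 0 / real n"
    unfolding h_def F using n by (simp add: right_diff_distrib sum_distrib_left diff_divide_distrib)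
  finally show ?thesis by (simp add: h_def fourier_freq_def mult.commute)
qed

end

section \<open>Weighted sums of resampled values\<close>

definition resample_pmf :: "nat \<Rightarrow> (nat \<Rightarrow> real) \<Rightarrow> (nat \<Rightarrow> real) pmf" where
  "resample_pmf N s = Pi_pmf {1..N} 0 (\<lambda>_. map_pmf s (pmf_of_set {1..N}))"

lemma finite_set_resample_pmf:
  assumes "N \<ge> 1"
  shows "finite (set_pmf (resample_pmf N s))"
proof -
  have "finite (set_pmf (map_pmf s (pmf_of_set {1..N})))" using assms by simp
  then show ?thesis unfolding resample_pmf_def
    by (subst set_Pi_pmf) (auto intro!: finite_PiE_dflt)
qed

lemma integrable_resample_pmf: "N \<ge> 1 \<Longrightarrow> integrable (measure_pmf (resample_pmf N s)) (g :: _ \<Rightarrow> real)"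
  by (intro integrable_measure_pmf_finite finite_set_resample_pmf)

lemma expectation_resample_component:
  fixes g :: "real \<Rightarrow> real"
  assumes "N \<ge> 1" "j \<in> {1..N}"
  shows "measure_pmf.expectation (resample_pmf N s) (\<lambda>e. g (e j)) = 1 / real N * (\<Sum>i=1..N. g (s i))"
proof -
  have "measure_pmf.expectation (resample_pmf N s) (\<lambda>e. g (e j)) =
      measure_pmf.expectation (map_pmf (\<lambda>e. e j) (resample_pmf N s)) g" by simp
  also have "map_pmf (\<lambda>e. e j) (resample_pmf N s) = map_pmf s (pmf_of_set {1..N})"
    unfolding resample_pmf_def using assms by (subst Pi_pmf_component) auto
  also have "measure_pmf.expectation \<dots> g = measure_pmf.expectation (pmf_of_set {1..N}) (\<lambda>i. g (s i))" by simp
  also have "\<dots> = 1 / real N * (\<Sum>i=1..N. g (s i))"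
    using assms by (subst integral_pmf_of_set) auto
  finally show ?thesis .
qed

lemma expectation_resample_pair:
  fixes g :: "real \<Rightarrow> real"
  assumes N: "N \<ge> 1" and ij: "i \<in> {1..N}" "j \<in> {1..N}" "i \<noteq> j"
    and g: "(\<Sum>i=1..N. g (s i)) = 0"
  shows "measure_pmf.expectation (resample_pmf N s) (\<lambda>e. g (e i) * g (e j)) = 0"
proof -
  let ?P = "measure_pmf (resample_pmf N s)"
  note ps = measure_pmf.prob_space_axioms[of "resample_pmf N s"]
  have "prob_space.indep_vars ?P (\<lambda>_. borel) (\<lambda>x e. g (e x)) {1..N}"
    by (rule prob_space.indep_vars_compose2[OF ps, where X="\<lambda>x f. f x" and M'="\<lambda>_. count_space UNIV"])
       (auto simp: resample_pmf_def intro!: indep_vars_Pi_pmf)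
  then have "prob_space.indep_vars ?P (\<lambda>_. borel) (\<lambda>x e. g (e x)) {i, j}"
    by (rule prob_space.indep_vars_subset[OF ps]) (use ij in auto)
  then have "measure_pmf.expectation (resample_pmf N s) (\<lambda>e. \<Prod>x\<in>{i, j}. g (e x)) = (\<Prod>x\<in>{i, j}. measure_pmf.expectation (resample_pmf N s) (\<lambda>e. g (e x)))"
    by (intro prob_space.indep_vars_lebesgue_integral[OF ps] integrable_resample_pmf N) auto
  then show ?thesis
    using ij expectation_resample_component[OF N ij(1), of s g] g by simp
qed

definition resample_law :: "nat \<Rightarrow> (nat \<Rightarrow> real) \<Rightarrow> (nat \<Rightarrow> real) \<Rightarrow> real measure" where
  "resample_law N s w = distr (measure_pmf (resample_pmf N s)) borel (\<lambda>e. \<Sum>j=1..N. w j * (e j - 1))"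

text \<open>The support is finite, so every integral exists; cross terms vanish because 1 is the
  empirical mean of \<open>s\<close> and components are independent.\<close>

lemma resample_law_basic:
  assumes N: "N \<ge> 1" and mean: "1 / real N * (\<Sum>i=1..N. s i) = 1"
  shows "real_distribution (resample_law N s w)"
    and "integrable (resample_law N s w) (\<lambda>z. z\<^sup>2)"
    and "(\<integral>z. z\<^sup>2 \<partial>resample_law N s w) = (1 / real N * (\<Sum>i=1..N. (s i - 1)\<^sup>2)) * (\<Sum>j=1..N. (w j)\<^sup>2)"
proof -
  show "real_distribution (resample_law N s w)"
    unfolding resample_law_def by (rule prob_space.real_distribution_distr[OF measure_pmf.prob_space_axioms]) simp
  show "integrable (resample_law N s w) (\<lambda>z. z\<^sup>2)"
    unfolding resample_law_def by (subst integrable_distr_eq) (auto intro!: integrable_resample_pmf N)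
  have "(\<integral>z. z\<^sup>2 \<partial>resample_law N s w) = measure_pmf.expectation (resample_pmf N s) (\<lambda>e. (\<Sum>j=1..N. w j * (e j - 1))\<^sup>2)"
    unfolding resample_law_def by (subst integral_distr) auto
  also have "\<dots> = measure_pmf.expectation (resample_pmf N s) (\<lambda>e. \<Sum>i=1..N. \<Sum>j=1..N. w i * w j * ((e i - 1) * (e j - 1)))"
    by (rule Bochner_Integration.integral_cong) (auto simp: power2_eq_square sum_product mult_ac)
  also have "\<dots> = (\<Sum>i=1..N. \<Sum>j=1..N. w i * w j * measure_pmf.expectation (resample_pmf N s) (\<lambda>e. (e i - 1) * (e j - 1)))"
    using integrable_resample_pmf[OF N] by (simp add: Bochner_Integration.integral_sum)
  also have "\<dots> = (\<Sum>i=1..N. \<Sum>j=1..N. if i = j then (w i)\<^sup>2 * (1 / real N * (\<Sum>i=1..N. (s i - 1)\<^sup>2)) else 0)"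
  proof (intro sum.cong refl)
    fix i j assume ij: "i \<in> {1..N}" "j \<in> {1..N}"
    have z: "(\<Sum>i=1..N. s i - 1) = 0" using mean N by (simp add: sum_subtractf field_simps)
    show "w i * w j * measure_pmf.expectation (resample_pmf N s) (\<lambda>e. (e i - 1) * (e j - 1)) =
        (if i = j then (w i)\<^sup>2 * (1 / real N * (\<Sum>i=1..N. (s i - 1)\<^sup>2)) else 0)"
    proof (cases "i = j")
      case True
      then show ?thesis
        using expectation_resample_component[OF N ij(1), of s "\<lambda>y. (y - 1)\<^sup>2"] by (simp add: power2_eq_square)
    next
      case False
      then show ?thesis using expectation_resample_pair[OF N ij False, of "\<lambda>y. y - 1" s] z by simp
    qed
  qed
  also have "\<dots> = (\<Sum>i=1..N. (w i)\<^sup>2 * (1 / real N * (\<Sum>i=1..N. (s i - 1)\<^sup>2)))"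
    by (intro sum.cong refl) (simp only: sum.delta' finite_atLeastAtMost if_True)
  also have "\<dots> = (1 / real N * (\<Sum>i=1..N. (s i - 1)\<^sup>2)) * (\<Sum>j=1..N. (w j)\<^sup>2)"
    unfolding sum_distrib_right[symmetric] by (rule mult.commute)
  finally show "(\<integral>z. z\<^sup>2 \<partial>resample_law N s w) = (1 / real N * (\<Sum>i=1..N. (s i - 1)\<^sup>2)) * (\<Sum>j=1..N. (w j)\<^sup>2)" .
qed

text \<open>Since the resampled values are identically distributed, both sums in Lyapunov's
  condition factor into an empirical moment of \<open>s\<close> and a power sum of the
  weights.\<close>

theorem resample_law_clt:
  fixes N :: "nat \<Rightarrow> nat" and s w :: "nat \<Rightarrow> nat \<Rightarrow> real"
  assumes N: "\<And>k. N k \<ge> 1" and mean: "\<And>k. 1 / real (N k) * (\<Sum>i=1..N k. s k i) = 1"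
    and var: "(\<lambda>k. (1 / real (N k) * (\<Sum>i=1..N k. (s k i - 1)\<^sup>2)) * (\<Sum>j=1..N k. (w k j)\<^sup>2)) \<longlonglongrightarrow> \<tau>\<^sup>2" and \<tau>: "\<tau> > 0"
    and fourth: "(\<lambda>k. (1 / real (N k) * (\<Sum>i=1..N k. (s k i - 1) ^ 4)) * (\<Sum>j=1..N k. (w k j) ^ 4)) \<longlonglongrightarrow> 0"
  shows "weak_conv_m (\<lambda>k. resample_law (N k) (s k) (w k)) (density lborel (normal_density 0 \<tau>))"
  unfolding resample_law_def
proof (rule lyapunov_central_limit[where Y="\<lambda>k j e. w k j * (e j - 1)" and J="\<lambda>k. {1..N k}"])
  fix k j
  show "prob_space.indep_vars (measure_pmf (resample_pmf (N k) (s k))) (\<lambda>_. borel) (\<lambda>j e. w k j * (e j - 1)) {1..N k}"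
    by (rule prob_space.indep_vars_compose2[OF measure_pmf.prob_space_axioms, where X="\<lambda>x f. f x" and M'="\<lambda>_. count_space UNIV"])
       (auto simp: resample_pmf_def intro!: indep_vars_Pi_pmf)
  assume j: "j \<in> {1..N k}"
  show "integrable (measure_pmf (resample_pmf (N k) (s k))) (\<lambda>e. (w k j * (e j - 1)) ^ 4)"
    by (rule integrable_resample_pmf[OF N])
  have z: "(\<Sum>i=1..N k. s k i - 1) = 0" using mean[of k] N[of k] by (simp add: sum_subtractf field_simps)
  show "measure_pmf.expectation (resample_pmf (N k) (s k)) (\<lambda>e. w k j * (e j - 1)) = 0"
    using expectation_resample_component[OF N j, of "s k" "\<lambda>y. w k j * (y - 1)"] z
    by (simp add: sum_distrib_left[symmetric])
next
  have e: "measure_pmf.expectation (resample_pmf (N k) (s k)) (\<lambda>e. (w k j * (e j - 1)) ^ p) =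
      (1 / real (N k) * (\<Sum>i=1..N k. (s k i - 1) ^ p)) * (w k j) ^ p" if "j \<in> {1..N k}" for k j p
    using expectation_resample_component[OF N that, of "s k" "\<lambda>y. (w k j * (y - 1)) ^ p"]
    by (simp add: power_mult_distrib sum_distrib_left[symmetric])
  have sum: "(\<Sum>j\<in>{1..N k}. measure_pmf.expectation (resample_pmf (N k) (s k)) (\<lambda>e. (w k j * (e j - 1)) ^ p)) =
      (1 / real (N k) * (\<Sum>i=1..N k. (s k i - 1) ^ p)) * (\<Sum>j=1..N k. (w k j) ^ p)" for k p
    unfolding sum_distrib_left[of _ _ "{1..N k}"] by (intro sum.cong refl) (simp add: e sum_distrib_left)
  show "(\<lambda>k. \<Sum>j\<in>{1..N k}. measure_pmf.expectation (resample_pmf (N k) (s k)) (\<lambda>e. (w k j * (e j - 1))\<^sup>2)) \<longlonglongrightarrow> \<tau>\<^sup>2"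
    unfolding sum by (rule var)
  show "(\<lambda>k. \<Sum>j\<in>{1..N k}. measure_pmf.expectation (resample_pmf (N k) (s k)) (\<lambda>e. (w k j * (e j - 1)) ^ 4)) \<longlonglongrightarrow> 0"
    unfolding sum by (rule fourth)
qed (use \<tau> in \<open>auto intro: measure_pmf.prob_space_axioms\<close>)

section \<open>Regularity of the spectral density on the circle\<close>

text \<open>Up to sign and periods, \<open>u\<close> equals \<open>arccos (cos u)\<close>. Cosine
  series are thus determined on [0, pi], the interval to which the assumptions on density and pilot
  refer.\<close>

lemma cos_multiples_reduce:
  obtains v where "v \<in> {0..pi}" "\<And>k::int. cos (of_int k * u) = cos (of_int k * v)"
proof -
  define v where "v = arccos (cos u)"
  have "cos u = cos v" unfolding v_def by simp
  then obtain q where q: "q \<in> \<int>" "u = v + 2 * q * pi \<or> u = - v + 2 * q * pi"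
    unfolding cos_eq by blast
  then obtain i :: int where i: "q = of_int i" by (auto elim: Ints_cases)
  have per: "cos (x + of_int k * (2 * q * pi)) = cos x" for k :: int and x
  proof -
    have "cos (x + of_int k * (2 * q * pi)) = Re (cis x * cis (2 * pi * of_int (k * i)))"
      unfolding cis_mult by (simp add: i mult_ac)
    also have "cis (2 * pi * of_int (k * i)) = 1" by (rule cis_multiple_2pi) simp
    finally show ?thesis by simp
  qed
  have "cos (of_int k * u) = cos (of_int k * v)" for k :: int
    using q(2)
  proof
    assume "u = v + 2 * q * pi"
    then have "of_int k * u = of_int k * v + of_int k * (2 * q * pi)" by (simp add: algebra_simps)
    then show ?thesis by (simp only: per)
  next
    assume "u = - v + 2 * q * pi"
    then have "of_int k * u = - (of_int k * v) + of_int k * (2 * q * pi)"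
      by (simp only: distrib_left mult_minus_right)
    then show ?thesis by (simp only: per cos_minus)
  qed
  moreover have "v \<in> {0..pi}" unfolding v_def by (simp add: arccos_lbound arccos_ubound)
  ultimately show ?thesis by (rule that[rotated])
qed

text \<open>The power map of exponent |k| is |k|-Lipschitz on the unit disc. Distance is measured on
  the circle because that is the factor the kernel estimate can absorb.\<close>

lemma cos_multiple_lipschitz:
  "\<bar>cos (of_int k * w) - cos (of_int k * w')\<bar> \<le> \<bar>of_int k\<bar> * cmod (cis w - cis w')"
proof -
  define m where "m = nat \<bar>k\<bar>"
  have c: "cos (of_int k * u) = Re (cis u ^ m)" for u
  proof -
    have "real m = \<bar>of_int k\<bar>" by (simp add: m_def)
    then have "Re (cis u ^ m) = cos (\<bar>of_int k\<bar> * u)" unfolding Complex.DeMoivre by simp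
    also have "\<dots> = cos (of_int k * u)" by (cases "k \<ge> 0") auto
    finally show ?thesis ..
  qed
  have "\<bar>cos (of_int k * w) - cos (of_int k * w')\<bar> = \<bar>Re (cis w ^ m - cis w' ^ m)\<bar>" by (simp add: c)
  also have "\<dots> \<le> cmod (cis w ^ m - cis w' ^ m)" by (rule abs_Re_le_cmod)
  also have "\<dots> \<le> real m * cmod (cis w - cis w')" by (rule norm_power_diff) auto
  finally show ?thesis by (simp add: m_def)
qed

context stationary_cumulants
begin

lemma abs_sd_le_R0: "\<bar>sd w\<bar> \<le> R0"
proof -
  have "1 * \<bar>sd w\<bar> \<le> 2 * pi * \<bar>sd w\<bar>" using pi_gt3 by (intro mult_right_mono) auto
  then show ?thesis using abs_sd_le[of w] by linarith
qed

lemma sd_lipschitz: "\<bar>sd w - sd w'\<bar> \<le> R1 * cmod (cis w - cis w')"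
proof -
  have "\<bar>2 * pi * sd w + - (2 * pi * sd w')\<bar> \<le> R1 * cmod (cis w - cis w')"
    unfolding real_norm_def[symmetric]
  proof (rule norm_infsum_le)
    show "((\<lambda>k. r k * cos (of_int k * w) + - (r k * cos (of_int k * w'))) has_sum (2 * pi * sd w + - (2 * pi * sd w'))) UNIV"
      by (intro has_sum_add has_sum_uminusI sd_has_sum)
    show "((\<lambda>k. \<bar>r k\<bar> * \<bar>of_int k\<bar> * cmod (cis w - cis w')) has_sum (R1 * cmod (cis w - cis w'))) UNIV"
      unfolding R1_def by (intro has_sum_cmult_left has_sum_infsum summable_autocov_abs)
    fix k :: int
    have "r k * cos (of_int k * w) + - (r k * cos (of_int k * w')) = r k * (cos (of_int k * w) - cos (of_int k * w'))"
      by (simp add: right_diff_distrib)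
    then show "norm (r k * cos (of_int k * w) + - (r k * cos (of_int k * w'))) \<le> \<bar>r k\<bar> * \<bar>of_int k\<bar> * cmod (cis w - cis w')"
      using mult_left_mono[OF cos_multiple_lipschitz[of k w w'], of "\<bar>r k\<bar>"] by (simp add: abs_mult mult.assoc)
  qed
  moreover have "\<bar>2 * pi * sd w + - (2 * pi * sd w')\<bar> = 2 * pi * \<bar>sd w - sd w'\<bar>"
    by (simp add: abs_mult flip: right_diff_distrib)
  moreover have "1 * \<bar>sd w - sd w'\<bar> \<le> 2 * pi * \<bar>sd w - sd w'\<bar>" using pi_gt3 by (intro mult_right_mono) auto
  ultimately show ?thesis unfolding mult_1 by simp
qed

lemma sd_square_lipschitz: "\<bar>(sd w)\<^sup>2 - (sd w')\<^sup>2\<bar> \<le> (2 * R0 * R1) * cmod (cis w - cis w')"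
proof -
  have "(sd w)\<^sup>2 - (sd w')\<^sup>2 = (sd w + sd w') * (sd w - sd w')" by (simp add: power2_eq_square algebra_simps)
  then have "\<bar>(sd w)\<^sup>2 - (sd w')\<^sup>2\<bar> = \<bar>sd w + sd w'\<bar> * \<bar>sd w - sd w'\<bar>" by (simp add: abs_mult)
  also have "\<dots> \<le> (2 * R0) * (R1 * cmod (cis w - cis w'))"
    using abs_sd_le_R0[of w] abs_sd_le_R0[of w'] sd_lipschitz[of w w'] R0_nonneg by (intro mult_mono) auto
  finally show ?thesis by (simp add: mult_ac)
qed

end

section \<open>Size of the bootstrap weights\<close>

context bootstrap_setting
begin

abbreviation wt :: "nat \<Rightarrow> (real \<Rightarrow> real) \<Rightarrow> nat \<Rightarrow> real" where
  "wt n ft j \<equiv> boot_weight (B n) n ft lam j"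

text \<open>The density is bounded by \<open>R0\<close> and each of the two kernels by 3 (1 + L)
  B_n; 36 is the square of 3 + 3.\<close>

definition wt_C :: real where "wt_C = 36 * R0\<^sup>2 * (1 + L)\<^sup>2"

lemma wt_C_nonneg: "wt_C \<ge> 0" by (simp add: wt_C_def)

lemma sd_kernel_square_le:
  assumes "\<bar>H\<bar> \<le> 6 * (1 + L) * real (B n)"
  shows "(sd w)\<^sup>2 * H\<^sup>2 \<le> wt_C * (real (B n))\<^sup>2"
proof -
  have "(sd w)\<^sup>2 * H\<^sup>2 \<le> R0\<^sup>2 * (6 * (1 + L) * real (B n))\<^sup>2"
    using power_mono[OF abs_sd_le_R0[of w], of 2] power_mono[OF assms, of 2] by (intro mult_mono) auto
  also have "(6 * (1 + L) * real (B n))\<^sup>2 = 36 * (1 + L)\<^sup>2 * (real (B n))\<^sup>2"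
    unfolding power_mult_distrib by simp
  finally show ?thesis by (simp only: wt_C_def mult_ac)
qed

lemma kernel_sum_le:
  "\<bar>K (B n) u + K (B n) v\<bar> \<le> 6 * (1 + L) * real (B n)" "\<bar>K (B n) u\<bar> \<le> 6 * (1 + L) * real (B n)"
proof -
  have "\<bar>K (B n) u\<bar> \<le> 3 * (1 + L) * real (B n)" "\<bar>K (B n) v\<bar> \<le> 3 * (1 + L) * real (B n)"
    by (intro abs_kernel_le B_pos)+
  moreover have "0 \<le> (1 + L) * real (B n)" using L_nonneg by simp
  ultimately show "\<bar>K (B n) u + K (B n) v\<bar> \<le> 6 * (1 + L) * real (B n)" "\<bar>K (B n) u\<bar> \<le> 6 * (1 + L) * real (B n)"
    by linarith+
qed

text \<open>No single frequency matters: this uniform smallness is later played against the fourth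
  moment of the residuals in Lyapunov's condition.\<close>

lemma wt_sd_square_le:
  assumes n: "n \<ge> 1"
  shows "real n * bw n * (wt n sd j)\<^sup>2 \<le> wt_C * (real (B n) / real n)"
proof -
  define H where "H = K (B n) (lam - fourier_freq n (int j)) + (if 2 * j = n then 0 else K (B n) (lam + fourier_freq n (int j)))"
  have H: "\<bar>H\<bar> \<le> 6 * (1 + L) * real (B n)" unfolding H_def using kernel_sum_le by simp
  have "real n * bw n * (wt n sd j)\<^sup>2 = bw n / real n * ((sd (fourier_freq n (int j)))\<^sup>2 * H\<^sup>2)"
    using n by (simp add: boot_weight_def H_def[symmetric] power_mult_distrib power_divide power2_eq_square[of "real n"])
  also have "\<dots> \<le> bw n / real n * (wt_C * (real (B n))\<^sup>2)"
    by (intro mult_left_mono sd_kernel_square_le H) auto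
  also have "\<dots> = wt_C * (real (B n) / real n)"
    using B_pos[of n] by (simp add: power2_eq_square)
  finally show ?thesis .
qed

text \<open>Every frequency except 0 and pi occurs with both signs in the symmetric grid sum, whose
  limit is known. Each of these two exceptions costs at most \<open>wt_C\<close> B_n/n.\<close>

theorem wt_variance_limit:
  "(\<lambda>n. real n * bw n * (\<Sum>j=1..n div 2. (wt n sd j)\<^sup>2)) \<longlonglongrightarrow> asymp_var a sd lam"
proof -
  define S where "S n = bw n / (2 * real n) * (\<Sum>j\<in>fourier_idx n. (sd (fourier_freq n j))\<^sup>2 * (kernel_sym (B n) lam (fourier_freq n j))\<^sup>2)" for n
  have S: "S \<longlonglongrightarrow> asymp_var a sd lam"
    unfolding S_def asymp_var_def
    by (rule kernel_variance_limit[OF B_top B_pos B_small sd_square_lipschitz]) (simp add: sd_minus)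
  have "(\<lambda>n. real n * bw n * (\<Sum>j=1..n div 2. (wt n sd j)\<^sup>2) - S n) \<longlonglongrightarrow> 0"
  proof (rule Lim_null_comparison)
    show "\<forall>\<^sub>F n in sequentially. norm (real n * bw n * (\<Sum>j=1..n div 2. (wt n sd j)\<^sup>2) - S n) \<le> 2 * wt_C * (real (B n) / real n)"
      using eventually_ge_at_top[of 1]
    proof eventually_elim
      case (elim n)
      define T where "T j = (sd (fourier_freq n j))\<^sup>2 * (kernel_sym (B n) lam (fourier_freq n j))\<^sup>2" for j
      have Tle: "T j \<le> wt_C * (real (B n))\<^sup>2" "T j \<ge> 0" for j
      proof -
        show "T j \<le> wt_C * (real (B n))\<^sup>2"
          unfolding T_def kernel_sym_def by (intro sd_kernel_square_le kernel_sum_le)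
        show "T j \<ge> 0" by (simp add: T_def)
      qed
      have Tm: "T (- j) = T j" for j
        unfolding T_def kernel_sym_def by (simp add: fourier_freq_minus sd_minus add.commute)
      have e: "real n * bw n * (wt n sd j)\<^sup>2 = bw n / (2 * real n) * (T (int j) + (if 2 * j = n then 0 else T (- int j)))"
        if "2 * j \<noteq> n" for j
        unfolding Tm using that elim
        by (simp add: boot_weight_def T_def kernel_sym_def power_mult_distrib power_divide power2_eq_square[of "real n"])
      define J where "J = {j \<in> {1..n div 2}. 2 * j = n}"
      define d where "d j = real n * bw n * (wt n sd j)\<^sup>2 - bw n / (2 * real n) * (T (int j) + (if 2 * j = n then 0 else T (- int j)))" for j
      have dJ: "\<bar>d j\<bar> \<le> wt_C * (real (B n) / real n)" for j
      proof (cases "2 * j = n")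
        case True
        have "bw n / (2 * real n) * T (int j) \<le> bw n / (2 * real n) * (wt_C * (real (B n))\<^sup>2)"
          by (intro mult_left_mono Tle) auto
        also have "\<dots> \<le> wt_C * (real (B n) / real n)"
          using B_pos[of n] elim wt_C_nonneg by (simp add: power2_eq_square field_simps)
        finally have "bw n / (2 * real n) * T (int j) \<le> wt_C * (real (B n) / real n)" .
        moreover have "0 \<le> bw n / (2 * real n) * T (int j)" using Tle by simp
        moreover have "0 \<le> real n * bw n * (wt n sd j)\<^sup>2" by simp
        moreover have "d j = real n * bw n * (wt n sd j)\<^sup>2 - bw n / (2 * real n) * T (int j)"
          using True by (simp add: d_def)
        ultimately show ?thesis using wt_sd_square_le[OF elim, of j] by linarith
      next
        case False
        then show ?thesis using e[OF False] wt_C_nonneg by (simp add: d_def)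
      qed
      have cJ: "real (card J) \<le> 1"
      proof -
        have "J \<subseteq> {n div 2}" unfolding J_def by auto
        then have "card J \<le> card {n div 2}" by (intro card_mono) auto
        then show ?thesis by simp
      qed
      have "(\<Sum>j=1..n div 2. d j) = (\<Sum>j\<in>J. d j)"
        by (rule sum.mono_neutral_right) (use e in \<open>auto simp: J_def d_def\<close>)
      then have "\<bar>\<Sum>j=1..n div 2. d j\<bar> \<le> (\<Sum>j\<in>J. wt_C * (real (B n) / real n))"
        by (simp only:) (rule order_trans[OF sum_abs sum_mono[OF dJ]])
      also have "\<dots> \<le> 1 * (wt_C * (real (B n) / real n))"
        unfolding sum_constant using cJ wt_C_nonneg by (intro mult_right_mono) auto
      finally have D: "\<bar>\<Sum>j=1..n div 2. d j\<bar> \<le> wt_C * (real (B n) / real n)" by simp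
      have T0: "\<bar>bw n / (2 * real n) * T 0\<bar> \<le> wt_C * (real (B n) / real n)"
      proof -
        have "bw n / (2 * real n) * T 0 \<le> bw n / (2 * real n) * (wt_C * (real (B n))\<^sup>2)"
          by (intro mult_left_mono Tle) auto
        also have "\<dots> \<le> wt_C * (real (B n) / real n)"
          using B_pos[of n] elim wt_C_nonneg by (simp add: power2_eq_square field_simps)
        finally show ?thesis using Tle(2)[of 0] by simp
      qed
      have "S n = bw n / (2 * real n) * T 0 + (\<Sum>j=1..n div 2. bw n / (2 * real n) * (T (int j) + (if 2 * j = n then 0 else T (- int j))))"
        unfolding S_def T_def[symmetric] sum_fourier_idx[OF elim] by (simp only: distrib_left sum_distrib_left)
      then have "real n * bw n * (\<Sum>j=1..n div 2. (wt n sd j)\<^sup>2) - S n = (\<Sum>j=1..n div 2. d j) - bw n / (2 * real n) * T 0"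
        by (simp only: d_def sum_subtractf sum_distrib_left[of "real n * bw n"])
      moreover have "\<bar>X - Y\<bar> \<le> 2 * c" if "X - Y = d' - t" "\<bar>d'\<bar> \<le> c" "\<bar>t\<bar> \<le> c" for X Y d' t c :: real
        using that by linarith
      ultimately show ?case using D T0 unfolding real_norm_def mult.assoc[of 2] by blast
    qed
    show "(\<lambda>n. 2 * wt_C * (real (B n) / real n)) \<longlonglongrightarrow> 0"
      using tendsto_mult_left[OF B_over_n_0, of "2 * wt_C"] by simp
  qed
  from tendsto_add[OF this S] show ?thesis by simp
qed

lemma integrable_fhat2: "integrable M (\<lambda>\<omega>. (fhat n \<omega> w)\<^sup>2)"
proof -
  have rr: "integrable M (\<lambda>\<omega>. racov n \<omega> k * racov n \<omega> k')" for k k'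
  proof -
    have "racov n \<omega> k * racov n \<omega> k' = 1 / real n * (1 / real n) * (\<Sum>i=1..int n - \<bar>k\<bar>. \<Sum>j=1..int n - \<bar>k'\<bar>.
        X i \<omega> * X (i + \<bar>k\<bar>) \<omega> * (X j \<omega> * X (j + \<bar>k'\<bar>) \<omega>))" for \<omega>
      unfolding sample_autocov_def sum_product[symmetric] by (simp only: mult_ac)
    then show ?thesis by (simp only:) (intro integrable_mult_right Bochner_Integration.integrable_sum integrable_four)
  qed
  have eq: "(fhat n \<omega> w)\<^sup>2 = 1 / (2 * pi) * (1 / (2 * pi)) * (\<Sum>k=- int (B n)..int (B n). \<Sum>k'=- int (B n)..int (B n).
      (a (of_int k * bw n) * cos (of_int k * w) * (a (of_int k' * bw n) * cos (of_int k' * w))) * (racov n \<omega> k * racov n \<omega> k'))" for \<omega>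
  proof -
    have "(fhat n \<omega> w)\<^sup>2 = 1 / (2 * pi) * (1 / (2 * pi)) * (\<Sum>k=- int (B n)..int (B n). \<Sum>k'=- int (B n)..int (B n).
      (racov n \<omega> k * a (of_int k * bw n) * cos (of_int k * w)) * (racov n \<omega> k' * a (of_int k' * bw n) * cos (of_int k' * w)))"
      unfolding lag_window_est_cos power2_eq_square sum_product[symmetric] by (simp only: mult_ac)
    then show ?thesis by (simp only: mult_ac)
  qed
  show ?thesis unfolding eq
    by (intro integrable_mult_right Bochner_Integration.integrable_sum rr)
qed

end

lemma Bseq_compose_filterlim:
  fixes f :: "nat \<Rightarrow> real"
  assumes "eventually (\<lambda>n. \<bar>f n\<bar> \<le> C) sequentially" "filterlim nk at_top sequentially"
  shows "Bseq (\<lambda>k. f (nk k))"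
proof (rule Bseq_eventually_mono)
  show "eventually (\<lambda>k. norm (f (nk k)) \<le> norm C) sequentially"
    using eventually_compose_filterlim[OF assms] by eventually_elim auto
qed simp

lemma tendsto_Bseq_mult_0:
  fixes f g :: "nat \<Rightarrow> real"
  assumes "Bseq f" "g \<longlonglongrightarrow> 0"
  shows "(\<lambda>k. f k * g k) \<longlonglongrightarrow> 0"
proof -
  obtain C where C: "\<And>k. \<bar>f k\<bar> \<le> C" using assms(1) unfolding Bseq_def by auto
  show ?thesis
  proof (rule Lim_null_comparison)
    show "\<forall>\<^sub>F k in sequentially. norm (f k * g k) \<le> C * \<bar>g k\<bar>"
      using C by (auto simp: abs_mult intro!: always_eventually mult_right_mono)
    show "(\<lambda>k. C * \<bar>g k\<bar>) \<longlonglongrightarrow> 0"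
      using tendsto_mult_left[OF tendsto_rabs[OF assms(2)], of C] by simp
  qed
qed

lemma weak_conv_m_compose:
  assumes "weak_conv_m \<mu> N" "filterlim nk at_top sequentially"
  shows "weak_conv_m (\<lambda>k. \<mu> (nk k)) N"
  using assms unfolding weak_conv_m_def weak_conv_def by (auto intro: filterlim_compose)

definition mean_power_resid :: "nat \<Rightarrow> nat \<Rightarrow> (int \<Rightarrow> real) \<Rightarrow> (real \<Rightarrow> real) \<Rightarrow> real" where
  "mean_power_resid p n x ft = 1 / real (n div 2) * (\<Sum>j=1..n div 2. (raw_resid n x ft j) ^ p)"

lemma mean_power_resid_nonneg:
  assumes "\<And>j. raw_resid n x ft j \<ge> 0"
  shows "mean_power_resid p n x ft \<ge> 0"
  unfolding mean_power_resid_def by (intro mult_nonneg_nonneg sum_nonneg zero_le_power assms) auto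

context bootstrap_setting
begin

lemma sd_extend:
  assumes "\<And>w. w \<in> {0..pi} \<Longrightarrow> \<bar>lag_window_est a m n x w - sd w\<bar> \<le> \<eta>"
  shows "\<bar>lag_window_est a m n x w - sd w\<bar> \<le> \<eta>"
proof -
  obtain v where v: "v \<in> {0..pi}" "\<And>k::int. cos (of_int k * w) = cos (of_int k * v)"
    using cos_multiples_reduce by blast
  have "2 * pi * sd w = 2 * pi * sd v"
    using has_sum_unique[OF sd_has_sum[of w]] sd_has_sum[of v] by (simp add: v(2))
  then have "sd w = sd v" by simp
  moreover have "lag_window_est a m n x w = lag_window_est a m n x v"
    unfolding lag_window_est_cos by (simp add: v(2))
  ultimately show ?thesis using assms[OF v(1)] by simp
qed

lemma sd_ge_extend:
  assumes "\<And>w. w \<in> {0..pi} \<Longrightarrow> f0 \<le> sd w"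
  shows "f0 \<le> sd w"
proof -
  obtain v where v: "v \<in> {0..pi}" "\<And>k::int. cos (of_int k * w) = cos (of_int k * v)"
    using cos_multiples_reduce by blast
  have "2 * pi * sd w = 2 * pi * sd v"
    using has_sum_unique[OF sd_has_sum[of w]] sd_has_sum[of v] by (simp add: v(2))
  then show ?thesis using assms[OF v(1)] by simp
qed

lemma window_square_integral_pos: "(LBINT t:{-1..1}. (a t)\<^sup>2) > 0"
proof -
  \<comment> \<open>Chosen so that \<open>a\<close> is at least 1/2 on [0, d], because L d <= 1/2;
    the 1 in 1 + L keeps \<open>d\<close> inside [0, 1].\<close>
  define d where "d = 1 / (2 * (1 + L))"
  have d: "d > 0" "d \<le> 1" "L * d \<le> 1 / 2" using L_nonneg by (auto simp: d_def field_simps)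
  have cont: "continuous_on {-1..1} (\<lambda>t. (a t)\<^sup>2)"
    using lipschitz_on_continuous_on[OF lipschitz] by (intro continuous_intros) (rule continuous_on_subset, auto)
  have "(LBINT t:{0..d}. 1 / 4) \<le> (LBINT t:{-1..1}. (a t)\<^sup>2)"
    unfolding set_lebesgue_integral_def
  proof (rule integral_mono)
    show "integrable lborel (\<lambda>t. indicator {0..d} t *\<^sub>R (1 / 4 :: real))"
      using borel_integrable_atLeastAtMost'[OF continuous_on_const, of 0 d "1 / 4 :: real"] unfolding set_integrable_def .
    show "integrable lborel (\<lambda>t. indicator {-1..1} t *\<^sub>R (a t)\<^sup>2)"
      using borel_integrable_atLeastAtMost'[OF cont] unfolding set_integrable_def .
    fix t :: real
    show "indicator {0..d} t *\<^sub>R (1 / 4) \<le> indicator {-1..1} t *\<^sub>R (a t)\<^sup>2"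
    proof (cases "t \<in> {0..d}")
      case True
      have "\<bar>a t - 1\<bar> \<le> L * \<bar>t - 0\<bar>" using lip[of t 0] at_0 by simp
      also have "\<dots> \<le> L * d" using True L_nonneg by (intro mult_left_mono) auto
      finally have "1 / 2 \<le> a t" using d by linarith
      then have "(1 / 2)\<^sup>2 \<le> (a t)\<^sup>2" by (intro power_mono) auto
      then show ?thesis using True d by (simp add: power2_eq_square)
    next
      case False
      then have "indicator {0..d} t = (0 :: real)" by (rule indicator_simps(2))
      then show ?thesis by simp
    qed
  qed
  moreover have "(LBINT t:{0..d}. 1 / 4) = d / 4"
    unfolding set_lebesgue_integral_def using d by simp
  ultimately show ?thesis using d by linarith
qed

lemma asymp_var_pos: "sd lam \<noteq> 0 \<Longrightarrow> asymp_var a sd lam > 0"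
  unfolding asymp_var_def eta_def using window_square_integral_pos by (intro mult_pos_pos) auto

section \<open>Stability of residuals and weights under the error of the pilot estimate\<close>

context
  fixes f0 \<eta> :: real and n :: nat and x :: "int \<Rightarrow> real" and ft :: "real \<Rightarrow> real"
  assumes f0: "f0 > 0" "\<And>w. f0 \<le> sd w" and \<eta>: "\<eta> \<ge> 0" "\<eta> < f0"
    and close: "\<And>w. \<bar>ft w - sd w\<bar> \<le> \<eta>"
begin

private definition \<rho> where "\<rho> = \<eta> / f0"

private lemma rho: "0 \<le> \<rho>" "\<rho> < 1" using f0 \<eta> by (auto simp: \<rho>_def)

text \<open>The lower bound \<open>f0\<close> turns the uniform error \<open>\<eta>\<close> into a
  relative one. Residuals and weights, being proportional to a power of the density, then change by
  factors between 1 - \<open>\<rho>\<close> and 1 + \<open>\<rho>\<close> or their inverses.\<close>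

private lemma ft_bounds: "(1 - \<rho>) * sd w \<le> ft w" "ft w \<le> (1 + \<rho>) * sd w" "ft w > 0" "sd w > 0"
proof -
  have "\<eta> = \<rho> * f0" using f0 by (simp add: \<rho>_def)
  also have "\<dots> \<le> \<rho> * sd w" using f0 rho by (intro mult_left_mono) auto
  finally show b: "(1 - \<rho>) * sd w \<le> ft w" "ft w \<le> (1 + \<rho>) * sd w"
    using close[of w] by (auto simp: algebra_simps)
  show s: "sd w > 0" using f0(2)[of w] f0(1) by linarith
  then have "(1 - \<rho>) * sd w > 0" using rho by simp
  then show "ft w > 0" using b by linarith
qed

private lemma raw_sd_nonneg: "raw_resid n x sd j \<ge> 0"
  unfolding raw_resid_def by (intro divide_nonneg_pos ft_bounds(4)) (simp add: periodogram_def)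

private lemma raw_bounds:
  "raw_resid n x ft j \<ge> 0" "raw_resid n x sd j / (1 + \<rho>) \<le> raw_resid n x ft j" "raw_resid n x ft j \<le> raw_resid n x sd j / (1 - \<rho>)"
proof -
  define w where "w = fourier_freq n (int j)"
  define I where "I = periodogram n x (int j)"
  have I: "I \<ge> 0" by (simp add: I_def periodogram_def)
  have b: "(1 - \<rho>) * sd w \<le> ft w" "ft w \<le> (1 + \<rho>) * sd w" "ft w > 0" "sd w > 0" by (rule ft_bounds)+
  have eq: "raw_resid n x ft j = I / ft w" "raw_resid n x sd j / (1 + \<rho>) = I / ((1 + \<rho>) * sd w)"
    "raw_resid n x sd j / (1 - \<rho>) = I / ((1 - \<rho>) * sd w)"
    by (simp_all add: raw_resid_def I_def w_def mult.commute)
  show "raw_resid n x ft j \<ge> 0" unfolding eq using I b by simp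
  show "raw_resid n x sd j / (1 + \<rho>) \<le> raw_resid n x ft j"
    unfolding eq using I b rho by (intro divide_left_mono) auto
  show "raw_resid n x ft j \<le> raw_resid n x sd j / (1 - \<rho>)"
    unfolding eq using I b rho by (intro divide_left_mono) auto
qed

lemma mean_power_resid_bounds:
  "mean_power_resid p n x sd / (1 + \<eta> / f0) ^ p \<le> mean_power_resid p n x ft"
  "mean_power_resid p n x ft \<le> mean_power_resid p n x sd / (1 - \<eta> / f0) ^ p"
  "mean_power_resid p n x ft \<ge> 0"
proof -
  have "(raw_resid n x sd j) ^ p / (1 + \<rho>) ^ p \<le> (raw_resid n x ft j) ^ p"
    "(raw_resid n x ft j) ^ p \<le> (raw_resid n x sd j) ^ p / (1 - \<rho>) ^ p" for j
    using power_mono[OF raw_bounds(2)[of j], of p] power_mono[OF raw_bounds(3)[of j], of p] raw_bounds(1)[of j] raw_sd_nonneg[of j] rho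
    by (auto simp: power_divide)
  then have "(\<Sum>j=1..n div 2. (raw_resid n x sd j) ^ p / (1 + \<rho>) ^ p) \<le> (\<Sum>j=1..n div 2. (raw_resid n x ft j) ^ p)"
    "(\<Sum>j=1..n div 2. (raw_resid n x ft j) ^ p) \<le> (\<Sum>j=1..n div 2. (raw_resid n x sd j) ^ p / (1 - \<rho>) ^ p)"
    by (auto intro!: sum_mono)
  from this[THEN mult_left_mono, of "1 / real (n div 2)"]
  show "mean_power_resid p n x sd / (1 + \<eta> / f0) ^ p \<le> mean_power_resid p n x ft"
    "mean_power_resid p n x ft \<le> mean_power_resid p n x sd / (1 - \<eta> / f0) ^ p"
    unfolding mean_power_resid_def \<rho>_def[symmetric] by (simp_all add: sum_divide_distrib[symmetric])
  show "mean_power_resid p n x ft \<ge> 0" by (rule mean_power_resid_nonneg[OF raw_bounds(1)])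
qed

lemma wt_square_bounds:
  "(1 - \<eta> / f0)\<^sup>2 * (wt n sd j)\<^sup>2 \<le> (wt n ft j)\<^sup>2" "(wt n ft j)\<^sup>2 \<le> (1 + \<eta> / f0)\<^sup>2 * (wt n sd j)\<^sup>2"
proof -
  define w where "w = fourier_freq n (int j)"
  define q where "q = ft w / sd w"
  have b: "(1 - \<rho>) * sd w \<le> ft w" "ft w \<le> (1 + \<rho>) * sd w" "sd w > 0" by (rule ft_bounds)+
  have q: "1 - \<rho> \<le> q" "q \<le> 1 + \<rho>" using b by (auto simp: q_def field_simps)
  have "wt n ft j = q * wt n sd j" using b(3) by (simp add: boot_weight_def q_def w_def)
  then have e: "(wt n ft j)\<^sup>2 = q\<^sup>2 * (wt n sd j)\<^sup>2" by (simp add: power_mult_distrib)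
  have "(1 - \<rho>)\<^sup>2 \<le> q\<^sup>2" "q\<^sup>2 \<le> (1 + \<rho>)\<^sup>2" using q rho by (auto intro!: power_mono)
  then show "(1 - \<eta> / f0)\<^sup>2 * (wt n sd j)\<^sup>2 \<le> (wt n ft j)\<^sup>2" "(wt n ft j)\<^sup>2 \<le> (1 + \<eta> / f0)\<^sup>2 * (wt n sd j)\<^sup>2"
    unfolding e \<rho>_def[symmetric] by (auto intro!: mult_right_mono)
qed

lemma bootstrap_defined_close:
  assumes n: "n \<ge> 2" and pos: "mean_resid n x sd > 0"
  shows "bootstrap_defined n x ft" "mean_resid n x ft > 0"
proof -
  have e: "mean_resid n x g = mean_power_resid 1 n x g" for g by (simp add: mean_resid_def mean_power_resid_def)
  have "0 < mean_resid n x sd / (1 + \<rho>)" using pos rho by simp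
  also have "\<dots> \<le> mean_resid n x ft" using mean_power_resid_bounds(1)[of 1] by (simp add: e \<rho>_def)
  finally show m: "mean_resid n x ft > 0" .
  have "ft w \<noteq> 0" for w using ft_bounds(3)[of w] by simp
  then show "bootstrap_defined n x ft" unfolding bootstrap_defined_def using m n by auto
qed

end

text \<open>With first and second empirical moments near 1 and 2 the middle formula gives a variance
  near 2 - 1 = 1. The 8 arises from applying (p + q)^2 <= 2 p^2 + 2 q^2 twice.\<close>

lemma scaled_resid_means:
  assumes n: "n \<ge> 2" and m: "mean_resid n x ft > 0"
  shows "1 / real (n div 2) * (\<Sum>i=1..n div 2. scaled_resid n x ft i) = 1"
    and "1 / real (n div 2) * (\<Sum>i=1..n div 2. (scaled_resid n x ft i - 1)\<^sup>2) =
      mean_power_resid 2 n x ft / (mean_resid n x ft)\<^sup>2 - 1"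
    and "1 / real (n div 2) * (\<Sum>i=1..n div 2. (scaled_resid n x ft i - 1) ^ 4) \<le>
      8 * (mean_power_resid 4 n x ft / (mean_resid n x ft) ^ 4 + 1)"
proof -
  define N where "N = n div 2"
  have N: "real N > 0" using n by (simp add: N_def)
  have p: "1 / real N * (\<Sum>i=1..N. (scaled_resid n x ft i) ^ p) = mean_power_resid p n x ft / (mean_resid n x ft) ^ p" for p
    unfolding scaled_resid_def mean_power_resid_def N_def power_divide by (simp add: sum_divide_distrib[symmetric])
  have "mean_power_resid 1 n x ft = mean_resid n x ft" by (simp add: mean_resid_def mean_power_resid_def)
  with p[of 1] m show one: "1 / real (n div 2) * (\<Sum>i=1..n div 2. scaled_resid n x ft i) = 1"
    by (simp add: N_def)
  have "1 / real N * (\<Sum>i=1..N. (scaled_resid n x ft i - 1)\<^sup>2) =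
     1 / real N * (\<Sum>i=1..N. (scaled_resid n x ft i)\<^sup>2) - 2 * (1 / real N * (\<Sum>i=1..N. scaled_resid n x ft i)) + 1"
    using N by (simp add: power2_diff sum.distrib sum_subtractf sum_distrib_left[symmetric] field_simps)
  then show "1 / real (n div 2) * (\<Sum>i=1..n div 2. (scaled_resid n x ft i - 1)\<^sup>2) =
      mean_power_resid 2 n x ft / (mean_resid n x ft)\<^sup>2 - 1"
    using one p[of 2] by (simp add: N_def)
  have le: "(y - 1) ^ 4 \<le> 8 * y ^ 4 + 8" for y :: real
  proof -
    have a: "(y - 1)\<^sup>2 \<le> 2 * y\<^sup>2 + 2" using sum_squares_bound[of y "- 1"] by (simp add: power2_diff)
    have "(y - 1) ^ 4 = ((y - 1)\<^sup>2)\<^sup>2" by simp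
    also have "\<dots> \<le> (2 * y\<^sup>2 + 2)\<^sup>2" using a by (intro power_mono) auto
    also have "\<dots> \<le> 8 * y ^ 4 + 8"
    proof -
      have "8 * y ^ 4 + 8 - (2 * y\<^sup>2 + 2)\<^sup>2 = 4 * (y\<^sup>2 - 1)\<^sup>2" by (simp add: power2_eq_square power4_eq_xxxx algebra_simps)
      moreover have "0 \<le> 4 * (y\<^sup>2 - 1)\<^sup>2" by simp
      ultimately show ?thesis by linarith
    qed
    finally show ?thesis .
  qed
  have "1 / real N * (\<Sum>i=1..N. (scaled_resid n x ft i - 1) ^ 4) \<le> 1 / real N * (\<Sum>i=1..N. 8 * (scaled_resid n x ft i) ^ 4 + 8)"
    by (intro mult_left_mono sum_mono le) auto
  also have "\<dots> = 8 * (1 / real N * (\<Sum>i=1..N. (scaled_resid n x ft i) ^ 4)) + 8"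
    using N by (simp add: sum.distrib sum_distrib_left[symmetric] field_simps)
  finally show "1 / real (n div 2) * (\<Sum>i=1..n div 2. (scaled_resid n x ft i - 1) ^ 4) \<le>
      8 * (mean_power_resid 4 n x ft / (mean_resid n x ft) ^ 4 + 1)"
    unfolding p[of 4] by (simp add: N_def)
qed

end

section \<open>Conditional laws along deterministic sequences\<close>

context bootstrap_setting
begin

abbreviation path :: "'a \<Rightarrow> int \<Rightarrow> real" where "path \<omega> \<equiv> (\<lambda>t. X t \<omega>)"

abbreviation centred_law :: "nat \<Rightarrow> real measure" where
  "centred_law n \<equiv> distr M borel (\<lambda>\<omega>. scale n * (fhat n \<omega> lam - expectation (\<lambda>\<omega>. fhat n \<omega> lam)))"

lemma measurable_fhat[measurable]: "(\<lambda>\<omega>. fhat n \<omega> w) \<in> borel_measurable M"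
  using integrable_fhat by (rule borel_measurable_integrable)

lemma centred_law_facts:
  shows "real_distribution (centred_law n)" and "integrable (centred_law n) (\<lambda>z. z\<^sup>2)"
    and "(\<integral>z. z\<^sup>2 \<partial>centred_law n) = real n * bw n * variance (\<lambda>\<omega>. fhat n \<omega> lam)"
proof -
  show "real_distribution (centred_law n)"
    by (rule real_distribution_distr) measurable
  have sq: "(scale n * (fhat n \<omega> lam - expectation (\<lambda>\<omega>. fhat n \<omega> lam)))\<^sup>2 =
      real n * bw n * (fhat n \<omega> lam - expectation (\<lambda>\<omega>. fhat n \<omega> lam))\<^sup>2" for \<omega>
    using bw_pos[of n] by (simp add: power_mult_distrib)
  have int: "integrable M (\<lambda>\<omega>. (fhat n \<omega> lam - expectation (\<lambda>\<omega>. fhat n \<omega> lam))\<^sup>2)"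
    unfolding power2_diff using integrable_fhat2[of n lam] integrable_fhat[of n lam] by auto
  have m: "(\<lambda>\<omega>. scale n * (fhat n \<omega> lam - expectation (\<lambda>\<omega>. fhat n \<omega> lam))) \<in> borel_measurable M"
    by measurable
  show "integrable (centred_law n) (\<lambda>z. z\<^sup>2)"
    by (rule integrable_distr_eq[OF m, THEN iffD2]) (simp, unfold sq, intro integrable_mult_right int)
  have "(\<integral>z. z\<^sup>2 \<partial>centred_law n) =
      (\<integral>\<omega>. (scale n * (fhat n \<omega> lam - expectation (\<lambda>\<omega>. fhat n \<omega> lam)))\<^sup>2 \<partial>M)"
    by (rule integral_distr[OF m]) measurable
  then show "(\<integral>z. z\<^sup>2 \<partial>centred_law n) = real n * bw n * variance (\<lambda>\<omega>. fhat n \<omega> lam)"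
    unfolding sq by (simp only: integral_mult_right_zero)
qed

text \<open>Subtracting the pilot estimate from the conditional mean replaces the outer window by
  its difference from 1, which is b_n^2 times the last factor of \<open>pilot_coeff\<close> before
  the cosine. The sample autocovariances are then split into mean and noise.\<close>

lemma pilot_mean_deviation:
  assumes n: "2 * B n + 1 < n" "Bt n \<le> B n"
  shows "(\<Sum>j=1..n div 2. wt n (pilot n \<omega>) j) - pilot n \<omega> lam =
    (bw n)\<^sup>2 / (2 * pi) * (pilot_noise n \<omega> + (\<Sum>k=- int (Bt n)..int (Bt n). pilot_coeff n k * ((1 - \<bar>of_int k\<bar> / real n) * r k)))
     - pilot n \<omega> 0 * K (B n) lam / real n"
proof -
  have "pilot_noise n \<omega> + (\<Sum>k=- int (Bt n)..int (Bt n). pilot_coeff n k * ((1 - \<bar>of_int k\<bar> / real n) * r k)) =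
     (\<Sum>k=- int (Bt n)..int (Bt n). pilot_coeff n k * racov n \<omega> k)"
    unfolding pilot_noise_def sum.distrib[symmetric] by (intro sum.cong refl) (simp add: right_diff_distrib)
  also have "(bw n)\<^sup>2 / (2 * pi) * \<dots> = 1 / (2 * pi) * (\<Sum>k=- int (Bt n)..int (Bt n). (bw n)\<^sup>2 * (pilot_coeff n k * racov n \<omega> k))"
    by (simp add: sum_distrib_left)
  also have "(\<Sum>k=- int (Bt n)..int (Bt n). (bw n)\<^sup>2 * (pilot_coeff n k * racov n \<omega> k)) =
     (\<Sum>k=- int (Bt n)..int (Bt n). racov n \<omega> k * a (of_int k * bwt n) * a (of_int k * bw n) * cos (of_int k * lam))
     - (\<Sum>k=- int (Bt n)..int (Bt n). racov n \<omega> k * a (of_int k * bwt n) * cos (of_int k * lam))"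
    unfolding sum_subtractf[symmetric]
  proof (intro sum.cong refl)
    fix k
    define \<beta> where "\<beta> = (bw n)\<^sup>2"
    have b: "\<beta> \<noteq> 0" using B_pos[of n] by (simp add: \<beta>_def)
    show "(bw n)\<^sup>2 * (pilot_coeff n k * racov n \<omega> k) =
       racov n \<omega> k * a (of_int k * bwt n) * a (of_int k * bw n) * cos (of_int k * lam) - racov n \<omega> k * a (of_int k * bwt n) * cos (of_int k * lam)"
      unfolding pilot_coeff_def \<beta>_def[symmetric] using b by (simp add: field_simps)
  qed
  finally have "(bw n)\<^sup>2 / (2 * pi) * (pilot_noise n \<omega> + (\<Sum>k=- int (Bt n)..int (Bt n). pilot_coeff n k * ((1 - \<bar>of_int k\<bar> / real n) * r k))) =
     1 / (2 * pi) * (\<Sum>k=- int (Bt n)..int (Bt n). racov n \<omega> k * a (of_int k * bwt n) * a (of_int k * bw n) * cos (of_int k * lam)) - pilot n \<omega> lam"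
    unfolding lag_window_est_cos by (simp only: right_diff_distrib)
  then show ?thesis using sum_boot_weight[OF B_pos Bt_pos n, of "path \<omega>" lam] by simp
qed

text \<open>Each resampled residual is written as its deviation from 1 plus 1: the deviations form
  the centred sum, the ones the conditional bias.\<close>

lemma boot_est_law_as_resample:
  assumes n: "n \<ge> 1"
  shows "distr (boot_est_law a (B n) n x ft lam) borel (\<lambda>y. c * (scale n * (y - z))) =
     distr (resample_law (n div 2) (scaled_resid n x ft) (\<lambda>j. scale n * wt n ft j)) borel
       (\<lambda>y. c * (y + scale n * ((\<Sum>j=1..n div 2. wt n ft j) - z)))"
proof -
  have "scale n * ((\<Sum>j=1..n div 2. e j * wt n ft j) - z) =
     (\<Sum>j=1..n div 2. scale n * wt n ft j * (e j - 1)) + scale n * ((\<Sum>j=1..n div 2. wt n ft j) - z)" for e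
  proof -
    have "(\<Sum>j=1..n div 2. scale n * wt n ft j * (e j - 1)) = scale n * (\<Sum>j=1..n div 2. e j * wt n ft j - wt n ft j)"
      unfolding sum_distrib_left by (intro sum.cong refl) (simp add: algebra_simps)
    then show ?thesis by (simp only: sum_subtractf right_diff_distrib)
  qed
  then show ?thesis
    unfolding boot_est_law_def resample_law_def resampled_resid_pmf_def resample_pmf_def boot_est_eq_weights[OF n]
    by (simp add: distr_distr comp_def)
qed

text \<open>The data enter only through the fixed points \<open>\<omega>k k\<close>, so all laws
  compared are deterministic. The scale factors \<open>c\<close> and \<open>c'\<close> serve both
  the plain and the normalised assertion.\<close>

theorem boot_mallows_sequence:
  fixes nk :: "nat \<Rightarrow> nat" and \<omega>k :: "nat \<Rightarrow> 'a" and \<eta> c' :: "nat \<Rightarrow> real"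
  assumes f0: "f0 > 0" "\<And>w. f0 \<le> sd w"
    and nk: "filterlim nk at_top sequentially" "\<And>k. nk k \<ge> 2"
    and \<eta>: "\<And>k. \<eta> k \<ge> 0" "\<And>k. \<eta> k < f0" "\<eta> \<longlonglongrightarrow> 0"
    and close: "\<And>k w. \<bar>pilot (nk k) (\<omega>k k) w - sd w\<bar> \<le> \<eta> k"
    and pos: "\<And>k. mean_resid (nk k) (path (\<omega>k k)) sd > 0"
    and m1: "(\<lambda>k. mean_resid (nk k) (path (\<omega>k k)) sd) \<longlonglongrightarrow> 1"
    and m2: "(\<lambda>k. mean_power_resid 2 (nk k) (path (\<omega>k k)) sd) \<longlonglongrightarrow> 2"
    and m4: "(\<lambda>k. real (B (nk k)) / real (nk k) * mean_power_resid 4 (nk k) (path (\<omega>k k)) sd) \<longlonglongrightarrow> 0"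
    and noise: "(\<lambda>k. pilot_noise (nk k) (\<omega>k k)) \<longlonglongrightarrow> 0"
    and c: "c' \<longlonglongrightarrow> c"
    and A6w: "weak_conv_m centred_law (density lborel (normal_density 0 (sqrt (asymp_var a sd lam))))"
    and A6v: "(\<lambda>n. real n * bw n * variance (\<lambda>\<omega>. fhat n \<omega> lam)) \<longlonglongrightarrow> asymp_var a sd lam"
  shows "(\<lambda>k. mallows_dist
      (distr M borel (\<lambda>\<omega>'. c * (scale (nk k) * (fhat (nk k) \<omega>' lam - sd lam))))
      (distr (boot_est_law a (B (nk k)) (nk k) (path (\<omega>k k)) (pilot (nk k) (\<omega>k k)) lam) borel
         (\<lambda>y. c' k * (scale (nk k) * (y - pilot (nk k) (\<omega>k k) lam))))) \<longlonglongrightarrow> 0"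
proof -
  define x where "x k = path (\<omega>k k)" for k
  define g where "g k = pilot (nk k) (\<omega>k k)" for k
  define N where "N k = nk k div 2" for k
  define s where "s k = scaled_resid (nk k) (x k) (g k)" for k
  define w where "w k j = scale (nk k) * wt (nk k) (g k) j" for k j
  define \<rho> where "\<rho> k = \<eta> k / f0" for k
  define A where "A p k = mean_power_resid p (nk k) (x k) (g k)" for p k
  define A0 where "A0 p k = mean_power_resid p (nk k) (x k) sd" for p k
  define b where "b k = real (B (nk k)) / real (nk k)" for k
  define V where "V k = (\<Sum>j=1..N k. (w k j)\<^sup>2)" for k
  define V0 where "V0 k = real (nk k) * bw (nk k) * (\<Sum>j=1..N k. (wt (nk k) sd j)\<^sup>2)" for k
  define v where "v k = 1 / real (N k) * (\<Sum>i=1..N k. (s k i - 1)\<^sup>2)" for k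
  define q where "q k = 1 / real (N k) * (\<Sum>i=1..N k. (s k i - 1) ^ 4)" for k
  define \<sigma> where "\<sigma> = sqrt (asymp_var a sd lam)"
  have av: "asymp_var a sd lam > 0" using f0(1) f0(2)[of lam] by (intro asymp_var_pos) auto
  have \<sigma>: "\<sigma> > 0" "\<sigma>\<^sup>2 = asymp_var a sd lam" using av by (auto simp: \<sigma>_def)
  have n1: "nk k \<ge> 1" "N k \<ge> 1" for k using nk(2)[of k] by (auto simp: N_def)
  note close' = close[folded g_def]
  note pert = f0 \<eta>(1) \<eta>(2) close'
  have \<rho>0: "\<rho> \<longlonglongrightarrow> 0" unfolding \<rho>_def using tendsto_divide[OF \<eta>(3) tendsto_const[of f0]] f0 by simp
  have \<rho>r: "0 \<le> \<rho> k" "\<rho> k < 1" for k using \<eta>(1,2)[of k] f0 by (auto simp: \<rho>_def)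
  have b0: "b \<longlonglongrightarrow> 0" unfolding b_def by (rule filterlim_compose[OF B_over_n_0 nk(1)])
  have bpos: "b k \<ge> 0" for k by (simp add: b_def)
  \<comment> \<open>Empirical moments with the pilot lie between those with the true density, up to
    powers of 1 + \<open>\<rho> k\<close> and 1 - \<open>\<rho> k\<close>.\<close>
  have A_lim: "A p \<longlonglongrightarrow> l" if "A0 p \<longlonglongrightarrow> l" for p l
  proof (rule tendsto_sandwich)
    show "\<forall>\<^sub>F k in sequentially. A0 p k / (1 + \<rho> k) ^ p \<le> A p k"
      unfolding A_def A0_def \<rho>_def by (intro always_eventually allI mean_power_resid_bounds(1)[OF pert])
    show "\<forall>\<^sub>F k in sequentially. A p k \<le> A0 p k / (1 - \<rho> k) ^ p"
      unfolding A_def A0_def \<rho>_def by (intro always_eventually allI mean_power_resid_bounds(2)[OF pert])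
    have "(\<lambda>k. A0 p k / (1 + \<rho> k) ^ p) \<longlonglongrightarrow> l / (1 + 0) ^ p" "(\<lambda>k. A0 p k / (1 - \<rho> k) ^ p) \<longlonglongrightarrow> l / (1 - 0) ^ p"
      by (intro tendsto_intros that \<rho>0; simp)+
    then show "(\<lambda>k. A0 p k / (1 + \<rho> k) ^ p) \<longlonglongrightarrow> l" "(\<lambda>k. A0 p k / (1 - \<rho> k) ^ p) \<longlonglongrightarrow> l" by simp_all
  qed
  have mean_eq: "mean_resid n y h = mean_power_resid 1 n y h" for n y h
    by (simp add: mean_resid_def mean_power_resid_def)
  have A1: "A 1 \<longlonglongrightarrow> 1" by (rule A_lim) (use m1 in \<open>simp only: A0_def[abs_def] x_def mean_eq\<close>)
  have A2: "A 2 \<longlonglongrightarrow> 2" by (rule A_lim) (use m2 in \<open>simp only: A0_def[abs_def] x_def\<close>)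
  have A4: "(\<lambda>k. b k * A 4 k) \<longlonglongrightarrow> 0"
  proof (rule tendsto_sandwich[OF _ _ tendsto_const])
    show "\<forall>\<^sub>F k in sequentially. 0 \<le> b k * A 4 k"
      unfolding A_def by (intro always_eventually allI mult_nonneg_nonneg bpos mean_power_resid_bounds(3)[OF pert])
    show "\<forall>\<^sub>F k in sequentially. b k * A 4 k \<le> (b k * A0 4 k) / (1 - \<rho> k) ^ 4"
    proof (intro always_eventually allI)
      fix k
      have "A 4 k \<le> A0 4 k / (1 - \<rho> k) ^ 4"
        unfolding A_def A0_def \<rho>_def by (rule mean_power_resid_bounds(2)[OF pert])
      from mult_left_mono[OF this bpos[of k]] show "b k * A 4 k \<le> (b k * A0 4 k) / (1 - \<rho> k) ^ 4" by simp
    qed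
    have "(\<lambda>k. (b k * A0 4 k) / (1 - \<rho> k) ^ 4) \<longlonglongrightarrow> 0 / (1 - 0) ^ 4"
      using m4 by (intro tendsto_intros \<rho>0) (auto simp: A0_def b_def x_def)
    then show "(\<lambda>k. (b k * A0 4 k) / (1 - \<rho> k) ^ 4) \<longlonglongrightarrow> 0" by simp
  qed
  have mpos: "mean_resid (nk k) (x k) (g k) > 0" for k
    using bootstrap_defined_close(2)[OF pert nk(2)] pos[of k] by (simp add: x_def)
  note means = scaled_resid_means[OF nk(2) mpos, folded N_def s_def]
  have v: "v \<longlonglongrightarrow> 1"
  proof -
    have "(\<lambda>k. A 2 k / (A 1 k)\<^sup>2 - 1) \<longlonglongrightarrow> 2 / 1\<^sup>2 - 1" by (intro tendsto_intros A1 A2) simp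
    then show ?thesis unfolding v_def means(2) by (simp add: A_def mean_eq)
  qed
  have q: "(\<lambda>k. b k * q k) \<longlonglongrightarrow> 0"
  proof (rule tendsto_sandwich[OF _ _ tendsto_const])
    show "\<forall>\<^sub>F k in sequentially. 0 \<le> b k * q k"
      unfolding q_def by (intro always_eventually allI mult_nonneg_nonneg bpos sum_nonneg) auto
    show "\<forall>\<^sub>F k in sequentially. b k * q k \<le> 8 * ((b k * A 4 k) / (A 1 k) ^ 4 + b k)"
    proof (intro always_eventually allI)
      fix k
      have "q k \<le> 8 * (A 4 k / (A 1 k) ^ 4 + 1)"
        using means(3)[of k] unfolding q_def by (simp add: A_def mean_eq)
      from mult_left_mono[OF this bpos[of k]] show "b k * q k \<le> 8 * ((b k * A 4 k) / (A 1 k) ^ 4 + b k)"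
        by (simp add: algebra_simps)
    qed
    have "(\<lambda>k. 8 * ((b k * A 4 k) / (A 1 k) ^ 4 + b k)) \<longlonglongrightarrow> 8 * (0 / 1 ^ 4 + 0)"
      by (intro tendsto_intros A4 A1 b0) simp
    then show "(\<lambda>k. 8 * ((b k * A 4 k) / (A 1 k) ^ 4 + b k)) \<longlonglongrightarrow> 0" by simp
  qed
  have V0: "V0 \<longlonglongrightarrow> \<sigma>\<^sup>2"
    unfolding V0_def N_def \<sigma>(2) by (rule filterlim_compose[OF wt_variance_limit nk(1)])
  have w2: "(w k j)\<^sup>2 = real (nk k) * bw (nk k) * (wt (nk k) (g k) j)\<^sup>2" for k j
    using bw_pos[of "nk k"] by (simp add: w_def power_mult_distrib)
  have V: "V \<longlonglongrightarrow> \<sigma>\<^sup>2"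
  proof (rule tendsto_sandwich)
    have nb: "0 \<le> real (nk k) * bw (nk k)" for k by simp
    show "\<forall>\<^sub>F k in sequentially. (1 - \<rho> k)\<^sup>2 * V0 k \<le> V k"
    proof (intro always_eventually allI)
      fix k
      have "(1 - \<rho> k)\<^sup>2 * V0 k = (\<Sum>j=1..N k. real (nk k) * bw (nk k) * ((1 - \<rho> k)\<^sup>2 * (wt (nk k) sd j)\<^sup>2))"
        unfolding V0_def sum_distrib_left by (intro sum.cong refl) (simp only: mult_ac)
      also have "\<dots> \<le> V k"
        unfolding V_def w2 \<rho>_def by (intro sum_mono mult_left_mono nb wt_square_bounds(1)[OF pert])
      finally show "(1 - \<rho> k)\<^sup>2 * V0 k \<le> V k" .
    qed
    show "\<forall>\<^sub>F k in sequentially. V k \<le> (1 + \<rho> k)\<^sup>2 * V0 k"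
    proof (intro always_eventually allI)
      fix k
      have "V k \<le> (\<Sum>j=1..N k. real (nk k) * bw (nk k) * ((1 + \<rho> k)\<^sup>2 * (wt (nk k) sd j)\<^sup>2))"
        unfolding V_def w2 \<rho>_def by (intro sum_mono mult_left_mono nb wt_square_bounds(2)[OF pert])
      also have "\<dots> = (1 + \<rho> k)\<^sup>2 * V0 k"
        unfolding V0_def sum_distrib_left by (intro sum.cong refl) (simp only: mult_ac)
      finally show "V k \<le> (1 + \<rho> k)\<^sup>2 * V0 k" .
    qed
    have "(\<lambda>k. (1 - \<rho> k)\<^sup>2 * V0 k) \<longlonglongrightarrow> (1 - 0)\<^sup>2 * \<sigma>\<^sup>2" "(\<lambda>k. (1 + \<rho> k)\<^sup>2 * V0 k) \<longlonglongrightarrow> (1 + 0)\<^sup>2 * \<sigma>\<^sup>2"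
      by (intro tendsto_intros \<rho>0 V0)+
    then show "(\<lambda>k. (1 - \<rho> k)\<^sup>2 * V0 k) \<longlonglongrightarrow> \<sigma>\<^sup>2" "(\<lambda>k. (1 + \<rho> k)\<^sup>2 * V0 k) \<longlonglongrightarrow> \<sigma>\<^sup>2" by simp_all
  qed
  have vV: "(\<lambda>k. v k * V k) \<longlonglongrightarrow> \<sigma>\<^sup>2" using tendsto_mult[OF v V] by simp
  have w2_le: "(w k j)\<^sup>2 \<le> 4 * wt_C * b k" for k j
  proof -
    have "(w k j)\<^sup>2 \<le> real (nk k) * bw (nk k) * ((1 + \<rho> k)\<^sup>2 * (wt (nk k) sd j)\<^sup>2)"
      unfolding w2 \<rho>_def by (intro mult_left_mono wt_square_bounds(2)[OF pert]) auto
    also have "\<dots> = (1 + \<rho> k)\<^sup>2 * (real (nk k) * bw (nk k) * (wt (nk k) sd j)\<^sup>2)" by (simp only: mult_ac)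
    also have "\<dots> \<le> 2\<^sup>2 * (wt_C * b k)"
      unfolding b_def using \<rho>r[of k] by (intro mult_mono power_mono wt_sd_square_le n1) auto
    finally show ?thesis by simp
  qed
  have q0: "q k \<ge> 0" for k unfolding q_def by (intro mult_nonneg_nonneg sum_nonneg) auto
  \<comment> \<open>Fourth powers of the weights are bounded by the largest square, O(B_n/n), times
    the sum of squares; the first factor is paired with the fourth moment \<open>q\<close>.\<close>
  have qW: "(\<lambda>k. q k * (\<Sum>j=1..N k. (w k j) ^ 4)) \<longlonglongrightarrow> 0"
  proof (rule tendsto_sandwich[OF _ _ tendsto_const])
    show "\<forall>\<^sub>F k in sequentially. 0 \<le> q k * (\<Sum>j=1..N k. (w k j) ^ 4)"
      by (intro always_eventually allI mult_nonneg_nonneg q0 sum_nonneg) auto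
    show "\<forall>\<^sub>F k in sequentially. q k * (\<Sum>j=1..N k. (w k j) ^ 4) \<le> 4 * wt_C * (b k * q k) * V k"
    proof (intro always_eventually allI)
      fix k
      have "(\<Sum>j=1..N k. (w k j) ^ 4) \<le> (\<Sum>j=1..N k. 4 * wt_C * b k * (w k j)\<^sup>2)"
      proof (rule sum_mono)
        fix j
        have "(w k j) ^ 4 = (w k j)\<^sup>2 * (w k j)\<^sup>2" by (simp add: power4_eq_xxxx power2_eq_square)
        also have "\<dots> \<le> 4 * wt_C * b k * (w k j)\<^sup>2" by (intro mult_right_mono w2_le) auto
        finally show "(w k j) ^ 4 \<le> 4 * wt_C * b k * (w k j)\<^sup>2" .
      qed
      also have "\<dots> = 4 * wt_C * b k * V k" by (simp add: V_def sum_distrib_left)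
      finally have "q k * (\<Sum>j=1..N k. (w k j) ^ 4) \<le> q k * (4 * wt_C * b k * V k)" by (intro mult_left_mono q0)
      then show "q k * (\<Sum>j=1..N k. (w k j) ^ 4) \<le> 4 * wt_C * (b k * q k) * V k" by (simp only: mult_ac)
    qed
    have "(\<lambda>k. 4 * wt_C * (b k * q k) * V k) \<longlonglongrightarrow> 4 * wt_C * 0 * \<sigma>\<^sup>2" by (intro tendsto_intros q V)
    then show "(\<lambda>k. 4 * wt_C * (b k * q k) * V k) \<longlonglongrightarrow> 0" by simp
  qed
  define \<nu> where "\<nu> k = resample_law (N k) (s k) (w k)" for k
  note law = resample_law_basic[OF n1(2) means(1)]
  have \<nu>: "real_distribution (\<nu> k)" "integrable (\<nu> k) (\<lambda>z. z\<^sup>2)" for k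
    unfolding \<nu>_def by (rule law(1), rule law(2))
  have \<nu>w: "weak_conv_m \<nu> (density lborel (normal_density 0 \<sigma>))"
    unfolding \<nu>_def
    by (rule resample_law_clt[OF n1(2) means(1) _ \<sigma>(1)]) (use vV qW in \<open>simp_all add: v_def V_def q_def\<close>)
  note nf = normal_distribution_facts[OF \<sigma>(1)]
  define ef where "ef n = expectation (\<lambda>\<omega>. fhat n \<omega> lam)" for n
  define xs where "xs n = scale n * (ef n - sd lam)" for n
  define y where "y k = scale (nk k) * ((\<Sum>j=1..N k. wt (nk k) (g k) j) - g k lam)" for k
  define \<beta>1 where "\<beta>1 n = 2 * pi * (ef n - sd lam) / (bw n)\<^sup>2" for n
  define \<beta>2 where "\<beta>2 n = (\<Sum>k=- int (Bt n)..int (Bt n). pilot_coeff n k * ((1 - \<bar>of_int k\<bar> / real n) * r k))" for n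
  \<comment> \<open>Common scale of both biases. It is only bounded, so the shifts need not
    converge; their difference does, because \<open>\<beta>1\<close> and \<open>\<beta>2\<close>
    have the same limit.\<close>
  define sb where "sb n = scale n * (bw n)\<^sup>2 / (2 * pi)" for n
  have \<beta>1: "(\<lambda>k. \<beta>1 (nk k)) \<longlonglongrightarrow> curvature" and \<beta>2: "(\<lambda>k. \<beta>2 (nk k)) \<longlonglongrightarrow> curvature"
    unfolding \<beta>1_def \<beta>2_def ef_def using filterlim_compose[OF fhat_bias nk(1)] filterlim_compose[OF pilot_bias nk(1)] .
  have sbB: "Bseq (\<lambda>k. sb (nk k))"
  proof -
    obtain C where C: "eventually (\<lambda>n. scale n * (bw n)\<^sup>2 \<le> C) sequentially" using scale_bw2_bounded by blast
    have "eventually (\<lambda>n. \<bar>sb n\<bar> \<le> C / (2 * pi)) sequentially"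
      using C by eventually_elim (simp add: sb_def divide_right_mono abs_mult)
    then show ?thesis by (rule Bseq_compose_filterlim[OF _ nk(1)])
  qed
  have xs_eq: "xs n = sb n * \<beta>1 n" for n
    using B_pos[of n] by (simp add: xs_def sb_def \<beta>1_def)
  have xB: "Bseq (\<lambda>k. xs (nk k))"
  proof -
    have "Bseq (\<lambda>k. \<beta>1 (nk k))" using \<beta>1 by (intro convergent_imp_Bseq convergentI)
    then show ?thesis unfolding xs_eq by (rule Bseq_mult[OF sbB])
  qed
  \<comment> \<open>The contribution of the suppressed frequency 0.\<close>
  define t where "t k = scale (nk k) * (g k 0 * K (B (nk k)) lam / real (nk k))" for k
  have t0: "t \<longlonglongrightarrow> 0"
  proof (rule Lim_null_comparison)
    show "\<forall>\<^sub>F k in sequentially. norm (t k) \<le> (R0 + f0) * (3 * (1 + L)) * (scale (nk k) * b k)"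
    proof (intro always_eventually allI)
      fix k
      have "\<bar>g k 0\<bar> \<le> R0 + f0" using close'[of k 0] \<eta>(2)[of k] abs_sd_le_R0[of 0] by linarith
      then have "\<bar>g k 0\<bar> * \<bar>K (B (nk k)) lam\<bar> \<le> (R0 + f0) * (3 * (1 + L) * real (B (nk k)))"
        using abs_kernel_le[OF B_pos] f0 R0_nonneg by (intro mult_mono) auto
      then have "scale (nk k) / real (nk k) * (\<bar>g k 0\<bar> * \<bar>K (B (nk k)) lam\<bar>) \<le>
          scale (nk k) / real (nk k) * ((R0 + f0) * (3 * (1 + L) * real (B (nk k))))"
        by (intro mult_left_mono) auto
      then show "norm (t k) \<le> (R0 + f0) * (3 * (1 + L)) * (scale (nk k) * b k)"
        by (simp add: t_def b_def abs_mult mult_ac)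
    qed
    show "(\<lambda>k. (R0 + f0) * (3 * (1 + L)) * (scale (nk k) * b k)) \<longlonglongrightarrow> 0"
      using tendsto_mult_left[OF filterlim_compose[OF scale_B_over_n_0 nk(1)], of "(R0 + f0) * (3 * (1 + L))"]
      by (simp add: b_def)
  qed
  have y_eq: "eventually (\<lambda>k. y k = sb (nk k) * (pilot_noise (nk k) (\<omega>k k) + \<beta>2 (nk k)) - t k) sequentially"
    using eventually_compose_filterlim[OF eventually_window_small[OF B_small] nk(1)]
      eventually_compose_filterlim[OF eventually_Bt_le_B nk(1)]
  proof eventually_elim
    case (elim k)
    show ?case
      unfolding y_def g_def N_def pilot_mean_deviation[OF elim] t_def sb_def \<beta>2_def
      by (simp add: right_diff_distrib)
  qed
  have xy: "(\<lambda>k. xs (nk k) - y k) \<longlonglongrightarrow> 0"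
  proof (rule Lim_transform_eventually)
    have "(\<lambda>k. \<beta>1 (nk k) - (pilot_noise (nk k) (\<omega>k k) + \<beta>2 (nk k))) \<longlonglongrightarrow> curvature - (0 + curvature)"
      by (intro tendsto_intros \<beta>1 \<beta>2 noise)
    then have "(\<lambda>k. sb (nk k) * (\<beta>1 (nk k) - (pilot_noise (nk k) (\<omega>k k) + \<beta>2 (nk k)))) \<longlonglongrightarrow> 0"
      by (intro tendsto_Bseq_mult_0[OF sbB]) simp
    from tendsto_add[OF this t0]
    show "(\<lambda>k. sb (nk k) * (\<beta>1 (nk k) - (pilot_noise (nk k) (\<omega>k k) + \<beta>2 (nk k))) + t k) \<longlonglongrightarrow> 0" by simp
    show "\<forall>\<^sub>F k in sequentially. sb (nk k) * (\<beta>1 (nk k) - (pilot_noise (nk k) (\<omega>k k) + \<beta>2 (nk k))) + t k = xs (nk k) - y k"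
      using y_eq by eventually_elim (simp add: xs_eq algebra_simps)
  qed
  have "(\<lambda>k. mallows_dist (distr (centred_law (nk k)) borel (\<lambda>z. c * (z + xs (nk k))))
                          (distr (\<nu> k) borel (\<lambda>z. c' k * (z + y k)))) \<longlonglongrightarrow> 0"
  proof (rule mallows_dist_tendsto_0[where N="density lborel (normal_density 0 \<sigma>)"])
    show "weak_conv_m (\<lambda>k. centred_law (nk k)) (density lborel (normal_density 0 \<sigma>))"
      unfolding \<sigma>_def by (rule weak_conv_m_compose[OF A6w nk(1)])
    show "(\<lambda>k. \<integral>z. z\<^sup>2 \<partial>centred_law (nk k)) \<longlonglongrightarrow> (\<integral>z. z\<^sup>2 \<partial>density lborel (\<lambda>x. ennreal (normal_density 0 \<sigma> x)))"
      unfolding centred_law_facts(3) nf(4) \<sigma>(2) by (rule filterlim_compose[OF A6v nk(1)])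
    show "(\<lambda>k. \<integral>z. z\<^sup>2 \<partial>\<nu> k) \<longlonglongrightarrow> (\<integral>z. z\<^sup>2 \<partial>density lborel (\<lambda>x. ennreal (normal_density 0 \<sigma> x)))"
      unfolding \<nu>_def law(3) nf(4) using vV by (simp add: v_def V_def)
  qed (use \<nu>w nf(1,3) centred_law_facts(1,2) \<nu> c xB xy in simp_all)
  moreover have "distr (centred_law (nk k)) borel (\<lambda>z. c * (z + xs (nk k))) =
      distr M borel (\<lambda>\<omega>'. c * (scale (nk k) * (fhat (nk k) \<omega>' lam - sd lam)))" for k
    by (subst distr_distr) (auto simp: comp_def xs_def ef_def algebra_simps intro!: distr_cong)
  moreover have "distr (boot_est_law a (B (nk k)) (nk k) (path (\<omega>k k)) (pilot (nk k) (\<omega>k k)) lam) borel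
         (\<lambda>y. c' k * (scale (nk k) * (y - pilot (nk k) (\<omega>k k) lam))) = distr (\<nu> k) borel (\<lambda>z. c' k * (z + y k))" for k
    unfolding boot_est_law_as_resample[OF n1(1)] \<nu>_def N_def s_def w_def[abs_def] y_def g_def x_def ..
  ultimately show ?thesis by simp
qed

end

section \<open>Convergence in probability\<close>

text \<open>If for every m some n >= m and some point made all statistics at most 1/(m+1) but
  \<open>D\<close> larger than \<open>\<epsilon>\<close>, these choices would form a sequence
  contradicting the second assumption. Hence one m works, and the exceptional sets of the statistics
  cover that of \<open>D\<close>, whose own measurability never enters.\<close>

lemma small_o_prob_transfer:
  assumes G: "\<And>G. G \<in> set Gs \<Longrightarrow> small_o_prob M G (\<lambda>_. 1)"
    and D: "\<And>nk \<omega>k. filterlim nk at_top sequentially \<Longrightarrow> (\<And>k. \<omega>k k \<in> space M) \<Longrightarrow>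
      (\<And>G. G \<in> set Gs \<Longrightarrow> (\<lambda>k. G (nk k) (\<omega>k k)) \<longlonglongrightarrow> 0) \<Longrightarrow> (\<lambda>k. D (nk k) (\<omega>k k)) \<longlonglongrightarrow> 0"
  shows "small_o_prob M D (\<lambda>_. 1)"
  unfolding small_o_prob_def
proof (intro allI impI)
  fix \<epsilon> :: real assume \<epsilon>: "\<epsilon> > 0"
  define bad where "bad m n \<omega> \<longleftrightarrow> n \<ge> m \<and> \<omega> \<in> space M \<and> (\<forall>G\<in>set Gs. \<bar>G n \<omega>\<bar> \<le> 1 / real (Suc m)) \<and> \<bar>D n \<omega>\<bar> > \<epsilon>"
    for m n \<omega>
  have "\<exists>m. \<forall>n \<omega>. \<not> bad m n \<omega>"
  proof (rule ccontr)
    assume "\<not> ?thesis"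
    then have "\<forall>m. \<exists>n \<omega>. bad m n \<omega>" by blast
    from choice[OF this] obtain nk where "\<forall>m. \<exists>\<omega>. bad m (nk m) \<omega>" by (rule exE)
    from choice[OF this] obtain \<omega>k where "\<forall>m. bad m (nk m) (\<omega>k m)" by (rule exE)
    then have nk: "\<And>m. nk m \<ge> m" "\<And>m. \<omega>k m \<in> space M"
      "\<And>m G. G \<in> set Gs \<Longrightarrow> \<bar>G (nk m) (\<omega>k m)\<bar> \<le> 1 / real (Suc m)" "\<And>m. \<bar>D (nk m) (\<omega>k m)\<bar> > \<epsilon>"
      unfolding bad_def by blast+
    have "(\<lambda>k. D (nk k) (\<omega>k k)) \<longlonglongrightarrow> 0"
    proof (rule D)
      show "filterlim nk at_top sequentially"
        by (rule filterlim_at_top_mono[OF filterlim_ident]) (use nk(1) in auto)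
      show "(\<lambda>k. G (nk k) (\<omega>k k)) \<longlonglongrightarrow> 0" if "G \<in> set Gs" for G
        by (rule Lim_null_comparison[OF _ LIMSEQ_inverse_real_of_nat])
          (use nk(3)[OF that] in \<open>auto simp: inverse_eq_divide\<close>)
    qed (rule nk(2))
    from tendsto_rabs[OF this] have "\<epsilon> \<le> \<bar>0\<bar>"
      by (rule LIMSEQ_le_const) (use nk(4) less_imp_le in blast)
    with \<epsilon> show False by simp
  qed
  then obtain m where m: "\<not> bad m n \<omega>" for n \<omega> by blast
  have "\<forall>G\<in>set Gs. \<exists>A. (\<forall>n. A n \<in> sets M \<and> {\<omega> \<in> space M. \<bar>G n \<omega> / 1\<bar> > 1 / real (Suc m)} \<subseteq> A n) \<and>
      (\<lambda>n. measure M (A n)) \<longlonglongrightarrow> 0"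
    using G unfolding small_o_prob_def by simp
  from bchoice[OF this] obtain A where A: "\<And>G n. G \<in> set Gs \<Longrightarrow> A G n \<in> sets M"
    "\<And>G n. G \<in> set Gs \<Longrightarrow> {\<omega> \<in> space M. \<bar>G n \<omega> / 1\<bar> > 1 / real (Suc m)} \<subseteq> A G n"
    "\<And>G. G \<in> set Gs \<Longrightarrow> (\<lambda>n. measure M (A G n)) \<longlonglongrightarrow> 0"
    by blast
  \<comment> \<open>Nothing is known for n < m, so the whole space is taken there; the limit does
    not see it.\<close>
  define A' where "A' n = (if n < m then space M else (\<Union>G\<in>set Gs. A G n))" for n
  have "A' n \<in> sets M" for n using A(1) by (auto simp: A'_def)
  moreover have "{\<omega> \<in> space M. \<bar>D n \<omega> / 1\<bar> > \<epsilon>} \<subseteq> A' n" for n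
  proof
    fix \<omega> assume \<omega>: "\<omega> \<in> {\<omega> \<in> space M. \<bar>D n \<omega> / 1\<bar> > \<epsilon>}"
    show "\<omega> \<in> A' n"
    proof (cases "n < m")
      case False
      then obtain G where "G \<in> set Gs" "\<bar>G n \<omega>\<bar> > 1 / real (Suc m)" using m[of n \<omega>] \<omega> unfolding bad_def by (auto simp: not_less)
      then show ?thesis using A(2)[of G n] \<omega> False by (auto simp: A'_def)
    qed (use \<omega> in \<open>auto simp: A'_def\<close>)
  qed
  moreover have "(\<lambda>n. measure M (A' n)) \<longlonglongrightarrow> 0"
  proof (rule tendsto_sandwich[OF _ _ tendsto_const])
    show "\<forall>\<^sub>F n in sequentially. measure M (A' n) \<le> (\<Sum>G\<in>set Gs. measure M (A G n))"
      using eventually_ge_at_top[of m]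
      by eventually_elim (use A(1) in \<open>auto simp: A'_def intro!: measure_UNION_le\<close>)
    show "(\<lambda>n. \<Sum>G\<in>set Gs. measure M (A G n)) \<longlonglongrightarrow> 0"
      by (rule tendsto_null_sum) (rule A(3))
  qed auto
  ultimately show "\<exists>A. (\<forall>n. A n \<in> sets M \<and> {\<omega> \<in> space M. \<bar>D n \<omega> / 1\<bar> > \<epsilon>} \<subseteq> A n) \<and>
      (\<lambda>n. measure M (A n)) \<longlonglongrightarrow> 0" by blast
qed

text \<open>Markov's inequality. Where integrability fails, which happens for finitely many
  \<open>n\<close> only, the covering set is the whole space.\<close>

lemma small_o_prob_Markov:
  assumes nonneg: "\<And>n \<omega>. Z n \<omega> \<ge> 0"
    and h: "eventually (\<lambda>n. integrable M (Z n) \<and> (\<integral>\<omega>. Z n \<omega> \<partial>M) \<le> h n) sequentially" "h \<longlonglongrightarrow> 0"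
  shows "small_o_prob M Z (\<lambda>_. 1)"
  unfolding small_o_prob_def
proof (intro allI impI)
  fix \<epsilon> :: real assume \<epsilon>: "\<epsilon> > 0"
  define A where "A n = (if integrable M (Z n) then {\<omega> \<in> space M. \<epsilon> \<le> Z n \<omega>} else space M)" for n
  have [measurable]: "A n \<in> sets M" for n
  proof (cases "integrable M (Z n)")
    case True
    then have [measurable]: "Z n \<in> borel_measurable M" by simp
    have "{\<omega> \<in> space M. \<epsilon> \<le> Z n \<omega>} \<in> sets M" by measurable
    then show ?thesis using True by (simp add: A_def)
  qed (simp add: A_def)
  moreover have "{\<omega> \<in> space M. \<bar>Z n \<omega> / 1\<bar> > \<epsilon>} \<subseteq> A n" for n
    using nonneg by (auto simp: A_def)
  moreover have "(\<lambda>n. measure M (A n)) \<longlonglongrightarrow> 0"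
  proof (rule tendsto_sandwich[OF _ _ tendsto_const])
    show "\<forall>\<^sub>F n in sequentially. measure M (A n) \<le> h n / \<epsilon>"
      using h(1)
    proof eventually_elim
      case (elim n)
      have "measure M {\<omega> \<in> space M. \<epsilon> \<le> Z n \<omega>} \<le> (\<integral>\<omega>. Z n \<omega> \<partial>M) / \<epsilon>"
        by (rule integral_Markov_inequality_measure[OF _ sets.top]) (use elim nonneg \<epsilon> in auto)
      also have "\<dots> \<le> h n / \<epsilon>" using elim \<epsilon> by (intro divide_right_mono) auto
      finally show ?case using elim by (simp add: A_def)
    qed
    show "(\<lambda>n. h n / \<epsilon>) \<longlonglongrightarrow> 0" using tendsto_divide[OF h(2) tendsto_const, of \<epsilon>] \<epsilon> by simp
  qed auto
  ultimately show "\<exists>A. (\<forall>n. A n \<in> sets M \<and> {\<omega> \<in> space M. \<bar>Z n \<omega> / 1\<bar> > \<epsilon>} \<subseteq> A n) \<and>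
      (\<lambda>n. measure M (A n)) \<longlonglongrightarrow> 0" by blast
qed

lemma tendsto_of_square_diff:
  fixes z :: "nat \<Rightarrow> real"
  assumes "(\<lambda>k. (z k - c)\<^sup>2) \<longlonglongrightarrow> 0"
  shows "z \<longlonglongrightarrow> c"
  using assms power_tendsto_0_iff[of 2 "\<lambda>k. z k - c" sequentially] by (simp add: LIM_zero_iff)

context bootstrap_setting
begin

text \<open>A real supremum bounds its members only for sets bounded above; here a trigonometric
  polynomial minus a bounded function supplies the bound.\<close>

lemma pilot_le_SUP:
  assumes "w \<in> {0..pi}"
  shows "\<bar>pilot n \<omega> w - sd w\<bar> \<le> (SUP l\<in>{0..pi}. \<bar>pilot n \<omega> l - sd l\<bar>)"
proof (rule cSUP_upper[OF assms])
  define C where "C = (\<Sum>k=- int (Bt n)..int (Bt n). \<bar>sample_autocov n (path \<omega>) k * a (of_int k * bwt n)\<bar>)"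
  have "\<bar>pilot n \<omega> l - sd l\<bar> \<le> 1 / (2 * pi) * C + R0" for l
  proof -
    have "\<bar>\<Sum>k=- int (Bt n)..int (Bt n). sample_autocov n (path \<omega>) k * a (of_int k * bwt n) * cos (of_int k * l)\<bar> \<le> C"
      unfolding C_def
      by (intro order_trans[OF sum_abs] sum_mono) (simp only: abs_mult mult_left_le abs_cos_le_one abs_ge_zero mult_nonneg_nonneg)
    then have "\<bar>pilot n \<omega> l\<bar> \<le> 1 / (2 * pi) * C"
      unfolding lag_window_est_cos abs_mult by (intro mult_mono) auto
    then show ?thesis using abs_sd_le_R0[of l] by linarith
  qed
  then show "bdd_above ((\<lambda>l. \<bar>pilot n \<omega> l - sd l\<bar>) ` {0..pi})"
    by (intro bdd_aboveI2)
qed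

text \<open>The function \<open>\<gamma>\<close> carries the normalisation of both laws; continuity
  at the true value turns consistency of the pilot into convergence of the random factor.\<close>

theorem boot_mallows_small_o_prob:
  fixes Lstar :: "nat \<Rightarrow> 'a \<Rightarrow> real measure" and \<gamma> :: "real \<Rightarrow> real"
  assumes f0: "f0 > 0" "\<And>w. w \<in> {0..pi} \<Longrightarrow> f0 \<le> sd w"
    and A3: "small_o_prob M (\<lambda>n \<omega>. SUP l\<in>{0..pi}. \<bar>pilot n \<omega> l - sd l\<bar>) bw"
    and Lstar: "\<And>n \<omega>. \<omega> \<in> space M \<Longrightarrow> bootstrap_defined n (path \<omega>) (pilot n \<omega>) \<Longrightarrow>
       Lstar n \<omega> = boot_est_law a (B n) n (path \<omega>) (pilot n \<omega>) lam"
    and A6w: "weak_conv_m centred_law (density lborel (normal_density 0 (sqrt (asymp_var a sd lam))))"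
    and A6v: "(\<lambda>n. real n * bw n * variance (\<lambda>\<omega>. fhat n \<omega> lam)) \<longlonglongrightarrow> asymp_var a sd lam"
    and \<gamma>: "isCont \<gamma> (sd lam)"
  shows "small_o_prob M (\<lambda>n \<omega>. mallows_dist
       (distr M borel (\<lambda>\<omega>'. \<gamma> (sd lam) * (scale n * (fhat n \<omega>' lam - sd lam))))
       (distr (Lstar n \<omega>) borel (\<lambda>y. \<gamma> (pilot n \<omega> lam) * (scale n * (y - pilot n \<omega> lam))))) (\<lambda>_. 1)"
proof -
  define S where "S n \<omega> = (SUP l\<in>{0..pi}. \<bar>pilot n \<omega> l - sd l\<bar>)" for n \<omega>
  \<comment> \<open>The five controlling statistics: pilot error, noise and three residual moments.
    Squares appear where the available information is convergence in mean square.\<close>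
  define G1 where "G1 n \<omega> = S n \<omega> / bw n" for n \<omega>
  define G2 where "G2 n \<omega> = (pilot_noise n \<omega>)\<^sup>2" for n \<omega>
  define G3 where "G3 n \<omega> = (mean_resid n (path \<omega>) sd - 1)\<^sup>2" for n \<omega>
  define G4 where "G4 n \<omega> = (mean_power_resid 2 n (path \<omega>) sd - 2)\<^sup>2" for n \<omega>
  define G5 where "G5 n \<omega> = real (B n) / real n * mean_power_resid 4 n (path \<omega>) sd" for n \<omega>
  have g1: "small_o_prob M G1 (\<lambda>_. 1)" using A3 by (simp add: small_o_prob_def G1_def S_def)
  have g2: "small_o_prob M G2 (\<lambda>_. 1)"
  proof -
    obtain h where h: "h \<longlonglongrightarrow> 0"
      "eventually (\<lambda>n. integrable M (\<lambda>\<omega>. (pilot_noise n \<omega>)\<^sup>2) \<and> expectation (\<lambda>\<omega>. (pilot_noise n \<omega>)\<^sup>2) \<le> h n) sequentially"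
      using pilot_noise_L2 by blast
    show ?thesis unfolding G2_def by (rule small_o_prob_Markov[OF _ h(2,1)]) simp
  qed
  have g3: "small_o_prob M G3 (\<lambda>_. 1)"
    unfolding G3_def by (rule small_o_prob_Markov[OF _ _ mean_resid_L2(2)[OF f0]]) (use mean_resid_L2(1)[OF f0] in auto)
  have g4: "small_o_prob M G4 (\<lambda>_. 1)"
    unfolding G4_def mean_power_resid_def
    by (rule small_o_prob_Markov[OF _ _ mean_square_resid_L2(2)[OF f0]]) (use mean_square_resid_L2(1)[OF f0] in auto)
  have g5: "small_o_prob M G5 (\<lambda>_. 1)"
  proof -
    obtain C where C: "\<And>n. n \<ge> 2 \<Longrightarrow> expectation (\<lambda>\<omega>. mean_power_resid 4 n (path \<omega>) sd) \<le> C"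
      using mean_fourth_resid_bounded(2)[OF f0] unfolding mean_power_resid_def by blast
    have i: "integrable M (\<lambda>\<omega>. mean_power_resid 4 n (path \<omega>) sd)" for n
      using mean_fourth_resid_bounded(1)[OF f0] unfolding mean_power_resid_def .
    have ev: "eventually (\<lambda>n. integrable M (G5 n) \<and> expectation (G5 n) \<le> real (B n) / real n * C) sequentially"
      using eventually_ge_at_top[of 2]
    proof eventually_elim
      case (elim n)
      have "integrable M (G5 n)" unfolding G5_def[abs_def] by (intro integrable_mult_right i)
      moreover have "expectation (G5 n) = real (B n) / real n * expectation (\<lambda>\<omega>. mean_power_resid 4 n (path \<omega>) sd)"
        unfolding G5_def[abs_def] by (rule integral_mult_right_zero)
      moreover have "\<dots> \<le> real (B n) / real n * C" by (intro mult_left_mono C elim) simp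
      ultimately show ?case by simp
    qed
    have "G5 n \<omega> \<ge> 0" for n \<omega>
      unfolding G5_def mean_power_resid_def by (intro mult_nonneg_nonneg sum_nonneg) auto
    moreover have "(\<lambda>n. real (B n) / real n * C) \<longlonglongrightarrow> 0" using tendsto_mult_right[OF B_over_n_0, of C] by simp
    ultimately show ?thesis using small_o_prob_Markov[OF _ ev] by blast
  qed
  have f0': "f0 \<le> sd w" for w by (rule sd_ge_extend) (rule f0(2))
  show ?thesis
  proof (rule small_o_prob_transfer[where Gs="[G1, G2, G3, G4, G5]"])
    show "small_o_prob M G (\<lambda>_. 1)" if "G \<in> set [G1, G2, G3, G4, G5]" for G
      using that g1 g2 g3 g4 g5 by auto
    fix nk :: "nat \<Rightarrow> nat" and \<omega>k
    assume nk: "filterlim nk at_top sequentially" and \<omega>: "\<And>k. \<omega>k k \<in> space M"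
      and G0: "\<And>G. G \<in> set [G1, G2, G3, G4, G5] \<Longrightarrow> (\<lambda>k. G (nk k) (\<omega>k k)) \<longlonglongrightarrow> 0"
    define \<eta> where "\<eta> k = S (nk k) (\<omega>k k)" for k
    have \<eta>0: "\<eta> \<longlonglongrightarrow> 0"
    proof -
      have "(\<lambda>k. G1 (nk k) (\<omega>k k) * bw (nk k)) \<longlonglongrightarrow> 0 * 0"
        by (intro tendsto_mult G0 filterlim_compose[OF bw_0 nk]) simp
      moreover have "G1 (nk k) (\<omega>k k) * bw (nk k) = \<eta> k" for k
        using B_pos[of "nk k"] by (simp add: G1_def \<eta>_def)
      ultimately show ?thesis by simp
    qed
    have close: "\<bar>pilot (nk k) (\<omega>k k) w - sd w\<bar> \<le> \<eta> k" for k w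
      unfolding \<eta>_def S_def by (rule sd_extend) (rule pilot_le_SUP)
    have \<eta>_nonneg: "\<eta> k \<ge> 0" for k using close[of k 0] by linarith
    have noise: "(\<lambda>k. pilot_noise (nk k) (\<omega>k k)) \<longlonglongrightarrow> 0"
      by (rule tendsto_of_square_diff) (use G0[of G2] in \<open>simp add: G2_def\<close>)
    have m1: "(\<lambda>k. mean_resid (nk k) (path (\<omega>k k)) sd) \<longlonglongrightarrow> 1"
      by (rule tendsto_of_square_diff) (use G0[of G3] in \<open>simp add: G3_def\<close>)
    have m2: "(\<lambda>k. mean_power_resid 2 (nk k) (path (\<omega>k k)) sd) \<longlonglongrightarrow> 2"
      by (rule tendsto_of_square_diff) (use G0[of G4] in \<open>simp add: G4_def\<close>)
    have m4: "(\<lambda>k. real (B (nk k)) / real (nk k) * mean_power_resid 4 (nk k) (path (\<omega>k k)) sd) \<longlonglongrightarrow> 0"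
      using G0[of G5] by (simp add: G5_def)
    have "(\<lambda>k. pilot (nk k) (\<omega>k k) lam - sd lam) \<longlonglongrightarrow> 0"
      by (rule Lim_null_comparison[OF _ \<eta>0]) (use close in auto)
    then have "(\<lambda>k. pilot (nk k) (\<omega>k k) lam) \<longlonglongrightarrow> sd lam" by (simp add: LIM_zero_iff)
    then have c: "(\<lambda>k. \<gamma> (pilot (nk k) (\<omega>k k) lam)) \<longlonglongrightarrow> \<gamma> (sd lam)" by (rule isCont_tendsto_compose[OF \<gamma>])
    \<comment> \<open>The deterministic theorem wants its side conditions for every index, so the
      sequence is shifted past the point from which they hold.\<close>
    have "eventually (\<lambda>k. nk k \<ge> 2 \<and> \<eta> k < f0 \<and> mean_resid (nk k) (path (\<omega>k k)) sd > 0) sequentially"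
      using filterlim_at_top[THEN iffD1, OF nk] order_tendstoD(2)[OF \<eta>0 f0(1)] order_tendstoD(1)[OF m1, of 0]
      by (intro eventually_conj) auto
    then obtain k0 where k0: "\<And>k. k \<ge> k0 \<Longrightarrow> nk k \<ge> 2 \<and> \<eta> k < f0 \<and> mean_resid (nk k) (path (\<omega>k k)) sd > 0"
      unfolding eventually_sequentially by blast
    have k0': "nk (k + k0) \<ge> 2" "\<eta> (k + k0) < f0" "mean_resid (nk (k + k0)) (path (\<omega>k (k + k0))) sd > 0" for k
      using k0[of "k + k0"] by auto
    have Leq: "Lstar (nk (k + k0)) (\<omega>k (k + k0)) = boot_est_law a (B (nk (k + k0))) (nk (k + k0))
         (path (\<omega>k (k + k0))) (pilot (nk (k + k0)) (\<omega>k (k + k0))) lam" for k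
      by (rule Lstar[OF \<omega>]) (rule bootstrap_defined_close(1)[OF f0(1) f0' \<eta>_nonneg k0'(2) close k0'(1,3)])
    have "(\<lambda>k. mallows_dist
       (distr M borel (\<lambda>\<omega>'. \<gamma> (sd lam) * (scale (nk (k + k0)) * (fhat (nk (k + k0)) \<omega>' lam - sd lam))))
       (distr (boot_est_law a (B (nk (k + k0))) (nk (k + k0)) (path (\<omega>k (k + k0))) (pilot (nk (k + k0)) (\<omega>k (k + k0))) lam) borel
          (\<lambda>y. \<gamma> (pilot (nk (k + k0)) (\<omega>k (k + k0)) lam) * (scale (nk (k + k0)) * (y - pilot (nk (k + k0)) (\<omega>k (k + k0)) lam))))) \<longlonglongrightarrow> 0"
    proof (rule boot_mallows_sequence[where nk="\<lambda>k. nk (k + k0)" and \<omega>k="\<lambda>k. \<omega>k (k + k0)" and \<eta>="\<lambda>k. \<eta> (k + k0)"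
        and c'="\<lambda>k. \<gamma> (pilot (nk (k + k0)) (\<omega>k (k + k0)) lam)"])
      show "filterlim (\<lambda>k. nk (k + k0)) at_top sequentially"
        by (rule filterlim_compose[OF nk filterlim_add_const_nat_at_top])
    qed (rule f0(1) f0' k0' \<eta>_nonneg close A6w A6v LIMSEQ_ignore_initial_segment \<eta>0 m1 m2 m4 noise c)+
    then have "(\<lambda>k. mallows_dist
       (distr M borel (\<lambda>\<omega>'. \<gamma> (sd lam) * (scale (nk (k + k0)) * (fhat (nk (k + k0)) \<omega>' lam - sd lam))))
       (distr (Lstar (nk (k + k0)) (\<omega>k (k + k0))) borel
          (\<lambda>y. \<gamma> (pilot (nk (k + k0)) (\<omega>k (k + k0)) lam) * (scale (nk (k + k0)) * (y - pilot (nk (k + k0)) (\<omega>k (k + k0)) lam))))) \<longlonglongrightarrow> 0"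
      unfolding Leq .
    then show "(\<lambda>k. mallows_dist
       (distr M borel (\<lambda>\<omega>'. \<gamma> (sd lam) * (scale (nk k) * (fhat (nk k) \<omega>' lam - sd lam))))
       (distr (Lstar (nk k) (\<omega>k k)) borel
          (\<lambda>y. \<gamma> (pilot (nk k) (\<omega>k k) lam) * (scale (nk k) * (y - pilot (nk k) (\<omega>k k) lam))))) \<longlonglongrightarrow> 0"
      by (rule LIMSEQ_offset)
  qed
qed

end

theorem theorem4p1:
  fixes M :: "'a measure" and X :: "int \<Rightarrow> 'a \<Rightarrow> real"
    and a :: "real \<Rightarrow> real" and B Bt :: "nat \<Rightarrow> nat"
    and r :: "int \<Rightarrow> real" and f :: "real \<Rightarrow> real"
    and fn ft :: "nat \<Rightarrow> 'a \<Rightarrow> real \<Rightarrow> real"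
    and lam c2 :: real
    and Lstar :: "nat \<Rightarrow> 'a \<Rightarrow> real measure"
  assumes "prob_space M"
    and "strictly_stationary M X"
    and "\<And>t. integrable M (\<lambda>\<omega>. \<bar>X t \<omega>\<bar> ^ 8)"
    and "\<And>t. (\<integral>\<omega>. X t \<omega> \<partial>M) = 0"
    and "\<And>t. a (- t) = a t"
    and "\<exists>L. L-lipschitz_on UNIV a"
    and "closure {t. a t \<noteq> 0} = {-1..1}"
    and "a 0 = 1"
    and "\<And>n. B n > 0" and "\<And>n. Bt n > 0"
    and "filterlim B at_top sequentially" and "filterlim Bt at_top sequentially"
    and "(\<lambda>n. real (B n)) \<in> o(\<lambda>n. real n)" and "(\<lambda>n. real (Bt n)) \<in> o(\<lambda>n. real n)"
    and r_def: "r = autocov M X"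
    and f_def: "f = spectral_density r"
    and fn_def: "fn = (\<lambda>n \<omega>. lag_window_est a (B n) n (\<lambda>t. X t \<omega>))"
    and ft_def: "ft = (\<lambda>n \<omega>. lag_window_est a (Bt n) n (\<lambda>t. X t \<omega>))"
    \<comment> \<open>the conditional law of the bootstrap estimate: prescribed where the bootstrap is defined,
        arbitrary (with finite second moment) elsewhere\<close>
    and "\<And>n \<omega>. \<omega> \<in> space M \<Longrightarrow> prob_space (Lstar n \<omega>)"
    and "\<And>n \<omega>. \<omega> \<in> space M \<Longrightarrow> sets (Lstar n \<omega>) = sets borel"
    and "\<And>n \<omega>. \<omega> \<in> space M \<Longrightarrow> integrable (Lstar n \<omega>) (\<lambda>y. y\<^sup>2)"
    and "\<And>n \<omega>. \<omega> \<in> space M \<Longrightarrow> bootstrap_defined n (\<lambda>t. X t \<omega>) (ft n \<omega>) \<Longrightarrow>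
           Lstar n \<omega> = boot_est_law a (B n) n (\<lambda>t. X t \<omega>) (ft n \<omega>) lam"
    and A1: "((\<lambda>x. (1 - a x) / x\<^sup>2) \<longlongrightarrow> c2) (at 0)" "c2 \<noteq> 0"
    and A2: "(INF l\<in>{0..pi}. f l) > 0"
    and A3: "small_o_prob M (\<lambda>n \<omega>. SUP l\<in>{0..pi}. \<bar>ft n \<omega> l - f l\<bar>) (\<lambda>n. bandwidth (B n))"
    and A4: "(\<lambda>k. \<bar>r k\<bar> * (of_int k)\<^sup>2) summable_on UNIV"
    and A5': "\<And>k. k \<in> {3..8} \<Longrightarrow>
           (\<lambda>ts. \<bar>joint_cumulant M (map X (0 # ts))\<bar>) summable_on {ts :: int list. length ts = k - 1}"
    and A6: "weak_conv_m
               (\<lambda>n. distr M borel (\<lambda>\<omega>. sqrt (real n * bandwidth (B n)) *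
                                         (fn n \<omega> lam - prob_space.expectation M (\<lambda>\<omega>. fn n \<omega> lam))))
               (density lborel (normal_density 0 (sqrt (asymp_var a f lam))))"
            "(\<lambda>n. real n * bandwidth (B n) * prob_space.variance M (\<lambda>\<omega>. fn n \<omega> lam))
               \<longlonglongrightarrow> asymp_var a f lam"
    and "(\<lambda>n. bandwidth (B n)) \<in> \<Theta>(\<lambda>n. real n powr (- 1 / 5))"
    and "(\<lambda>n. bandwidth (B n)) \<in> o(\<lambda>n. bandwidth (Bt n))"
  shows "small_o_prob M
           (\<lambda>n \<omega>. mallows_dist
              (distr M borel (\<lambda>\<omega>'. sqrt (real n * bandwidth (B n)) * (fn n \<omega>' lam - f lam)))
              (distr (Lstar n \<omega>) borel
                 (\<lambda>y. sqrt (real n * bandwidth (B n)) * (y - ft n \<omega> lam))))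
           (\<lambda>_. 1) \<and>
         small_o_prob M
           (\<lambda>n \<omega>. mallows_dist
              (distr M borel (\<lambda>\<omega>'. sqrt (real n * bandwidth (B n)) * (fn n \<omega>' lam - f lam) / f lam))
              (distr (Lstar n \<omega>) borel
                 (\<lambda>y. sqrt (real n * bandwidth (B n)) * (y - ft n \<omega> lam) / ft n \<omega> lam)))
           (\<lambda>_. 1)"
proof -
  interpret prob_space M by fact
  obtain L where "L-lipschitz_on UNIV a" using \<open>\<exists>L. L-lipschitz_on UNIV a\<close> by blast
  interpret bootstrap_setting M X a L B Bt c2 lam
    by unfold_locales (use assms \<open>L-lipschitz_on UNIV a\<close> in \<open>simp_all only: r_def\<close>)
  have f: "f = sd" by (simp add: f_def r_def)
  define f0 where "f0 = (INF l\<in>{0..pi}. sd l)"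
  have f0: "f0 > 0" using A2 by (simp add: f0_def f)
  have f0_le: "f0 \<le> sd w" if "w \<in> {0..pi}" for w
    unfolding f0_def
  proof (rule cINF_lower[OF _ that])
    have "- R0 \<le> sd l" for l using abs_sd_le_R0[of l] by linarith
    then show "bdd_below (sd ` {0..pi})" by (intro bdd_belowI2)
  qed
  have sd_pos: "sd w > 0" for w using sd_ge_extend[OF f0_le, of w] f0 by linarith
  have L: "Lstar n \<omega> = boot_est_law a (B n) n (\<lambda>t. X t \<omega>) (pilot n \<omega>) lam"
    if "\<omega> \<in> space M" "bootstrap_defined n (\<lambda>t. X t \<omega>) (pilot n \<omega>)" for n \<omega>
    \<comment> \<open>This assumption prescribes \<open>Lstar\<close> on the event where the
      bootstrap is defined.\<close>
    using assms(22)[OF that(1)] that(2) by (simp add: ft_def)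
  have core: "small_o_prob M (\<lambda>n \<omega>. mallows_dist
       (distr M borel (\<lambda>\<omega>'. \<gamma> (sd lam) * (scale n * (fhat n \<omega>' lam - sd lam))))
       (distr (Lstar n \<omega>) borel (\<lambda>y. \<gamma> (pilot n \<omega> lam) * (scale n * (y - pilot n \<omega> lam))))) (\<lambda>_. 1)"
    if "isCont \<gamma> (sd lam)" for \<gamma>
    by (rule boot_mallows_small_o_prob[OF f0 _ A3[unfolded ft_def f] _ A6(1)[unfolded fn_def f] A6(2)[unfolded fn_def f] that])
      (rule f0_le L; assumption)+
  \<comment> \<open>The reciprocal gives the assertion normalised by the density, which is positive
    at \<open>lam\<close>; the constant 1 gives the plain one.\<close>
  have "isCont (\<lambda>y. 1 / y) (sd lam)" using sd_pos[of lam] by (intro continuous_intros) auto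
  from core[OF this] core[of "\<lambda>_. 1", OF continuous_const] show ?thesis
    unfolding fn_def ft_def f by simp
qed

end
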